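(* There exists an isomorphism of ($\mathbb{N}$-colored) topological operads $W_0\mathcal{O}\cong B\mathcal{O}$.
   Context: **Trees.** A tree $T$ is a finite rooted tree with vertex set $V(T)$ and edge set $E(T)$; external edges are the root and the leaves $L(T)$, the other edges are internal. Each vertex $v$ has one outgoing edge $out(v)$ and $|v|\ge0$ incoming edges $in(v)$. $\eta$ is the tree with one edge and no vertices; the corolla $C_n$ has one vertex and $n$ leaves. A planar tree has a chosen linear order on the incoming edges of each vertex. A subtree $S\subset T$ with $V(S)\ne\emptyset$ is determined by its (connected) vertex set and contains all edges incident to these vertices. **The operad $\mathcal{O}$.** $\mathcal{O}$ is the $\mathbb{N}$-colored operad in sets for which $\mathcal{O}(n;m_1,\dots,m_k)$ is the set of isomorphism classes of triples $(T,\sigma,\tau)$, with $T$ a planar tree with $k$ vertices and $n$ leaves, $\sigma:\{1,\dots,k\}\to V(T)$ and $\tau:\{1,\dots,n\}\to L(T)$ bijections, and $|\sigma(i)|=m_i$. The composition $(T,\sigma,\tau)\circ_i(T',\sigma',\tau')$ (where $T'$ has $m_i$ leaves) substitutes $T'$ for the vertex $\sigma(i)$ of $T$, gluing the leaf of $T'$ labelled $a$ to the $a$th incoming edge of $\sigma(i)$; leaves keep their $\tau$ labels and vertices are ordered by inserting $\sigma'$ at place $i$ of $\sigma$. $\Sigma_k$ acts by relabelling vertices; the unit of color $n$ is $C_n$ with leaves labelled in planar order. **$B\mathcal{O}$.** A tree is large if it has at least two vertices. A bracketing of $T$ is a (possibly empty) set $B$ of large proper subtrees of $T$ which is nested: for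 $S,S'\in B$, $V(S)\cap V(S')$ is $V(S)$, $V(S')$ or $\emptyset$. $\mathcal{B}(T)$ is the poset of bracketings under inclusion and $|\mathcal{B}(T)|$ the geometric realization of its nerve. $B\mathcal{O}$ is the $\mathbb{N}$-colored topological operad with $B\mathcal{O}(n;m_1,\dots,m_k)=\coprod_{(T,\sigma,\tau)\in\mathcal{O}(n;m_1,\dots,m_k)}|\mathcal{B}(T)|$, whose composition is the realization of the poset maps $\mathcal{B}(T)\times\mathcal{B}(T')\to\mathcal{B}(T'')$ covering $(T,\sigma,\tau)\circ_i(T',\sigma',\tau')=(T'',\sigma'',\tau)$, sending $(B,B')$ to the set of those among the following subtrees of $T''$ that are large and proper: $\tilde S$ for $S\in B$ ($\tilde S=S$ if $\sigma(i)\notin V(S)$, and $\tilde S$ is $S$ with $T'$ substituted for $\sigma(i)$ otherwise), the elements of $B'$, and $T'$ itself. Symmetric actions and units come from $\mathcal{O}$. **$W\mathcal{P}$ and $W_0\mathcal{P}$.** Let $\mathcal{P}$ be a $\mathfrak{C}$-colored (discrete or topological) operad. Points of $W\mathcal{P}(c;c_1,\dots,c_k)$ are represented by tuples $(\mathbb{T},f,\lambda,s,p)$: $\mathbb{T}$ a planar tree with $k$ leaves, $f:E(\mathbb{T})\to\mathfrak{C}$ a coloring, $\lambda:\{1,\dots,k\}\to L(\mathbb{T})$ a bijection with $f(\lambda(i))=c_i$ and the root colored $c$, $s$ a choice of length in $[0,1]$ for every internal edge, and $p=(p_v)_{v\in V(\mathbb{T})}$ with $p_v\in\mathcal{P}(out(v);in(v))$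 (colors of the edges, inputs in planar order). The topology is that of the quotient of $\coprod_{(\mathbb{T},f,\lambda)}[0,1]^{\#\text{internal edges}}\times\prod_v\mathcal{P}(out(v);in(v))$ by the relations generated by: ($*$) tuples related by a non-planar isomorphism of trees compatible with colors, leaf labels and lengths, and with the decorations up to the permutations of inputs it induces, are identified; (1) an internal edge of length $0$ may be collapsed, composing the labels of its end vertices; (2) a vertex with one input labelled by an identity $\iota_c\in\mathcal{P}(c;c)$ may be deleted, the resulting new edge, if internal, having length the maximum of the lengths of the two original internal edges. Composition is grafting of trees, with length $1$ for the new internal edge; the symmetric group relabels the leaves. $W_0\mathcal{P}$ is the quotient of $W\mathcal{P}$ in which (2) is strengthened by the relations: ($2'$) a vertex $v$ with exactly one input, with input and output of the same color $c$, adjacent to at least one other vertex $w$ and labelled by any element of $\mathcal{P}(c;c)$, may be deleted, composing its label with that of $w$ in $\mathcal{P}$; if the resulting new edge is internal its length is the maximum of the lengths of the two original edges adjacent to $v$; ($3'$) a vertex $v$ with no inputs, adjacent to another vertex $w$ and labelled by any element of $\mathcal{P}(c;\emptyset)$, may be deleted together with the edge between $v$ and $w$, composing its label with that of $w$ in $\mathcal{P}$. Here $\mathcal{P}=\mathcal{O}$. *)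

theory Defs
  imports "HOL-Analysis.Analysis" "HOL-Combinatorics.Permutations" "HOL-Homology.Simplices"
begin

section \<open>Coloured topological operads\<close>

text \<open>
  An operad is presented by its partial compositions. Operations are not indexed by profiles, so
  operations of different profiles are meant to be different elements. Positions in profiles are
  counted from \<open>0\<close>: \<^term>\<open>circ P i x y\<close> plugs \<open>y\<close> into the input \<open>i < length cs\<close> of
  \<open>x \<in> P(c; cs)\<close>. The symmetric groups act on the right, \<open>x\<cdot>\<pi> \<in> P(c; c\<^sub>\<pi>\<^sub>0, \<dots>, c\<^sub>\<pi>\<^sub>(\<^sub>k\<^sub>-\<^sub>1\<^sub>))\<close>.
\<close>

record ('c, 'x) operad =
  ops :: "'c \<Rightarrow> 'c list \<Rightarrow> 'x topology"
  circ :: "nat \<Rightarrow> 'x \<Rightarrow> 'x \<Rightarrow> 'x"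
  ident :: "'c \<Rightarrow> 'x"
  act :: "(nat \<Rightarrow> nat) \<Rightarrow> 'x \<Rightarrow> 'x"

definition plug_profile :: "nat \<Rightarrow> 'c list \<Rightarrow> 'c list \<Rightarrow> 'c list" where
  "plug_profile i cs ds = take i cs @ ds @ drop (Suc i) cs"

text \<open>
  When \<open>l\<close> inputs are inserted in place of the input \<open>i\<close>, the old input \<open>j \<noteq> i\<close> moves to position
  \<^term>\<open>outer_idx i l j\<close> and the inserted input \<open>j\<close> to position \<open>i + j\<close>.
\<close>

definition outer_idx :: "nat \<Rightarrow> nat \<Rightarrow> nat \<Rightarrow> nat" where
  "outer_idx i l j = (if j < i then j else j + l - 1)"

locale topological_operad =
  fixes P :: "('c, 'x) operad"
  assumes ident_in: "ident P c \<in> topspace (ops P c [c])"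
    and circ_continuous: "i < length cs \<Longrightarrow>
      continuous_map (prod_topology (ops P c cs) (ops P (cs ! i) ds))
        (ops P c (plug_profile i cs ds)) (\<lambda>(x, y). circ P i x y)"
    and act_continuous: "\<pi> permutes {..<length cs} \<Longrightarrow>
      continuous_map (ops P c cs) (ops P c (permute_list \<pi> cs)) (act P \<pi>)"
    and circ_ident_left: "x \<in> topspace (ops P c cs) \<Longrightarrow> circ P 0 (ident P c) x = x"
    and circ_ident_right: "\<lbrakk>x \<in> topspace (ops P c cs); i < length cs\<rbrakk> \<Longrightarrow>
      circ P i x (ident P (cs ! i)) = x"
    and circ_assoc_sequential:
      "\<lbrakk>x \<in> topspace (ops P c cs); i < length cs; y \<in> topspace (ops P (cs ! i) ds);
        j < length ds; z \<in> topspace (ops P (ds ! j) es)\<rbrakk> \<Longrightarrow>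
      circ P (i + j) (circ P i x y) z = circ P i x (circ P j y z)"
    and circ_assoc_parallel:
      "\<lbrakk>x \<in> topspace (ops P c cs); i < k; k < length cs; y \<in> topspace (ops P (cs ! i) ds);
        z \<in> topspace (ops P (cs ! k) es)\<rbrakk> \<Longrightarrow>
      circ P (outer_idx i (length ds) k) (circ P i x y) z = circ P i (circ P k x z) y"
    and act_id: "x \<in> topspace (ops P c cs) \<Longrightarrow> act P id x = x"
    and act_comp:
      "\<lbrakk>x \<in> topspace (ops P c cs); \<pi> permutes {..<length cs}; \<rho> permutes {..<length cs}\<rbrakk> \<Longrightarrow>
      act P \<rho> (act P \<pi> x) = act P (\<pi> \<circ> \<rho>) x"
    and circ_act_inner:
      "\<lbrakk>x \<in> topspace (ops P c cs); i < length cs; y \<in> topspace (ops P (cs ! i) ds);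
        \<pi> permutes {..<length ds};
        \<rho> permutes {..<length (plug_profile i cs ds)};
        \<And>j. \<lbrakk>j < length cs; j \<noteq> i\<rbrakk> \<Longrightarrow>
          \<rho> (outer_idx i (length ds) j) = outer_idx i (length ds) j;
        \<And>j. j < length ds \<Longrightarrow> \<rho> (i + j) = i + \<pi> j\<rbrakk> \<Longrightarrow>
      circ P i x (act P \<pi> y) = act P \<rho> (circ P i x y)"
    and circ_act_outer:
      "\<lbrakk>x \<in> topspace (ops P c cs); i < length cs; y \<in> topspace (ops P (cs ! \<pi> i) ds);
        \<pi> permutes {..<length cs};
        \<rho> permutes {..<length (plug_profile (\<pi> i) cs ds)};
        \<And>j. \<lbrakk>j < length cs; j \<noteq> i\<rbrakk> \<Longrightarrow>
          \<rho> (outer_idx i (length ds) j) = outer_idx (\<pi> i) (length ds) (\<pi> j);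
        \<And>j. j < length ds \<Longrightarrow> \<rho> (i + j) = \<pi> i + j\<rbrakk> \<Longrightarrow>
      circ P i (act P \<pi> x) y = act P \<rho> (circ P (\<pi> i) x y)"

definition operad_iso ::
  "('c, 'x) operad \<Rightarrow> ('c, 'y) operad \<Rightarrow> ('c \<Rightarrow> 'c list \<Rightarrow> 'x \<Rightarrow> 'y) \<Rightarrow> bool" where
  "operad_iso P Q \<phi> \<longleftrightarrow>
     topological_operad P \<and> topological_operad Q \<and>
     (\<forall>c cs. homeomorphic_map (ops P c cs) (ops Q c cs) (\<phi> c cs)) \<and>
     (\<forall>c. \<phi> c [c] (ident P c) = ident Q c) \<and>
     (\<forall>c cs i ds. i < length cs \<longrightarrow>
        (\<forall>x\<in>topspace (ops P c cs). \<forall>y\<in>topspace (ops P (cs ! i) ds).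
           \<phi> c (plug_profile i cs ds) (circ P i x y) =
             circ Q i (\<phi> c cs x) (\<phi> (cs ! i) ds y))) \<and>
     (\<forall>c cs \<pi>. \<pi> permutes {..<length cs} \<longrightarrow>
        (\<forall>x\<in>topspace (ops P c cs).
           \<phi> c (permute_list \<pi> cs) (act P \<pi> x) = act Q \<pi> (\<phi> c cs x)))"


section \<open>Quotient topologies\<close>

definition quot_topology :: "'a topology \<Rightarrow> ('a \<Rightarrow> 'b) \<Rightarrow> 'b topology" where
  "quot_topology X q =
     topology (\<lambda>U. U \<subseteq> q ` topspace X \<and> openin X {x \<in> topspace X. q x \<in> U})"

lemma openin_quot_topology:
  "openin (quot_topology X q) U \<longleftrightarrow> U \<subseteq> q ` topspace X \<and> openin X {x \<in> topspace X. q x \<in> U}"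
proof -
  have "istopology (\<lambda>U. U \<subseteq> q ` topspace X \<and> openin X {x \<in> topspace X. q x \<in> U})"
    unfolding istopology_def
  proof (rule conjI; intro allI impI)
    fix S T
    assume "S \<subseteq> q ` topspace X \<and> openin X {x \<in> topspace X. q x \<in> S}"
      and "T \<subseteq> q ` topspace X \<and> openin X {x \<in> topspace X. q x \<in> T}"
    moreover have "{x \<in> topspace X. q x \<in> S \<inter> T} =
        {x \<in> topspace X. q x \<in> S} \<inter> {x \<in> topspace X. q x \<in> T}"
      by auto
    ultimately show "S \<inter> T \<subseteq> q ` topspace X \<and> openin X {x \<in> topspace X. q x \<in> S \<inter> T}"
      by auto
  next
    fix K
    assume "\<forall>S\<in>K. S \<subseteq> q ` topspace X \<and> openin X {x \<in> topspace X. q x \<in> S}"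
    moreover have "{x \<in> topspace X. q x \<in> \<Union>K} = (\<Union>S\<in>K. {x \<in> topspace X. q x \<in> S})"
      by auto
    ultimately show "\<Union>K \<subseteq> q ` topspace X \<and> openin X {x \<in> topspace X. q x \<in> \<Union>K}"
      by auto
  qed
  then show ?thesis
    by (simp add: quot_topology_def topology_inverse')
qed

lemma topspace_quot_topology [simp]: "topspace (quot_topology X q) = q ` topspace X"
proof (rule antisym)
  show "topspace (quot_topology X q) \<subseteq> q ` topspace X"
    using openin_quot_topology[of X q] by auto
  have "{x \<in> topspace X. q x \<in> q ` topspace X} = topspace X"
    by auto
  then have "openin (quot_topology X q) (q ` topspace X)"
    by (simp add: openin_quot_topology)
  then show "q ` topspace X \<subseteq> topspace (quot_topology X q)"
    by (rule openin_subset)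
qed

lemma quotient_map_quot_topology: "quotient_map X (quot_topology X q) q"
  by (auto simp: quotient_map_def openin_quot_topology)


section \<open>Planar trees\<close>

text \<open>
  Planar trees have no non-trivial automorphisms, so the elements of this datatype are exactly the
  isomorphism classes of finite planar trees with decorated vertices and leaves. The tree without
  vertices is \<^term>\<open>Leaf a\<close>, its unique edge being both the root and a leaf.
\<close>

datatype (vset: 'v, lset: 'l) ptree =
  Leaf 'l
| Node 'v "('v, 'l) ptree list"
for map: map_ptree

fun leaves :: "('v, 'l) ptree \<Rightarrow> 'l list" where
  "leaves (Leaf a) = [a]"
| "leaves (Node v ts) = concat (map leaves ts)"

text \<open>The vertices, each with its number of inputs.\<close>

fun verts :: "('v, 'l) ptree \<Rightarrow> ('v \<times> nat) list" where
  "verts (Leaf a) = []"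
| "verts (Node v ts) = (v, length ts) # concat (map verts ts)"

text \<open>Pairs of a vertex and one of its direct successors.\<close>

fun inner_edges :: "('v, 'l) ptree \<Rightarrow> ('v \<times> 'v) set" where
  "inner_edges (Leaf a) = {}"
| "inner_edges (Node v ts) =
     {(v, w) | w us. Node w us \<in> set ts} \<union> (\<Union>t\<in>set ts. inner_edges t)"

fun plug :: "('l \<Rightarrow> ('v, 'm) ptree) \<Rightarrow> ('v, 'l) ptree \<Rightarrow> ('v, 'm) ptree" where
  "plug f (Leaf a) = f a"
| "plug f (Node v ts) = Node v (map (plug f) ts)"


section \<open>The operad \<open>\<O>\<close>\<close>

text \<open>
  The triple \<open>(T, \<sigma>, \<tau>)\<close> is encoded by decorating the vertex \<open>\<sigma>(i)\<close> with \<open>i\<close> and the leaf \<open>\<tau>(a)\<close>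
  with \<open>a\<close>, where \<open>i\<close> and \<open>a\<close> are counted from \<open>0\<close>.
\<close>

type_synonym ltree = "(nat, nat) ptree"

definition ltrees :: "nat \<Rightarrow> nat list \<Rightarrow> ltree set" where
  "ltrees n ms =
     {T. distinct (map fst (verts T)) \<and> set (verts T) = {(i, ms ! i) | i. i < length ms} \<and>
         distinct (leaves T) \<and> set (leaves T) = {..<n}}"

fun subst_vertex :: "nat \<Rightarrow> ltree \<Rightarrow> ltree \<Rightarrow> ltree" where
  "subst_vertex i T' (Leaf a) = Leaf a"
| "subst_vertex i T' (Node v ts) =
     (let us = map (subst_vertex i T') ts
      in if v = i then plug (\<lambda>a. us ! a) (map_ptree (\<lambda>j. i + j) id T')
         else Node (outer_idx i (length (verts T')) v) us)"

definition corolla :: "nat \<Rightarrow> ltree" where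
  "corolla n = Node 0 (map Leaf [0..<n])"

text \<open>
  The action of \<open>\<pi>\<close> is \<open>(T, \<sigma>, \<tau>)\<cdot>\<pi> = (T, \<sigma> \<circ> \<pi>, \<tau>)\<close>, so the vertex decorated with \<open>j\<close> becomes
  decorated with the \<open>i\<close> such that \<open>\<pi> i = j\<close>.
\<close>

definition relabel_vertices :: "(nat \<Rightarrow> nat) \<Rightarrow> ltree \<Rightarrow> ltree" where
  "relabel_vertices \<pi> = map_ptree (inv_into UNIV \<pi>) id"

definition O_operad :: "(nat, ltree) operad" where
  "O_operad =
     \<lparr>ops = \<lambda>n ms. discrete_topology (ltrees n ms),
      circ = \<lambda>i T T'. subst_vertex i T' T,
      ident = corolla,
      act = relabel_vertices\<rparr>"


section \<open>Geometric realization of the nerve of a poset\<close>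

text \<open>
  An \<open>n\<close>-simplex of the nerve is a weakly increasing list of length \<open>n + 1\<close>. The realization is
  the quotient of the disjoint union of the products of the sets of \<open>n\<close>-simplices with the standard
  \<open>n\<close>-simplices, identifying \<open>(\<alpha>\<^sup>*\<xi>, t)\<close> with \<open>(\<xi>, \<alpha>\<^sub>*t)\<close> for weakly increasing
  \<open>\<alpha> : {0..m} \<rightarrow> {0..n}\<close>.
\<close>

type_synonym 'b simplex_point = "'b list \<times> (nat \<Rightarrow> real)"

definition nerve :: "'b::order set \<Rightarrow> 'b list set" where
  "nerve A = {\<xi>. \<xi> \<noteq> [] \<and> set \<xi> \<subseteq> A \<and> sorted_wrt (\<le>) \<xi>}"

definition nerve_space :: "'b::order set \<Rightarrow> 'b simplex_point topology" where
  "nerve_space A =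
     sum_topology (\<lambda>\<xi>. subtopology (powertop_real UNIV) (standard_simplex (length \<xi> - 1))) (nerve A)"

definition nerve_step :: "'b simplex_point \<Rightarrow> 'b simplex_point \<Rightarrow> bool" where
  "nerve_step p q \<longleftrightarrow>
     (\<exists>\<alpha> m \<xi> t.
        (\<forall>i j. i \<le> j \<and> j \<le> m \<longrightarrow> \<alpha> i \<le> \<alpha> j) \<and> (\<forall>j\<le>m. \<alpha> j < length \<xi>) \<and>
        p = (map (\<lambda>j. \<xi> ! \<alpha> j) [0..<Suc m], t) \<and>
        q = (\<xi>, \<lambda>i. \<Sum>j | j \<le> m \<and> \<alpha> j = i. t j))"

definition real_class :: "'b::order set \<Rightarrow> 'b simplex_point \<Rightarrow> 'b simplex_point set" where
  "real_class A p =
     {q. equivclp (\<lambda>p q. p \<in> topspace (nerve_space A) \<and> q \<in> topspace (nerve_space A) \<and>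
                         nerve_step p q) p q}"

definition realization :: "'b::order set \<Rightarrow> 'b simplex_point set topology" where
  "realization A = quot_topology (nerve_space A) (real_class A)"

text \<open>
  The map of realizations induced by a monotone map \<open>f\<close> into \<open>A\<close>. The classes in the union all
  coincide.
\<close>

definition real_map ::
  "'a::order set \<Rightarrow> ('b::order \<Rightarrow> 'a) \<Rightarrow> 'b simplex_point set \<Rightarrow> 'a simplex_point set" where
  "real_map A f w = (\<Union>(\<xi>, t)\<in>w. real_class A (map f \<xi>, t))"

text \<open>The inverse of the canonical homeomorphism \<open>\<bar>A \<times> B\<bar> \<rightarrow> \<bar>A\<bar> \<times> \<bar>B\<bar>\<close>.\<close>

definition real_pair ::
  "'a::order set \<Rightarrow> 'b::order set \<Rightarrow> 'a simplex_point set \<Rightarrow> 'b simplex_point set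
    \<Rightarrow> ('a \<times> 'b) simplex_point set" where
  "real_pair A B z z' =
     (THE w. w \<in> topspace (realization (A \<times> B)) \<and> real_map A fst w = z \<and> real_map B snd w = z')"


section \<open>The operad \<open>B\<O>\<close>\<close>

text \<open>A subtree with at least one vertex is represented by its set of vertices.\<close>

definition subtree :: "ltree \<Rightarrow> nat set \<Rightarrow> bool" where
  "subtree T S \<longleftrightarrow> S \<noteq> {} \<and> S \<subseteq> vset T \<and>
     (\<forall>v\<in>S. \<forall>w\<in>S. (v, w) \<in> ((inner_edges T \<union> (inner_edges T)\<inverse>) \<inter> S \<times> S)\<^sup>*)"

definition large_proper :: "ltree \<Rightarrow> nat set \<Rightarrow> bool" where
  "large_proper T S \<longleftrightarrow> 2 \<le> card S \<and> S \<noteq> vset T"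

definition bracketings :: "ltree \<Rightarrow> nat set set set" where
  "bracketings T =
     {B. (\<forall>S\<in>B. subtree T S \<and> large_proper T S) \<and>
         (\<forall>S\<in>B. \<forall>S'\<in>B. S \<inter> S' = S \<or> S \<inter> S' = S' \<or> S \<inter> S' = {})}"

definition subst_subtree :: "nat \<Rightarrow> ltree \<Rightarrow> nat set \<Rightarrow> nat set" where
  "subst_subtree i T' S =
     outer_idx i (length (verts T')) ` (S - {i}) \<union> (if i \<in> S then (\<lambda>j. i + j) ` vset T' else {})"

definition subst_bracketing ::
  "nat \<Rightarrow> ltree \<Rightarrow> ltree \<Rightarrow> nat set set \<times> nat set set \<Rightarrow> nat set set" where
  "subst_bracketing i T T' = (\<lambda>(B, B').
     {S \<in> subst_subtree i T' ` B \<union> image (\<lambda>j. i + j) ` B' \<union> {(\<lambda>j. i + j) ` vset T'}.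
        large_proper (subst_vertex i T' T) S})"

type_synonym bracketed_tree = "ltree \<times> nat set set simplex_point set"

definition BO_circ :: "nat \<Rightarrow> bracketed_tree \<Rightarrow> bracketed_tree \<Rightarrow> bracketed_tree" where
  "BO_circ i = (\<lambda>(T, z) (T', z').
     (subst_vertex i T' T,
      real_map (bracketings (subst_vertex i T' T)) (subst_bracketing i T T')
        (real_pair (bracketings T) (bracketings T') z z')))"

definition BO_act :: "(nat \<Rightarrow> nat) \<Rightarrow> bracketed_tree \<Rightarrow> bracketed_tree" where
  "BO_act \<pi> = (\<lambda>(T, z).
     (relabel_vertices \<pi> T,
      real_map (bracketings (relabel_vertices \<pi> T)) (image (image (inv_into UNIV \<pi>))) z))"

text \<open>The only bracketing of a corolla is the empty one, so its realization is a point.\<close>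

definition BO_ident :: "nat \<Rightarrow> bracketed_tree" where
  "BO_ident n =
     (corolla n, real_class (bracketings (corolla n)) ([{}], \<lambda>j. if j = 0 then 1 else 0))"

definition BO_operad :: "(nat, bracketed_tree) operad" where
  "BO_operad =
     \<lparr>ops = \<lambda>n ms. sum_topology (\<lambda>T. realization (bracketings T)) (ltrees n ms),
      circ = BO_circ,
      ident = BO_ident,
      act = BO_act\<rparr>"


section \<open>The operad \<open>W\<^sub>0P\<close>\<close>

text \<open>
  A tuple \<open>(\<TT>, f, \<lambda>, s, p)\<close> is encoded as a tree in which the leaf \<open>\<lambda>(j)\<close> is decorated with its
  colour and \<open>j\<close>, and each vertex with the colour of its outgoing edge, the length of its outgoing
  edge, and its label. The outgoing edge of the root vertex is external; it gets the dummy length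
  \<open>1\<close>. Since lengths are at most \<open>1\<close>, taking the maximum with a dummy length gives the dummy length
  again, as it should when the merged edge becomes the root.
\<close>

type_synonym ('c, 'x) wtree = "('c \<times> real \<times> 'x, 'c \<times> nat) ptree"

text \<open>The triple \<open>(\<TT>, f, \<lambda>)\<close> alone.\<close>

type_synonym 'c wshape = "('c, 'c \<times> nat) ptree"

definition shape :: "('c, 'x) wtree \<Rightarrow> 'c wshape" where
  "shape = map_ptree fst id"

fun root_color :: "'c wshape \<Rightarrow> 'c" where
  "root_color (Leaf (c, j)) = c"
| "root_color (Node c ts) = c"

definition wshapes :: "'c \<Rightarrow> 'c list \<Rightarrow> 'c wshape set" where
  "wshapes c cs =
     {S. root_color S = c \<and> distinct (map snd (leaves S)) \<and>
         set (leaves S) = {(cs ! j, j) | j. j < length cs}}"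

text \<open>
  Vertices are addressed by the positions on the path from the root vertex \<open>[]\<close>; an internal edge
  is addressed by the vertex it comes out of.
\<close>

fun vertex_pos :: "('v, 'l) ptree \<Rightarrow> nat list set" where
  "vertex_pos (Leaf a) = {}"
| "vertex_pos (Node v ts) = insert [] (\<Union>i<length ts. Cons i ` (map vertex_pos ts ! i))"

fun tree_at :: "('v, 'l) ptree \<Rightarrow> nat list \<Rightarrow> ('v, 'l) ptree" where
  "tree_at t [] = t"
| "tree_at (Leaf a) (i # p) = undefined"
| "tree_at (Node v ts) (i # p) = tree_at (ts ! i) p"

fun vertex_label :: "('v, 'l) ptree \<Rightarrow> 'v" where
  "vertex_label (Leaf a) = undefined"
| "vertex_label (Node v ts) = v"

fun input_colors :: "'c wshape \<Rightarrow> 'c list" where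
  "input_colors (Leaf a) = []"
| "input_colors (Node c ts) = map root_color ts"

definition decoration_space ::
  "('c, 'x) operad \<Rightarrow> 'c wshape \<Rightarrow> ((nat list \<Rightarrow> real) \<times> (nat list \<Rightarrow> 'x)) topology" where
  "decoration_space P S =
     prod_topology
       (product_topology (\<lambda>_. top_of_set {0..1}) (vertex_pos S - {[]}))
       (product_topology (\<lambda>v. ops P (root_color (tree_at S v)) (input_colors (tree_at S v)))
          (vertex_pos S))"

definition untangle ::
  "('c, 'x) wtree \<Rightarrow> 'c wshape \<times> (nat list \<Rightarrow> real) \<times> (nat list \<Rightarrow> 'x)" where
  "untangle t =
     (shape t,
      (\<lambda>e\<in>vertex_pos t - {[]}. fst (snd (vertex_label (tree_at t e)))),
      (\<lambda>v\<in>vertex_pos t. snd (snd (vertex_label (tree_at t v)))))"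

fun dummy_root_length :: "('c, 'x) wtree \<Rightarrow> bool" where
  "dummy_root_length (Leaf a) \<longleftrightarrow> True"
| "dummy_root_length (Node (c, l, x) ts) \<longleftrightarrow> l = 1"

text \<open>
  \<^term>\<open>untangle\<close> is a bijection from the points of this space onto the disjoint union of the
  decoration spaces, and the topology is transported along it.
\<close>

definition wspace :: "('c, 'x) operad \<Rightarrow> 'c \<Rightarrow> 'c list \<Rightarrow> ('c, 'x) wtree topology" where
  "wspace P c cs =
     pullback_topology {t. dummy_root_length t} untangle
       (sum_topology (decoration_space P) (wshapes c cs))"

inductive nonplanar_iso ::
  "('c, 'x) operad \<Rightarrow> ('c, 'x) wtree \<Rightarrow> ('c, 'x) wtree \<Rightarrow> bool"
  for P where
  iso_leaf: "nonplanar_iso P (Leaf a) (Leaf a)"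
| iso_node: "\<lbrakk>list_all2 (nonplanar_iso P) ts us; \<pi> permutes {..<length us}\<rbrakk> \<Longrightarrow>
    nonplanar_iso P (Node (c, l, x) ts) (Node (c, l, act P \<pi> x) (permute_list \<pi> us))"

text \<open>
  The length of the edge obtained by deleting a unary vertex with outgoing edge of length \<open>l\<close> below
  the given tree.
\<close>

fun merge_length :: "real \<Rightarrow> ('c, 'x) wtree \<Rightarrow> ('c, 'x) wtree" where
  "merge_length l (Leaf a) = Leaf a"
| "merge_length l (Node (c, l', x) ts) = Node (c, max l l', x) ts"

text \<open>
  The generating relations. A unary vertex can be absorbed by the vertex above it
  (\<open>delete_unary_up\<close>) or by the one below it (\<open>delete_unary_down\<close>).
\<close>

inductive w0_step ::
  "('c, 'x) operad \<Rightarrow> ('c, 'x) wtree \<Rightarrow> ('c, 'x) wtree \<Rightarrow> bool"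
  for P where
  iso: "nonplanar_iso P t u \<Longrightarrow> w0_step P t u"
| collapse:
    "w0_step P (Node (c, l, x) (ts @ Node (d, 0, y) us # ws))
               (Node (c, l, circ P (length ts) x y) (ts @ us @ ws))"
| delete_ident: "root_color (shape t) = c \<Longrightarrow>
     w0_step P (Node (c, l, ident P c) [t]) (merge_length l t)"
| delete_unary_up: "x \<in> topspace (ops P c [c]) \<Longrightarrow>
     w0_step P (Node (c, l, x) [Node (c, l', y) us]) (Node (c, max l l', circ P 0 x y) us)"
| delete_unary_down: "\<lbrakk>y \<in> topspace (ops P d [d]); root_color (shape t) = d\<rbrakk> \<Longrightarrow>
     w0_step P (Node (c, l, x) (ts @ Node (d, l', y) [t] # ws))
               (Node (c, l, circ P (length ts) x y) (ts @ merge_length l' t # ws))"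
| delete_nullary: "y \<in> topspace (ops P d []) \<Longrightarrow>
     w0_step P (Node (c, l, x) (ts @ Node (d, l', y) [] # ws))
               (Node (c, l, circ P (length ts) x y) (ts @ ws))"
| in_context: "w0_step P t u \<Longrightarrow>
     w0_step P (Node v (ts @ t # ws)) (Node v (ts @ u # ws))"

definition w0_class :: "('c, 'x) operad \<Rightarrow> ('c, 'x) wtree \<Rightarrow> ('c, 'x) wtree set" where
  "w0_class P t =
     {u. equivclp (\<lambda>t u. (\<exists>c cs. t \<in> topspace (wspace P c cs) \<and> u \<in> topspace (wspace P c cs)) \<and>
                         w0_step P t u) t u}"

text \<open>
  Grafting \<open>u\<close> onto the leaf \<open>i\<close> of \<open>t\<close>. The new internal edge has length \<open>1\<close> because this is the
  dummy length of the root of \<open>u\<close>.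
\<close>

definition graft :: "nat \<Rightarrow> ('c, 'x) wtree \<Rightarrow> ('c, 'x) wtree \<Rightarrow> ('c, 'x) wtree" where
  "graft i t u =
     plug (\<lambda>(c, j). if j = i then map_ptree id (\<lambda>(d, a). (d, i + a)) u
                    else Leaf (c, outer_idx i (length (leaves u)) j)) t"

definition relabel_leaves :: "(nat \<Rightarrow> nat) \<Rightarrow> ('c, 'x) wtree \<Rightarrow> ('c, 'x) wtree" where
  "relabel_leaves \<pi> = map_ptree id (\<lambda>(c, j). (c, inv_into UNIV \<pi> j))"

text \<open>
  Taking the quotient by all relations at once gives the same space as first forming \<open>WP\<close> and then
  dividing out the additional relations. Operations on classes are unions over representatives; the
  classes in such a union all coincide.
\<close>

definition W0 :: "('c, 'x) operad \<Rightarrow> ('c, ('c, 'x) wtree set) operad" where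
  "W0 P =
     \<lparr>ops = \<lambda>c cs. quot_topology (wspace P c cs) (w0_class P),
      circ = \<lambda>i X Y. \<Union>t\<in>X. \<Union>u\<in>Y. w0_class P (graft i t u),
      ident = \<lambda>c. w0_class P (Leaf (c, 0)),
      act = \<lambda>\<pi> X. \<Union>t\<in>X. w0_class P (relabel_leaves \<pi> t)\<rparr>"

end

theory Submission
  imports Defs
begin

text \<open>
  Both operads are identified with a third one. Its operations are the pairs of a labelled tree \<open>T\<close>
  and a weight function on sets of vertices of \<open>T\<close> with values in the unit interval such that the
  sets of positive weight form a bracketing of \<open>T\<close>.

  A point of the realization of the poset of bracketings is a chain of bracketings with barycentric
  coordinates; the weight of a subtree is the sum of the coordinates of the bracketings containing
  it. A decorated tree \<open>t\<close> is sent to the composite \<open>T\<close> of its labels, and every internal edge of \<open>t\<close>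
  cuts off a part of \<open>t\<close> whose leaves are the vertices of a subtree of \<open>T\<close>; the weight of a subtree is
  the largest length of an edge that cuts it off. Edges of length zero disappear, and the edges
  on both sides of a unary vertex cut off the same subtree, which is why lengths are merged by
  taking the maximum. Nullary and unary vertices can be absorbed by their neighbours, and what is
  left is determined by the composite and the weights; conversely, every nested family of
  subtrees can be cut out of \<open>T\<close>. The resulting continuous bijection from the quotient is a
  homeomorphism because finitely many compact families of decorated trees meet every class.
  Grafting creates an edge of length one, which corresponds to the new bracket in the composition
  of bracketings.
\<close>

section \<open>Simultaneous substitution in planar trees\<close>

text \<open>Being topological operads is part of the claim, but composition in \<open>W0\<close> is
  a union over representatives and in \<open>BO_operad\<close> it uses a definite description.
  Grafting of trees satisfies the axioms on the nose and every point of the third operad comes from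
  a tree, so the axioms for composition are checked on trees and transported.

  The main obstacle is that the invariants determine the class. The normal form sorts children by
  least leaf number and demands that the composite of each part cut off has its leaves numbered in
  planar order. The root is exceptional: its vertex may stay unary or nullary, and leaving its
  length free is what lets relations be applied inside larger trees.

  Weights are compared through superlevel sets: maxima become unions, and the threshold
  \<open>a\<close> corresponds to the value of a step function at \<open>1 - a\<close>.\<close>

definition single :: "'v \<Rightarrow> nat \<Rightarrow> ('v, nat) ptree" where
  "single v n = Node v (map Leaf [0..<n])"

text \<open>The label \<open>g v n\<close> takes the place of the vertex, and its leaf
  \<open>a\<close> receives the substituted child number \<open>a\<close>. The arity is passed to
  \<open>g\<close> because \<open>v\<close> alone does not determine it. Both composition in
  \<open>O_operad\<close> and the composite of a decorated tree are instances.\<close>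

fun sub :: "('v \<Rightarrow> nat \<Rightarrow> ('w, nat) ptree) \<Rightarrow> ('v, 'l) ptree \<Rightarrow> ('w, 'l) ptree" where
  "sub g (Leaf a) = Leaf a"
| "sub g (Node v ts) = plug (\<lambda>a. map (sub g) ts ! a) (g v (length ts))"

lemma set_leaves: "set (leaves t) = lset t"
  by (induction t) auto

lemma fst_set_verts: "fst ` set (verts t) = vset t"
  by (induction t) (auto simp: image_Un image_UN)

lemma vset_verts: "v \<in> vset t \<longleftrightarrow> (\<exists>n. (v, n) \<in> set (verts t))"
  using fst_set_verts[of t] by force

lemma plug_cong: "(\<And>a. a \<in> lset t \<Longrightarrow> f a = f' a) \<Longrightarrow> plug f t = plug f' t"
  by (induction t) auto

lemma plug_Leaf [simp]: "plug Leaf t = t"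
  by (induction t) (auto intro: map_idI)

lemma plug_plug: "plug f (plug g t) = plug (\<lambda>a. plug f (g a)) t"
  by (induction t) auto

lemma plug_map: "plug f (map_ptree id k t) = plug (\<lambda>a. f (k a)) t"
  by (induction t) auto

lemma map_plug: "map_ptree h k (plug f t) = plug (\<lambda>a. map_ptree h k (f a)) (map_ptree h id t)"
  by (induction t) auto

lemma map_leaves_plug: "map_ptree id k t = plug (\<lambda>a. Leaf (k a)) t"
  by (induction t) auto

lemma lset_plug: "lset (plug f t) = (\<Union>a\<in>lset t. lset (f a))"
  by (induction t) auto

lemma vset_plug: "vset (plug f t) = vset t \<union> (\<Union>a\<in>lset t. vset (f a))"
  by (induction t) auto

lemma leaves_plug: "leaves (plug f t) = concat (map (\<lambda>a. leaves (f a)) (leaves t))"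
proof (induction t)
  case (Node v ts)
  have "concat (map (\<lambda>t. leaves (plug f t)) ts) = concat (map (\<lambda>a. leaves (f a)) (concat (map leaves ts)))"
    using Node by (induction ts) auto
  then show ?case
    by (simp add: comp_def)
qed auto

lemma leaves_map: "leaves (map_ptree h k t) = map k (leaves t)"
  by (induction t) (auto simp: map_concat intro!: arg_cong[where f=concat])

lemma verts_map: "verts (map_ptree h k t) = map (map_prod h id) (verts t)"
  by (induction t) (auto simp: map_concat intro!: arg_cong[where f=concat])

lemma mset_verts_plug:
  "mset (verts (plug f t)) = mset (verts t) + (\<Sum>a\<leftarrow>leaves t. mset (verts (f a)))"
proof (induction t)
  case (Node v ts)
  have "(\<Sum>t\<leftarrow>ts. mset (verts (plug f t))) =
      (\<Sum>t\<leftarrow>ts. mset (verts t)) + (\<Sum>t\<leftarrow>ts. \<Sum>a\<leftarrow>leaves t. mset (verts (f a)))"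
    using Node by (induction ts) auto
  moreover have "(\<Sum>a\<leftarrow>concat (map leaves ts). mset (verts (f a))) =
      (\<Sum>t\<leftarrow>ts. \<Sum>a\<leftarrow>leaves t. mset (verts (f a)))"
    by (induction ts) auto
  ultimately show ?case
    by (simp add: mset_concat comp_def)
qed auto

lemma leaves_single [simp]: "leaves (single v n) = [0..<n]"
  by (simp add: single_def comp_def concat_map_singleton)

lemma verts_single [simp]: "verts (single v n) = [(v, n)]"
  by (simp add: single_def comp_def)

lemma vset_single [simp]: "vset (single v n) = {v}"
  by (auto simp: single_def)

lemma sub_cong:
  "(\<And>v n. (v, n) \<in> set (verts t) \<Longrightarrow> g v n = g' v n) \<Longrightarrow> sub g t = sub g' t"
proof (induction t)
  case (Node v ts)
  have "map (sub g) ts = map (sub g') ts"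
    using Node by (intro map_cong refl) auto
  then show ?case
    using Node.prems[of v "length ts"] by (simp del: map_eq_conv)
qed auto

text \<open>A substitution is only meaningful if vertices with \<open>n\<close> inputs are replaced by trees whose
  leaves are among \<open>0, \<dots>, n - 1\<close>.\<close>

definition arity_ok :: "('v \<Rightarrow> nat \<Rightarrow> ('w, nat) ptree) \<Rightarrow> ('v, 'l) ptree \<Rightarrow> bool" where
  "arity_ok g t \<longleftrightarrow> (\<forall>(v, n)\<in>set (verts t). lset (g v n) \<subseteq> {..<n})"

lemma arity_ok_Node:
  "arity_ok g (Node v ts) \<longleftrightarrow> lset (g v (length ts)) \<subseteq> {..<length ts} \<and> (\<forall>t\<in>set ts. arity_ok g t)"
  by (auto simp: arity_ok_def)

lemma lset_sub: "arity_ok g t \<Longrightarrow> lset (sub g t) \<subseteq> lset t"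
proof (induction t)
  case (Node v ts)
  show ?case
  proof
    fix x assume "x \<in> lset (sub g (Node v ts))"
    then obtain a where a: "a \<in> lset (g v (length ts))" "x \<in> lset (map (sub g) ts ! a)"
      by (auto simp: lset_plug)
    then have "a < length ts"
      using Node.prems by (auto simp: arity_ok_Node)
    then show "x \<in> lset (Node v ts)"
      using a Node.IH[of "ts ! a"] Node.prems by (force simp: arity_ok_Node)
  qed
qed auto

text \<open>\<open>arity_ok\<close> keeps every leaf label of \<open>g v n\<close> a valid index
  into the list of children; beyond its end \<open>!\<close> is arbitrary and would not commute with
  \<open>map\<close>.\<close>

lemma sub_plug:
  "arity_ok g t \<Longrightarrow> sub g (plug f t) = plug (\<lambda>a. sub g (f a)) (sub g t)"
proof (induction t)
  case (Node v ts)
  have "map (sub g) (map (plug f) ts) ! a = plug (\<lambda>a. sub g (f a)) (map (sub g) ts ! a)"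
    if "a \<in> lset (g v (length ts))" for a
    using that Node by (auto simp: arity_ok_Node)
  then show ?case
    by (auto simp: plug_plug intro!: plug_cong)
qed auto

text \<open>This is associativity of composition in its simultaneous form; the invariance of
  composites under collapsing edges reduces to it. The inductive step moves the outer substitution
  past \<open>plug\<close> by \<open>sub_plug\<close>.\<close>

lemma sub_sub:
  assumes "arity_ok h t" "\<And>v n. (v, n) \<in> set (verts t) \<Longrightarrow> arity_ok g (h v n)"
  shows "sub g (sub h t) = sub (\<lambda>v n. sub g (h v n)) t"
  using assms
proof (induction t)
  case (Node v ts)
  have ok: "arity_ok g (h v (length ts))"
    by (rule Node.prems(2)) simp
  have "sub g (map (sub h) ts ! a) = map (sub (\<lambda>v n. sub g (h v n))) ts ! a"
    if "a \<in> lset (sub g (h v (length ts)))" for a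
  proof -
    have a: "a < length ts"
      using that lset_sub[OF ok] Node.prems(1) unfolding arity_ok_Node by blast
    moreover have "arity_ok h (ts ! a)"
      using a Node.prems(1) by (simp add: arity_ok_Node)
    then have "sub g (sub h (ts ! a)) = sub (\<lambda>v n. sub g (h v n)) (ts ! a)"
      using a by (intro Node.IH Node.prems(2)) auto
    ultimately show ?thesis
      by simp
  qed
  then show ?case
    unfolding sub.simps sub_plug[OF ok] by (rule plug_cong)
qed auto

lemma sub_single:
  assumes "lset (g v n) \<subseteq> {..<n}"
  shows "sub g (single v n) = g v n"
proof -
  have "sub g (single v n) = plug Leaf (g v n)"
    unfolding single_def sub.simps length_map length_upt diff_zero
    by (rule plug_cong) (use assms in auto)
  then show ?thesis
    by simp
qed

lemma plug_single:
  "length us = n \<Longrightarrow> plug (\<lambda>a. us ! a) (single v n) = Node v us"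
  by (auto simp: single_def intro: nth_equalityI)

lemma sub_map: "sub g (map_ptree f id t) = sub (\<lambda>v. g (f v)) t"
proof (induction t)
  case (Node v ts)
  have "map (sub g) (map (map_ptree f id) ts) = map (sub (\<lambda>v. g (f v))) ts"
    using Node by (auto simp: id_def)
  then show ?case
    by (simp only: ptree.map sub.simps length_map)
qed auto

lemma map_leaves_sub: "map_ptree id f (sub g t) = sub g (map_ptree id f t)"
  if "arity_ok g t"
  using that
proof (induction t)
  case (Node v ts)
  have "map_ptree id f (map (sub g) ts ! a) = map (sub g) (map (map_ptree id f) ts) ! a"
    if "a \<in> lset (g v (length ts))" for a
    using that Node by (auto simp: arity_ok_Node id_def)
  then have "plug (\<lambda>a. map_ptree id f (map (sub g) ts ! a)) (g v (length ts)) =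
      plug (\<lambda>a. map (sub g) (map (map_ptree id f) ts) ! a) (g v (length ts))"
    by (rule plug_cong)
  moreover have "map_ptree id f (sub g (Node v ts)) =
      plug (\<lambda>a. map_ptree id f (map (sub g) ts ! a)) (map_ptree id id (g v (length ts)))"
    by (simp only: sub.simps map_plug)
  ultimately show ?case
    unfolding ptree.map_id ptree.map sub.simps length_map id_apply by (rule trans[rotated])
qed auto

lemma map_eq_sub: "map_ptree f id t = sub (\<lambda>v. single (f v)) t"
  by (induction t) (simp_all add: plug_single cong: map_cong)

text \<open>A partial composition substitutes corollas, renumbered by \<open>outer_idx\<close>, at
  all vertices but one. In this form it can be fed into \<open>sub_sub\<close>.\<close>

lemma subst_vertex_eq_sub:
  "subst_vertex i T' T =
     sub (\<lambda>v n. if v = i then map_ptree (\<lambda>j. i + j) id T'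
                else single (outer_idx i (length (verts T')) v) n) T"
  by (induction T) (simp_all add: plug_single Let_def cong: map_cong)

section \<open>Vertices and leaves of a substitution\<close>

text \<open>One multiset equation says that every input occurs exactly once; unlike distinctness it
  adds up under substitution.\<close>

definition numbered :: "nat \<Rightarrow> ('v, nat) ptree \<Rightarrow> bool" where
  "numbered n t \<longleftrightarrow> mset (leaves t) = mset [0..<n]"

lemma lset_numbered: "numbered n t \<Longrightarrow> lset t = {..<n}"
  unfolding numbered_def by (drule mset_eq_setD) (simp add: set_leaves atLeast_upt)

lemma numbered_single [simp]: "numbered n (single v n)"
  by (simp add: numbered_def)

lemma numbered_map [simp]: "numbered n (map_ptree f id t) \<longleftrightarrow> numbered n t"
  by (simp add: numbered_def leaves_map)

lemma arity_okI: "(\<And>v n. (v, n) \<in> set (verts t) \<Longrightarrow> numbered n (g v n)) \<Longrightarrow> arity_ok g t"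
  by (auto simp: arity_ok_def dest!: lset_numbered)

lemma sum_list_mset_cong:
  "mset xs = mset ys \<Longrightarrow> (\<Sum>x\<leftarrow>xs. f x) = (\<Sum>x\<leftarrow>ys. f x)" for f :: "'a \<Rightarrow> 'b::comm_monoid_add"
  by (simp flip: sum_mset_sum_list)

lemma sum_list_singleton_mset: "(\<Sum>x\<leftarrow>xs. {#f x#}) = mset (map f xs)"
  by (induction xs) auto

lemma sum_list_eq:
  "(\<And>x. x \<in> set xs \<Longrightarrow> f x = g x) \<Longrightarrow> (\<Sum>x\<leftarrow>xs. f x) = (\<Sum>x\<leftarrow>xs. g x)"
  by (metis map_cong)

lemma sum_list_nth: "(\<Sum>a\<leftarrow>[0..<length ts]. f (ts ! a)) = (\<Sum>t\<leftarrow>ts. f t)"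
proof -
  have "map (\<lambda>a. f (ts ! a)) [0..<length ts] = map f ts"
    by (rule nth_equalityI) auto
  then show ?thesis
    by simp
qed

text \<open>A numbered label uses each child exactly once, so the sum over the leaves of the label
  is the sum over the children in another order.\<close>

lemma mset_leaves_sub:
  assumes "\<And>v n. (v, n) \<in> set (verts t) \<Longrightarrow> numbered n (g v n)"
  shows "mset (leaves (sub g t)) = mset (leaves t)"
  using assms
proof (induction t)
  case (Node v ts)
  have num: "mset (leaves (g v (length ts))) = mset [0..<length ts]"
    using Node.prems by (auto simp: numbered_def)
  have "mset (leaves (sub g (Node v ts))) = (\<Sum>a\<leftarrow>leaves (g v (length ts)). mset (leaves (map (sub g) ts ! a)))"
    by (simp add: leaves_plug mset_concat comp_def)
  also have "\<dots> = (\<Sum>a\<leftarrow>[0..<length ts]. mset (leaves (map (sub g) ts ! a)))"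
    by (rule sum_list_mset_cong[OF num])
  also have "\<dots> = (\<Sum>t\<leftarrow>ts. mset (leaves (sub g t)))"
    using sum_list_nth[of "\<lambda>t. mset (leaves t)" "map (sub g) ts"] by (simp add: comp_def)
  also have "\<dots> = (\<Sum>t\<leftarrow>ts. mset (leaves t))"
    by (rule sum_list_eq) (use Node in auto)
  finally show ?case
    by (simp add: mset_concat comp_def)
qed auto

lemma numbered_sub:
  "(\<And>v n. (v, n) \<in> set (verts t) \<Longrightarrow> numbered n (g v n)) \<Longrightarrow> numbered m t \<Longrightarrow> numbered m (sub g t)"
  by (simp add: numbered_def[of m] mset_leaves_sub)

lemma mset_verts_sub:
  assumes "\<And>v n. (v, n) \<in> set (verts t) \<Longrightarrow> numbered n (g v n)"
  shows "mset (verts (sub g t)) = (\<Sum>(v, n)\<leftarrow>verts t. mset (verts (g v n)))"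
  using assms
proof (induction t)
  case (Node v ts)
  have num: "mset (leaves (g v (length ts))) = mset [0..<length ts]"
    using Node.prems by (auto simp: numbered_def)
  have "(\<Sum>a\<leftarrow>leaves (g v (length ts)). mset (verts (map (sub g) ts ! a)))
      = (\<Sum>a\<leftarrow>[0..<length ts]. mset (verts (map (sub g) ts ! a)))"
    by (rule sum_list_mset_cong[OF num])
  also have "\<dots> = (\<Sum>t\<leftarrow>ts. mset (verts (sub g t)))"
    using sum_list_nth[of "\<lambda>t. mset (verts t)" "map (sub g) ts"] by (simp add: comp_def)
  also have "\<dots> = (\<Sum>t\<leftarrow>ts. \<Sum>(v, n)\<leftarrow>verts t. mset (verts (g v n)))"
    by (rule sum_list_eq) (use Node in auto)
  also have "\<dots> = (\<Sum>(v, n)\<leftarrow>concat (map verts ts). mset (verts (g v n)))"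
    by (induction ts) auto
  finally show ?case
    by (simp add: mset_verts_plug)
qed auto

lemma inner_edges_vset: "inner_edges t \<subseteq> vset t \<times> vset t"
  by (induction t) fastforce+

text \<open>Distinctness together with a set of entries is replaced by equality of multisets, the
  form in which the vertices of composites can be counted.\<close>

lemma ltrees_iff:
  "T \<in> ltrees n ms \<longleftrightarrow>
     numbered n T \<and> mset (verts T) = mset (map (\<lambda>i. (i, ms ! i)) [0..<length ms])"
proof -
  have 1: "distinct (leaves T) \<and> set (leaves T) = {..<n} \<longleftrightarrow> numbered n T"
    unfolding numbered_def
    by (metis atLeast_upt distinct_upt mset_eq_imp_distinct_iff set_eq_iff_mset_eq_distinct set_mset_mset)
  have 2: "distinct (map (\<lambda>i. (i, ms ! i)) [0..<length ms])"
    by (simp add: distinct_map inj_on_def)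
  have 3: "set (map (\<lambda>i. (i, ms ! i)) [0..<length ms]) = {(i, ms ! i) | i. i < length ms}"
    by auto
  have "distinct (map fst (verts T)) \<and> set (verts T) = {(i, ms ! i) | i. i < length ms} \<longleftrightarrow>
    mset (verts T) = mset (map (\<lambda>i. (i, ms ! i)) [0..<length ms])"
    (is "?l \<longleftrightarrow> ?r")
  proof
    assume ?l
    then show ?r
      using 2 3 by (metis distinct_map set_eq_iff_mset_eq_distinct)
  next
    assume r: ?r
    then have "mset (map fst (verts T)) = mset [0..<length ms]"
      by (metis (no_types, lifting) comp_apply fst_conv map_map map_idI mset_map)
    then have "distinct (map fst (verts T))"
      using mset_eq_imp_distinct_iff by (metis distinct_upt)
    then show ?l
      using r 3 by (metis set_mset_mset)
  qed
  then show ?thesis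
    using 1 unfolding ltrees_def by blast
qed

lemma vset_ltrees: "T \<in> ltrees n ms \<Longrightarrow> vset T = {..<length ms}"
  unfolding ltrees_def fst_set_verts[symmetric] by force

lemma length_verts_ltrees: "T \<in> ltrees n ms \<Longrightarrow> length (verts T) = length ms"
  unfolding ltrees_iff by (metis diff_zero length_map length_upt size_mset)

lemma distinct_verts_ltrees: "T \<in> ltrees n ms \<Longrightarrow> distinct (map fst (verts T))"
  by (simp add: ltrees_def)

lemma set_verts_ltrees: "T \<in> ltrees n ms \<Longrightarrow> set (verts T) = {(i, ms ! i) | i. i < length ms}"
  by (simp add: ltrees_def)

lemma upt_add_map: "[0..<a + b] = [0..<a] @ map (\<lambda>j. a + j) [0..<b]"
proof -
  have "map (\<lambda>j. a + j) [0..<b] = [a..<a + b]"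
    using map_add_upt[of a b] by (simp add: add.commute)
  then show ?thesis
    using upt_add_eq_append[of 0 a b] by simp
qed

text \<open>The positions of the new profile form three blocks: those before \<open>i\<close>, the
  inserted ones, and those after \<open>i\<close>, which \<open>outer_idx\<close> shifts. Applied
  with singleton multisets for \<open>F\<close>, it counts the vertices of a composite.\<close>

lemma sum_list_upt_plug:
  fixes F :: "nat \<Rightarrow> 'a \<Rightarrow> 'b::comm_monoid_add"
  assumes "i < length ms"
  shows "(\<Sum>j\<leftarrow>[0..<length ms]. if j = i then (\<Sum>k\<leftarrow>[0..<length ds]. F (i + k) (ds ! k))
            else F (outer_idx i (length ds) j) (ms ! j)) =
         (\<Sum>j\<leftarrow>[0..<length (plug_profile i ms ds)]. F j (plug_profile i ms ds ! j))"
proof -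
  let ?p = "plug_profile i ms ds"
  have len: "length ?p = i + length ds + (length ms - Suc i)"
    using assms by (simp add: plug_profile_def)
  have upt1: "[0..<length ms] = [0..<i] @ [i] @ map (\<lambda>j. Suc i + j) [0..<length ms - Suc i]"
    using assms upt_add_map[of "Suc i" "length ms - Suc i"]
    by (simp only: upt_Suc_append zero_le le_add_diff_inverse Suc_leI append_assoc)
  have upt2: "[0..<length ?p] = [0..<i] @ map (\<lambda>j. i + j) [0..<length ds] @
      map (\<lambda>j. i + length ds + j) [0..<length ms - Suc i]"
    by (simp only: len upt_add_map[of "i + length ds" "length ms - Suc i"] upt_add_map[of i "length ds"] append_assoc)
  have a: "?p ! j = ms ! j" if "j < i" for j
    using assms that by (simp add: plug_profile_def nth_append)
  have b: "?p ! (i + j) = ds ! j" if "j < length ds" for j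
    using assms that by (simp add: plug_profile_def nth_append)
  have c: "?p ! (i + (length ds + j)) = ms ! (Suc i + j)" if "j < length ms - Suc i" for j
    using assms that by (simp add: plug_profile_def nth_append)
  have o': "outer_idx i (length ds) (Suc i + j) = i + length ds + j" for j
    by (simp add: outer_idx_def)
  have "(\<Sum>j\<leftarrow>[0..<i]. if j = i then (\<Sum>k\<leftarrow>[0..<length ds]. F (i + k) (ds ! k))
            else F (outer_idx i (length ds) j) (ms ! j)) = (\<Sum>j\<leftarrow>[0..<i]. F j (?p ! j))"
    by (rule sum_list_eq) (simp add: outer_idx_def a)
  moreover have "(\<Sum>k\<leftarrow>[0..<length ds]. F (i + k) (ds ! k)) = (\<Sum>k\<leftarrow>[0..<length ds]. F (i + k) (?p ! (i + k)))"
    by (rule sum_list_eq) (simp add: b)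
  moreover have "(\<Sum>k\<leftarrow>[0..<length ms - Suc i]. F (i + (length ds + k)) (ms ! Suc (i + k))) =
      (\<Sum>k\<leftarrow>[0..<length ms - Suc i]. F (i + (length ds + k)) (?p ! (i + (length ds + k))))"
    by (rule sum_list_eq) (simp add: c)
  moreover have "(\<Sum>j\<leftarrow>map (\<lambda>j. Suc i + j) [0..<length ms - Suc i].
        if j = i then (\<Sum>k\<leftarrow>[0..<length ds]. F (i + k) (ds ! k)) else F (outer_idx i (length ds) j) (ms ! j)) =
      (\<Sum>k\<leftarrow>[0..<length ms - Suc i]. F (i + (length ds + k)) (ms ! Suc (i + k)))"
    unfolding map_map comp_def by (rule sum_list_eq) (use o' in \<open>simp add: add.assoc\<close>)
  moreover have "(\<Sum>j\<leftarrow>map (\<lambda>j. i + length ds + j) [0..<length ms - Suc i]. F j (?p ! j)) =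
      (\<Sum>k\<leftarrow>[0..<length ms - Suc i]. F (i + (length ds + k)) (?p ! (i + (length ds + k))))"
    unfolding map_map comp_def by (rule sum_list_eq) (simp add: add.assoc)
  moreover have "(\<Sum>j\<leftarrow>map (\<lambda>j. i + j) [0..<length ds]. F j (?p ! j)) =
      (\<Sum>k\<leftarrow>[0..<length ds]. F (i + k) (?p ! (i + k)))"
    unfolding map_map comp_def by (rule sum_list_eq) simp
  ultimately show ?thesis
    by (simp only: upt1 upt2 map_append sum_list_append list.map sum_list.Cons sum_list.Nil refl if_True add_0_right)
qed

text \<open>By \<open>mset_verts_sub\<close> the vertices of the substituted pieces simply add up;
  what remains is the re-indexing \<open>sum_list_upt_plug\<close>.\<close>

lemma subst_vertex_ltrees:
  assumes T: "T \<in> ltrees n ms" and T': "T' \<in> ltrees (ms ! i) ds" and i: "i < length ms"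
  shows "subst_vertex i T' T \<in> ltrees n (plug_profile i ms ds)"
proof -
  let ?g = "\<lambda>v n. if v = i then map_ptree (\<lambda>j. i + j) id T'
                else single (outer_idx i (length (verts T')) v) n"
  have num: "numbered m (?g v m)" if "(v, m) \<in> set (verts T)" for v m
    using that T T' by (auto simp: set_verts_ltrees ltrees_iff[of T'])
  have "mset (verts (subst_vertex i T' T)) = (\<Sum>(v, m)\<leftarrow>verts T. mset (verts (?g v m)))"
    unfolding subst_vertex_eq_sub by (rule mset_verts_sub[OF num])
  also have "\<dots> = (\<Sum>(v, m)\<leftarrow>map (\<lambda>i. (i, ms ! i)) [0..<length ms]. mset (verts (?g v m)))"
    by (rule sum_list_mset_cong) (use T in \<open>simp add: ltrees_iff\<close>)
  also have "\<dots> = (\<Sum>j\<leftarrow>[0..<length ms]. if j = i then (\<Sum>k\<leftarrow>[0..<length ds]. {#(i + k, ds ! k)#})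
            else {#(outer_idx i (length ds) j, ms ! j)#})"
  proof -
    have "mset (verts (map_ptree (\<lambda>j. i + j) id T')) = (\<Sum>k\<leftarrow>[0..<length ds]. {#(i + k, ds ! k)#})"
    proof -
      have "mset (verts (map_ptree (\<lambda>j. i + j) id T')) = image_mset (map_prod ((+) i) id) (mset (verts T'))"
        by (simp add: verts_map)
      also have "\<dots> = image_mset (map_prod ((+) i) id) (mset (map (\<lambda>i. (i, ds ! i)) [0..<length ds]))"
        using T' by (simp add: ltrees_iff)
      also have "\<dots> = mset (map (\<lambda>k. (i + k, ds ! k)) [0..<length ds])"
        unfolding mset_map[symmetric] map_map by (simp add: comp_def id_def map_prod_def del: mset_map mset_upt)
      also have "\<dots> = (\<Sum>k\<leftarrow>[0..<length ds]. {#(i + k, ds ! k)#})"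
        by (simp only: sum_list_singleton_mset)
      finally show ?thesis .
    qed
    then show ?thesis
      unfolding map_map comp_def
      by - (rule sum_list_eq, simp add: length_verts_ltrees[OF T'])
  qed
  also have "\<dots> = (\<Sum>j\<leftarrow>[0..<length (plug_profile i ms ds)]. {#(j, plug_profile i ms ds ! j)#})"
    using sum_list_upt_plug[OF i, where F = "\<lambda>a b. {#(a, b)#}"] .
  also have "\<dots> = mset (map (\<lambda>j. (j, plug_profile i ms ds ! j)) [0..<length (plug_profile i ms ds)])"
    by (simp only: sum_list_singleton_mset)
  finally have "mset (verts (subst_vertex i T' T)) =
      mset (map (\<lambda>j. (j, plug_profile i ms ds ! j)) [0..<length (plug_profile i ms ds)])" .
  moreover have "numbered n (subst_vertex i T' T)"
    unfolding subst_vertex_eq_sub by (rule numbered_sub[OF num]) (use T in \<open>auto simp: ltrees_iff\<close>)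
  ultimately show ?thesis
    by (simp add: ltrees_iff)
qed

section \<open>Realizations of posets\<close>

text \<open>A point of the realization of a poset is the same as a monotone step function on the half-open
  unit interval with values in the poset: a point of a simplex gives the function that takes
  the value of its \<open>j\<close>th vertex on an interval whose length is the \<open>j\<close>th coordinate.\<close>

definition level :: "'b simplex_point \<Rightarrow> real \<Rightarrow> 'b" where
  "level p u = fst p ! (LEAST j. u \<le> sum (snd p) {..j})"

text \<open>The right ends of the intervals on which the step function is constant. The point
  \<open>0\<close> is added so that the set contains both ends of the unit interval, as
  \<open>breakpoints\<close> demands.\<close>

definition heads :: "'b simplex_point \<Rightarrow> real set" where
  "heads p = insert 0 ((\<lambda>j. sum (snd p) {..j}) ` {..<length (fst p)})"

text \<open>Intervals are open on the left and closed on the right, so a jump between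
  \<open>u\<close> and \<open>u'\<close> is blamed on a breakpoint in \<open>{u..<u'}\<close>. In
  particular a breakpoint at \<open>u\<close> itself allows a jump right after
  \<open>u\<close>.\<close>

definition steps_in :: "real set \<Rightarrow> (real \<Rightarrow> 'b) \<Rightarrow> bool" where
  "steps_in D g \<longleftrightarrow> (\<forall>u u'. 0 < u \<longrightarrow> u \<le> u' \<longrightarrow> u' \<le> 1 \<longrightarrow> D \<inter> {u..<u'} = {} \<longrightarrow> g u = g u')"

text \<open>Each interval between consecutive breakpoints gets the value of \<open>g\<close> at its
  right end, in keeping with the half-open convention; the coordinates are the lengths of the
  intervals.\<close>

definition refine :: "(real \<Rightarrow> 'b) \<Rightarrow> real set \<Rightarrow> 'b simplex_point" where
  "refine g D = (let ds = sorted_list_of_set D; k = length ds - 1 in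
     (map (\<lambda>j. g (ds ! Suc j)) [0..<k], \<lambda>j. if j < k then ds ! Suc j - ds ! j else 0))"

lemma nerve_space_iff:
  "p \<in> topspace (nerve_space A) \<longleftrightarrow>
     fst p \<noteq> [] \<and> set (fst p) \<subseteq> A \<and> sorted_wrt (\<le>) (fst p) \<and>
     snd p \<in> standard_simplex (length (fst p) - 1)"
  by (cases p) (auto simp: nerve_space_def nerve_def)

lemma standard_simplex_iff:
  assumes "0 < n"
  shows "t \<in> standard_simplex (n - 1) \<longleftrightarrow> (\<forall>i. 0 \<le> t i) \<and> (\<forall>i\<ge>n. t i = 0) \<and> sum t {..<n} = 1"
proof -
  have *: "{..n - 1} = {..<n}"
    using assms by auto
  have "t i \<le> 1" if "\<forall>i. 0 \<le> t i" "\<forall>i\<ge>n. t i = 0" "sum t {..<n} = 1" for i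
  proof (cases "i < n")
    case True
    then have "t i \<le> sum t {..<n}"
      using that by (intro member_le_sum) auto
    then show ?thesis
      using that by simp
  qed (use that in auto)
  moreover have "(\<forall>i>n - 1. t i = 0) \<longleftrightarrow> (\<forall>i\<ge>n. t i = 0)"
    using assms by (auto simp: less_eq_Suc_le)
  ultimately show ?thesis
    unfolding standard_simplex_def * by auto
qed

context
  fixes A :: "'b::order set" and p :: "'b simplex_point"
  assumes p: "p \<in> topspace (nerve_space A)"
begin

lemma weight_nonneg: "0 \<le> snd p j"
  using p by (auto simp: nerve_space_iff standard_simplex_def)

lemma weight_zero: "length (fst p) \<le> j \<Longrightarrow> snd p j = 0"
  using p standard_simplex_iff[of "length (fst p)" "snd p"] by (auto simp: nerve_space_iff)

lemma weight_sum: "sum (snd p) {..<length (fst p)} = 1"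
  using p standard_simplex_iff[of "length (fst p)" "snd p"] by (auto simp: nerve_space_iff)

lemma head_mono: "i \<le> j \<Longrightarrow> sum (snd p) {..i} \<le> sum (snd p) {..j}"
  by (intro sum_mono2) (auto simp: weight_nonneg)

lemma head_last: "sum (snd p) {..length (fst p) - 1} = 1"
proof -
  have "{..length (fst p) - 1} = {..<length (fst p)}"
    using p by (cases "fst p") (auto simp: nerve_space_iff)
  then show ?thesis
    using weight_sum by simp
qed

lemma level_index:
  assumes "u \<le> 1"
  shows "u \<le> sum (snd p) {..LEAST j. u \<le> sum (snd p) {..j}}"
    "(LEAST j. u \<le> sum (snd p) {..j}) < length (fst p)"
proof -
  have *: "u \<le> sum (snd p) {..length (fst p) - 1}"
    using assms by (simp only: head_last)
  show "u \<le> sum (snd p) {..LEAST j. u \<le> sum (snd p) {..j}}"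
    using * by (rule LeastI)
  have "(LEAST j. u \<le> sum (snd p) {..j}) \<le> length (fst p) - 1"
    using * by (rule Least_le)
  moreover have "fst p \<noteq> []"
    using p by (auto simp: nerve_space_iff)
  ultimately show "(LEAST j. u \<le> sum (snd p) {..j}) < length (fst p)"
    by (cases "fst p") auto
qed

lemma level_in: "u \<le> 1 \<Longrightarrow> level p u \<in> A"
  using level_index(2)[of u] p unfolding level_def nerve_space_iff by auto

lemma level_mono:
  assumes "u \<le> u'" "u' \<le> 1"
  shows "level p u \<le> level p u'"
proof -
  have "(LEAST j. u \<le> sum (snd p) {..j}) \<le> (LEAST j. u' \<le> sum (snd p) {..j})"
    using level_index(1)[OF assms(2)] assms(1) by (intro Least_le) auto
  then show ?thesis
    using level_index(2)[OF assms(2)] p unfolding level_def nerve_space_iff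
    by (cases "(LEAST j. u \<le> sum (snd p) {..j}) = (LEAST j. u' \<le> sum (snd p) {..j})")
       (auto intro: sorted_wrt_nth_less)
qed

lemma heads_bounds: "heads p \<subseteq> {0..1}" "finite (heads p)" "0 \<in> heads p" "1 \<in> heads p"
proof -
  have "sum (snd p) {..j} \<le> 1" if "j < length (fst p)" for j
    using head_mono[of j "length (fst p) - 1"] that unfolding head_last by simp
  then show "heads p \<subseteq> {0..1}"
    by (auto simp: heads_def weight_nonneg intro!: sum_nonneg)
  have "fst p \<noteq> []"
    using p by (auto simp: nerve_space_iff)
  then show "1 \<in> heads p"
    unfolding heads_def using head_last[symmetric] by (intro insertI2 image_eqI) auto
qed (auto simp: heads_def)

lemma steps_in_level:
  assumes "heads p \<subseteq> D"
  shows "steps_in D (level p)"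
  unfolding steps_in_def
proof (intro allI impI)
  fix u u' :: real
  assume u: "0 < u" "u \<le> u'" "u' \<le> 1" "D \<inter> {u..<u'} = {}"
  let ?j = "LEAST j. u \<le> sum (snd p) {..j}"
  have j: "u \<le> sum (snd p) {..?j}" "?j < length (fst p)"
    using level_index[of u] u by auto
  then have "sum (snd p) {..?j} \<in> D"
    using assms by (auto simp: heads_def)
  then have "u' \<le> sum (snd p) {..?j}"
    using u(4) j(1) by (meson atLeastLessThan_iff disjoint_iff not_le)
  then have "(LEAST j. u' \<le> sum (snd p) {..j}) = ?j"
    using u(2) by (intro Least_equality) (auto intro: Least_le)
  then show "level p u = level p u'"
    by (simp add: level_def)
qed

end

section \<open>Subdividing a point of a realization along a finite set of breakpoints\<close>

locale breakpoints =
  fixes D :: "real set"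
  assumes finite: "finite D" and subset: "D \<subseteq> {0..1}" and zero: "0 \<in> D" and one: "1 \<in> D"
begin

definition ds where "ds = sorted_list_of_set D"

definition k where "k = length ds - 1"

lemma set_ds: "set ds = D"
  by (simp add: ds_def finite)

lemma ds_less: "i < j \<Longrightarrow> j \<le> k \<Longrightarrow> ds ! i < ds ! j"
  using strict_sorted_list_of_set[of D] unfolding ds_def k_def
  by (intro sorted_wrt_nth_less[of "(<)"]) auto

lemma length_ds: "length ds = Suc k" "0 < k"
proof -
  have "card D \<ge> card {0::real, 1}"
    using zero one by (intro card_mono finite) auto
  then show "length ds = Suc k" "0 < k"
    by (auto simp: k_def ds_def)
qed

lemma ds_le_iff: "i \<le> k \<Longrightarrow> j \<le> k \<Longrightarrow> ds ! i \<le> ds ! j \<longleftrightarrow> i \<le> j"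
  by (metis ds_less le_less linorder_not_less order.asym)

lemma ds_less_iff: "i \<le> k \<Longrightarrow> j \<le> k \<Longrightarrow> ds ! i < ds ! j \<longleftrightarrow> i < j"
  by (metis ds_le_iff linorder_not_le)

lemma ds_in: "j \<le> k \<Longrightarrow> ds ! j \<in> D"
  using set_ds length_ds nth_mem[of j ds] by auto

lemma in_ds: "d \<in> D \<Longrightarrow> \<exists>j\<le>k. d = ds ! j"
  using set_ds length_ds by (metis in_set_conv_nth less_Suc_eq_le)

lemma ds_0: "ds ! 0 = 0"
proof -
  obtain j where "j \<le> k" "0 = ds ! j"
    using in_ds[OF zero] by auto
  moreover have "0 \<le> ds ! 0"
    using ds_in[of 0] subset by auto
  ultimately show ?thesis
    by (metis ds_le_iff le_zero_eq order.refl zero_le order.antisym)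
qed

lemma ds_k: "ds ! k = 1"
proof -
  obtain j where "j \<le> k" "1 = ds ! j"
    using in_ds[OF one] by auto
  moreover have "ds ! k \<le> 1"
    using ds_in[of k] subset by auto
  ultimately show ?thesis
    by (metis ds_le_iff order.refl order.antisym)
qed

lemma refine_eq:
  "refine g D = (map (\<lambda>j. g (ds ! Suc j)) [0..<k], \<lambda>j. if j < k then ds ! Suc j - ds ! j else 0)"
  unfolding refine_def Let_def ds_def[symmetric] k_def[symmetric] by simp

lemma sum_gaps: "q \<le> r \<Longrightarrow> r \<le> k \<Longrightarrow> (\<Sum>j = q..<r. ds ! Suc j - ds ! j) = ds ! r - ds ! q"
  by (simp add: sum_Suc_diff')

lemma head_refine: "j < k \<Longrightarrow> sum (snd (refine g D)) {..j} = ds ! Suc j"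
proof -
  assume j: "j < k"
  have "sum (snd (refine g D)) {..j} = (\<Sum>j = 0..<Suc j. ds ! Suc j - ds ! j)"
    using j by (intro sum.cong) (auto simp: refine_eq)
  then show ?thesis
    using sum_gaps[of 0 "Suc j"] j by (simp add: ds_0)
qed

lemma refine_in:
  assumes "\<And>u. 0 < u \<Longrightarrow> u \<le> 1 \<Longrightarrow> g u \<in> A"
    and "\<And>u u'. 0 < u \<Longrightarrow> u \<le> u' \<Longrightarrow> u' \<le> 1 \<Longrightarrow> g u \<le> g u'"
  shows "refine g D \<in> topspace (nerve_space A)"
proof -
  have pos: "0 < ds ! Suc j" "ds ! Suc j \<le> 1" if "j < k" for j
    using that ds_less[of 0 "Suc j"] ds_in[of "Suc j"] subset by (auto simp: ds_0)
  have "sum (snd (refine g D)) {..<k} = 1"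
    using head_refine[of "k - 1" g] length_ds ds_k by (simp add: lessThan_Suc_atMost flip: lessThan_Suc_atMost)
  moreover have "0 \<le> snd (refine g D) j" for j
    using ds_less[of j "Suc j"] by (auto simp: refine_eq)
  ultimately have "snd (refine g D) \<in> standard_simplex (k - 1)"
    using length_ds by (subst standard_simplex_iff) (auto simp: refine_eq)
  moreover have "sorted_wrt (\<le>) (fst (refine g D))"
    unfolding sorted_wrt_iff_nth_less
    using pos by (auto simp: refine_eq ds_le_iff intro!: assms(2))
  ultimately show ?thesis
    using pos length_ds by (auto simp: nerve_space_iff refine_eq intro!: assms(1))
qed

text \<open>The least breakpoint at or above \<open>u\<close> closes the interval that contains
  \<open>u\<close>, and \<open>g\<close> is constant from \<open>u\<close> up to it.\<close>

lemma level_refine: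
  assumes "steps_in D g" "0 < u" "u \<le> 1"
  shows "level (refine g D) u = g u"
proof -
  let ?P = "\<lambda>j. u \<le> ds ! Suc j"
  have P: "?P (k - 1)"
    using assms(3) length_ds by (simp add: ds_k)
  let ?j = "LEAST j. ?P j"
  have j: "?P ?j" "?j \<le> k - 1"
    using P by (auto intro: LeastI Least_le)
  then have jk: "?j < k"
    using length_ds by linarith
  have "(LEAST j. u \<le> sum (snd (refine g D)) {..j}) = ?j"
  proof (rule Least_equality)
    show "u \<le> sum (snd (refine g D)) {..?j}"
      using j jk by (simp add: head_refine)
    fix y assume y: "u \<le> sum (snd (refine g D)) {..y}"
    show "?j \<le> y"
    proof (cases "y < k")
      case True
      then show ?thesis
        using y by (intro Least_le) (simp add: head_refine)
    qed (use jk in simp)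
  qed
  then have "level (refine g D) u = g (ds ! Suc ?j)"
    using jk by (simp add: level_def refine_eq)
  also have "g u = g (ds ! Suc ?j)"
  proof -
    have "D \<inter> {u..<ds ! Suc ?j} = {}"
    proof (rule ccontr)
      assume "D \<inter> {u..<ds ! Suc ?j} \<noteq> {}"
      then obtain d where d: "d \<in> D" "u \<le> d" "d < ds ! Suc ?j"
        by auto
      then obtain i where i: "i \<le> k" "d = ds ! i"
        using in_ds by auto
      then have "i < Suc ?j"
        using d jk ds_less_iff[of i "Suc ?j"] by auto
      moreover have "i \<noteq> 0"
        using i d assms(2) ds_0 by (metis linorder_not_less)
      then obtain i' where "i = Suc i'"
        by (cases i) auto
      ultimately show False
        using not_less_Least[of i' ?P] d i by auto
    qed
    moreover have "ds ! Suc ?j \<le> 1"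
      using ds_in[of "Suc ?j"] jk subset by auto
    ultimately show ?thesis
      using assms j(1) unfolding steps_in_def by blast
  qed
  finally show ?thesis
    by simp
qed

text \<open>Refining cuts the intervals of \<open>p\<close> into smaller ones. The map \<alpha>
  sends each small interval to the interval of \<open>p\<close> that contains it, so pulling back
  the chain repeats values and pushing forward the coordinates adds the lengths up again.\<close>

lemma nerve_step_refine:
  assumes p: "p \<in> topspace (nerve_space A)" and D: "heads p \<subseteq> D"
  shows "nerve_step (refine (level p) D) p"
proof -
  define m where "m = k - 1"
  have m: "k = Suc m"
    using length_ds by (simp add: m_def)
  define \<alpha> where "\<alpha> j = (LEAST i. ds ! Suc j \<le> sum (snd p) {..i})" for j
  have le1: "ds ! Suc j \<le> 1" if "j \<le> m" for j
    using that ds_in[of "Suc j"] subset m by auto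
  have \<alpha>: "ds ! Suc j \<le> sum (snd p) {..\<alpha> j}" "\<alpha> j < length (fst p)" if "j \<le> m" for j
    using level_index[OF p le1[OF that]] by (auto simp: \<alpha>_def)
  have mono: "\<alpha> i \<le> \<alpha> j" if "i \<le> j" "j \<le> m" for i j
    unfolding \<alpha>_def[of i]
  proof (rule Least_le)
    have "ds ! Suc i \<le> ds ! Suc j"
      using that m by (subst ds_le_iff) auto
    then show "ds ! Suc i \<le> sum (snd p) {..\<alpha> j}"
      using \<alpha>(1)[OF that(2)] by linarith
  qed
  \<comment> \<open>Interval \<open>i\<close> of \<open>p\<close> runs from \<open>a\<close> to
    \<open>b\<close>, and both ends are breakpoints, with numbers \<open>q\<close> and
    \<open>r\<close>. The small intervals inside it are those with \<open>q \<le> j\<close> and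
    \<open>j < r\<close>, and their lengths telescope.\<close>
  have weights: "snd p i = (\<Sum>j | j \<le> m \<and> \<alpha> j = i. ds ! Suc j - ds ! j)" for i
  proof (cases "i < length (fst p)")
    case True
    define a where "a = sum (snd p) {..<i}"
    define b where "b = sum (snd p) {..i}"
    have ab: "b = a + snd p i"
      by (simp add: a_def b_def flip: lessThan_Suc_atMost)
    have "a \<in> heads p"
      using True unfolding a_def heads_def by (cases i) (auto simp: lessThan_Suc_atMost)
    then obtain q where q: "q \<le> k" "a = ds ! q"
      using in_ds D by auto
    have "b \<in> heads p"
      using True unfolding b_def heads_def by auto
    then obtain r where r: "r \<le> k" "b = ds ! r"
      using in_ds D by auto
    have qr: "q \<le> r"
      using ab q r weight_nonneg[OF p, of i] ds_le_iff[of q r] by simp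
    have "\<alpha> j = i \<longleftrightarrow> q \<le> j \<and> j < r" if "j \<le> m" for j
    proof -
      have "\<alpha> j = i \<longleftrightarrow> a < ds ! Suc j \<and> ds ! Suc j \<le> b"
      proof
        assume ai: "\<alpha> j = i"
        have "a < ds ! Suc j"
        proof (cases i)
          case 0
          then show ?thesis
            using ds_less[of 0 "Suc j"] that m by (simp add: a_def ds_0)
        next
          case (Suc i')
          then have "\<not> ds ! Suc j \<le> sum (snd p) {..i'}"
            using ai not_less_Least[of i' "\<lambda>i. ds ! Suc j \<le> sum (snd p) {..i}"]
            by (simp add: \<alpha>_def)
          then show ?thesis
            using Suc by (simp add: a_def lessThan_Suc_atMost)
        qed
        then show "a < ds ! Suc j \<and> ds ! Suc j \<le> b"
          using \<alpha>(1)[OF that] ai by (simp add: b_def)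
      next
        assume *: "a < ds ! Suc j \<and> ds ! Suc j \<le> b"
        show "\<alpha> j = i"
          unfolding \<alpha>_def
        proof (rule Least_equality)
          fix y assume y: "ds ! Suc j \<le> sum (snd p) {..y}"
          show "i \<le> y"
          proof (rule ccontr)
            assume "\<not> i \<le> y"
            then have "sum (snd p) {..y} \<le> a"
              unfolding a_def using weight_nonneg[OF p] by (intro sum_mono2) auto
            then show False
              using y * by simp
          qed
        qed (use * in \<open>simp add: b_def\<close>)
      qed
      also have "\<dots> \<longleftrightarrow> q < Suc j \<and> Suc j \<le> r"
        using that m q r by (simp add: ds_less_iff ds_le_iff)
      finally show ?thesis
        by auto
    qed
    then have "{j. j \<le> m \<and> \<alpha> j = i} = {j. j \<le> m \<and> q \<le> j \<and> j < r}"
      by blast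
    also have "\<dots> = {q..<r}"
      using r m by auto
    finally have "{j. j \<le> m \<and> \<alpha> j = i} = {q..<r}" .
    then show ?thesis
      using sum_gaps[OF qr r(1)] ab q r by simp
  next
    case False
    then have "{j. j \<le> m \<and> \<alpha> j = i} = {}"
      using \<alpha>(2) by auto
    then show ?thesis
      using False weight_zero[OF p, of i] by (simp only: sum.empty)
  qed
  have "refine (level p) D = (map (\<lambda>j. fst p ! \<alpha> j) [0..<Suc m], snd (refine (level p) D))"
    by (simp add: refine_eq level_def \<alpha>_def m del: upt_Suc)
  moreover have "p = (fst p, \<lambda>i. \<Sum>j | j \<le> m \<and> \<alpha> j = i. snd (refine (level p) D) j)"
  proof -
    have "(\<Sum>j | j \<le> m \<and> \<alpha> j = i. snd (refine (level p) D) j) = snd p i" for i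
      unfolding weights by (intro sum.cong) (auto simp: refine_eq m)
    then show ?thesis
      by simp
  qed
  ultimately show ?thesis
    unfolding nerve_step_def using mono \<alpha>(2) by blast
qed

end

text \<open>Since \<alpha> is monotone, the partial sums of the pushed forward coordinates are sums
  over initial segments; hence the first interval of \<open>q\<close> that reaches \<open>u\<close>
  is the image under \<alpha> of the first one of \<open>p\<close>.\<close>

lemma level_nerve_step:
  assumes p: "p \<in> topspace (nerve_space A)" and q: "q \<in> topspace (nerve_space A)"
    and step: "nerve_step p q" and u: "0 < u" "u \<le> 1"
  shows "level p u = level q u"
proof -
  obtain \<alpha> m \<xi> t where \<alpha>: "\<And>i j. i \<le> j \<Longrightarrow> j \<le> m \<Longrightarrow> \<alpha> i \<le> \<alpha> j"
    and p': "p = (map (\<lambda>j. \<xi> ! \<alpha> j) [0..<Suc m], t)"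
    and q': "q = (\<xi>, \<lambda>i. \<Sum>j | j \<le> m \<and> \<alpha> j = i. t j)"
    using step unfolding nerve_step_def by blast
  have nonneg: "0 \<le> t j" for j
    using weight_nonneg[OF p, of j] p' by simp
  let ?J = "LEAST j. u \<le> sum t {..j}"
  have J: "u \<le> sum t {..?J}" "?J \<le> m"
    using level_index[OF p u(2)] p' by auto
  have head: "sum (snd q) {..i} = (\<Sum>j | j \<le> m \<and> \<alpha> j \<le> i. t j)" for i
  proof -
    have "sum (snd q) {..i} = (\<Sum>y\<in>{..i}. \<Sum>j\<in>{j \<in> {j. j \<le> m \<and> \<alpha> j \<le> i}. \<alpha> j = y}. t j)"
      unfolding q' snd_conv by (rule sum.cong[OF refl], rule sum.cong) auto
    also have "\<dots> = (\<Sum>j | j \<le> m \<and> \<alpha> j \<le> i. t j)"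
      by (rule sum.group) auto
    finally show ?thesis .
  qed
  have "(LEAST i. u \<le> sum (snd q) {..i}) = \<alpha> ?J"
  proof (rule Least_equality)
    have "sum t {..?J} \<le> (\<Sum>j | j \<le> m \<and> \<alpha> j \<le> \<alpha> ?J. t j)"
      using J \<alpha> nonneg by (intro sum_mono2) auto
    then show "u \<le> sum (snd q) {..\<alpha> ?J}"
      using J unfolding head by linarith
  next
    fix y assume y: "u \<le> sum (snd q) {..y}"
    show "\<alpha> ?J \<le> y"
    proof (rule ccontr)
      assume "\<not> \<alpha> ?J \<le> y"
      then have sub: "{j. j \<le> m \<and> \<alpha> j \<le> y} \<subseteq> {..<?J}"
        using \<alpha>[of ?J] by (auto simp: not_le[symmetric]) (meson le_trans)
      have "sum (snd q) {..y} \<le> sum t {..<?J}"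
        unfolding head using sub nonneg by (intro sum_mono2) auto
      also have "\<dots> < u"
      proof (cases "?J")
        case (Suc J')
        then show ?thesis
          using not_less_Least[of J' "\<lambda>j. u \<le> sum t {..j}"] by (simp add: lessThan_Suc_atMost)
      qed (use u in simp)
      finally show False
        using y by simp
    qed
  qed
  then show ?thesis
    using J(2) by (simp add: level_def p' q' del: upt_Suc)
qed

text \<open>Step functions are invariant under \<open>nerve_step\<close>. Conversely, two points
  with the same step function have the same refinement along the union of their breakpoints, and one
  step leads from it to either of them.\<close>

lemma real_class_eq:
  assumes p: "p \<in> topspace (nerve_space A)"
  shows "real_class A p = {q \<in> topspace (nerve_space A). \<forall>u\<in>{0<..1}. level q u = level p u}"
proof -
  let ?R = "\<lambda>p q. p \<in> topspace (nerve_space A) \<and> q \<in> topspace (nerve_space A) \<and> nerve_step p q"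
  have 1: "q \<in> topspace (nerve_space A) \<and> (\<forall>u\<in>{0<..1}. level q u = level p u)" if "equivclp ?R p q" for q
    using that
  proof (induction rule: equivclp_induct)
    case (step y z)
    then show ?case
      using level_nerve_step[of y A z] level_nerve_step[of z A y] by fastforce
  qed (use p in auto)
  have 2: "equivclp ?R p q" if q: "q \<in> topspace (nerve_space A)"
    and eq: "\<And>u. u \<in> {0<..1} \<Longrightarrow> level q u = level p u" for q
  proof -
    define D where "D = heads p \<union> heads q"
    interpret breakpoints D
      using heads_bounds[OF p] heads_bounds[OF q] by unfold_locales (auto simp: D_def)
    have *: "refine (level q) D = refine (level p) D"
      unfolding refine_eq
    proof (intro map_cong refl arg_cong2[where f=Pair])
      fix j assume "j \<in> set [0..<k]"
      then show "level q (ds ! Suc j) = level p (ds ! Suc j)"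
        using ds_less[of 0 "Suc j"] ds_in[of "Suc j"] subset by (intro eq) (auto simp: ds_0)
    qed
    have r: "refine (level p) D \<in> topspace (nerve_space A)"
      using level_in[OF p] level_mono[OF p] by (intro refine_in) auto
    have "?R (refine (level p) D) p"
      using nerve_step_refine[OF p] p r by (auto simp: D_def)
    moreover have "?R (refine (level p) D) q"
      using nerve_step_refine[OF q] q r * by (auto simp: D_def)
    ultimately show ?thesis
      by (rule equivclp_trans[OF equivclp_sym[OF r_into_equivclp] r_into_equivclp])
  qed
  show ?thesis
    unfolding real_class_def by (rule Collect_cong, rule iffI, erule 1) (elim conjE, erule 2, erule bspec)
qed

text \<open>By \<open>real_class_eq\<close> every representative gives the same function on
  \<open>{0<..1}\<close>, and this function determines the class.\<close>

definition rlevel :: "'b simplex_point set \<Rightarrow> real \<Rightarrow> 'b" where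
  "rlevel z = level (SOME p. p \<in> z)"

lemma realization_point:
  assumes "z \<in> topspace (realization A)"
  shows "\<exists>p\<in>topspace (nerve_space A). z = real_class A p"
  using assms by (auto simp: realization_def)

lemma real_class_self: "p \<in> topspace (nerve_space A) \<Longrightarrow> p \<in> real_class A p"
  by (simp add: real_class_eq)

lemma real_class_in: "p \<in> topspace (nerve_space A) \<Longrightarrow> real_class A p \<in> topspace (realization A)"
  by (simp add: realization_def)

lemma rlevel_eq:
  assumes "z \<in> topspace (realization A)" "p \<in> z" "0 < u" "u \<le> 1"
  shows "rlevel z u = level p u"
proof -
  obtain q where "q \<in> topspace (nerve_space A)" "z = real_class A q"
    using realization_point[OF assms(1)] by blast
  moreover have "(SOME p. p \<in> z) \<in> z"
    using assms(2) by (rule someI)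
  ultimately show ?thesis
    using assms(2-) by (auto simp: rlevel_def real_class_eq)
qed

lemma rlevel_real_class:
  "p \<in> topspace (nerve_space A) \<Longrightarrow> 0 < u \<Longrightarrow> u \<le> 1 \<Longrightarrow> rlevel (real_class A p) u = level p u"
  by (rule rlevel_eq[OF real_class_in real_class_self])

lemma realization_member:
  assumes "z \<in> topspace (realization A)" "p \<in> z"
  shows "p \<in> topspace (nerve_space A)"
  using realization_point[OF assms(1)] assms(2) by (auto simp: real_class_eq)

lemma realization_eqI:
  assumes "z \<in> topspace (realization A)" "z' \<in> topspace (realization A)"
    and "\<And>u. 0 < u \<Longrightarrow> u \<le> 1 \<Longrightarrow> rlevel z u = rlevel z' u"
  shows "z = z'"
proof -
  obtain p where p: "p \<in> topspace (nerve_space A)" "z = real_class A p"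
    using realization_point[OF assms(1)] by blast
  obtain q where q: "q \<in> topspace (nerve_space A)" "z' = real_class A q"
    using realization_point[OF assms(2)] by blast
  have "level p u = level q u" if "u \<in> {0<..1}" for u
    using assms(3)[of u] that p q by (simp add: rlevel_real_class)
  then show ?thesis
    unfolding p(2) q(2) real_class_eq[OF p(1)] real_class_eq[OF q(1)] by auto
qed

lemma rlevel_props:
  assumes "z \<in> topspace (realization A)"
  shows "0 < u \<Longrightarrow> u \<le> 1 \<Longrightarrow> rlevel z u \<in> A"
    and "0 < u \<Longrightarrow> u \<le> u' \<Longrightarrow> u' \<le> 1 \<Longrightarrow> rlevel z u \<le> rlevel z u'"
    and "\<exists>D. breakpoints D \<and> steps_in D (rlevel z)"
proof -
  obtain p where p: "p \<in> topspace (nerve_space A)" "z = real_class A p"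
    using realization_point[OF assms(1)] by blast
  show "rlevel z u \<in> A" if "0 < u" "u \<le> 1" for u
    using that level_in[OF p(1)] by (simp add: p rlevel_real_class[OF p(1)])
  show "rlevel z u \<le> rlevel z u'" if "0 < u" "u \<le> u'" "u' \<le> 1"
    using that level_mono[OF p(1)] by (simp add: p rlevel_real_class[OF p(1)])
  have "breakpoints (heads p)"
    using heads_bounds[OF p(1)] by unfold_locales auto
  moreover have "steps_in (heads p) (rlevel z)"
    using steps_in_level[OF p(1) order.refl] unfolding steps_in_def
    by (simp add: p rlevel_real_class[OF p(1)])
  ultimately show "\<exists>D. breakpoints D \<and> steps_in D (rlevel z)"
    by blast
qed

lemma realization_exists:
  assumes "breakpoints D" "steps_in D g" "\<And>u. 0 < u \<Longrightarrow> u \<le> 1 \<Longrightarrow> g u \<in> A"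
    and "\<And>u u'. 0 < u \<Longrightarrow> u \<le> u' \<Longrightarrow> u' \<le> 1 \<Longrightarrow> g u \<le> g u'"
  shows "\<exists>z\<in>topspace (realization A). \<forall>u. 0 < u \<longrightarrow> u \<le> 1 \<longrightarrow> rlevel z u = g u"
proof -
  interpret breakpoints D
    by fact
  have "refine g D \<in> topspace (nerve_space A)"
    using assms by (intro refine_in) auto
  then show ?thesis
    using level_refine[OF assms(2)] by (intro bexI[OF _ real_class_in]) (auto simp: rlevel_real_class)
qed

lemma steps_in_mono: "steps_in D g \<Longrightarrow> D \<subseteq> D' \<Longrightarrow> steps_in D' g"
  unfolding steps_in_def by (meson disjoint_iff subsetD)

text \<open>Applying \<open>f\<close> to a chain composes its step function with \<open>f\<close>;
  hence all classes in the union defining \<open>real_map\<close> coincide.\<close>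

lemma real_map:
  assumes z: "z \<in> topspace (realization B)"
    and f: "\<And>b. b \<in> B \<Longrightarrow> f b \<in> A" "\<And>b b'. b \<in> B \<Longrightarrow> b' \<in> B \<Longrightarrow> b \<le> b' \<Longrightarrow> f b \<le> f b'"
  shows real_map_in: "real_map A f z \<in> topspace (realization A)"
    and rlevel_real_map: "0 < u \<Longrightarrow> u \<le> 1 \<Longrightarrow> rlevel (real_map A f z) u = f (rlevel z u)"
proof -
  obtain p where p: "p \<in> topspace (nerve_space B)" "z = real_class B p"
    using realization_point[OF z] by blast
  have in_A: "(map f (fst q), snd q) \<in> topspace (nerve_space A)" if "q \<in> topspace (nerve_space B)" for q
  proof -
    have "sorted_wrt (\<le>) (map f (fst q))"
      using that f(2) unfolding sorted_wrt_map nerve_space_iff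
      by (auto intro: sorted_wrt_mono_rel[of "fst q" "(\<le>)"])
    then show ?thesis
      using that f(1) by (auto simp: nerve_space_iff)
  qed
  have level: "level (map f (fst q), snd q) u = f (level q u)"
    if "q \<in> topspace (nerve_space B)" "u \<le> 1" for q u
    using level_index(2)[OF that] by (simp add: level_def)
  have class_eq: "real_class A (map f (fst q), snd q) = real_class A (map f (fst p), snd p)" if "q \<in> z" for q
  proof -
    have q: "q \<in> topspace (nerve_space B)" "\<forall>u\<in>{0<..1}. level q u = level p u"
      using that p by (auto simp: real_class_eq)
    then show ?thesis
      by (auto simp: real_class_eq in_A p(1) level)
  qed
  have "p \<in> z"
    using p(2) real_class_self[OF p(1)] by simp
  then have *: "real_map A f z = real_class A (map f (fst p), snd p)"
    unfolding real_map_def case_prod_unfold by (intro SUP_eq_const class_eq) auto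
  show "real_map A f z \<in> topspace (realization A)"
    unfolding * by (rule real_class_in[OF in_A[OF p(1)]])
  show "rlevel (real_map A f z) u = f (rlevel z u)" if "0 < u" "u \<le> 1"
    unfolding * using that p by (simp add: rlevel_real_class in_A level)
qed

text \<open>The pair of the two step functions is a step function for the union of their
  breakpoints. This makes the definite description well defined without subdividing products of
  simplices.\<close>

lemma real_pair:
  assumes z: "z \<in> topspace (realization A)" and z': "z' \<in> topspace (realization B)"
  shows real_pair_in: "real_pair A B z z' \<in> topspace (realization (A \<times> B))"
    and rlevel_real_pair:
      "0 < u \<Longrightarrow> u \<le> 1 \<Longrightarrow> rlevel (real_pair A B z z') u = (rlevel z u, rlevel z' u)"
proof -
  obtain D where D: "breakpoints D" "steps_in D (rlevel z)"
    using rlevel_props(3)[OF z] by blast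
  obtain D' where D': "breakpoints D'" "steps_in D' (rlevel z')"
    using rlevel_props(3)[OF z'] by blast
  have bp: "breakpoints (D \<union> D')"
    using D(1) D'(1) by (auto simp: breakpoints_def)
  have "steps_in (D \<union> D') (\<lambda>u. (rlevel z u, rlevel z' u))"
    using steps_in_mono[OF D(2), of "D \<union> D'"] steps_in_mono[OF D'(2), of "D \<union> D'"]
    unfolding steps_in_def by (metis sup_ge1 sup_ge2)
  then obtain w where w: "w \<in> topspace (realization (A \<times> B))"
    "\<And>u. 0 < u \<Longrightarrow> u \<le> 1 \<Longrightarrow> rlevel w u = (rlevel z u, rlevel z' u)"
    using realization_exists[OF bp, of "\<lambda>u. (rlevel z u, rlevel z' u)" "A \<times> B"]
      rlevel_props[OF z] rlevel_props[OF z'] by (auto simp: less_eq_prod_def)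
  have fst: "real_map A fst v \<in> topspace (realization A)"
    "\<And>u. 0 < u \<Longrightarrow> u \<le> 1 \<Longrightarrow> rlevel (real_map A fst v) u = fst (rlevel v u)"
    if "v \<in> topspace (realization (A \<times> B))" for v
    using real_map[OF that, of fst A] by (auto simp: less_eq_prod_def)
  have snd: "real_map B snd v \<in> topspace (realization B)"
    "\<And>u. 0 < u \<Longrightarrow> u \<le> 1 \<Longrightarrow> rlevel (real_map B snd v) u = snd (rlevel v u)"
    if "v \<in> topspace (realization (A \<times> B))" for v
    using real_map[OF that, of snd B] by (auto simp: less_eq_prod_def)
  have "real_pair A B z z' = w"
    unfolding real_pair_def
  proof (rule the_equality)
    have "real_map A fst w = z"
      using w(2) fst[OF w(1)] by (intro realization_eqI[OF _ z]) auto
    moreover have "real_map B snd w = z'"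
      using w(2) snd[OF w(1)] by (intro realization_eqI[OF _ z']) auto
    ultimately show "w \<in> topspace (realization (A \<times> B)) \<and> real_map A fst w = z \<and> real_map B snd w = z'"
      using w(1) by blast
    fix v assume v: "v \<in> topspace (realization (A \<times> B)) \<and> real_map A fst v = z \<and> real_map B snd v = z'"
    show "v = w"
    proof (rule realization_eqI[of _ "A \<times> B"])
      fix u :: real assume "0 < u" "u \<le> 1"
      then show "rlevel v u = rlevel w u"
        using v w(2) fst(2)[of v u] snd(2)[of v u] by (auto simp: prod_eq_iff)
    qed (use v w in auto)
  qed
  then show "real_pair A B z z' \<in> topspace (realization (A \<times> B))"
    "0 < u \<Longrightarrow> u \<le> 1 \<Longrightarrow> rlevel (real_pair A B z z') u = (rlevel z u, rlevel z' u)"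
    using w by auto
qed


section \<open>Realizations of simplicial complexes\<close>

text \<open>On \<open>K\<close> the map is closed, since a compact space is mapped to a Hausdorff
  one, and hence a quotient map; this passes from the subspace to \<open>X\<close>. In both
  applications \<open>X\<close> is a disjoint union over an index set that is infinite in general,
  whereas \<open>K\<close> meets only finitely many pieces.\<close>

lemma quotient_map_compact:
  assumes f: "continuous_map X Y f" and Y: "Hausdorff_space Y"
    and K: "compactin X K" "f ` K = topspace Y"
  shows "quotient_map X Y f"
proof (rule quotient_map_from_composition[OF _ f])
  show id: "continuous_map (subtopology X K) X id"
    by (rule continuous_map_from_subtopology) simp
  have K': "topspace (subtopology X K) = K"
    using compactin_subset_topspace[OF K(1)] by auto
  have cont: "continuous_map (subtopology X K) Y (f \<circ> id)"
    using id f by (rule continuous_map_compose)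
  moreover have "closed_map (subtopology X K) Y (f \<circ> id)"
    using K(1) Y cont
    by (intro continuous_imp_closed_map_gen Hausdorff_imp_kc_space) (auto simp: compactin_subspace)
  ultimately show "quotient_map (subtopology X K) Y (f \<circ> id)"
    using K(2) K' by (intro continuous_closed_imp_quotient_map) auto
qed

lemma homeomorphic_map_quot_topology:
  assumes f: "quotient_map X Y f"
    and q: "\<And>x y. x \<in> topspace X \<Longrightarrow> y \<in> topspace X \<Longrightarrow> f x = f y \<Longrightarrow> q x = q y"
    and h: "\<And>x. x \<in> topspace X \<Longrightarrow> h (q x) = f x"
  shows "homeomorphic_map (quot_topology X q) Y h"
proof -
  have "quotient_map (quot_topology X q) Y h"
    unfolding quotient_map_def
  proof (intro conjI allI impI)
    show "h ` topspace (quot_topology X q) = topspace Y"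
    proof -
      have "h ` q ` topspace X = f ` topspace X"
        unfolding image_image by (rule image_cong[OF refl h])
      then show ?thesis
        using f by (simp add: quotient_map_def)
    qed
    fix U assume "U \<subseteq> topspace Y"
    then have "openin X {x \<in> topspace X. f x \<in> U} = openin Y U"
      using f by (simp add: quotient_map_def)
    moreover have "{x \<in> topspace X. q x \<in> {z \<in> topspace (quot_topology X q). h z \<in> U}} =
        {x \<in> topspace X. f x \<in> U}"
      by (rule Collect_cong) (use h in \<open>simp cong: conj_cong\<close>)
    ultimately show "openin (quot_topology X q) {x \<in> topspace (quot_topology X q). h x \<in> U} = openin Y U"
      unfolding openin_quot_topology by auto
  qed
  moreover have "inj_on h (topspace (quot_topology X q))"
  proof (rule inj_onI)
    fix a b assume "a \<in> topspace (quot_topology X q)" "b \<in> topspace (quot_topology X q)" "h a = h b"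
    then obtain x y where "x \<in> topspace X" "a = q x" "y \<in> topspace X" "b = q y" "h (q x) = h (q y)"
      by auto
    then show "a = b"
      using q[of x y] h[of x] h[of y] by simp
  qed
  ultimately show ?thesis
    by (simp add: homeomorphic_map_def)
qed

lemma continuous_map_from_sum_topology:
  assumes "\<And>i. i \<in> I \<Longrightarrow> continuous_map (X i) Y (\<lambda>x. f (i, x))"
  shows "continuous_map (sum_topology X I) Y f"
  unfolding continuous_map_def
proof (intro conjI allI impI)
  show "f \<in> topspace (sum_topology X I) \<rightarrow> topspace Y"
    using assms by (auto simp: continuous_map_def Pi_iff)
  fix U assume "openin Y U"
  then have "openin (X i) {x \<in> topspace (X i). f (i, x) \<in> U}" if "i \<in> I" for i
    using assms[OF that] by (simp add: continuous_map_def)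
  then show "openin (sum_topology X I) {x \<in> topspace (sum_topology X I). f x \<in> U}"
    by (auto simp: openin_sum_topology)
qed

text \<open>The chain increases, so \<open>S\<close> is present exactly on a final segment of the
  unit interval; this is the length of that segment.\<close>

definition vertex_weight :: "'k set simplex_point \<Rightarrow> 'k \<Rightarrow> real" where
  "vertex_weight p S = (\<Sum>j<length (fst p). if S \<in> fst p ! j then snd p j else 0)"

lemma vertex_weight_level:
  assumes p: "p \<in> topspace (nerve_space A)" and u: "0 < u" "u \<le> 1"
  shows "S \<in> level p u \<longleftrightarrow> 1 - u < vertex_weight p S"
proof -
  define n where "n = length (fst p)"
  have mono: "fst p ! i \<subseteq> fst p ! j" if "i \<le> j" "j < n" for i j
    using p that unfolding nerve_space_iff n_def
    by (cases "i = j") (auto dest!: sorted_wrt_nth_less[of _ _ i j])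
  let ?J = "LEAST j. u \<le> sum (snd p) {..j}"
  have J: "u \<le> sum (snd p) {..?J}" "?J < n"
    using level_index[OF p u(2)] by (auto simp: n_def)
  have one: "sum (snd p) {..<n} = 1"
    using weight_sum[OF p] by (simp add: n_def)
  \<comment> \<open>The intervals whose value lacks \<open>S\<close> form an initial segment, so it
    is their total length that compares directly with \<open>u\<close>.\<close>
  have compl: "vertex_weight p S = 1 - (\<Sum>j | j < n \<and> S \<notin> fst p ! j. snd p j)"
  proof -
    have "vertex_weight p S = (\<Sum>j | j < n \<and> S \<in> fst p ! j. snd p j)"
      unfolding vertex_weight_def n_def[symmetric] by (rule sum.inter_filter[symmetric, of "{..<n}", simplified])
    moreover have "sum (snd p) ({..<n}) = (\<Sum>j | j < n \<and> S \<in> fst p ! j. snd p j) + (\<Sum>j | j < n \<and> S \<notin> fst p ! j. snd p j)"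
      by (subst sum.union_disjoint[symmetric]) (auto intro!: sum.cong)
    ultimately show ?thesis
      using one by simp
  qed
  have "level p u = fst p ! ?J"
    by (simp add: level_def)
  moreover have "S \<in> fst p ! ?J \<longleftrightarrow> 1 - u < vertex_weight p S"
  proof
    assume S: "S \<in> fst p ! ?J"
    have sub: "{j. j < n \<and> S \<notin> fst p ! j} \<subseteq> {..<?J}"
      using S mono[of ?J] by (fastforce simp: not_le[symmetric])
    have "(\<Sum>j | j < n \<and> S \<notin> fst p ! j. snd p j) \<le> sum (snd p) {..<?J}"
      using sub weight_nonneg[OF p] by (intro sum_mono2) auto
    also have "\<dots> < u"
    proof (cases "?J")
      case (Suc J')
      then show ?thesis
        using not_less_Least[of J' "\<lambda>j. u \<le> sum (snd p) {..j}"] by (simp add: lessThan_Suc_atMost)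
    qed (use u in simp)
    finally show "1 - u < vertex_weight p S"
      using compl by simp
  next
    assume *: "1 - u < vertex_weight p S"
    show "S \<in> fst p ! ?J"
    proof (rule ccontr)
      assume "S \<notin> fst p ! ?J"
      then have "{..?J} \<subseteq> {j. j < n \<and> S \<notin> fst p ! j}"
        using mono[of _ ?J] J(2) by fastforce
      then have "sum (snd p) {..?J} \<le> (\<Sum>j | j < n \<and> S \<notin> fst p ! j. snd p j)"
        using weight_nonneg[OF p] by (intro sum_mono2) auto
      then show False
        using * compl J by simp
    qed
  qed
  ultimately show ?thesis
    by simp
qed

lemma vertex_weight_bounds:
  assumes p: "p \<in> topspace (nerve_space A)"
  shows "0 \<le> vertex_weight p S" "vertex_weight p S \<le> 1"
proof -
  show "0 \<le> vertex_weight p S"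
    unfolding vertex_weight_def by (intro sum_nonneg) (auto simp: weight_nonneg[OF p])
  have "vertex_weight p S \<le> sum (snd p) {..<length (fst p)}"
    unfolding vertex_weight_def by (intro sum_mono) (auto simp: weight_nonneg[OF p])
  then show "vertex_weight p S \<le> 1"
    by (simp add: weight_sum[OF p])
qed

definition weight :: "'k set simplex_point set \<Rightarrow> 'k \<Rightarrow> real" where
  "weight z = vertex_weight (SOME p. p \<in> z)"

text \<open>If the numbers differ, the smaller one is itself a threshold that only the larger one
  exceeds.\<close>

lemma superlevels_eqI:
  fixes a b :: real
  assumes "0 \<le> a" "a \<le> 1" "0 \<le> b" "b \<le> 1"
    and "\<And>u. 0 < u \<Longrightarrow> u \<le> 1 \<Longrightarrow> 1 - u < a \<longleftrightarrow> 1 - u < b"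
  shows "a = b"
proof (rule ccontr)
  assume "a \<noteq> b"
  then have "a < b \<or> b < a"
    by auto
  then show False
    using assms(5)[of "1 - a"] assms(5)[of "1 - b"] assms(1-4) by fastforce
qed

lemma weight_point:
  assumes z: "z \<in> topspace (realization A)" and "p \<in> z"
  shows "weight z = vertex_weight p"
proof -
  let ?q = "SOME p. p \<in> z"
  have q: "?q \<in> z"
    using assms(2) by (rule someI)
  then have pq: "?q \<in> topspace (nerve_space A)" "p \<in> topspace (nerve_space A)"
    using realization_member[OF z] assms(2) by auto
  have "level ?q u = level p u" if "0 < u" "u \<le> 1" for u
    using that rlevel_eq[OF z q] rlevel_eq[OF z assms(2)] by simp
  then have "vertex_weight ?q S = vertex_weight p S" for S
    using vertex_weight_level[OF pq(1)] vertex_weight_level[OF pq(2)]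
    by (intro superlevels_eqI vertex_weight_bounds[OF pq(1)] vertex_weight_bounds[OF pq(2)]) blast
  then show ?thesis
    by (auto simp: weight_def)
qed

lemma weight_level:
  assumes z: "z \<in> topspace (realization A)" and u: "0 < u" "u \<le> 1"
  shows "S \<in> rlevel z u \<longleftrightarrow> 1 - u < weight z S"
proof -
  obtain p where p: "p \<in> topspace (nerve_space A)" "z = real_class A p"
    using realization_point[OF z] by blast
  then have "p \<in> z"
    using real_class_self[of p A] by simp
  then show ?thesis
    using vertex_weight_level[OF p(1) u] rlevel_eq[OF z _ u, of p] weight_point[OF z, of p] by simp
qed

text \<open>If \<open>A\<close> is closed under subsets, this is the union of the cubes with
  coordinates in \<open>B\<close>, for \<open>B\<close> in \<open>A\<close>; the chains in
  \<open>A\<close> triangulate each cube in the standard way.\<close>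

definition weight_functions :: "'k set set \<Rightarrow> ('k \<Rightarrow> real) set" where
  "weight_functions A = {w. (\<forall>S. 0 \<le> w S \<and> w S \<le> 1) \<and> {S. 0 < w S} \<in> A}"

text \<open>The inverse sends \<open>w\<close> to the step function of its superlevel sets, which
  lie in \<open>A\<close> because \<open>A\<close> is closed under subsets. The number of jumps is
  bounded, so finitely many simplices suffice for \<open>quotient_map_compact\<close>.\<close>

lemma homeomorphic_weight:
  fixes A :: "'k set set"
  assumes fin: "finite A" and sub: "\<And>B B'. B \<in> A \<Longrightarrow> B' \<subseteq> B \<Longrightarrow> B' \<in> A"
  shows "homeomorphic_map (realization A) (subtopology (powertop_real UNIV) (weight_functions A)) weight"
  unfolding realization_def
proof (rule homeomorphic_map_quot_topology)
  let ?X = "nerve_space A" and ?W = "weight_functions A"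
  let ?Y = "subtopology (powertop_real UNIV) ?W"
  have vw: "vertex_weight p \<in> ?W" if p: "p \<in> topspace ?X" for p
  proof -
    have "{S. 0 < vertex_weight p S} = level p 1"
      using vertex_weight_level[OF p, of 1] by auto
    then show ?thesis
      using vertex_weight_bounds[OF p] level_in[OF p, of 1] by (auto simp: weight_functions_def)
  qed
  have "finite B" if "B \<in> A" for B
    using that sub finite_subset[OF _ fin, of "Pow B"] by (auto simp: finite_Pow_iff)
  then have finU: "finite (\<Union>A)"
    using fin by auto
  \<comment> \<open>The breakpoints needed for a weight function \<open>w\<close> are
    \<open>0\<close>, \<open>1\<close> and the numbers \<open>1 - w S\<close> with \<open>S\<close>
    in the union of \<open>A\<close>.\<close>
  define N where "N = 2 + card (\<Union>A)"
  define L where "L = {\<xi> \<in> nerve A. length \<xi> \<le> N}"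
  define K where "K = (\<Union>\<xi>\<in>L. Pair \<xi> ` standard_simplex (length \<xi> - 1))"
  have "finite L"
    using finite_lists_length_le[OF fin, of N] by (rule finite_subset[rotated]) (auto simp: L_def nerve_def)
  moreover have "compactin ?X (Pair \<xi> ` standard_simplex (length \<xi> - 1))" if "\<xi> \<in> L" for \<xi>
  proof (rule image_compactin)
    show "compactin (subtopology (powertop_real UNIV) (standard_simplex (length \<xi> - 1)))
       (standard_simplex (length \<xi> - 1))"
      by (simp add: compactin_subtopology compactin_standard_simplex)
    show "continuous_map (subtopology (powertop_real UNIV) (standard_simplex (length \<xi> - 1))) ?X (Pair \<xi>)"
      unfolding nerve_space_def
      using that continuous_map_component_injection[of \<xi> "nerve A"
        "\<lambda>\<xi>. subtopology (powertop_real UNIV) (standard_simplex (length \<xi> - 1))"]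
      by (simp add: L_def)
  qed
  ultimately have K: "compactin ?X K"
    unfolding K_def by (intro compactin_Union) auto
  have "continuous_map ?X (powertop_real UNIV) vertex_weight"
    unfolding nerve_space_def continuous_map_componentwise_UNIV
  proof (intro allI continuous_map_from_sum_topology)
    fix S :: 'k and \<xi> :: "'k set list"
    have "continuous_map (powertop_real UNIV) euclideanreal (\<lambda>t. if S \<in> \<xi> ! j then t j else 0)" for j
      by (cases "S \<in> \<xi> ! j") (auto intro: continuous_map_product_projection)
    then show "continuous_map (subtopology (powertop_real UNIV) (standard_simplex (length \<xi> - 1))) euclideanreal
        (\<lambda>t. vertex_weight (\<xi>, t) S)"
      unfolding vertex_weight_def fst_conv snd_conv
      by (intro continuous_map_from_subtopology continuous_map_sum) auto
  qed
  then have cont: "continuous_map ?X ?Y vertex_weight"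
    using vw by (intro continuous_map_into_subtopology) auto
  show "quotient_map ?X ?Y vertex_weight"
  proof (rule quotient_map_compact[OF cont _ K])
    show "Hausdorff_space ?Y"
      by (intro Hausdorff_space_subtopology) (simp add: Hausdorff_space_product_topology)
    have "K \<subseteq> topspace ?X"
      using compactin_subset_topspace[OF K] .
    moreover have "w \<in> vertex_weight ` K" if w: "w \<in> ?W" for w
    proof -
      define D where "D = {0, 1} \<union> (\<lambda>S. 1 - w S) ` \<Union>A"
      have bnd: "0 \<le> w S" "w S \<le> 1" for S
        using w by (auto simp: weight_functions_def)
      interpret breakpoints D
        using finU bnd by unfold_locales (auto simp: D_def)
      define g where "g u = {S. 1 - u < w S}" for u
      have g: "g u \<in> A" if "0 < u" "u \<le> 1" for u
      proof -
        have "g u \<subseteq> {S. 0 < w S}"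
          using that by (auto simp: g_def)
        then show ?thesis
          using w sub by (auto simp: weight_functions_def)
      qed
      have steps: "steps_in D g"
        unfolding steps_in_def
      proof (intro allI impI)
        fix u u' :: real assume u: "0 < u" "u \<le> u'" "u' \<le> 1" "D \<inter> {u..<u'} = {}"
        have "S \<in> g u" if "S \<in> g u'" for S
        proof -
          have "S \<in> \<Union>A"
            using g[of u'] u that by auto
          then have "1 - w S \<in> D"
            by (auto simp: D_def)
          then show ?thesis
            using u(4) that by (auto simp: g_def disjoint_iff)
        qed
        then show "g u = g u'"
          using u(2) by (auto simp: g_def)
      qed
      have p: "refine g D \<in> topspace ?X"
        using g by (intro refine_in) (auto simp: g_def)
      have "card D \<le> N"
      proof -
        have "card D \<le> card {0::real, 1} + card ((\<lambda>S. 1 - w S) ` \<Union>A)"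
          unfolding D_def by (rule card_Un_le)
        then show ?thesis
          using card_image_le[OF finU, of "\<lambda>S. 1 - w S"] by (simp add: N_def)
      qed
      then have "length (fst (refine g D)) \<le> N"
        by (simp add: refine_eq k_def ds_def)
      then have "refine g D \<in> K"
        using p by (cases "refine g D") (auto simp: K_def L_def nerve_space_def)
      moreover have "vertex_weight (refine g D) S = w S" for S
        using vertex_weight_level[OF p] level_refine[OF steps]
        by (intro superlevels_eqI bnd vertex_weight_bounds[OF p]) (auto simp: g_def)
      ultimately show ?thesis
        by (metis ext image_eqI)
    qed
    ultimately show "vertex_weight ` K = topspace ?Y"
      using vw by auto
  qed
  fix p q assume p: "p \<in> topspace ?X"
  show "weight (real_class A p) = vertex_weight p"
    using weight_point[OF real_class_in real_class_self] p by blast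
  assume q: "q \<in> topspace ?X" and eq: "vertex_weight p = vertex_weight q"
  have "level p u = level q u" if "0 < u" "u \<le> 1" for u
    using vertex_weight_level[OF p that] vertex_weight_level[OF q that] eq by auto
  then show "real_class A p = real_class A q"
    by (auto simp: real_class_eq p q)
qed

section \<open>Trees decorated by trees\<close>

lemma shape_simps [simp]:
  "shape (Leaf a) = Leaf a"
  "shape (Node v ts) = Node (fst v) (map shape ts)"
  by (auto simp: shape_def)

abbreviation rc :: "('c, 'x) wtree \<Rightarrow> 'c" where
  "rc t \<equiv> root_color (shape t)"

text \<open>These are the vertices of the composite that come from \<open>t\<close>; for a subtree
  they form the set that its outgoing edge cuts off.\<close>

definition tags :: "('v, 'c \<times> nat) ptree \<Rightarrow> nat set" where
  "tags t = snd ` lset t"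

lemma tags_simps [simp]:
  "tags (Leaf (c, j)) = {j}"
  "tags (Node v ts) = (\<Union>t\<in>set ts. tags t)"
  by (auto simp: tags_def)

lemma finite_tags [simp]: "finite (tags t)"
  by (simp add: tags_def flip: set_leaves)

text \<open>The length of the outgoing edge of the root may be any number in the unit interval, so
  that the predicate passes to subtrees; the dummy length is imposed separately in
  \<open>wpoints\<close>.\<close>

fun wf_wtree :: "(nat, ltree) wtree \<Rightarrow> bool" where
  "wf_wtree (Leaf a) \<longleftrightarrow> True"
| "wf_wtree (Node (c, l, x) ts) \<longleftrightarrow>
     0 \<le> l \<and> l \<le> 1 \<and> x \<in> ltrees c (map rc ts) \<and> (\<forall>t\<in>set ts. wf_wtree t)"

lemma numbered_iff: "numbered n T \<longleftrightarrow> distinct (leaves T) \<and> set (leaves T) = {..<n}"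
  unfolding numbered_def
  by (metis atLeast_upt distinct_upt mset_eq_imp_distinct_iff set_eq_iff_mset_eq_distinct set_mset_mset)

text \<open>Child \<open>k\<close> is substituted for vertex \<open>k\<close> of the label. A leaf
  stands for an uncomposed input and hence contributes the vertex \<open>j\<close>, whose arity is
  the colour.\<close>

fun composite :: "(nat, ltree) wtree \<Rightarrow> ltree" where
  "composite (Leaf (c, j)) = single j c"
| "composite (Node (c, l, x) ts) = sub (\<lambda>k n. map composite ts ! k) x"

lemma verts_label:
  assumes "x \<in> ltrees c (map f ts)" "(v, n) \<in> set (verts x)"
  shows "v < length ts" "n = f (ts ! v)"
  using assms by (auto simp: set_verts_ltrees)

lemma numbered_composite: "wf_wtree t \<Longrightarrow> numbered (rc t) (composite t)"
proof (induction t rule: composite.induct)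
  case (2 c l x ts)
  have "numbered n (map composite ts ! v)" if "(v, n) \<in> set (verts x)" for v n
    using 2 that verts_label[of x c rc ts v n] by auto
  then show ?case
    using 2 by (auto simp: ltrees_iff intro: numbered_sub)
qed auto

lemma numbered_child:
  assumes "x \<in> ltrees c (map rc ts)" "\<forall>t\<in>set ts. wf_wtree t" "(v, n) \<in> set (verts x)"
  shows "numbered n (map composite ts ! v)"
  using assms verts_label[OF assms(1,3)] numbered_composite[of "ts ! v"] by auto

text \<open>Vertex \<open>k\<close> of a label occurs exactly once and is replaced by the composite
  of child \<open>k\<close>, so only the leaves survive as vertices, with their colours as
  arities.\<close>

lemma mset_verts_composite:
  "wf_wtree t \<Longrightarrow> mset (verts (composite t)) = mset (map (\<lambda>(c, j). (j, c)) (leaves t))"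
proof (induction t rule: composite.induct)
  case (2 c l x ts)
  have "mset (verts (composite (Node (c, l, x) ts))) = (\<Sum>(v, n)\<leftarrow>verts x. mset (verts (map composite ts ! v)))"
    unfolding composite.simps by (rule mset_verts_sub[OF numbered_child]) (use 2 in auto)
  also have "\<dots> = (\<Sum>(v, n)\<leftarrow>map (\<lambda>i. (i, map rc ts ! i)) [0..<length ts]. mset (verts (map composite ts ! v)))"
    by (rule sum_list_mset_cong) (use 2 in \<open>simp add: ltrees_iff\<close>)
  also have "\<dots> = (\<Sum>k\<leftarrow>[0..<length ts]. mset (verts (map composite ts ! k)))"
    by (simp add: comp_def)
  also have "\<dots> = (\<Sum>t\<leftarrow>ts. mset (verts (composite t)))"
    using sum_list_nth[of "\<lambda>t. mset (verts t)" "map composite ts"] by (simp add: comp_def)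
  also have "\<dots> = (\<Sum>t\<leftarrow>ts. mset (map (\<lambda>(c, j). (j, c)) (leaves t)))"
    by (rule sum_list_eq) (use 2 in auto)
  finally show ?case
    by (simp add: map_concat mset_concat comp_def)
qed auto

lemma set_verts_composite:
  "wf_wtree t \<Longrightarrow> (j, c) \<in> set (verts (composite t)) \<longleftrightarrow> (c, j) \<in> lset t"
  using mset_eq_setD[OF mset_verts_composite] by (force simp: set_leaves)

lemma vset_composite: "wf_wtree t \<Longrightarrow> vset (composite t) = tags t"
  using set_verts_composite by (auto simp: vset_verts tags_def image_iff) force+

lemma composite_ltrees:
  assumes "wf_wtree t" "distinct (map snd (leaves t))"
    and "set (leaves t) = {(cs ! j, j) | j. j < length cs}"
  shows "composite t \<in> ltrees (rc t) cs"
proof -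
  have "mset (map fst (verts (composite t))) = mset (map snd (leaves t))"
    using arg_cong[OF mset_verts_composite[OF assms(1)], of "image_mset fst"]
    by (simp add: image_mset.compositionality comp_def case_prod_unfold)
  then have "distinct (map fst (verts (composite t)))"
    using assms(2) mset_eq_imp_distinct_iff by blast
  moreover have "set (verts (composite t)) = (\<lambda>(c, j). (j, c)) ` set (leaves t)"
    using mset_eq_setD[OF mset_verts_composite[OF assms(1)]] by simp
  then have "set (verts (composite t)) = {(i, cs ! i) | i. i < length cs}"
    unfolding assms(3) by force
  moreover have "distinct (leaves (composite t)) \<and> set (leaves (composite t)) = {..<rc t}"
    using numbered_composite[OF assms(1)] by (simp add: numbered_iff)
  ultimately show ?thesis
    by (simp add: ltrees_def)
qed

lemma rc_merge_length [simp]: "rc (merge_length l t) = rc t"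
  by (cases "(l, t)" rule: merge_length.cases) auto

lemma composite_merge_length [simp]: "composite (merge_length l t) = composite t"
  by (cases "(l, t)" rule: merge_length.cases) auto

lemma leaves_merge_length [simp]: "leaves (merge_length l t) = leaves t"
  by (cases "(l, t)" rule: merge_length.cases) auto

lemma tags_leaves: "tags t = snd ` set (leaves t)"
  by (simp add: tags_def set_leaves)

lemma wf_merge_length: "wf_wtree t \<Longrightarrow> 0 \<le> l \<Longrightarrow> l \<le> 1 \<Longrightarrow> wf_wtree (merge_length l t)"
  by (cases "(l, t)" rule: merge_length.cases) auto

lemma plug_profile_map:
  "plug_profile (length ts) (map f (ts @ t # ws)) (map f us) = map f (ts @ us @ ws)"
  by (simp add: plug_profile_def)

text \<open>This is \<open>sub_sub\<close> for the partial composition \<open>subst_vertex\<close>.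
  The children \<open>us\<close> enter the list at position \<open>length ts\<close>, and later
  children move just as \<open>outer_idx\<close> renumbers the vertices of \<open>x\<close>.\<close>

lemma collapse:
  assumes x: "x \<in> ltrees c (map rc (ts @ t # ws))" and y: "y \<in> ltrees (rc t) (map rc us)"
    and wf: "\<forall>t\<in>set (ts @ us @ ws). wf_wtree t" "wf_wtree t"
    and t: "composite t = sub (\<lambda>k n. map composite us ! k) y"
  shows ltrees_collapse: "subst_vertex (length ts) y x \<in> ltrees c (map rc (ts @ us @ ws))"
    and composite_collapse:
      "sub (\<lambda>k n. map composite (ts @ us @ ws) ! k) (subst_vertex (length ts) y x) =
         sub (\<lambda>k n. map composite (ts @ t # ws) ! k) x"
proof -
  define i where "i = length ts"
  let ?ms = "map rc (ts @ t # ws)"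
  let ?G = "\<lambda>k n::nat. map composite (ts @ us @ ws) ! k"
  let ?h = "\<lambda>v n. if v = i then map_ptree (\<lambda>j. i + j) id y
                else single (outer_idx i (length (verts y)) v) n"
  have i: "i < length ?ms" "?ms ! i = rc t"
    by (auto simp: i_def nth_append)
  show "subst_vertex (length ts) y x \<in> ltrees c (map rc (ts @ us @ ws))"
    using subst_vertex_ltrees[of x c ?ms y i "map rc us"] x y i
    unfolding i_def plug_profile_map by simp
  have len: "length (verts y) = length us"
    using length_verts_ltrees[OF y] by simp
  have num_h: "numbered n (?h v n)" if "(v, n) \<in> set (verts x)" for v n
    using y i x that by (auto simp: ltrees_iff[of y] set_verts_ltrees)
  have numG: "numbered (rc ((ts @ us @ ws) ! k)) (map composite (ts @ us @ ws) ! k)" if "k < length (ts @ us @ ws)" for k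
    unfolding nth_map[OF that] using wf(1) nth_mem[OF that] by (intro numbered_composite) blast
  have y_label: "k < length us" "m = rc ((ts @ us @ ws) ! (i + k))" if "(k, m) \<in> set (verts y)" for k m
    using verts_label[OF y that] by (auto simp: i_def nth_append)
  have idx: "outer_idx i (length us) v < length (ts @ us @ ws)"
    "(ts @ us @ ws) ! outer_idx i (length us) v = (ts @ t # ws) ! v"
    if v: "v < length (ts @ t # ws)" "v \<noteq> i" for v
  proof -
    consider "v < i" | "i < v"
      using v(2) by linarith
    then have "outer_idx i (length us) v < length (ts @ us @ ws) \<and>
      (ts @ us @ ws) ! outer_idx i (length us) v = (ts @ t # ws) ! v"
    proof cases
      case 2
      then obtain v' where v': "v = Suc (i + v')"
        by (metis less_iff_Suc_add)
      have "(ts @ us @ ws) ! (i + length us + v') = ws ! v'"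
        by (simp add: i_def nth_append)
      then show ?thesis
        using v v' by (simp add: outer_idx_def i_def nth_append add_ac)
    qed (use v in \<open>auto simp: outer_idx_def i_def nth_append\<close>)
    then show "outer_idx i (length us) v < length (ts @ us @ ws)"
      "(ts @ us @ ws) ! outer_idx i (length us) v = (ts @ t # ws) ! v"
      by auto
  qed
  have arity_G: "arity_ok ?G (?h v n)" if "(v, n) \<in> set (verts x)" for v n
  proof (rule arity_okI)
    fix k m assume km: "(k, m) \<in> set (verts (?h v n))"
    show "numbered m (?G k m)"
    proof (cases "v = i")
      case True
      then obtain k' where "k = i + k'" "(k', m) \<in> set (verts y)"
        using km by (auto simp: verts_map)
      then show ?thesis
        using y_label[of k' m] numG[of k] by (auto simp: i_def)
    next
      case False
      then have "k = outer_idx i (length us) v" "m = n"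
        using km by (auto simp: len)
      then show ?thesis
        using False verts_label[OF x that] idx[of v] numG[of k] by simp
    qed
  qed
  have "sub ?G (subst_vertex i y x) = sub (\<lambda>v n. sub ?G (?h v n)) x"
    unfolding subst_vertex_eq_sub by (intro sub_sub arity_okI num_h arity_G)
  also have "\<dots> = sub (\<lambda>k n. map composite (ts @ t # ws) ! k) x"
  proof (rule sub_cong)
    fix v n assume vn: "(v, n) \<in> set (verts x)"
    show "sub ?G (?h v n) = map composite (ts @ t # ws) ! v"
    proof (cases "v = i")
      case True
      have "sub ?G (?h v n) = sub (\<lambda>k. ?G (i + k)) y"
        using True by (simp add: sub_map)
      also have "\<dots> = sub (\<lambda>k n. map composite us ! k) y"
        using y_label by (intro sub_cong) (auto simp: i_def nth_append)
      finally show ?thesis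
        using True t by (simp add: i_def nth_append)
    next
      case False
      have "sub ?G (single (outer_idx i (length us) v) n) = ?G (outer_idx i (length us) v) n"
        using arity_G[OF vn] False by (intro sub_single) (auto simp: arity_ok_def len)
      then show ?thesis
        using False idx[of v] verts_label[OF x vn] by (simp add: len del: map_append)
    qed
  qed
  finally show "sub ?G (subst_vertex (length ts) y x) = sub (\<lambda>k n. map composite (ts @ t # ws) ! k) x"
    by (simp add: i_def)
qed

lemma relabel_vertices_ltrees:
  assumes x: "x \<in> ltrees c ms" and \<pi>: "\<pi> permutes {..<length ms}"
  shows "relabel_vertices \<pi> x \<in> ltrees c (permute_list \<pi> ms)"
proof -
  have inv: "inv_into UNIV \<pi> permutes {..<length ms}"
    by (rule permutes_inv[OF \<pi>])
  have "inj (inv_into UNIV \<pi>)"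
    using inv by (rule permutes_inj)
  then have "distinct (map fst (verts (relabel_vertices \<pi> x)))"
    using distinct_verts_ltrees[OF x]
    by (simp add: relabel_vertices_def verts_map comp_def distinct_map inj_on_def)
  moreover have "set (verts (relabel_vertices \<pi> x)) = {(i, permute_list \<pi> ms ! i) | i. i < length ms}"
  proof -
    have "set (verts (relabel_vertices \<pi> x)) = (\<lambda>i. (inv_into UNIV \<pi> i, ms ! i)) ` {..<length ms}"
    proof -
      have "{(i, ms ! i) | i. i < length ms} = (\<lambda>i. (i, ms ! i)) ` {..<length ms}"
        by auto
      then show ?thesis
        by (simp add: relabel_vertices_def verts_map set_verts_ltrees[OF x] image_image)
    qed
    also have "\<dots> = (\<lambda>i. (inv_into UNIV \<pi> i, permute_list \<pi> ms ! inv_into UNIV \<pi> i)) ` {..<length ms}"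
      using permutes_in_image[OF inv] \<pi>
      by (intro image_cong refl) (simp add: permute_list_nth permutes_inverses)
    also have "\<dots> = (\<lambda>i. (i, permute_list \<pi> ms ! i)) ` inv_into UNIV \<pi> ` {..<length ms}"
      by (simp only: image_image)
    finally show ?thesis
      unfolding permutes_image[OF inv] by auto
  qed
  ultimately show ?thesis
    using x by (simp add: ltrees_def relabel_vertices_def leaves_map)
qed

lemma O_simps [simp]:
  "circ O_operad i x y = subst_vertex i y x"
  "ident O_operad = corolla"
  "act O_operad = relabel_vertices"
  "topspace (ops O_operad n ms) = ltrees n ms"
  "ops O_operad n ms = discrete_topology (ltrees n ms)"
  by (auto simp: O_operad_def)

subsection \<open>Weights of the edges\<close>

text \<open>The leading \<open>0\<close> is the weight of sets that no edge cuts off. The outgoing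
  edge of the root counts like any other, for the sake of the recursion; its set of leaves is
  improper and is discarded by \<open>model_point\<close>.\<close>

fun edge_weight :: "('c, 'x) wtree \<Rightarrow> nat set \<Rightarrow> real" where
  "edge_weight (Leaf a) S = 0"
| "edge_weight (Node (c, l, x) ts) S =
     Max (set (0 # (if S = tags (Node (c, l, x) ts) then l else 0) # map (\<lambda>t. edge_weight t S) ts))"

text \<open>For nonnegative thresholds these are the superlevel sets of \<open>edge_weight\<close>,
  see \<open>cuts_iff\<close>; in this form the maximum is a union and the effect of each relation
  can be read off.\<close>

fun cuts :: "real \<Rightarrow> ('c, 'x) wtree \<Rightarrow> nat set set" where
  "cuts a (Leaf b) = {}"
| "cuts a (Node (c, l, x) ts) =
     (if a < l then {tags (Node (c, l, x) ts)} else {}) \<union> \<Union> (set (map (cuts a) ts))"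

lemma cuts_iff: "0 \<le> a \<Longrightarrow> S \<in> cuts a t \<longleftrightarrow> a < edge_weight t S"
proof (induction t S rule: edge_weight.induct)
  case (2 c l x ts S)
  then show ?case
    by (subst edge_weight.simps, subst Max_gr_iff) auto
qed auto

lemma edge_weight_nonneg: "0 \<le> edge_weight t S"
  by (cases "(t, S)" rule: edge_weight.cases) auto

lemma edge_weight_le: "wf_wtree t \<Longrightarrow> edge_weight t S \<le> 1"
  by (induction t rule: wf_wtree.induct) auto

lemma cuts_subset_tags: "S \<in> cuts a t \<Longrightarrow> S \<subseteq> tags t"
  by (induction a t rule: cuts.induct) (auto split: if_splits)

text \<open>Sets with fewer than two elements are left out because edges cutting them off can
  disappear, by deletion of nullary vertices or of unary vertices next to a leaf. The full set of
  leaves is kept, since it can become a proper one inside a larger tree; this makes the relation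
  compatible with contexts.\<close>

definition wequiv :: "(nat, ltree) wtree \<Rightarrow> (nat, ltree) wtree \<Rightarrow> bool" where
  "wequiv t u \<longleftrightarrow> wf_wtree t \<and> wf_wtree u \<and> rc t = rc u \<and> mset (leaves t) = mset (leaves u) \<and>
     composite t = composite u \<and> (\<forall>a\<ge>0. \<forall>S. 2 \<le> card S \<longrightarrow> S \<in> cuts a t \<longleftrightarrow> S \<in> cuts a u)"

lemma tags_mset: "mset (leaves t) = mset (leaves u) \<Longrightarrow> tags t = tags u"
  unfolding tags_leaves by (drule mset_eq_setD) simp

lemma cuts_merge_length:
  "2 \<le> card S \<Longrightarrow> S \<in> cuts a (merge_length l t) \<longleftrightarrow> S \<in> cuts a t \<or> (a < l \<and> S = tags t)"
  by (cases "(l, t)" rule: merge_length.cases) (auto simp: less_max_iff_disj)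

text \<open>Covers collapsing and the absorption of unary and nullary vertices: each composes two
  adjacent labels, and they differ only in what happens to the length \<open>l'\<close> of the
  vanishing edge. It may be dropped, enter the root length \<open>m\<close>, or enter the length of
  a child, which turns \<open>us\<close> into \<open>vs\<close>.\<close>

lemma wequiv_collapse:
  assumes wf: "wf_wtree (Node (c, l, x) (ts @ Node (d, l', y) us # ws))"
    and l: "0 \<le> m" "m \<le> 1"
    and cuts: "\<And>a S. 0 \<le> a \<Longrightarrow> 2 \<le> card S \<Longrightarrow>
      (a < l \<and> S = (\<Union>t\<in>set (ts @ us @ ws). tags t)) \<or> (a < l' \<and> S = (\<Union>t\<in>set us. tags t)) \<or> (\<exists>t\<in>set us. S \<in> cuts a t)
      \<longleftrightarrow> (a < m \<and> S = (\<Union>t\<in>set (ts @ us @ ws). tags t)) \<or> (\<exists>t\<in>set vs. S \<in> cuts a t)"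
    and vs: "\<forall>t\<in>set vs. wf_wtree t" "map rc vs = map rc us" "map composite vs = map composite us"
       "map leaves vs = map leaves us"
  shows "wequiv (Node (c, l, x) (ts @ Node (d, l', y) us # ws))
           (Node (c, m, subst_vertex (length ts) y x) (ts @ vs @ ws))"
proof -
  let ?N = "Node (d, l', y) us"
  have "x \<in> ltrees c (map rc (ts @ ?N # ws))" "y \<in> ltrees (rc ?N) (map rc us)"
    "\<forall>t\<in>set (ts @ us @ ws). wf_wtree t" "wf_wtree ?N"
    "composite ?N = sub (\<lambda>k n. map composite us ! k) y"
    using wf by auto
  note * = collapse[OF this]
  have tg: "(\<Union>t\<in>set vs. tags t) = (\<Union>t\<in>set us. tags t)"
  proof -
    have "map (\<lambda>xs. snd ` set xs) (map leaves vs) = map (\<lambda>xs. snd ` set xs) (map leaves us)"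
      by (simp only: vs(4))
    then have "set (map tags vs) = set (map tags us)"
      unfolding map_map comp_def tags_leaves[symmetric] by simp
    then show ?thesis
      unfolding set_map by simp
  qed
  have "concat (map leaves vs) = concat (map leaves us)"
    using vs(4) by simp
  moreover have "composite (Node (c, m, subst_vertex (length ts) y x) (ts @ vs @ ws)) =
      composite (Node (c, l, x) (ts @ ?N # ws))"
    using *(2) vs(3) by simp
  moreover have "wf_wtree (Node (c, m, subst_vertex (length ts) y x) (ts @ vs @ ws))"
    using wf l *(1) vs(1,2) by auto
  moreover have "S \<in> cuts a (Node (c, l, x) (ts @ ?N # ws)) \<longleftrightarrow>
      S \<in> cuts a (Node (c, m, subst_vertex (length ts) y x) (ts @ vs @ ws))"
    if "0 \<le> a" "2 \<le> card S" for a S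
  proof -
    have "S \<in> cuts a (Node (c, l, x) (ts @ ?N # ws)) \<longleftrightarrow>
       ((a < l \<and> S = (\<Union>t\<in>set (ts @ us @ ws). tags t)) \<or> (a < l' \<and> S = (\<Union>t\<in>set us. tags t)) \<or> (\<exists>t\<in>set us. S \<in> cuts a t))
       \<or> (\<exists>t\<in>set ts \<union> set ws. S \<in> cuts a t)"
      by auto
    also have "\<dots> \<longleftrightarrow>
      ((a < m \<and> S = (\<Union>t\<in>set (ts @ us @ ws). tags t)) \<or> (\<exists>t\<in>set vs. S \<in> cuts a t))
       \<or> (\<exists>t\<in>set ts \<union> set ws. S \<in> cuts a t)"
      by (simp only: cuts[OF that])
    also have "\<dots> \<longleftrightarrow> S \<in> cuts a (Node (c, m, subst_vertex (length ts) y x) (ts @ vs @ ws))"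
      by (auto simp: tg)
    finally show ?thesis .
  qed
  ultimately show ?thesis
    using wf unfolding wequiv_def by simp
qed

text \<open>The relabelled label looks up child \<open>k\<close> at the position
  \<open>inv_into UNIV \<pi> k\<close>, where the permuted list now has it; so the composites and
  the sets cut off agree.\<close>

lemma wequiv_iso: "nonplanar_iso O_operad t u \<Longrightarrow> wf_wtree t \<Longrightarrow> wequiv t u"
proof (induction rule: nonplanar_iso.induct)
  case (iso_leaf a)
  then show ?case
    by (simp add: wequiv_def)
next
  case (iso_node ts us \<pi> c l x)
  have len: "length ts = length us"
    using iso_node(1) by (auto dest: list_all2_lengthD)
  have nth: "wequiv (ts ! k) (us ! k)" if "k < length us" for k
    using iso_node len that by (auto simp: list_all2_conv_all_nth)
  have \<pi>: "\<pi> permutes {..<length us}"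
    by fact
  have inv: "inv_into UNIV \<pi> permutes {..<length us}"
    by (rule permutes_inv[OF \<pi>])
  have rc: "map rc us = map rc ts"
    using nth len by (intro nth_equalityI) (auto simp: wequiv_def)
  have x: "x \<in> ltrees c (map rc us)"
    using iso_node.prems rc by simp
  have set: "set (permute_list \<pi> us) = set us"
    using \<pi> by simp
  have wf: "\<forall>t\<in>set us. wf_wtree t"
    using nth by (auto simp: in_set_conv_nth wequiv_def)
  have wf_u: "wf_wtree (Node (c, l, relabel_vertices \<pi> x) (permute_list \<pi> us))"
    using iso_node.prems relabel_vertices_ltrees[OF x, of \<pi>] \<pi> wf
    by (simp add: set permute_list_map)
  have "composite (Node (c, l, relabel_vertices \<pi> x) (permute_list \<pi> us)) =
      sub (\<lambda>k n. map composite (permute_list \<pi> us) ! inv_into UNIV \<pi> k) x"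
    by (simp add: relabel_vertices_def sub_map)
  also have "\<dots> = sub (\<lambda>k n. map composite ts ! k) x"
  proof (rule sub_cong)
    fix v n assume "(v, n) \<in> set (verts x)"
    then have v: "v < length us"
      using verts_label[OF x] by simp
    then have "inv_into UNIV \<pi> v < length us"
      using permutes_in_image[OF inv] by auto
    then show "map composite (permute_list \<pi> us) ! inv_into UNIV \<pi> v = map composite ts ! v"
      using nth[OF v] v \<pi> len by (simp add: permute_list_nth permutes_inverses wequiv_def)
  qed
  finally have comp: "composite (Node (c, l, relabel_vertices \<pi> x) (permute_list \<pi> us)) =
    composite (Node (c, l, x) ts)"
    by simp
  have "mset (map leaves (permute_list \<pi> us)) = mset (map leaves us)"
    using \<pi> by simp
  then have "mset (concat (map leaves (permute_list \<pi> us))) = mset (concat (map leaves us))"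
    using sum_list_mset_cong[of "permute_list \<pi> us" us "\<lambda>t. mset (leaves t)"] \<pi>
    by (simp add: mset_concat comp_def)
  also have "mset (concat (map leaves us)) = (\<Sum>k\<leftarrow>[0..<length us]. mset (leaves (us ! k)))"
    using sum_list_nth[of "\<lambda>t. mset (leaves t)" us] by (simp add: mset_concat comp_def)
  also have "\<dots> = (\<Sum>k\<leftarrow>[0..<length us]. mset (leaves (ts ! k)))"
    by (rule sum_list_eq) (use nth in \<open>simp add: wequiv_def\<close>)
  also have "\<dots> = mset (concat (map leaves ts))"
    using sum_list_nth[of "\<lambda>t. mset (leaves t)" ts] len by (simp add: mset_concat comp_def)
  finally have leaves: "mset (concat (map leaves (permute_list \<pi> us))) = mset (concat (map leaves ts))" .
  then have "tags (Node (c, l, relabel_vertices \<pi> x) (permute_list \<pi> us)) = tags (Node (c, l, x) ts)"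
    by (intro tags_mset) simp
  then have tags: "(\<Union>t\<in>set us. tags t) = (\<Union>t\<in>set ts. tags t)"
    by (simp add: set)
  have cuts: "(\<exists>t\<in>set ts. S \<in> cuts a t) \<longleftrightarrow> (\<exists>t\<in>set us. S \<in> cuts a t)" if "0 \<le> a" "2 \<le> card S" for a S
    using nth len that unfolding wequiv_def by (metis in_set_conv_nth)
  show ?case
    unfolding wequiv_def O_simps
  proof (intro conjI allI impI)
    fix a :: real and S :: "nat set" assume "0 \<le> a" "2 \<le> card S"
    then show "S \<in> cuts a (Node (c, l, x) ts) \<longleftrightarrow> S \<in> cuts a (Node (c, l, relabel_vertices \<pi> x) (permute_list \<pi> us))"
      using cuts[of a S] by (simp add: set tags)
  qed (use iso_node.prems wf_u comp leaves in auto)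
qed

lemma corolla_single: "corolla n = single 0 n"
  by (simp add: corolla_def single_def)

lemma wequiv_step: "w0_step O_operad t u \<Longrightarrow> wf_wtree t \<Longrightarrow> wequiv t u"
proof (induction rule: w0_step.induct)
  case (iso t u)
  then show ?case
    by (rule wequiv_iso)
next
  case (collapse c l x ts d y us ws)
  then have "0 \<le> l" "l \<le> 1"
    by auto
  then show ?case
    unfolding O_simps by (rule wequiv_collapse[OF collapse.prems]) (use collapse in auto)
next
  case (delete_ident t c l)
  have sb: "sub (\<lambda>k n. [composite t] ! k) (corolla c) = composite t"
    unfolding corolla_single using delete_ident lset_numbered[OF numbered_composite, of t]
    by (subst sub_single) auto
  then show ?case
    using delete_ident unfolding wequiv_def
    by (auto simp: wf_merge_length cuts_merge_length)
next
  case (delete_unary_up x c l l' y us)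
  \<comment> \<open>A unary vertex and the vertex above it cut off the same set, so their lengths
    combine to the maximum.\<close>
  have "wequiv (Node (c, l, x) ([] @ Node (c, l', y) us # []))
      (Node (c, max l l', subst_vertex (length ([] :: (nat, ltree) wtree list)) y x) ([] @ us @ []))"
    by (rule wequiv_collapse) (use delete_unary_up in \<open>auto simp: less_max_iff_disj\<close>)
  then show ?case
    by simp
next
  case (delete_unary_down y d t c l x ts l' ws)
  have "0 \<le> l" "l \<le> 1"
    using delete_unary_down by auto
  then have "wequiv (Node (c, l, x) (ts @ Node (d, l', y) [t] # ws))
     (Node (c, l, subst_vertex (length ts) y x) (ts @ [merge_length l' t] @ ws))"
    by (rule wequiv_collapse[OF delete_unary_down.prems])
       (use delete_unary_down in \<open>auto simp: cuts_merge_length wf_merge_length\<close>)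
  then show ?case
    by simp
next
  case (delete_nullary y d c l x ts l' ws)
  have "0 \<le> l" "l \<le> 1"
    using delete_nullary by auto
  then have "wequiv (Node (c, l, x) (ts @ Node (d, l', y) [] # ws))
     (Node (c, l, subst_vertex (length ts) y x) (ts @ [] @ ws))"
    by (rule wequiv_collapse[OF delete_nullary.prems]) (use delete_nullary in auto)
  then show ?case
    by simp
next
  case (in_context t u v ts ws)
  obtain c l x where v: "v = (c, l, x)"
    by (cases v)
  have tu: "wequiv t u"
    using in_context v by auto
  then have "tags t = tags u"
    unfolding wequiv_def using tags_mset by metis
  moreover have "map composite (ts @ t # ws) = map composite (ts @ u # ws)"
    "map rc (ts @ t # ws) = map rc (ts @ u # ws)"
    using tu by (auto simp: wequiv_def)
  ultimately show ?case
    using tu in_context.prems unfolding wequiv_def v composite.simps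
    by (auto split: if_splits)
qed

subsection \<open>Grafting\<close>

text \<open>Grafting and relabelling both replace leaves by trees. A leaf contributes a vertex of
  the composite, so replacing it amounts to substitution at that vertex; the inductive step is again
  \<open>sub_sub\<close>.\<close>

lemma composite_plug:
  assumes "wf_wtree t" "\<And>c j. (c, j) \<in> lset t \<Longrightarrow> wf_wtree (F (c, j)) \<and> rc (F (c, j)) = c"
  shows "wf_wtree (plug F t) \<and> rc (plug F t) = rc t \<and>
    composite (plug F t) = sub (\<lambda>j n. composite (F (n, j))) (composite t)"
  using assms
proof (induction t rule: composite.induct)
  case (1 c j)
  then show ?case
    using lset_numbered[OF numbered_composite, of "F (c, j)"] by (simp add: sub_single)
next
  case (2 c l x ts)
  let ?H = "\<lambda>j n. composite (F (n, j))"
  have IH: "wf_wtree (plug F t)" "rc (plug F t) = rc t" "composite (plug F t) = sub ?H (composite t)"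
    if "t \<in> set ts" for t
    using 2 that by auto
  have x: "x \<in> ltrees c (map rc ts)"
    using 2 by simp
  have "arity_ok ?H (map composite ts ! v)" if "(v, n) \<in> set (verts x)" for v n
  proof (rule arity_okI)
    fix j m assume "(j, m) \<in> set (verts (map composite ts ! v))"
    moreover have v: "v < length ts"
      using verts_label[OF x that] by simp
    ultimately have "(m, j) \<in> lset (ts ! v)"
      using 2 set_verts_composite[of "ts ! v"] by auto
    then have "wf_wtree (F (m, j)) \<and> rc (F (m, j)) = m"
      using v by (intro 2) auto
    then show "numbered m (composite (F (m, j)))"
      using numbered_composite by metis
  qed
  moreover have "arity_ok (\<lambda>k n. map composite ts ! k) x"
    using numbered_child[OF x] 2 by (intro arity_okI) auto
  ultimately have "sub ?H (sub (\<lambda>k n. map composite ts ! k) x) = sub (\<lambda>k n. sub ?H (map composite ts ! k)) x"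
    by (intro sub_sub)
  also have "\<dots> = sub (\<lambda>k n. map composite (map (plug F) ts) ! k) x"
    using verts_label[OF x] IH(3) by (intro sub_cong) auto
  finally have "composite (plug F (Node (c, l, x) ts)) = sub ?H (composite (Node (c, l, x) ts))"
    by (simp only: composite.simps plug.simps)
  moreover have "map rc (map (plug F) ts) = map rc ts"
    using IH(2) by simp
  ultimately show ?case
    using 2(2) IH(1) by (simp only: plug.simps wf_wtree.simps shape_simps root_color.simps set_map fst_conv) auto
qed

lemma tags_plug:
  assumes "\<And>c j. (c, j) \<in> lset t \<Longrightarrow> tags (F (c, j)) = f j"
  shows "tags (plug F t) = \<Union> (f ` tags t)"
proof -
  have "tags (plug F t) = (\<Union>b\<in>lset t. tags (F b))"
    by (auto simp: tags_def lset_plug)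
  also have "\<dots> = (\<Union>b\<in>lset t. f (snd b))"
    using assms by (intro SUP_cong) auto
  finally show ?thesis
    by (simp add: tags_def image_image)
qed

text \<open>An edge of \<open>t\<close> now cuts off the leaves that have grown from those it cut
  off before; every other edge belongs to one of the trees plugged in, including its outgoing root
  edge.\<close>

lemma cuts_plug:
  assumes "\<And>c j. (c, j) \<in> lset t \<Longrightarrow> tags (F (c, j)) = f j"
  shows "cuts a (plug F t) = (\<lambda>S. \<Union> (f ` S)) ` cuts a t \<union> (\<Union>b\<in>lset t. cuts a (F b))"
  using assms
proof (induction a t rule: cuts.induct)
  case (2 a c l x ts)
  have "tags (plug F (Node (c, l, x) ts)) = \<Union> (f ` tags (Node (c, l, x) ts))"
    using 2 by (intro tags_plug)
  moreover have "cuts a (plug F t) = (\<lambda>S. \<Union> (f ` S)) ` cuts a t \<union> (\<Union>b\<in>lset t. cuts a (F b))"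
    if "t \<in> set ts" for t
    using that by (rule 2(1)) (use that 2(2) in auto)
  then have "\<Union> (cuts a ` plug F ` set ts) =
      (\<lambda>S. \<Union> (f ` S)) ` \<Union> (cuts a ` set ts) \<union> (\<Union>b\<in>lset (Node (c, l, x) ts). cuts a (F b))"
    by (auto simp: image_UN UN_Un_distrib)
  ultimately show ?case
    by (simp add: image_Un Un_assoc)
qed auto

lemma composite_map_leaves:
  assumes "wf_wtree t"
  shows "wf_wtree (map_ptree id (\<lambda>(c, j). (c, f j)) t) \<and> rc (map_ptree id (\<lambda>(c, j). (c, f j)) t) = rc t \<and>
    composite (map_ptree id (\<lambda>(c, j). (c, f j)) t) = map_ptree f id (composite t)"
  unfolding map_leaves_plug[of _ t]
  using composite_plug[OF assms, of "\<lambda>a. Leaf (case a of (c, j) \<Rightarrow> (c, f j))"]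
  by (simp add: map_eq_sub)

lemma tags_map_leaves: "tags (map_ptree id (\<lambda>(c, j). (c, f j)) t) = f ` tags t"
  by (force simp: tags_def ptree.set_map)

lemma cuts_map_leaves: "cuts a (map_ptree id (\<lambda>(c, j). (c, f j)) t) = image f ` cuts a t"
proof -
  have "cuts a (map_ptree id (\<lambda>(c, j). (c, f j)) t) = (\<lambda>S. \<Union> ((\<lambda>j. {f j}) ` S)) ` cuts a t"
    unfolding map_leaves_plug[of _ t] by (subst cuts_plug[where f="\<lambda>j. {f j}"]) auto
  moreover have "\<Union> ((\<lambda>j. {f j}) ` S) = f ` S" for S
    by auto
  ultimately show ?thesis
    by simp
qed

section \<open>Cutting off subtrees\<close>

text \<open>Branches are cut at the first vertex outside \<open>S\<close> and become decorations of
  the new leaves. This undoes \<open>plug\<close> if the vertices of the outer tree lie in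
  \<open>S\<close> and the trees plugged in do not start with a vertex of \<open>S\<close>.\<close>

fun prune :: "'v set \<Rightarrow> ('v, 'l) ptree \<Rightarrow> ('v, ('v, 'l) ptree) ptree" where
  "prune S (Leaf a) = Leaf (Leaf a)"
| "prune S (Node v ts) = (if v \<in> S then Node v (map (prune S) ts) else Leaf (Node v ts))"

lemma prune_plug:
  "vset t \<subseteq> S \<Longrightarrow> (\<And>a. a \<in> lset t \<Longrightarrow> prune S (f a) = Leaf (f a)) \<Longrightarrow> prune S (plug f t) = map_ptree id f t"
proof (induction t)
  case (Node v ts)
  have "prune S (plug f t) = map_ptree id f t" if "t \<in> set ts" for t
    using that Node.prems(1) by (intro Node.IH Node.prems(2)) auto
  then show ?case
    using Node.prems(1) by (simp add: id_def)
qed auto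

text \<open>Equal images force equal shapes, so the two lists of leaves split at the same
  places.\<close>

lemma map_leaves_inj:
  "map_ptree id f t = map_ptree id f' t' \<Longrightarrow> leaves t = leaves t' \<Longrightarrow> t = t'"
proof (induction t arbitrary: t')
  case (Leaf a)
  then show ?case
    by (cases t') auto
next
  case (Node v ts)
  obtain ts' where t': "t' = Node v ts'"
    using Node.prems by (cases t') auto
  have eq: "map (map_ptree id f) ts = map (map_ptree id f') ts'"
    using Node.prems by (simp add: t' id_def)
  then have len: "length ts = length ts'"
    by (metis length_map)
  have nth: "map_ptree id f (ts ! k) = map_ptree id f' (ts' ! k)" if "k < length ts" for k
    using eq that len by (metis nth_map)
  have "length (leaves (ts ! k)) = length (leaves (ts' ! k))" if "k < length ts" for k
    using arg_cong[OF nth[OF that], of "\<lambda>t. length (leaves t)"] by (simp add: leaves_map)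
  then have "map leaves ts = map leaves ts'"
    using Node.prems(2) len unfolding t'
    by (intro concat_injective) (auto simp: set_zip)
  then have "leaves (ts ! k) = leaves (ts' ! k)" if "k < length ts" for k
    using that len by (metis nth_map)
  then have "ts = ts'"
    using nth len by (intro nth_equalityI Node.IH) (auto simp: id_def)
  then show ?case
    by (simp add: t')
qed

text \<open>The root of the composite lies in the block of exactly one vertex, which identifies the
  root vertex \<open>k\<close> of \<open>x\<close>; pruning along the block of \<open>k\<close> then
  separates \<open>g k\<close> from the substituted children. Pruning recovers \<open>g k\<close>
  only up to the names of its leaves, and the planar numbering fixes these.\<close>

lemma sub_cancel:
  assumes "sub (\<lambda>k n. g k) x = sub (\<lambda>k n. g' k) x'"
    and "distinct (map fst (verts x))" "distinct (map fst (verts x'))"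
    and "\<And>k. k \<in> vset x \<union> vset x' \<Longrightarrow> vset (g k) = vset (g' k) \<and> vset (g k) \<noteq> {}"
    and "\<And>j k. j \<in> vset x \<union> vset x' \<Longrightarrow> k \<in> vset x \<union> vset x' \<Longrightarrow> j \<noteq> k \<Longrightarrow> vset (g j) \<inter> vset (g k) = {}"
    and "\<And>k n. (k, n) \<in> set (verts x) \<Longrightarrow> leaves (g k) = [0..<n]"
    and "\<And>k n. (k, n) \<in> set (verts x') \<Longrightarrow> leaves (g' k) = [0..<n]"
  shows "x = x' \<and> (\<forall>k\<in>vset x. g k = g' k)"
  using assms
proof (induction x arbitrary: x')
  case (Leaf a)
  show ?case
  proof (cases x')
    case (Node k xs)
    then have "vset (g' k) \<noteq> {}"
      using Leaf.prems(4)[of k] by auto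
    then obtain r ts where "g' k = Node r ts"
      by (cases "g' k") auto
    then show ?thesis
      using Leaf.prems(1) Node by simp
  qed (use Leaf.prems(1) in auto)
next
  case (Node k xs)
  have kx: "k \<in> vset (Node k xs)"
    by simp
  obtain r ts where gk: "g k = Node r ts"
    using Node.prems(4)[of k] by (cases "g k") auto
  obtain k' xs' where x': "x' = Node k' xs'"
    using Node.prems(1) gk by (cases x') auto
  obtain r' ts' where gk': "g' k' = Node r' ts'"
    using Node.prems(4)[of k'] x' by (cases "g' k'") auto
  have "r = r'"
    using Node.prems(1) x' gk gk' by simp
  then have "r \<in> vset (g k) \<inter> vset (g k')"
    using gk gk' Node.prems(4)[of k'] x' by auto
  then have k': "k' = k"
    using Node.prems(5)[of k k'] x' by auto
  define S where "S = vset (g k)"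
  \<comment> \<open>A child that is not a leaf starts with a vertex from the block of another vertex
    \<open>j\<close>; this block is disjoint from \<open>S\<close>, so pruning stops there at
    once.\<close>
  have prune_child: "prune S (sub (\<lambda>k n. h k) y) = Leaf (sub (\<lambda>k n. h k) y)"
    if y: "y \<in> set ys" and dist: "distinct (map fst (verts (Node k ys)))"
      and sub: "vset (Node k ys) \<subseteq> vset (Node k xs) \<union> vset x'"
      and h: "\<And>j. j \<in> vset (Node k ys) \<Longrightarrow> vset (h j) = vset (g j)" for y ys and h :: "_ \<Rightarrow> _"
  proof (cases y)
    case (Node j zs)
    have j: "j \<in> vset (Node k ys)"
      using y Node by force
    have "k \<notin> fst ` set (verts y)"
      using dist y by (auto simp: map_concat)
    then have "j \<noteq> k"
      using Node by auto
    then have "vset (g j) \<inter> S = {}"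
      unfolding S_def using Node.prems(5)[of j k] j sub by auto
    moreover have "vset (h j) = vset (g j)"
      using h[of j] y Node by force
    moreover have "vset (g j) \<noteq> {}"
      using Node.prems(4)[of j] j sub by auto
    ultimately obtain q us where "h j = Node q us" "q \<notin> S"
      by (cases "h j") auto
    then show ?thesis
      using Node by simp
  qed simp
  let ?f = "\<lambda>a. map (sub (\<lambda>k n. g k)) xs ! a" and ?f' = "\<lambda>a. map (sub (\<lambda>k n. g' k)) xs' ! a"
  have lv: "leaves (g k) = [0..<length xs]" "leaves (g' k) = [0..<length xs']"
    using Node.prems(6,7) x' k' by auto
  then have ls: "lset (g k) = {..<length xs}" "lset (g' k) = {..<length xs'}"
    by (auto simp flip: set_leaves)
  have S': "S = vset (g' k)"
    using Node.prems(4)[of k] by (simp add: S_def)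
  have "prune S (plug ?f (g k)) = map_ptree id ?f (g k)"
  proof (rule prune_plug)
    fix a assume "a \<in> lset (g k)"
    then show "prune S (?f a) = Leaf (?f a)"
      using Node.prems(2) by (simp add: ls del: verts.simps) (rule prune_child[of _ xs], auto)
  qed (simp add: S_def)
  moreover have "prune S (plug ?f' (g' k)) = map_ptree id ?f' (g' k)"
  proof (rule prune_plug)
    fix a assume "a \<in> lset (g' k)"
    moreover have "vset (g' j) = vset (g j)" if "j \<in> vset (Node k xs')" for j
      using Node.prems(4)[of j] that x' k' by auto
    ultimately have "prune S (sub (\<lambda>k n. g' k) (xs' ! a)) = Leaf (sub (\<lambda>k n. g' k) (xs' ! a))"
      using Node.prems(3) x' k' by (intro prune_child[of _ xs']) (auto simp: ls)
    then show "prune S (?f' a) = Leaf (?f' a)"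
      using \<open>a \<in> lset (g' k)\<close> by (simp add: ls)
  qed (simp add: S')
  ultimately have eq: "map_ptree id ?f (g k) = map_ptree id ?f' (g' k)"
    using Node.prems(1) x' k' by simp
  \<comment> \<open>The decorations of the leaves, read in planar order, are the substituted
    children themselves; so these agree one by one.\<close>
  have "map ?f [0..<length xs] = map ?f' [0..<length xs']"
    using arg_cong[OF eq, of leaves] unfolding leaves_map lv .
  then have len: "length xs = length xs'"
    by (metis length_map length_upt diff_zero)
  have child: "sub (\<lambda>k n. g k) (xs ! a) = sub (\<lambda>k n. g' k) (xs' ! a)" if "a < length xs" for a
    using arg_cong[OF \<open>map ?f [0..<length xs] = map ?f' [0..<length xs']\<close>, of "\<lambda>ys. ys ! a"] that len
    by simp
  have gk_eq: "g k = g' k"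
    using map_leaves_inj[OF eq] lv len by simp
  have IH: "xs ! a = xs' ! a \<and> (\<forall>k\<in>vset (xs ! a). g k = g' k)" if a: "a < length xs" for a
  proof (rule Node.IH)
    show "xs ! a \<in> set xs"
      using a by simp
    show "sub (\<lambda>k n. g k) (xs ! a) = sub (\<lambda>k n. g' k) (xs' ! a)"
      by (rule child[OF a])
    have sub: "vset (xs ! a) \<union> vset (xs' ! a) \<subseteq> vset (Node k xs) \<union> vset x'"
      using a len x' by force
    have dc: "distinct (map fst (verts t))" if "t \<in> set ts" "distinct (map fst (verts (Node k ts)))" for t ts
      using that by (auto simp: map_concat distinct_concat_iff dest!: split_list)
    show "distinct (map fst (verts (xs ! a)))"
      using dc[OF _ Node.prems(2)] a by simp
    show "distinct (map fst (verts (xs' ! a)))"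
      using dc[of _ xs'] Node.prems(3) a len x' k' by simp
    show "vset (g j) = vset (g' j) \<and> vset (g j) \<noteq> {}" if "j \<in> vset (xs ! a) \<union> vset (xs' ! a)" for j
      using Node.prems(4) sub that by blast
    show "vset (g i) \<inter> vset (g j) = {}"
      if "i \<in> vset (xs ! a) \<union> vset (xs' ! a)" "j \<in> vset (xs ! a) \<union> vset (xs' ! a)" "i \<noteq> j" for i j
      using Node.prems(5) sub that by blast
    show "leaves (g j) = [0..<n]" if "(j, n) \<in> set (verts (xs ! a))" for j n
      using that a by (intro Node.prems(6)) auto
    show "leaves (g' j) = [0..<n]" if "(j, n) \<in> set (verts (xs' ! a))" for j n
      using that a len x' by (intro Node.prems(7)) auto
  qed
  then have "xs = xs'"
    using len by (intro nth_equalityI) auto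
  moreover have "\<forall>j\<in>vset (Node k xs). g j = g' j"
    using IH gk_eq by (auto simp: in_set_conv_nth)
  ultimately show ?case
    using x' k' by simp
qed

section \<open>Normal forms\<close>

text \<open>Unlike in \<open>w0_class\<close>, neither a profile nor the dummy root length is
  prescribed; this allows steps to be carried out inside a larger tree. The passage back is made by
  \<open>weq_wrel\<close>.\<close>

definition weq :: "(nat, ltree) wtree \<Rightarrow> (nat, ltree) wtree \<Rightarrow> bool" where
  "weq = equivclp (\<lambda>t u. wf_wtree t \<and> w0_step O_operad t u)"

lemma weq_step: "wf_wtree t \<Longrightarrow> w0_step O_operad t u \<Longrightarrow> weq t u"
  unfolding weq_def by (rule r_into_equivclp) simp

lemma weq_refl [simp]: "weq t t"
  by (simp add: weq_def)

lemma weq_sym: "weq t u \<Longrightarrow> weq u t"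
  unfolding weq_def by (rule equivclp_sym)

lemma weq_trans [trans]: "weq t u \<Longrightarrow> weq u v \<Longrightarrow> weq t v"
  unfolding weq_def by (rule equivclp_trans)

lemma weq_induct [consumes 1, case_names refl step rev_step]:
  assumes "weq t u" "P t"
    and "\<And>y z. weq t y \<Longrightarrow> wf_wtree y \<Longrightarrow> w0_step O_operad y z \<Longrightarrow> P y \<Longrightarrow> P z"
    and "\<And>y z. weq t y \<Longrightarrow> wf_wtree z \<Longrightarrow> w0_step O_operad z y \<Longrightarrow> P y \<Longrightarrow> P z"
  shows "P u"
  using assms(1) unfolding weq_def
proof (induction rule: equivclp_induct)
  case base
  show ?case
    by fact
next
  case (step y z)
  then show ?case
    using assms(3,4)[of y z] unfolding weq_def by blast
qed

lemma wequiv_refl: "wf_wtree t \<Longrightarrow> wequiv t t"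
  by (simp add: wequiv_def)

lemma wequiv_sym: "wequiv t u \<Longrightarrow> wequiv u t"
  by (simp add: wequiv_def)

lemma wequiv_trans: "wequiv t u \<Longrightarrow> wequiv u v \<Longrightarrow> wequiv t v"
  by (simp add: wequiv_def)

lemma weq_wequiv: "weq t u \<Longrightarrow> wf_wtree t \<Longrightarrow> wequiv t u"
proof (induction rule: weq_induct)
  case refl
  then show ?case
    by (rule wequiv_refl)
next
  case (step y z)
  then show ?case
    using wequiv_step wequiv_trans by blast
next
  case (rev_step y z)
  then show ?case
    using wequiv_step wequiv_trans wequiv_sym by blast
qed

lemma wf_context:
  assumes "wf_wtree (Node v (ts @ t # ws))" "wequiv t u"
  shows "wf_wtree (Node v (ts @ u # ws))"
  using assms by (cases v) (auto simp: wequiv_def)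

text \<open>By \<open>weq_wequiv\<close> every intermediate tree has the root colour of
  \<open>t\<close>, so the context stays well formed along the chain.\<close>

lemma weq_context:
  assumes "weq t u" "wf_wtree (Node v (ts @ t # ws))"
  shows "weq (Node v (ts @ t # ws)) (Node v (ts @ u # ws))"
  using assms(1)
proof (induction rule: weq_induct)
  case (step y z)
  have "wf_wtree t"
    using assms(2) by (cases v) auto
  then have "wf_wtree (Node v (ts @ y # ws))"
    using wf_context[OF assms(2)] weq_wequiv step by blast
  then show ?case
    using step weq_step[OF _ w0_step.in_context] weq_trans by blast
next
  case (rev_step y z)
  have "wf_wtree t"
    using assms(2) by (cases v) auto
  then have "wequiv t z"
    using weq_wequiv rev_step weq_step weq_sym weq_trans by meson
  then have "wf_wtree (Node v (ts @ z # ws))"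
    by (rule wf_context[OF assms(2)])
  then show ?case
    using rev_step weq_step[OF _ w0_step.in_context] weq_trans weq_sym by blast
qed simp

text \<open>Each condition removes one source of ambiguity: a positive length rules out collapsing,
  two inputs rule out unary and nullary vertices, the order of the children fixes the planar
  structure, and the planar numbering of the composite fixes the twist treated in
  \<open>weq_untwist\<close>.\<close>

fun normal_tree :: "(nat, ltree) wtree \<Rightarrow> bool" where
  "normal_tree (Leaf a) \<longleftrightarrow> True"
| "normal_tree (Node (c, l, x) ts) \<longleftrightarrow> 0 < l \<and> 2 \<le> length ts \<and>
     sorted_wrt (\<lambda>t u. Min (tags t) < Min (tags u)) ts \<and>
     leaves (composite (Node (c, l, x) ts)) = [0..<c] \<and> (\<forall>t\<in>set ts. normal_tree t)"

text \<open>The children of a root vertex in normal form. The root vertex may be nullary or carry a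
  single leaf, having then no neighbour to absorb it; with a single vertex above it, it would be
  absorbed.\<close>

definition normal_forest :: "(nat, ltree) wtree list \<Rightarrow> bool" where
  "normal_forest ts \<longleftrightarrow> (\<forall>t\<in>set ts. normal_tree t) \<and>
     sorted_wrt (\<lambda>t u. Min (tags t) < Min (tags u)) ts \<and> (length ts = 1 \<longrightarrow> (\<exists>a. ts = [Leaf a]))"

section \<open>Existence of normal forms\<close>

lemma tags_nonempty: "normal_tree t \<Longrightarrow> tags t \<noteq> {}"
proof (induction t rule: normal_tree.induct)
  case (1 a)
  then show ?case
    by (cases a) auto
next
  case (2 c l x ts)
  then show ?case
    by (cases ts) auto
qed

text \<open>Both sides count the edges: every edge is a leaf or comes out of a vertex, and every
  edge is the root or enters a vertex.\<close>

lemma length_leaves_verts: "length (leaves t) + length (verts t) = 1 + (\<Sum>(v, n)\<leftarrow>verts t. n)"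
proof (induction t)
  case (Node v ts)
  have "length (concat (map leaves ts)) + length (concat (map verts ts)) =
      length ts + (\<Sum>(v, n)\<leftarrow>concat (map verts ts). n)"
    using Node
  proof (induction ts)
    case (Cons t ts)
    have "length (leaves t) + length (verts t) = 1 + (\<Sum>(v, n)\<leftarrow>verts t. n)"
      by (rule Cons.prems) simp
    moreover have "length (concat (map leaves ts)) + length (concat (map verts ts)) =
        length ts + (\<Sum>(v, n)\<leftarrow>concat (map verts ts). n)"
      by (rule Cons.IH, rule Cons.prems) simp
    ultimately show ?case
      by simp
  qed simp
  then show ?case
    by simp
qed auto

text \<open>By the count of edges, a tree with one vertex has as many leaves as that vertex has
  inputs. So every unary vertex of a decorated tree has equal input and output colours, and the
  relations for unary vertices apply to it.\<close>

lemma ltrees_unary: "x \<in> ltrees n [m] \<Longrightarrow> n = m"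
proof -
  assume x: "x \<in> ltrees n [m]"
  then have "mset (leaves x) = mset [0..<n]" "mset (verts x) = {#(0, m)#}"
    by (auto simp: ltrees_iff numbered_def)
  then have "length (leaves x) = n" "verts x = [(0, m)]"
    by (metis diff_zero length_upt size_mset) (metis \<open>mset (verts x) = {#(0, m)#}\<close> mset_single_iff_right)
  then show "n = m"
    using length_leaves_verts[of x] by simp
qed

lemma nonplanar_iso_refl: "nonplanar_iso O_operad t t"
proof (induction t)
  case (Node v ts)
  obtain c l x where v: "v = (c, l, x)"
    by (cases v)
  have "list_all2 (nonplanar_iso O_operad) ts ts"
    using Node by (auto simp: list_all2_conv_all_nth)
  from nonplanar_iso.iso_node[OF this permutes_id, of c l x]
  show ?case
    by (simp add: v relabel_vertices_def ptree.map_id)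
qed (rule nonplanar_iso.iso_leaf)

lemma weq_permute:
  assumes "wf_wtree (Node (c, l, x) ts)" "\<pi> permutes {..<length ts}"
  shows "weq (Node (c, l, x) ts) (Node (c, l, relabel_vertices \<pi> x) (permute_list \<pi> ts))"
proof (rule weq_step[OF assms(1) w0_step.iso])
  have "list_all2 (nonplanar_iso O_operad) ts ts"
    by (auto simp: list_all2_conv_all_nth nonplanar_iso_refl)
  from nonplanar_iso.iso_node[OF this assms(2), of c l x]
  show "nonplanar_iso O_operad (Node (c, l, x) ts) (Node (c, l, relabel_vertices \<pi> x) (permute_list \<pi> ts))"
    by simp
qed

text \<open>A permutation of the leaves of the label of a vertex is the label of a unary vertex that can be
  absorbed on both sides of the edge below.\<close>

lemma weq_untwist:
  assumes wf: "wf_wtree (Node (c, l, x) (ts @ Node (d, l', y) us # ws))"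
  shows "\<exists>x' y'. weq (Node (c, l, x) (ts @ Node (d, l', y) us # ws))
                    (Node (c, l, x') (ts @ Node (d, l', y') us # ws)) \<and>
           leaves (composite (Node (d, l', y') us)) = [0..<d]"
proof -
  have wfN: "wf_wtree (Node (d, l', y) us)"
    using wf by simp
  define p where "p = leaves (composite (Node (d, l', y) us))"
  have p: "mset p = mset [0..<d]"
    using numbered_composite[OF wfN] by (simp add: p_def numbered_def del: composite.simps)
  then have "length p = d"
    by (metis diff_zero length_upt size_mset)
  obtain \<rho> where \<rho>: "\<rho> permutes {..<d}" "permute_list \<rho> [0..<d] = p"
    using mset_eq_permutation[OF p] by auto
  have \<rho>_nth: "map \<rho> [0..<d] = p"
  proof (rule nth_equalityI)
    fix i assume "i < length (map \<rho> [0..<d])"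
    then have "i < d"
      by simp
    then show "map \<rho> [0..<d] ! i = p ! i"
      using \<rho> permutes_in_image[OF \<rho>(1), of i] by (auto simp: permute_list_nth)
  qed (simp add: \<open>length p = d\<close>)
  define \<sigma> where "\<sigma> = inv_into UNIV \<rho>"
  have \<sigma>: "\<sigma> permutes {..<d}" "\<sigma> \<circ> \<rho> = id" "\<rho> \<circ> \<sigma> = id"
    using permutes_inv[OF \<rho>(1)] permutes_inv_o[OF \<rho>(1)] by (auto simp: \<sigma>_def)
  have twist: "numbered d (map_ptree id \<tau> z)" if "numbered d z" "\<tau> permutes {..<d}"
    for z :: ltree and \<tau>
  proof -
    have "mset (map \<tau> (leaves z)) = mset (map \<tau> [0..<d])"
      using that(1) unfolding numbered_def mset_map by simp
    also have "\<dots> = mset [0..<d]"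
      using permutes_image[OF that(2)] permutes_inj_on[OF that(2)]
      by (simp add: lessThan_atLeast0 image_mset_mset_set)
    finally show ?thesis
      unfolding numbered_def leaves_map .
  qed
  \<comment> \<open>The twist is split off from \<open>y\<close>: the inverse \<sigma> removes it
    from the leaves, and the corolla \<open>e\<close> with leaves permuted by \<rho> puts it
    back.\<close>
  define y' where "y' = map_ptree id \<sigma> y"
  define e where "e = map_ptree id \<rho> (single 0 d :: ltree)"
  have y: "y \<in> ltrees d (map rc us)" and us: "\<forall>t\<in>set us. wf_wtree t" and l': "0 \<le> l'" "l' \<le> 1"
    using wfN by auto
  have y': "y' \<in> ltrees d (map rc us)"
    using y twist[of y \<sigma>] \<sigma>(1) by (auto simp: y'_def ltrees_iff verts_map map_prod.id)
  have e: "e \<in> ltrees d [d]"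
    using twist[of "single 0 d" \<rho>] \<rho>(1) by (auto simp: e_def ltrees_iff verts_map)
  have e_y': "subst_vertex 0 y' e = y"
  proof -
    have lset_y': "lset y' = {..<d}"
      using y' lset_numbered by (auto simp: ltrees_iff)
    have "subst_vertex 0 y' e = plug (\<lambda>a. Leaf (\<rho> a)) y'"
    proof -
      have "(\<lambda>j. 0 + j) = (\<lambda>j. j :: nat)"
        by simp
      then have "subst_vertex 0 y' e = plug (\<lambda>a. map (\<lambda>a. Leaf (\<rho> a)) [0..<d] ! a) (map_ptree (\<lambda>j. j) id y')"
        by (simp only: e_def single_def Let_def comp_def ptree.map subst_vertex.simps map_map id_apply if_True refl)
      also have "\<dots> = plug (\<lambda>a. map (\<lambda>a. Leaf (\<rho> a)) [0..<d] ! a) y'"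
        by (simp add: ptree.map_ident id_def)
      also have "\<dots> = plug (\<lambda>a. Leaf (\<rho> a)) y'"
        by (rule plug_cong) (simp add: lset_y')
      finally show ?thesis .
    qed
    also have "\<dots> = y"
      using \<sigma> by (simp add: y'_def ptree.map_comp ptree.map_id flip: map_leaves_plug)
    finally show ?thesis .
  qed
  have "composite (Node (d, l', y') us) = map_ptree id \<sigma> (composite (Node (d, l', y) us))"
    unfolding composite.simps y'_def
    by (rule map_leaves_sub[symmetric], rule arity_okI, rule numbered_child[OF y us])
  then have lv: "leaves (composite (Node (d, l', y') us)) = [0..<d]"
    using \<sigma> by (simp add: leaves_map p_def[symmetric] \<rho>_nth[symmetric] del: composite.simps)
  \<comment> \<open>In \<open>?M\<close> the twist \<open>e\<close> is a unary vertex with an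
    outgoing edge of length \<open>0\<close>. Absorbing it into the vertex above gives the original
    tree, absorbing it into the vertex below gives the untwisted one; the merged length is
    \<open>max 0 l' = l'\<close> in both cases.\<close>
  let ?M = "Node (c, l, x) (ts @ Node (d, 0, e) [Node (d, l', y') us] # ws)"
  have wfM: "wf_wtree ?M"
    using wf y' e us l' by auto
  have "w0_step O_operad (Node (d, 0, e) [Node (d, l', y') us]) (Node (d, max 0 l', circ O_operad 0 e y') us)"
    using e by (intro w0_step.delete_unary_up) simp
  then have "weq ?M (Node (c, l, x) (ts @ Node (d, l', y) us # ws))"
    using weq_step[OF wfM w0_step.in_context] l' by (simp add: e_y' max_def)
  moreover have "w0_step O_operad ?M (Node (c, l, circ O_operad (length ts) x e)
      (ts @ merge_length 0 (Node (d, l', y') us) # ws))"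
    using e by (intro w0_step.delete_unary_down) auto
  then have "weq ?M (Node (c, l, subst_vertex (length ts) e x) (ts @ Node (d, l', y') us # ws))"
    using weq_step[OF wfM] l' by (simp add: max_def)
  ultimately show ?thesis
    using lv weq_sym weq_trans by blast
qed


text \<open>A vertex with normal children can be absorbed unless it has at least two children and a
  positive length; in that case it only has to be untwisted to become normal.\<close>

lemma weq_absorb_child:
  assumes wf: "wf_wtree (Node (c, l, x) (ts @ Node (d, l', y) ns # ws))" and ns: "normal_forest ns"
  shows "\<exists>x' us. weq (Node (c, l, x) (ts @ Node (d, l', y) ns # ws)) (Node (c, l, x') (ts @ us @ ws)) \<and>
           (\<forall>u\<in>set us. normal_tree u)"
proof -
  let ?t = "Node (c, l, x) (ts @ Node (d, l', y) ns # ws)"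
  have y: "y \<in> ltrees d (map rc ns)" "0 \<le> l'" "\<forall>t\<in>set ns. normal_tree t"
    using wf ns by (auto simp: normal_forest_def)
  consider "ns = []" | a where "ns = [Leaf a]" | "l' = 0" | "2 \<le> length ns" "0 < l'"
  proof -
    have "length ns = 0 \<or> length ns = 1 \<or> 2 \<le> length ns"
      by linarith
    then show thesis
      using that y(2) ns by (fastforce simp: normal_forest_def)
  qed
  then show ?thesis
  proof cases
    case 1
    then have "w0_step O_operad ?t (Node (c, l, circ O_operad (length ts) x y) (ts @ ws))"
      using y w0_step.delete_nullary[of y O_operad d c l x ts l' ws] by simp
    then show ?thesis
      using weq_step[OF wf] by (intro exI[of _ "circ O_operad (length ts) x y"] exI[of _ "[]"]) auto
  next
    case (2 a)
    then have "d = rc (Leaf a :: (nat, ltree) wtree)"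
      using y(1) ltrees_unary[of y d "rc (Leaf a :: (nat, ltree) wtree)"] by simp
    then have "w0_step O_operad ?t (Node (c, l, circ O_operad (length ts) x y) (ts @ merge_length l' (Leaf a) # ws))"
      unfolding 2 using y 2 by (intro w0_step.delete_unary_down) auto
    then show ?thesis
      using weq_step[OF wf] by (intro exI[of _ "circ O_operad (length ts) x y"] exI[of _ "[Leaf a]"]) auto
  next
    case 3
    then have "w0_step O_operad ?t (Node (c, l, circ O_operad (length ts) x y) (ts @ ns @ ws))"
      by (simp add: w0_step.collapse del: O_simps)
    then show ?thesis
      using weq_step[OF wf] y(3) by (intro exI[of _ "circ O_operad (length ts) x y"] exI[of _ ns]) auto
  next
    case 4
    obtain x' y' where *: "weq ?t (Node (c, l, x') (ts @ Node (d, l', y') ns # ws))"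
      "leaves (composite (Node (d, l', y') ns)) = [0..<d]"
      using weq_untwist[OF wf] by blast
    then have "normal_tree (Node (d, l', y') ns)"
      using 4 ns by (simp add: normal_forest_def)
    then show ?thesis
      using * by (intro exI[of _ x'] exI[of _ "[Node (d, l', y') ns]"]) auto
  qed
qed

definition tag_distinct :: "('v, 'c \<times> nat) ptree \<Rightarrow> bool" where
  "tag_distinct t \<longleftrightarrow> distinct (map snd (leaves t))"

lemma tag_distinct_child: "tag_distinct (Node v ts) \<Longrightarrow> t \<in> set ts \<Longrightarrow> tag_distinct t"
  unfolding tag_distinct_def by (induction ts) auto

lemma tags_disjoint:
  assumes "tag_distinct (Node v ts)" "i < length ts" "j < length ts" "i \<noteq> j"
  shows "tags (ts ! i) \<inter> tags (ts ! j) = {}"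
proof -
  have aux: "set (map snd (leaves (ts ! i))) \<inter> set (map snd (leaves (ts ! j))) = {}"
    if "i < j" "j < length ts" for i j
    using assms(1) that
  proof (induction ts arbitrary: i j)
    case (Cons t ts)
    then have d: "distinct (map snd (concat (map leaves ts)))"
      "snd ` set (leaves t) \<inter> snd ` (\<Union>t\<in>set ts. set (leaves t)) = {}"
      by (auto simp: tag_distinct_def)
    show ?case
    proof (cases i)
      case 0
      then have "ts ! (j - 1) \<in> set ts"
        using Cons by auto
      then have "snd ` set (leaves (ts ! (j - 1))) \<subseteq> snd ` (\<Union>t\<in>set ts. set (leaves t))"
        by (intro image_mono UN_upper)
      then have "snd ` set (leaves t) \<inter> snd ` set (leaves (ts ! (j - 1))) = {}"
        using d(2) by (simp only: disjoint_iff subset_iff) meson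
      then show ?thesis
        using 0 Cons.prems(2) by (simp add: nth_Cons')
    next
      case (Suc i')
      then show ?thesis
        using Cons.IH[of i' "j - 1"] Cons.prems d(1) by (auto simp: nth_Cons' tag_distinct_def)
    qed
  qed simp
  show ?thesis
    using aux[of i j] aux[of j i] assms(2-) unfolding tags_leaves
    by (cases "i < j") (auto simp: Int_commute)
qed

lemma tag_distinct_weq: "weq t u \<Longrightarrow> wf_wtree t \<Longrightarrow> tag_distinct t \<Longrightarrow> tag_distinct u"
  using weq_wequiv[of t u] unfolding wequiv_def tag_distinct_def
  by (metis mset_map mset_eq_imp_distinct_iff)

text \<open>\<open>done\<close> holds the children already treated. One untreated child may be
  replaced by several or by none, so the induction runs over the remaining ones.\<close>

lemma weq_normal_children:
  assumes "\<And>t. t \<in> set ts \<Longrightarrow> \<exists>c l x ns. weq t (Node (c, l, x) ns) \<and> normal_forest ns"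
    and "wf_wtree (Node (c, l, x) (done @ ts))" "\<forall>t\<in>set done. normal_tree t"
  shows "\<exists>x' us. weq (Node (c, l, x) (done @ ts)) (Node (c, l, x') us) \<and> (\<forall>u\<in>set us. normal_tree u)"
  using assms
proof (induction ts arbitrary: x "done")
  case Nil
  then show ?case
    by (intro exI[of _ x] exI[of _ "done"]) auto
next
  case (Cons t ts)
  obtain d l' y ns where t: "weq t (Node (d, l', y) ns)" "normal_forest ns"
    using Cons.prems(1)[of t] by auto
  have 1: "weq (Node (c, l, x) (done @ t # ts)) (Node (c, l, x) (done @ Node (d, l', y) ns # ts))"
    by (rule weq_context[OF t(1) Cons.prems(2)])
  then have "wf_wtree (Node (c, l, x) (done @ Node (d, l', y) ns # ts))"
    using weq_wequiv[OF 1 Cons.prems(2)] by (simp only: wequiv_def)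
  then obtain x' us where 2: "weq (Node (c, l, x) (done @ Node (d, l', y) ns # ts)) (Node (c, l, x') (done @ us @ ts))"
    "\<forall>u\<in>set us. normal_tree u"
    using weq_absorb_child[OF _ t(2)] by blast
  have 3: "weq (Node (c, l, x) (done @ t # ts)) (Node (c, l, x') ((done @ us) @ ts))"
    using weq_trans[OF 1 2(1)] by simp
  then have "wf_wtree (Node (c, l, x') ((done @ us) @ ts))"
    using weq_wequiv[OF 3 Cons.prems(2)] by (simp only: wequiv_def)
  then obtain x'' vs where "weq (Node (c, l, x') ((done @ us) @ ts)) (Node (c, l, x'') vs)" "\<forall>u\<in>set vs. normal_tree u"
  proof -
    have "\<forall>u\<in>set (done @ us). normal_tree u"
      using Cons.prems(3) 2(2) by auto
    then show thesis
      using Cons.IH[of x' "done @ us"] Cons.prems(1) \<open>wf_wtree (Node (c, l, x') ((done @ us) @ ts))\<close> that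
      by (metis list.set_intros(2))
  qed
  then show ?case
    using weq_trans[OF 3] by blast
qed

text \<open>Nonempty disjoint sets have distinct minima, so sorting by minima yields a strict
  order.\<close>

lemma weq_sort:
  assumes "wf_wtree (Node (c, l, x) ts)" "tag_distinct (Node v ts)" "\<forall>t\<in>set ts. normal_tree t"
  shows "\<exists>x' us. weq (Node (c, l, x) ts) (Node (c, l, x') us) \<and> length us = length ts \<and>
     (\<forall>t\<in>set us. normal_tree t) \<and> sorted_wrt (\<lambda>t u. Min (tags t) < Min (tags u)) us"
proof -
  define us where "us = sort_key (\<lambda>t. Min (tags t)) ts"
  have "mset us = mset ts"
    by (simp add: us_def)
  then obtain \<pi> where \<pi>: "\<pi> permutes {..<length ts}" "permute_list \<pi> ts = us"
    using mset_eq_permutation by metis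
  have "inj_on (\<lambda>i. Min (tags (ts ! i))) {..<length ts}"
  proof (rule inj_onI, rule ccontr)
    fix i j assume *: "i \<in> {..<length ts}" "j \<in> {..<length ts}" "Min (tags (ts ! i)) = Min (tags (ts ! j))" "i \<noteq> j"
    then have "Min (tags (ts ! i)) \<in> tags (ts ! i) \<inter> tags (ts ! j)"
      using assms(3) tags_nonempty by (metis IntI Min_in finite_tags lessThan_iff nth_mem)
    then show False
      using tags_disjoint[OF assms(2)] * by auto
  qed
  then have "distinct (map (\<lambda>i. Min (tags (ts ! i))) [0..<length ts])"
    by (simp add: distinct_map lessThan_atLeast0)
  moreover have "map (\<lambda>i. Min (tags (ts ! i))) [0..<length ts] = map (\<lambda>t. Min (tags t)) ts"
    by (rule nth_equalityI) auto
  ultimately have "distinct (map (\<lambda>t. Min (tags t)) us)"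
    using \<open>mset us = mset ts\<close> by (metis mset_map mset_eq_imp_distinct_iff)
  moreover have "sorted (map (\<lambda>t. Min (tags t)) us)"
    by (simp add: us_def)
  ultimately have "sorted_wrt (<) (map (\<lambda>t. Min (tags t)) us)"
    by (simp add: strict_sorted_iff)
  then have "sorted_wrt (\<lambda>t u. Min (tags t) < Min (tags u)) us"
    by (simp add: sorted_wrt_map)
  moreover have "set us = set ts" "length us = length ts"
    by (simp_all add: us_def)
  ultimately show ?thesis
    using weq_permute[OF assms(1) \<pi>(1)] \<pi>(2) assms(3) by blast
qed

proposition weq_normal:
  "wf_wtree t \<Longrightarrow> tag_distinct t \<Longrightarrow> \<exists>c l x ns. weq t (Node (c, l, x) ns) \<and> normal_forest ns"
proof (induction t)
  case (Leaf a)
  obtain c j where a: "a = (c, j)"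
    by (cases a)
  \<comment> \<open>A bare leaf has no vertex; an identity vertex is put below it to provide the
    root vertex of the normal form.\<close>
  have "corolla c \<in> ltrees c [c]"
    by (simp add: corolla_single ltrees_iff)
  then have "wf_wtree (Node (c, 1, corolla c) [Leaf (c, j)])"
    by simp
  moreover have "w0_step O_operad (Node (c, 1, ident O_operad c) [Leaf (c, j)]) (merge_length 1 (Leaf (c, j)))"
    by (rule w0_step.delete_ident) simp
  ultimately have "weq (Node (c, 1, corolla c) [Leaf (c, j)]) (Leaf (c, j))"
    using weq_step by simp
  then show ?case
    using weq_sym unfolding a by (fastforce simp: normal_forest_def)
next
  case (Node v ts)
  obtain c l x where v: "v = (c, l, x)"
    by (cases v)
  have "\<exists>c l x ns. weq t (Node (c, l, x) ns) \<and> normal_forest ns" if "t \<in> set ts" for t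
    using that Node.prems tag_distinct_child[OF Node.prems(2) that] by (intro Node.IH) (auto simp: v)
  then obtain x' us where 1: "weq (Node v ts) (Node (c, l, x') us)" "\<forall>u\<in>set us. normal_tree u"
    using weq_normal_children[of ts c l x "[]"] Node.prems(1) by (auto simp: v)
  have wf: "wf_wtree (Node (c, l, x') us)"
    using weq_wequiv[OF 1(1) Node.prems(1)] by (simp only: wequiv_def)
  show ?case
  proof (cases "\<exists>d l' y ns. us = [Node (d, l', y) ns]")
    case True
    \<comment> \<open>A unary root with a vertex above it is absorbed upwards; that vertex is
      normal, so its children already form a normal forest.\<close>
    then obtain d l' y ns where us: "us = [Node (d, l', y) ns]"
      by blast
    then have x': "x' \<in> ltrees c [d]"
      using wf by simp
    then have "c = d"
      by (rule ltrees_unary)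
    then have "weq (Node (c, l, x') us) (Node (c, max l l', circ O_operad 0 x' y) ns)"
      using x' unfolding us by (intro weq_step[OF wf[unfolded us]]) (auto intro: w0_step.delete_unary_up simp del: O_simps simp: O_simps(4))
    moreover have "normal_forest ns"
      using 1(2) us by (auto simp: normal_forest_def)
    ultimately show ?thesis
      using weq_trans[OF 1(1)] by blast
  next
    case False
    have "tag_distinct (Node (c, l, x') us)"
      by (rule tag_distinct_weq[OF 1(1) Node.prems])
    then obtain x'' vs where 2: "weq (Node (c, l, x') us) (Node (c, l, x'') vs)" "length vs = length us"
      "\<forall>t\<in>set vs. normal_tree t" "sorted_wrt (\<lambda>t u. Min (tags t) < Min (tags u)) vs"
      using weq_sort[OF wf _ 1(2)] by blast
    show ?thesis
    proof (cases "length us = 1")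
      case True
      then obtain u where "us = [u]"
        by (auto simp: length_Suc_conv)
      then have "normal_forest us"
        using False 1(2) by (cases u) (auto simp: normal_forest_def)
      then show ?thesis
        using 1(1) by blast
    next
      case False
      then have "normal_forest vs"
        using 2 by (simp add: normal_forest_def)
      then show ?thesis
        using weq_trans[OF 1(1) 2(1)] by blast
    qed
  qed
qed

section \<open>Uniqueness of normal forms\<close>

lemma normal_tree_forest: "normal_tree (Node (c, l, x) ts) \<Longrightarrow> normal_forest ts"
  by (simp add: normal_forest_def)

text \<open>There are at least two children, and their sets of leaves are nonempty and disjoint; so
  every edge below a vertex of a normal tree is visible to \<open>wequiv\<close>.\<close>

lemma normal_card:
  assumes "normal_tree (Node v ts)" "tag_distinct (Node v ts)"
  shows "2 \<le> card (tags (Node v ts))"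
proof -
  have len: "2 \<le> length ts" and ts: "\<forall>t\<in>set ts. normal_tree t"
    using assms(1) by (cases v; simp)+
  have mem: "ts ! 0 \<in> set ts" "ts ! 1 \<in> set ts"
    using len by (auto intro!: nth_mem)
  then have "tags (ts ! 0) \<noteq> {}" "tags (ts ! 1) \<noteq> {}"
    using ts tags_nonempty by blast+
  then obtain a b where ab: "a \<in> tags (ts ! 0)" "b \<in> tags (ts ! 1)"
    by blast
  have "tags (ts ! 0) \<inter> tags (ts ! 1) = {}"
    using len by (intro tags_disjoint[OF assms(2)]) auto
  then have "a \<noteq> b"
    using ab by blast
  moreover have "{a, b} \<subseteq> tags (Node v ts)"
    unfolding tags_simps using ab mem by blast
  ultimately show ?thesis
    by (metis card_2_iff card_mono finite_tags)
qed

lemma normal_child_proper: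
  assumes "normal_forest ts" "tag_distinct (Node v ts)" "k < length ts" "ts ! k = Node w us"
  shows "tags (ts ! k) \<noteq> (\<Union>t\<in>set ts. tags t)"
proof -
  have "length ts \<noteq> 1"
    using assms by (auto simp: normal_forest_def)
  then obtain j where j: "j < length ts" "j \<noteq> k"
    using assms(3) by (intro that[of "if k = 0 then 1 else 0"]) (auto split: if_splits)
  have "tags (ts ! j) \<noteq> {}"
    using assms(1) j tags_nonempty by (auto simp: normal_forest_def)
  moreover have "tags (ts ! j) \<inter> tags (ts ! k) = {}"
    using tags_disjoint[OF assms(2)] j assms(3) by auto
  moreover have "tags (ts ! j) \<subseteq> (\<Union>t\<in>set ts. tags t)"
    using nth_mem[OF j(1)] by blast
  ultimately show ?thesis
    by blast
qed

lemma cuts_forest_proper: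
  assumes "normal_forest ts" "tag_distinct (Node v ts)" "k < length ts" "S \<in> cuts a (ts ! k)"
  shows "S \<noteq> (\<Union>t\<in>set ts. tags t)"
proof -
  obtain w us where "ts ! k = Node w us"
    using assms(4) by (cases "ts ! k") auto
  then have "tags (ts ! k) \<noteq> (\<Union>t\<in>set ts. tags t)"
    using normal_child_proper assms by blast
  moreover have "tags (ts ! k) \<subseteq> (\<Union>t\<in>set ts. tags t)"
    using nth_mem[OF assms(3)] by blast
  ultimately show ?thesis
    using cuts_subset_tags[OF assms(4)] by blast
qed

text \<open>A child is a single leaf, or its edge cuts off a proper set with at least two elements.
  In the latter case this set is also cut off in the other forest, inside one of its
  children.\<close>

lemma forest_refines:
  assumes ts: "normal_forest ts" "tag_distinct (Node v ts)"
    and V: "(\<Union>t\<in>set ts. tags t) = (\<Union>t\<in>set us. tags t)"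
    and cuts: "\<And>S. 2 \<le> card S \<Longrightarrow> S \<noteq> (\<Union>t\<in>set ts. tags t) \<Longrightarrow> \<exists>t\<in>set ts. S \<in> cuts 0 t \<Longrightarrow> \<exists>u\<in>set us. S \<in> cuts 0 u"
    and t: "t \<in> set ts"
  shows "\<exists>u\<in>set us. tags t \<subseteq> tags u"
proof (cases t)
  case (Leaf a)
  then obtain c j where "t = Leaf (c, j)"
    by (cases a) auto
  then have "j \<in> (\<Union>t\<in>set ts. tags t)"
    using t by force
  then show ?thesis
    using \<open>t = Leaf (c, j)\<close> unfolding V by auto
next
  case (Node w vs)
  obtain c l x where w: "w = (c, l, x)"
    by (cases w)
  obtain k where k: "k < length ts" "t = ts ! k"
    using t by (metis in_set_conv_nth)
  have norm: "normal_tree t"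
    using ts(1) t by (simp add: normal_forest_def)
  then have "tags t \<in> cuts 0 t"
    using Node w by auto
  moreover have "2 \<le> card (tags t)"
    using normal_card[of w vs] norm Node tag_distinct_child[OF ts(2) t] by simp
  moreover have "tags t \<noteq> (\<Union>t\<in>set ts. tags t)"
    using normal_child_proper[OF ts k(1)] k Node by blast
  ultimately show ?thesis
    using cuts[of "tags t"] t cuts_subset_tags by blast
qed

text \<open>Mutual refinement gives the same partition of the leaves, and sorting by minima gives
  the same order of its parts.\<close>

lemma forest_tags_eq:
  assumes ts: "normal_forest ts" "tag_distinct (Node v ts)"
    and us: "normal_forest us" "tag_distinct (Node w us)"
    and V: "(\<Union>t\<in>set ts. tags t) = (\<Union>t\<in>set us. tags t)"
    and cuts: "\<And>S. 2 \<le> card S \<Longrightarrow> S \<noteq> (\<Union>t\<in>set ts. tags t) \<Longrightarrow>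
      (\<exists>t\<in>set ts. S \<in> cuts 0 t) \<longleftrightarrow> (\<exists>u\<in>set us. S \<in> cuts 0 u)"
  shows "map tags ts = map tags us"
proof -
  \<comment> \<open>Each set of the first family lies in one of the second, which lies in one of the
    first; disjointness makes the outer two equal.\<close>
  have half: "tags ` set ts \<subseteq> tags ` set us"
    if ts: "normal_forest ts" "tag_distinct (Node v ts)"
    and us: "normal_forest us" "tag_distinct (Node w us)"
    and V: "(\<Union>t\<in>set ts. tags t) = (\<Union>t\<in>set us. tags t)"
    and cuts: "\<And>S. 2 \<le> card S \<Longrightarrow> S \<noteq> (\<Union>t\<in>set ts. tags t) \<Longrightarrow>
      (\<exists>t\<in>set ts. S \<in> cuts 0 t) \<longleftrightarrow> (\<exists>u\<in>set us. S \<in> cuts 0 u)"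
    for ts us and v w :: "nat \<times> real \<times> ltree"
  proof
    fix A assume "A \<in> tags ` set ts"
    then obtain t where t: "t \<in> set ts" "A = tags t"
      by blast
    then obtain u where u: "u \<in> set us" "tags t \<subseteq> tags u"
      using forest_refines[OF ts V] cuts by blast
    obtain t' where t': "t' \<in> set ts" "tags u \<subseteq> tags t'"
      using forest_refines[OF us V[symmetric], of u] cuts V u by auto
    obtain i j where ij: "i < length ts" "t = ts ! i" "j < length ts" "t' = ts ! j"
      using t t' by (metis in_set_conv_nth)
    have "tags t \<noteq> {}"
      using t ts(1) tags_nonempty by (auto simp: normal_forest_def)
    then have "i = j"
      using tags_disjoint[OF ts(2) ij(1) ij(3)] ij u t' by blast
    then have "tags t = tags u"
      using u t' ij by auto
    then show "A \<in> tags ` set us"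
      using t u by auto
  qed
  have sets: "tags ` set ts = tags ` set us"
    using half[OF ts us V cuts] half[OF us ts V[symmetric]] cuts V by auto
  have "sorted_wrt (<) (map (Min \<circ> tags) ts)" "sorted_wrt (<) (map (Min \<circ> tags) us)"
    using ts us by (auto simp: normal_forest_def sorted_wrt_map)
  moreover have "set (map (Min \<circ> tags) ts) = set (map (Min \<circ> tags) us)"
    using arg_cong[OF sets, of "image Min"] by (simp add: image_comp)
  ultimately have mins: "map (Min \<circ> tags) ts = map (Min \<circ> tags) us"
    by (intro strict_sorted_equal) auto
  then have len: "length ts = length us"
    by (metis length_map)
  have "tags (ts ! k) = tags (us ! k)" if k: "k < length ts" for k
  proof -
    obtain j where j: "j < length us" "tags (ts ! k) = tags (us ! j)"
      using sets k by (metis (no_types, opaque_lifting) image_iff in_set_conv_nth)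
    have "Min (tags (us ! j)) = Min (tags (us ! k))"
      using arg_cong[OF mins, of "\<lambda>xs. xs ! k"] k len j by simp
    moreover have "distinct (map (Min \<circ> tags) us)"
      using \<open>sorted_wrt (<) (map (Min \<circ> tags) us)\<close> strict_sorted_iff by blast
    ultimately have "j = k"
      using j k len by (metis (no_types, lifting) comp_apply length_map nth_eq_iff_index_eq nth_map)
    then show ?thesis
      using j by simp
  qed
  then show ?thesis
    using len by (intro nth_equalityI) auto
qed

text \<open>A nonempty set of leaves fits into only one child, so a cut shared by the forests occurs
  in children with the same number.\<close>

lemma forest_cuts_match:
  assumes ts: "normal_forest ts" "tag_distinct (Node v ts)" and us: "tag_distinct (Node w us)"
    and tags: "map tags ts = map tags us"
    and cuts: "\<And>S. 2 \<le> card S \<Longrightarrow> S \<noteq> (\<Union>t\<in>set ts. tags t) \<Longrightarrow>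
      (\<exists>t\<in>set ts. S \<in> cuts a t) \<Longrightarrow> (\<exists>u\<in>set us. S \<in> cuts a u)"
    and k: "k < length ts" and S: "2 \<le> card S" "S \<in> cuts a (ts ! k)"
  shows "S \<in> cuts a (us ! k)"
proof -
  have len: "length ts = length us"
    using tags by (metis length_map)
  have nth: "tags (ts ! k) = tags (us ! k)"
    using arg_cong[OF tags, of "\<lambda>xs. xs ! k"] k len by simp
  have "S \<noteq> (\<Union>t\<in>set ts. tags t)"
    by (rule cuts_forest_proper[OF ts k S(2)])
  then obtain u where "u \<in> set us" "S \<in> cuts a u"
    using cuts[OF S(1)] S(2) nth_mem[OF k] by blast
  then obtain j where j: "j < length us" "S \<in> cuts a (us ! j)"
    by (metis in_set_conv_nth)
  have "S \<noteq> {}"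
    using S(1) by auto
  moreover have "S \<subseteq> tags (us ! j)" "S \<subseteq> tags (us ! k)"
    using cuts_subset_tags[OF j(2)] cuts_subset_tags[OF S(2)] nth by auto
  ultimately have "j = k"
    using tags_disjoint[OF us j(1), of k] k len by auto
  then show ?thesis
    using j by simp
qed

text \<open>The full set of leaves is excepted in \<open>cuts\<close> because the length below the
  root vertex is left open; by \<open>cuts_forest_proper\<close> no child cuts off this set. The
  labels are then separated from the children by \<open>sub_cancel\<close>, whose last two
  hypotheses are the planar numbering built into normal trees.\<close>

lemma forest_unique:
  assumes wf: "wf_wtree (Node (c, l, x) ts)" "wf_wtree (Node (c', l', x') us)"
    and dist: "tag_distinct (Node (c, l, x) ts)" "tag_distinct (Node (c', l', x') us)"
    and norm: "normal_forest ts" "normal_forest us"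
    and comp: "composite (Node (c, l, x) ts) = composite (Node (c', l', x') us)"
    and cuts: "\<And>a S. 0 \<le> a \<Longrightarrow> 2 \<le> card S \<Longrightarrow> S \<noteq> tags (Node (c, l, x) ts) \<Longrightarrow>
      S \<in> cuts a (Node (c, l, x) ts) \<longleftrightarrow> S \<in> cuts a (Node (c', l', x') us)"
  shows "c = c' \<and> x = x' \<and> length ts = length us \<and> (\<forall>k<length ts. composite (ts ! k) = composite (us ! k) \<and>
    (\<forall>a\<ge>0. \<forall>S. 2 \<le> card S \<longrightarrow> S \<in> cuts a (ts ! k) \<longleftrightarrow> S \<in> cuts a (us ! k)))"
proof -
  have V: "(\<Union>t\<in>set ts. tags t) = (\<Union>t\<in>set us. tags t)"
    using vset_composite[OF wf(1)] vset_composite[OF wf(2)] comp by simp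
  have cuts': "(\<exists>t\<in>set ts. S \<in> cuts a t) \<longleftrightarrow> (\<exists>u\<in>set us. S \<in> cuts a u)"
    if "0 \<le> a" "2 \<le> card S" "S \<noteq> (\<Union>t\<in>set ts. tags t)" for a S
    using cuts[OF that(1,2)] that(3) V unfolding cuts.simps tags_simps by (simp split: if_splits)
  have tags: "map tags ts = map tags us"
    by (rule forest_tags_eq[OF norm(1) dist(1) norm(2) dist(2) V cuts']) simp
  have len: "length ts = length us"
    using tags by (metis length_map)
  have nth: "tags (ts ! k) = tags (us ! k)" if "k < length ts" for k
    using arg_cong[OF tags, of "\<lambda>xs. xs ! k"] that len by simp
  have "length (leaves (composite (Node (c, l, x) ts))) = c"
    "length (leaves (composite (Node (c', l', x') us))) = c'"
    using numbered_composite[OF wf(1)] numbered_composite[OF wf(2)]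
    unfolding numbered_def by (metis diff_zero length_upt size_mset shape_simps(2) root_color.simps(2) fst_conv)+
  then have c: "c = c'"
    using comp by simp
  have xs: "x \<in> ltrees c (map rc ts)" "x' \<in> ltrees c' (map rc us)"
    and wfs: "\<forall>t\<in>set ts. wf_wtree t" "\<forall>t\<in>set us. wf_wtree t"
    using wf by auto
  have planar: "leaves (composite t) = [0..<rc t]" if "normal_tree t" for t
  proof (cases t)
    case (Node v us)
    then show ?thesis
      using that by (cases v) (simp del: composite.simps)
  next
    case (Leaf a)
    then show ?thesis
      by (cases a) simp
  qed
  have pl: "leaves (composite (ts ! k)) = [0..<rc (ts ! k)]" "leaves (composite (us ! k)) = [0..<rc (us ! k)]"
    if "k < length ts" for k
    using planar norm that len by (auto simp: normal_forest_def)
  have K: "vset x = {..<length ts}" "vset x' = {..<length ts}"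
    using vset_ltrees[OF xs(1)] vset_ltrees[OF xs(2)] len by auto
  have "x = x' \<and> (\<forall>k\<in>vset x. map composite ts ! k = map composite us ! k)"
  proof (rule sub_cancel)
    show "sub (\<lambda>k n. map composite ts ! k) x = sub (\<lambda>k n. map composite us ! k) x'"
      using comp by simp
    show "distinct (map fst (verts x))" "distinct (map fst (verts x'))"
      using xs distinct_verts_ltrees by auto
    fix k assume "k \<in> vset x \<union> vset x'"
    then have k: "k < length ts"
      by (simp add: K)
    have vs: "vset (composite (ts ! i)) = tags (ts ! i)" "vset (composite (us ! i)) = tags (us ! i)" if "i < length ts" for i
      using that len wfs vset_composite by auto
    show "vset (map composite ts ! k) = vset (map composite us ! k) \<and> vset (map composite ts ! k) \<noteq> {}"
      using k len vs[OF k] nth[OF k] tags_nonempty[of "ts ! k"] norm(1) by (simp add: normal_forest_def)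
    fix j assume "j \<in> vset x \<union> vset x'" "k \<noteq> j"
    then show "vset (map composite ts ! k) \<inter> vset (map composite ts ! j) = {}"
      using k vs tags_disjoint[OF dist(1), of k j] by (simp add: K)
  next
    fix k n assume "(k, n) \<in> set (verts x)"
    then show "leaves (map composite ts ! k) = [0..<n]"
      using verts_label[OF xs(1)] pl by simp
  next
    fix k n assume "(k, n) \<in> set (verts x')"
    then show "leaves (map composite us ! k) = [0..<n]"
      using verts_label[OF xs(2)] pl len by simp
  qed
  moreover have "S \<in> cuts a (ts ! k) \<longleftrightarrow> S \<in> cuts a (us ! k)"
    if "k < length ts" "0 \<le> a" "2 \<le> card S" for k a S
  proof
    show "S \<in> cuts a (us ! k)" if "S \<in> cuts a (ts ! k)"
      using that \<open>k < length ts\<close> \<open>2 \<le> card S\<close> cuts'[OF \<open>0 \<le> a\<close>]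
      by (intro forest_cuts_match[OF norm(1) dist tags]) auto
    show "S \<in> cuts a (ts ! k)" if "S \<in> cuts a (us ! k)"
      using that \<open>k < length ts\<close> \<open>2 \<le> card S\<close> cuts'[OF \<open>0 \<le> a\<close>] V len
      by (intro forest_cuts_match[OF norm(2) dist(2) dist(1) tags[symmetric]]) auto
  qed
  ultimately show ?thesis
    using c len K by auto
qed

text \<open>Labels and children are recovered by \<open>forest_unique\<close> and induction. The
  root length is then read off from the thresholds at which the full set of leaves is cut off, since
  no edge above the root vertex cuts it off.\<close>

lemma normal_unique:
  assumes "normal_tree t" "normal_tree u" "wf_wtree t" "wf_wtree u" "tag_distinct t" "tag_distinct u"
    and "composite t = composite u"
    and "\<And>a S. 0 \<le> a \<Longrightarrow> 2 \<le> card S \<Longrightarrow> S \<in> cuts a t \<longleftrightarrow> S \<in> cuts a u"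
  shows "t = u"
  using assms
proof (induction t arbitrary: u)
  case (Leaf a)
  obtain c j where a: "a = (c, j)"
    by (cases a)
  have "tags u = tags (Leaf a :: (nat, ltree) wtree)"
    using Leaf.prems vset_composite[of u] vset_composite[of "Leaf a"] by simp
  then have card: "card (tags u) = 1"
    by (simp add: a)
  show ?case
  proof (cases u)
    case (Leaf b)
    obtain d k where b: "b = (d, k)"
      by (cases b)
    then have "verts (single j c) = verts (single k d)"
      using Leaf.prems(7) a Leaf by simp
    then show ?thesis
      using a b Leaf by simp
  next
    case (Node w vs)
    then show ?thesis
      using normal_card[of w vs] Leaf.prems card by simp
  qed
next
  case (Node v ts)
  obtain c l x where v: "v = (c, l, x)"
    by (cases v)
  have tags_eq: "tags u = tags (Node v ts)"
    using Node.prems vset_composite[of u] vset_composite[of "Node v ts"] by simp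
  then have card: "2 \<le> card (tags u)" "2 \<le> card (tags (Node v ts))"
    using normal_card[of v ts] Node.prems by auto
  show ?case
  proof (cases u)
    case (Leaf b)
    then show ?thesis
      using card by (cases b) auto
  next
    case u: (Node w us)
    obtain c' l' x' where w: "w = (c', l', x')"
      by (cases w)
    have forests: "normal_forest ts" "normal_forest us"
      using Node.prems normal_tree_forest u v w by blast+
    have *: "c = c' \<and> x = x' \<and> length ts = length us \<and> (\<forall>k<length ts. composite (ts ! k) = composite (us ! k) \<and>
      (\<forall>a\<ge>0. \<forall>S. 2 \<le> card S \<longrightarrow> S \<in> cuts a (ts ! k) \<longleftrightarrow> S \<in> cuts a (us ! k)))"
      using Node.prems forests unfolding u v w by (intro forest_unique[of c l x ts c' l' x' us]) blast+
    have "ts ! k = us ! k" if k: "k < length ts" for k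
    proof (rule Node.IH)
      show "normal_tree (ts ! k)" "normal_tree (us ! k)"
        using forests k * by (auto simp: normal_forest_def)
      show "wf_wtree (ts ! k)" "wf_wtree (us ! k)"
        using Node.prems(3,4) k * by (auto simp: u v w)
      show "tag_distinct (ts ! k)" "tag_distinct (us ! k)"
        using Node.prems(5,6) k * tag_distinct_child nth_mem unfolding u by metis+
    qed (use k * in auto)
    then have ts: "ts = us"
      using * by (intro nth_equalityI) auto
    have root: "tags (Node v ts) \<in> cuts a (Node (d, m, y) ts) \<longleftrightarrow> a < m" for a d m y
    proof -
      have "tags (Node v ts) \<notin> cuts a t" if "t \<in> set ts" for t
        using cuts_forest_proper[OF forests(1) Node.prems(5), of _ "tags (Node v ts)" a] that
        by (metis in_set_conv_nth tags_simps(2))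
      then show ?thesis
        by auto
    qed
    have iff: "a < l \<longleftrightarrow> a < l'" if "0 \<le> a" for a
      using Node.prems(8)[OF that card(2)] root[of a] unfolding u v w ts[symmetric] by simp
    have "0 < l" "0 < l'"
      using Node.prems(1,2) by (auto simp: u v w)
    then have "l = l'"
      using iff[of l] iff[of l'] by linarith
    then show ?thesis
      using * ts by (simp add: u v w)
  qed
qed

text \<open>The root lengths \<open>l\<close> and \<open>l'\<close> may differ, as the full set of
  leaves is excepted in \<open>cuts\<close>; resetting them to the dummy length closes this gap in
  \<open>w0_class_wpoints\<close>.\<close>

proposition weq_common_form:
  assumes wf: "wf_wtree t" "wf_wtree u" and dist: "tag_distinct t" "tag_distinct u"
    and comp: "composite t = composite u"
    and cuts: "\<And>a S. 0 \<le> a \<Longrightarrow> 2 \<le> card S \<Longrightarrow> S \<noteq> tags t \<Longrightarrow> S \<in> cuts a t \<longleftrightarrow> S \<in> cuts a u"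
  shows "\<exists>c x l l' ns. weq t (Node (c, l, x) ns) \<and> weq u (Node (c, l', x) ns)"
proof -
  obtain c l x ts where t: "weq t (Node (c, l, x) ts)" "normal_forest ts"
    using weq_normal[OF wf(1) dist(1)] by blast
  obtain c' l' x' us where u: "weq u (Node (c', l', x') us)" "normal_forest us"
    using weq_normal[OF wf(2) dist(2)] by blast
  have wt: "wequiv t (Node (c, l, x) ts)" and wu: "wequiv u (Node (c', l', x') us)"
    using weq_wequiv t u wf by auto
  have tags: "tags (Node (c, l, x) ts) = tags t"
    using wt tags_mset unfolding wequiv_def by metis
  have dist': "tag_distinct (Node (c, l, x) ts)" "tag_distinct (Node (c', l', x') us)"
    using tag_distinct_weq t(1) u(1) wf dist by blast+
  have wf': "wf_wtree (Node (c, l, x) ts)" "wf_wtree (Node (c', l', x') us)"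
    using wt wu by (simp_all only: wequiv_def)
  have *: "c = c' \<and> x = x' \<and> length ts = length us \<and> (\<forall>k<length ts. composite (ts ! k) = composite (us ! k) \<and>
      (\<forall>a\<ge>0. \<forall>S. 2 \<le> card S \<longrightarrow> S \<in> cuts a (ts ! k) \<longleftrightarrow> S \<in> cuts a (us ! k)))"
  proof (rule forest_unique[OF wf' dist' t(2) u(2)])
    show "composite (Node (c, l, x) ts) = composite (Node (c', l', x') us)"
      using wt wu comp unfolding wequiv_def by metis
    fix a :: real and S :: "nat set"
    assume "0 \<le> a" "2 \<le> card S" "S \<noteq> tags (Node (c, l, x) ts)"
    then show "S \<in> cuts a (Node (c, l, x) ts) \<longleftrightarrow> S \<in> cuts a (Node (c', l', x') us)"
      using wt wu cuts[of a S] unfolding tags wequiv_def by metis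
  qed
  have "ts ! k = us ! k" if k: "k < length ts" for k
  proof (rule normal_unique)
    show "normal_tree (ts ! k)" "normal_tree (us ! k)"
      using t u k * by (auto simp: normal_forest_def)
    show "wf_wtree (ts ! k)" "wf_wtree (us ! k)"
      using wf' k * by auto
    show "tag_distinct (ts ! k)" "tag_distinct (us ! k)"
      using dist' k * tag_distinct_child nth_mem by metis+
  qed (use k * in auto)
  then have "ts = us"
    using * by (intro nth_equalityI) auto
  then show ?thesis
    using * t u by blast
qed

section \<open>Points of \<open>W\<O>\<close> and their classes\<close>

definition wpoints :: "nat \<Rightarrow> nat list \<Rightarrow> (nat, ltree) wtree set" where
  "wpoints c cs = {t. wf_wtree t \<and> dummy_root_length t \<and> rc t = c \<and> tag_distinct t \<and>
     set (leaves t) = {(cs ! j, j) | j. j < length cs}}"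

lemma vertex_pos_shape: "vertex_pos (shape t) = vertex_pos t"
proof (induction t)
  case (Node v ts)
  then show ?case
    by (simp cong: SUP_cong_simp)
qed simp

lemma tree_at_shape: "p \<in> vertex_pos t \<Longrightarrow> tree_at (shape t) p = shape (tree_at t p)"
proof (induction t arbitrary: p)
  case (Node v ts)
  then show ?case
    by (cases p) auto
qed simp

lemma tree_at_vertex: "p \<in> vertex_pos t \<Longrightarrow> \<exists>v ts. tree_at t p = Node v ts"
proof (induction t arbitrary: p)
  case (Node v ts)
  then show ?case
    by (cases p) auto
qed simp

lemma finite_vertex_pos: "finite (vertex_pos t)"
  by (induction t) auto

definition length_at :: "('c, 'x) wtree \<Rightarrow> nat list \<Rightarrow> real" where
  "length_at t p = fst (snd (vertex_label (tree_at t p)))"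

definition label_at :: "('c, 'x) wtree \<Rightarrow> nat list \<Rightarrow> 'x" where
  "label_at t p = snd (snd (vertex_label (tree_at t p)))"

definition ok_at :: "(nat, ltree) wtree \<Rightarrow> nat list \<Rightarrow> bool" where
  "ok_at t p \<longleftrightarrow> length_at t p \<in> {0..1} \<and>
     label_at t p \<in> ltrees (root_color (tree_at (shape t) p)) (input_colors (tree_at (shape t) p))"

lemma wf_wtree_iff: "wf_wtree t \<longleftrightarrow> (\<forall>p\<in>vertex_pos t. ok_at t p)"
proof (induction t)
  case (Node v ts)
  obtain c l x where v: "v = (c, l, x)"
    by (cases v)
  have cons: "ok_at (Node v ts) (i # p) \<longleftrightarrow> ok_at (ts ! i) p" if "i < length ts" for i p
    using that by (simp add: ok_at_def length_at_def label_at_def)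
  have root: "ok_at (Node v ts) [] \<longleftrightarrow> 0 \<le> l \<and> l \<le> 1 \<and> x \<in> ltrees c (map rc ts)"
    by (simp add: ok_at_def length_at_def label_at_def v comp_def)
  have pos: "vertex_pos (Node v ts) = insert [] (\<Union>i<length ts. Cons i ` vertex_pos (ts ! i))"
    by simp
  have "(\<forall>p\<in>vertex_pos (Node v ts). ok_at (Node v ts) p) \<longleftrightarrow>
      ok_at (Node v ts) [] \<and> (\<forall>i<length ts. \<forall>p\<in>vertex_pos (ts ! i). ok_at (Node v ts) (i # p))"
    unfolding pos by blast
  also have "\<dots> \<longleftrightarrow> ok_at (Node v ts) [] \<and> (\<forall>i<length ts. \<forall>p\<in>vertex_pos (ts ! i). ok_at (ts ! i) p)"
    using cons by blast
  also have "\<dots> \<longleftrightarrow> ok_at (Node v ts) [] \<and> (\<forall>t\<in>set ts. wf_wtree t)"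
    using Node unfolding all_set_conv_all_nth by (metis nth_mem)
  finally have *: "(\<forall>p\<in>vertex_pos (Node v ts). ok_at (Node v ts) p) \<longleftrightarrow>
      ok_at (Node v ts) [] \<and> (\<forall>t\<in>set ts. wf_wtree t)" .
  show ?case
    unfolding * root unfolding v wf_wtree.simps by blast
qed simp

lemma untangle_eq:
  "untangle t = (shape t, restrict (length_at t) (vertex_pos t - {[]}), restrict (label_at t) (vertex_pos t))"
  unfolding untangle_def length_at_def label_at_def by simp

text \<open>The decoration space has no length coordinate at the root, but the dummy length lies in
  the unit interval, so well-formedness holds there too.\<close>

lemma topspace_wspace: "topspace (wspace O_operad c cs) = wpoints c cs"
proof -
  have "t \<in> topspace (wspace O_operad c cs) \<longleftrightarrow> t \<in> wpoints c cs" for t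
  proof -
    have root: "length_at t [] = 1" if "dummy_root_length t" "[] \<in> vertex_pos t"
    proof (cases t)
      case (Node v ts)
      then show ?thesis
        using that by (cases v) (simp add: length_at_def)
    qed (use that in simp)
    have "t \<in> topspace (wspace O_operad c cs) \<longleftrightarrow> dummy_root_length t \<and> shape t \<in> wshapes c cs \<and>
        (\<forall>p\<in>vertex_pos t - {[]}. length_at t p \<in> {0..1}) \<and>
        (\<forall>p\<in>vertex_pos t. label_at t p \<in> ltrees (root_color (tree_at (shape t) p)) (input_colors (tree_at (shape t) p)))"
      by (simp add: wspace_def topspace_pullback_topology untangle_eq decoration_space_def vertex_pos_shape
        PiE_iff Pi_iff conj_ac)
    also have "\<dots> \<longleftrightarrow> dummy_root_length t \<and> shape t \<in> wshapes c cs \<and> wf_wtree t"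
      unfolding wf_wtree_iff ok_at_def using root by (cases "[] \<in> vertex_pos t") auto
    also have "\<dots> \<longleftrightarrow> t \<in> wpoints c cs"
      by (auto simp: wpoints_def wshapes_def shape_def leaves_map tag_distinct_def)
    finally show ?thesis .
  qed
  then show ?thesis
    by blast
qed

fun reset_root :: "('c, 'x) wtree \<Rightarrow> ('c, 'x) wtree" where
  "reset_root (Leaf a) = Leaf a"
| "reset_root (Node (c, l, x) ts) = Node (c, 1, x) ts"

lemma reset_root_dummy: "dummy_root_length t \<Longrightarrow> reset_root t = t"
  by (cases t rule: reset_root.cases) auto

lemma reset_root_merge: "wf_wtree t \<Longrightarrow> reset_root (merge_length l t) = merge_length 1 t"
  by (cases t rule: reset_root.cases) auto

text \<open>Lengths are at most \<open>1\<close>, so a maximum with the dummy length is the dummy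
  length again and each step survives the reset.\<close>

lemma reset_root_step: "w0_step O_operad t u \<Longrightarrow> wf_wtree t \<Longrightarrow> w0_step O_operad (reset_root t) (reset_root u)"
proof (induction rule: w0_step.induct)
  case (iso t u)
  then have "nonplanar_iso O_operad (reset_root t) (reset_root u)"
    by (cases rule: nonplanar_iso.cases) (auto intro: nonplanar_iso.intros simp del: O_simps)
  then show ?case
    by (rule w0_step.iso)
next
  case (delete_ident t c l)
  then show ?case
    using w0_step.delete_ident[of t c O_operad 1] by (simp add: reset_root_merge del: O_simps)
next
  case (delete_unary_up x c l l' y us)
  then show ?case
    using w0_step.delete_unary_up[of x O_operad c 1 l' y us] by (simp add: max_absorb1 del: O_simps)
next
  case (in_context t u v ts ws)
  then show ?case
    by (cases v) (auto intro: w0_step.in_context simp del: O_simps)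
qed (auto intro: w0_step.intros simp del: O_simps)

lemma reset_root_wpoints:
  assumes "wequiv t u" "reset_root t \<in> wpoints c cs"
  shows "reset_root u \<in> wpoints c cs"
proof -
  have "leaves (reset_root s) = leaves s" "dummy_root_length (reset_root s)" "rc (reset_root s) = rc s"
    "wf_wtree s \<Longrightarrow> wf_wtree (reset_root s)" for s :: "(nat, ltree) wtree"
    by (cases s rule: reset_root.cases; simp)+
  moreover have "set (leaves t) = set (leaves u)" "mset (map snd (leaves t)) = mset (map snd (leaves u))"
    using assms(1) by (auto simp: wequiv_def dest: mset_eq_setD)
  ultimately show ?thesis
    using assms mset_eq_imp_distinct_iff[of "map snd (leaves t)"]
    by (auto simp: wpoints_def wequiv_def tag_distinct_def)
qed

definition wrel :: "(nat, ltree) wtree \<Rightarrow> (nat, ltree) wtree \<Rightarrow> bool" where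
  "wrel t u \<longleftrightarrow> (\<exists>c cs. t \<in> wpoints c cs \<and> u \<in> wpoints c cs) \<and> w0_step O_operad t u"

lemma w0_class_eq: "w0_class O_operad t = {u. equivclp wrel t u}"
  unfolding w0_class_def wrel_def topspace_wspace by (rule refl)

text \<open>A chain of steps between arbitrary trees is turned into a chain of points of one profile
  by resetting the root length of each tree in it.\<close>

lemma weq_wrel:
  assumes "weq t u" "wf_wtree t" "reset_root t \<in> wpoints c cs"
  shows "equivclp wrel (reset_root t) (reset_root u)"
  using assms(1)
proof (induction rule: weq_induct)
  case (step y z)
  have "weq t z"
    using step weq_step weq_trans by blast
  then have "wequiv t y" "wequiv t z"
    using weq_wequiv step assms(2) by blast+
  then have "wrel (reset_root y) (reset_root z)"
    unfolding wrel_def using reset_root_wpoints[OF _ assms(3)] reset_root_step[OF step(3) step(2)] by blast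
  then show ?case
    using step(4) by (meson equivclp_trans r_into_equivclp)
next
  case (rev_step y z)
  have "weq t z"
    using rev_step weq_step weq_trans weq_sym by meson
  then have "wequiv t y" "wequiv t z"
    using weq_wequiv rev_step assms(2) by blast+
  then have "wrel (reset_root z) (reset_root y)"
    unfolding wrel_def using reset_root_wpoints[OF _ assms(3)] reset_root_step[OF rev_step(3) rev_step(2)] by blast
  then show ?case
    using rev_step(4) by (meson equivclp_trans equivclp_sym r_into_equivclp)
qed simp

text \<open>Compared with \<open>wequiv\<close> the full set of leaves is dropped as well; what
  remains is the information recorded by \<open>model_point\<close>.\<close>

definition same_invariants :: "(nat, ltree) wtree \<Rightarrow> (nat, ltree) wtree \<Rightarrow> bool" where
  "same_invariants t u \<longleftrightarrow> composite t = composite u \<and>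
     (\<forall>a\<ge>0. \<forall>S. large_proper (composite t) S \<longrightarrow> S \<in> cuts a t \<longleftrightarrow> S \<in> cuts a u)"

text \<open>The relation \<open>wrel\<close> mentions some profile for each step; uniqueness keeps a
  chain of steps inside one space.\<close>

lemma wpoints_profile:
  assumes "t \<in> wpoints c cs" "t \<in> wpoints c' cs'"
  shows "c = c' \<and> cs = cs'"
proof -
  have *: "{(cs ! j, j) | j. j < length cs} = {(cs' ! j, j) | j. j < length cs'}"
    using assms unfolding wpoints_def by auto
  then have "snd ` {(cs ! j, j) | j. j < length cs} = snd ` {(cs' ! j, j) | j. j < length cs'}"
    by (rule arg_cong)
  moreover have "snd ` {(ds ! j, j) | j. j < length ds} = {..<length ds}" for ds :: "nat list"
    by force
  ultimately have "length cs = length cs'"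
    by auto
  moreover have "cs ! j = cs' ! j" if "j < length cs" for j
  proof -
    have "(cs ! j, j) \<in> {(cs' ! j, j) | j. j < length cs'}"
      using that unfolding *[symmetric] by auto
    then show ?thesis
      by auto
  qed
  ultimately have "cs = cs'"
    by (intro nth_equalityI) auto
  then show ?thesis
    using assms by (auto simp: wpoints_def)
qed

text \<open>One inclusion is invariance under each step. For the other, the two trees have the same
  normal form up to the root length, which \<open>reset_root\<close> makes equal to
  \<open>1\<close>.\<close>

proposition w0_class_wpoints:
  assumes t: "t \<in> wpoints c cs"
  shows "w0_class O_operad t = {u \<in> wpoints c cs. same_invariants t u}"
proof -
  have wf_t: "wf_wtree t"
    using t by (simp add: wpoints_def)
  have 1: "u \<in> wpoints c cs \<and> wequiv t u" if "equivclp wrel t u" for u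
    using that
  proof (induction rule: equivclp_induct)
    case base
    then show ?case
      using t wf_t by (simp add: wequiv_refl)
  next
    case (step y z)
    have z: "z \<in> wpoints c cs"
      using step(2,3) wpoints_profile unfolding wrel_def by metis
    have "wequiv y z"
      using step(2)
    proof
      assume "wrel y z"
      then have "w0_step O_operad y z" "wf_wtree y"
        using step(3) by (simp_all add: wrel_def wpoints_def)
      then show ?thesis
        by (rule wequiv_step)
    next
      assume "wrel z y"
      then have "w0_step O_operad z y" "wf_wtree z"
        using z by (simp_all add: wrel_def wpoints_def)
      then show ?thesis
        by (intro wequiv_sym[OF wequiv_step])
    qed
    then show ?case
      using z step(3) wequiv_trans by blast
  qed
  have 2: "same_invariants t u" if "wequiv t u" for u
    using that by (auto simp: same_invariants_def wequiv_def large_proper_def)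
  have 3: "equivclp wrel t u" if u: "u \<in> wpoints c cs" and same: "same_invariants t u" for u
  proof -
    have wf_u: "wf_wtree u"
      using u by (simp add: wpoints_def)
    have "\<exists>c x l l' ns. weq t (Node (c, l, x) ns) \<and> weq u (Node (c, l', x) ns)"
      using same vset_composite[OF wf_t] t u
      by (intro weq_common_form) (auto simp: same_invariants_def large_proper_def wpoints_def)
    then obtain d x l l' ns where *: "weq t (Node (d, l, x) ns)" "weq u (Node (d, l', x) ns)"
      by blast
    have r: "reset_root t = t" "reset_root u = u"
      using t u by (auto simp: wpoints_def reset_root_dummy)
    have "equivclp wrel t (Node (d, 1, x) ns)"
      using weq_wrel[OF *(1) wf_t] t r by simp
    moreover have "equivclp wrel u (Node (d, 1, x) ns)"
      using weq_wrel[OF *(2) wf_u] u r by simp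
    ultimately show ?thesis
      by (meson equivclp_sym equivclp_trans)
  qed
  show ?thesis
    unfolding w0_class_eq
    by (rule Collect_cong, rule iffI) (use 1 2 in blast, elim conjE, rule 3)
qed

section \<open>Decomposing a tree along a partition into subtrees\<close>

definition conn :: "('v \<times> 'v) set \<Rightarrow> 'v set \<Rightarrow> bool" where
  "conn E S \<longleftrightarrow> (\<forall>v\<in>S. \<forall>w\<in>S. (v, w) \<in> ((E \<union> E\<inverse>) \<inter> S \<times> S)\<^sup>*)"

lemma subtree_conn: "subtree T S \<longleftrightarrow> S \<noteq> {} \<and> S \<subseteq> vset T \<and> conn (inner_edges T) S"
  by (simp add: subtree_def conn_def)

text \<open>No edge inside \<open>S\<close> joins \<open>C\<close> to its complement, so a path in
  \<open>S\<close> that starts at \<open>c\<close> cannot leave \<open>C\<close>.\<close>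

lemma conn_subset:
  assumes "conn E S" "c \<in> C" "c \<in> S"
    and "\<And>a b. (a, b) \<in> E \<Longrightarrow> a \<in> S \<Longrightarrow> b \<in> S \<Longrightarrow> a \<in> C \<longleftrightarrow> b \<in> C"
  shows "S \<subseteq> C"
proof
  fix w assume "w \<in> S"
  then have "(c, w) \<in> ((E \<union> E\<inverse>) \<inter> S \<times> S)\<^sup>*"
    using assms by (simp add: conn_def)
  then show "w \<in> C"
    by (induction rule: rtrancl_induct) (use assms in auto)
qed

lemma conn_mono:
  assumes "conn E S" "\<And>a b. (a, b) \<in> E \<Longrightarrow> a \<in> S \<Longrightarrow> b \<in> S \<Longrightarrow> (a, b) \<in> E'"
  shows "conn E' S"
proof -
  have "((E \<union> E\<inverse>) \<inter> S \<times> S)\<^sup>* \<subseteq> ((E' \<union> E'\<inverse>) \<inter> S \<times> S)\<^sup>*"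
    using assms(2) by (intro rtrancl_mono) auto
  then show ?thesis
    using assms(1) unfolding conn_def by blast
qed

lemma conn_singleton: "conn E {v}"
  by (simp add: conn_def)

text \<open>Used to see that an edge within one block never crosses a cut made by
  \<open>prune\<close>.\<close>

lemma inner_edges_plug:
  "inner_edges (plug f t) \<subseteq> inner_edges t \<union> (\<Union>l\<in>lset t. inner_edges (f l)) \<union>
     {(a, w). a \<in> vset t \<and> (\<exists>l\<in>lset t. \<exists>us. f l = Node w us)}"
proof (induction t)
  case (Node v ts)
  let ?R = "inner_edges (Node v ts) \<union> (\<Union>l\<in>lset (Node v ts). inner_edges (f l)) \<union>
     {(a, w). a \<in> vset (Node v ts) \<and> (\<exists>l\<in>lset (Node v ts). \<exists>us. f l = Node w us)}"
  have child: "(v, w) \<in> inner_edges (Node v ts) \<union> {(a, w). a \<in> vset (Node v ts) \<and> (\<exists>l\<in>lset (Node v ts). \<exists>us. f l = Node w us)}"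
    if *: "Node w us = plug f t" "t \<in> set ts" for w us t
  proof (cases t)
    case (Leaf l)
    then have "l \<in> lset (Node v ts)" "f l = Node w us"
      using * by (auto intro!: bexI[of _ t])
    then show ?thesis
      by auto
  next
    case (Node z zs)
    then have "Node w zs \<in> set ts"
      using * by simp
    then show ?thesis
      by auto
  qed
  have "{(v, w) | w us. Node w us \<in> plug f ` set ts} \<subseteq>
      inner_edges (Node v ts) \<union> {(a, w). a \<in> vset (Node v ts) \<and> (\<exists>l\<in>lset (Node v ts). \<exists>us. f l = Node w us)}"
  proof
    fix e assume "e \<in> {(v, w) | w us. Node w us \<in> plug f ` set ts}"
    then obtain w us t where e: "e = (v, w)" and *: "Node w us = plug f t" "t \<in> set ts"
      by blast
    show "e \<in> inner_edges (Node v ts) \<union> {(a, w). a \<in> vset (Node v ts) \<and> (\<exists>l\<in>lset (Node v ts). \<exists>us. f l = Node w us)}"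
      unfolding e by (rule child[OF *])
  qed
  then have 1: "{(v, w) | w us. Node w us \<in> plug f ` set ts} \<subseteq> ?R"
    by (rule order.trans) blast
  have 2: "inner_edges (plug f t) \<subseteq> ?R" if "t \<in> set ts" for t
  proof -
    have "inner_edges t \<subseteq> inner_edges (Node v ts)" "lset t \<subseteq> lset (Node v ts)" "vset t \<subseteq> vset (Node v ts)"
      using that by auto
    then show ?thesis
      by (intro order.trans[OF Node[OF that]] Un_mono UN_mono) blast+
  qed
  have "inner_edges (plug f (Node v ts)) =
      {(v, w) | w us. Node w us \<in> plug f ` set ts} \<union> (\<Union>t\<in>set ts. inner_edges (plug f t))"
    by simp
  then show ?case
    using 1 2 by (simp only: Un_least UN_least)
qed auto

lemma inner_edges_map_leaves: "inner_edges (map_ptree id f t) = inner_edges t"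
proof (induction t)
  case (Node v ts)
  have "{(v, w) | w us. Node w us \<in> map_ptree id f ` set ts} = {(v, w) | w us. Node w us \<in> set ts}"
  proof (intro equalityI subsetI)
    fix e assume "e \<in> {(v, w) | w us. Node w us \<in> map_ptree id f ` set ts}"
    then obtain w us t where *: "e = (v, w)" "Node w us = map_ptree id f t" "t \<in> set ts"
      by auto
    then show "e \<in> {(v, w) | w us. Node w us \<in> set ts}"
      by (cases t) auto
  next
    fix e assume "e \<in> {(v, w) | w us. Node w us \<in> set ts}"
    then obtain w us where "e = (v, w)" "Node w us \<in> set ts"
      by auto
    then show "e \<in> {(v, w) | w us. Node w us \<in> map_ptree id f ` set ts}"
      by (auto intro!: exI[of _ "map (map_ptree id f) us"] image_eqI[of _ _ "Node w us"])
  qed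
  then show ?case
    using Node by (simp add: id_def)
qed auto

text \<open>The numbers start at an arbitrary \<open>k\<close> so that the induction can run through
  a list of siblings; \<open>L\<close> recovers the decorations from the numbers.\<close>

lemma ex_numbering:
  "(\<And>i. i < length (leaves t) \<Longrightarrow> L (k + i) = leaves t ! i) \<Longrightarrow>
     \<exists>s. leaves s = [k..<k + length (leaves t)] \<and> map_ptree id L s = t"
proof (induction t arbitrary: k)
  case (Leaf a)
  then show ?case
    by (intro exI[of _ "Leaf k"]) auto
next
  case (Node v ts)
  have "\<exists>ss. concat (map leaves ss) = [k..<k + length (concat (map leaves ts))] \<and> map (map_ptree id L) ss = ts"
    using Node
  proof (induction ts arbitrary: k)
    case Nil
    then show ?case
      by (intro exI[of _ "[]"]) auto
  next
    case (Cons t ts)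
    have L: "L (k + i) = (leaves t @ concat (map leaves ts)) ! i"
      if "i < length (leaves t) + length (concat (map leaves ts))" for i
      using Cons.prems(2)[of i] that by simp
    have "\<exists>s. leaves s = [k..<k + length (leaves t)] \<and> map_ptree id L s = t"
      using L by (intro Cons.prems(1)) (auto simp: nth_append)
    then obtain s where s: "leaves s = [k..<k + length (leaves t)]" "map_ptree id L s = t"
      by blast
    have "\<exists>ss. concat (map leaves ss) = [k + length (leaves t)..<k + length (leaves t) + length (concat (map leaves ts))] \<and>
        map (map_ptree id L) ss = ts"
    proof (rule Cons.IH)
      fix i assume "i < length (leaves (Node v ts))"
      then show "L (k + length (leaves t) + i) = leaves (Node v ts) ! i"
        using L[of "length (leaves t) + i"] by (simp add: add.assoc)
    qed (rule Cons.prems(1), auto)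
    then obtain ss where ss: "concat (map leaves ss) = [k + length (leaves t)..<k + length (leaves t) + length (concat (map leaves ts))]"
      "map (map_ptree id L) ss = ts"
      by blast
    then show ?case
      using s upt_add_eq_append[of k "k + length (leaves t)" "length (concat (map leaves ts))"]
      by (intro exI[of _ "s # ss"]) (simp add: add.assoc id_def)
  qed
  then obtain ss where "concat (map leaves ss) = [k..<k + length (concat (map leaves ts))]" "map (map_ptree id L) ss = ts"
    by blast
  then show ?case
    by (intro exI[of _ "Node v ss"]) (simp add: id_def)
qed

lemma plug_prune: "plug (\<lambda>t. t) (prune S t) = t"
  by (induction t) (auto intro: map_idI)

lemma vset_prune: "vset (prune S t) \<subseteq> S"
  by (induction t) auto

lemma root_lset_prune: "Node w us \<in> lset (prune S t) \<Longrightarrow> w \<notin> S"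
  by (induction t) (auto split: if_splits)

lemma distinct_concat_nth:
  "distinct (concat xss) \<Longrightarrow> i < length xss \<Longrightarrow> j < length xss \<Longrightarrow> i \<noteq> j \<Longrightarrow>
     set (xss ! i) \<inter> set (xss ! j) = {}"
proof (induction xss arbitrary: i j)
  case (Cons xs xss)
  have 1: "set (xss ! k) \<subseteq> set (concat xss)" if "k < length xss" for k
    using nth_mem[OF that] by auto
  have 2: "set xs \<inter> set (concat xss) = {}" "distinct (concat xss)"
    using Cons.prems by auto
  show ?case
  proof (cases i)
    case 0
    then obtain j' where "j = Suc j'"
      using Cons.prems by (cases j) auto
    then show ?thesis
      using 0 1[of j'] 2 Cons.prems by auto
  next
    case (Suc i')
    show ?thesis
    proof (cases j)
      case 0
      then show ?thesis
        using Suc 1[of i'] 2 Cons.prems by auto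
    next
      case (Suc j')
      then show ?thesis
        using \<open>i = Suc i'\<close> 2 Cons.prems Cons.IH[of i' j'] by simp
    qed
  qed
qed simp

text \<open>The block \<open>S\<close> of the root is split off by \<open>prune\<close>:
  connectedness shows that the pruned tree has all of \<open>S\<close> as vertices and that every
  other block lies within one of the branches, where induction applies. The vertices of
  \<open>X\<close> are decorated by the pieces themselves. The clause about edges lets smaller
  connected sets stay connected inside their piece.\<close>

lemma block_decomposition:
  fixes T :: "('v, 'l) ptree"
  assumes "distinct (map fst (verts T))" "\<Union>\<P> = vset T" "disjoint \<P>"
    and "\<And>S. S \<in> \<P> \<Longrightarrow> S \<noteq> {} \<and> conn (inner_edges T) S"
  shows "\<exists>X :: (('v, nat) ptree, 'l) ptree. sub (\<lambda>A n. A) X = T \<and>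
     (\<forall>(A, n)\<in>set (verts X). leaves A = [0..<n] \<and> vset A \<in> \<P> \<and>
        (\<forall>a b. (a, b) \<in> inner_edges T \<longrightarrow> a \<in> vset A \<longrightarrow> b \<in> vset A \<longrightarrow> (a, b) \<in> inner_edges A))"
  using assms
proof (induction "length (verts T)" arbitrary: T \<P> rule: less_induct)
  case less
  show ?case
  proof (cases T)
    case (Leaf a)
    then show ?thesis
      by (intro exI[of _ "Leaf a"]) auto
  next
    case T: (Node v ts)
    then obtain S where S: "S \<in> \<P>" "v \<in> S"
      using less.prems(2) by auto
    define A0 where "A0 = prune S T"
    define Rs where "Rs = leaves A0"
    have A0: "A0 = Node v (map (prune S) ts)"
      using S T by (simp add: A0_def)
    have plugA0: "plug (\<lambda>t. t) A0 = T"
      by (simp add: A0_def plug_prune)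
    have "mset (verts T) = mset (verts A0 @ concat (map verts Rs))"
      using mset_verts_plug[of "\<lambda>t. t" A0] by (simp add: plugA0 Rs_def mset_concat comp_def)
    then have msetT: "mset (map fst (verts T)) = mset (map fst (verts A0 @ concat (map verts Rs)))"
      by (metis mset_map)
    then have dist: "distinct (map fst (verts A0 @ concat (map verts Rs)))"
      using less.prems(1) mset_eq_imp_distinct_iff by blast
    have vsetT: "vset T = vset A0 \<union> (\<Union>R\<in>set Rs. vset R)"
      using vset_plug[of "\<lambda>t. t" A0] by (simp add: plugA0 Rs_def set_leaves)
    have F1: "vset R \<inter> vset A0 = {}" if "R \<in> set Rs" for R
    proof -
      have "fst ` set (verts A0) \<inter> fst ` (\<Union>R\<in>set Rs. set (verts R)) = {}"
        using dist by auto
      then show ?thesis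
        unfolding fst_set_verts[symmetric] using that by blast
    qed
    have F2: "R = R'" if RR: "R \<in> set Rs" "R' \<in> set Rs" "w \<in> vset R" "w \<in> vset R'" for R R' w
    proof (rule ccontr)
      assume "R \<noteq> R'"
      obtain i j where ij: "i < length Rs" "R = Rs ! i" "j < length Rs" "R' = Rs ! j"
        using RR(1,2) unfolding in_set_conv_nth by blast
      have "distinct (concat (map (\<lambda>R. map fst (verts R)) Rs))"
        using dist by (simp add: map_concat comp_def)
      moreover have "i \<noteq> j"
        using ij \<open>R \<noteq> R'\<close> by auto
      ultimately have "set (map fst (verts R)) \<inter> set (map fst (verts R')) = {}"
        using ij distinct_concat_nth[of "map (\<lambda>R. map fst (verts R)) Rs" i j] by simp
      then show False
        using RR(3,4) by (auto simp: fst_set_verts)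
    qed
    have F3: "w \<notin> S" if "Node w us \<in> set Rs" for w us
      using that root_lset_prune unfolding Rs_def A0_def set_leaves by metis
    have edges: "(a, b) \<in> inner_edges A0 \<or> (\<exists>R\<in>set Rs. (a, b) \<in> inner_edges R) \<or>
        (a \<in> vset A0 \<and> (\<exists>us. Node b us \<in> set Rs))" if "(a, b) \<in> inner_edges T" for a b
      using inner_edges_plug[of "\<lambda>t. t" A0] that unfolding plugA0 Rs_def set_leaves by fastforce
    have A0_S: "vset A0 \<subseteq> S"
      by (simp add: A0_def vset_prune)
    \<comment> \<open>The only further edges lead from the pruned tree, hence from \<open>S\<close>,
      to a vertex outside \<open>S\<close>; they cannot stay within a block.\<close>
    have inside: "(a, b) \<in> inner_edges A0 \<or> (\<exists>R\<in>set Rs. (a, b) \<in> inner_edges R)"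
      if e: "(a, b) \<in> inner_edges T" "S' \<in> \<P>" "a \<in> S'" "b \<in> S'" for a b S'
    proof (rule ccontr)
      assume "\<not> ?thesis"
      then obtain us where *: "a \<in> vset A0" "Node b us \<in> set Rs"
        using edges[OF e(1)] by blast
      then have "S' = S"
        using e less.prems(3) S A0_S by (auto simp: disjoint_def)
      then show False
        using F3 * e by blast
    qed
    have SA0: "vset A0 = S"
    proof
      show "S \<subseteq> vset A0"
      proof (rule conn_subset[of "inner_edges T" S v])
        fix a b assume "(a, b) \<in> inner_edges T" "a \<in> S" "b \<in> S"
        then consider "(a, b) \<in> inner_edges A0" | R where "R \<in> set Rs" "(a, b) \<in> inner_edges R"
          using inside S by blast
        then show "a \<in> vset A0 \<longleftrightarrow> b \<in> vset A0"
        proof cases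
          case 1
          then show ?thesis
            using inner_edges_vset by blast
        next
          case (2 R)
          then show ?thesis
            using F1[of R] inner_edges_vset[of R] by blast
        qed
      qed (use less.prems(4) S A0 in auto)
    qed (rule A0_S)
    have sub: "S' \<subseteq> vset R" if RS: "R \<in> set Rs" "S' \<in> \<P>" "S' \<inter> vset R \<noteq> {}" for R S'
    proof -
      obtain c where c: "c \<in> S'" "c \<in> vset R"
        using RS(3) by blast
      show ?thesis
      proof (rule conn_subset[of "inner_edges T" S' c])
        fix a b assume "(a, b) \<in> inner_edges T" "a \<in> S'" "b \<in> S'"
        then consider "(a, b) \<in> inner_edges A0" | R' where "R' \<in> set Rs" "(a, b) \<in> inner_edges R'"
          using inside RS(2) by blast
        then show "a \<in> vset R \<longleftrightarrow> b \<in> vset R"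
        proof cases
          case 1
          then show ?thesis
            using inner_edges_vset[of A0] F1[OF RS(1)] by blast
        next
          case (2 R')
          then show ?thesis
            using inner_edges_vset[of R'] F2[OF RS(1), of R'] by blast
        qed
      qed (use less.prems(4) RS c in auto)
    qed
    have restrict: "(a, b) \<in> inner_edges R"
      if RS: "R \<in> set Rs" "S' \<in> \<P>" "S' \<subseteq> vset R" "(a, b) \<in> inner_edges T" "a \<in> S'" "b \<in> S'" for R S' a b
    proof -
      consider "(a, b) \<in> inner_edges A0" | R' where "R' \<in> set Rs" "(a, b) \<in> inner_edges R'"
        using inside[OF RS(4,2,5,6)] by blast
      then show ?thesis
      proof cases
        case 1
        then have "a \<in> vset A0"
          using inner_edges_vset by blast
        then show ?thesis
          using F1[OF RS(1)] RS(3,5) by blast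
      next
        case (2 R')
        then have "a \<in> vset R'"
          using inner_edges_vset by blast
        then have "R = R'"
          using RS(3,5) by (intro F2[OF RS(1) 2(1), of a]) auto
        then show ?thesis
          using 2 by simp
      qed
    qed
    define \<P>R where "\<P>R R = {S' \<in> \<P>. S' \<inter> vset R \<noteq> {}}" for R :: "('v, 'l) ptree"
    have "\<exists>X :: (('v, nat) ptree, 'l) ptree. sub (\<lambda>A n. A) X = R \<and>
     (\<forall>(A, n)\<in>set (verts X). leaves A = [0..<n] \<and> vset A \<in> \<P>R R \<and>
        (\<forall>a b. (a, b) \<in> inner_edges R \<longrightarrow> a \<in> vset A \<longrightarrow> b \<in> vset A \<longrightarrow> (a, b) \<in> inner_edges A))"
      if R: "R \<in> set Rs" for R
    proof (rule less.hyps)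
      have "length (verts T) = length (verts A0) + length (concat (map verts Rs))"
        using arg_cong[OF msetT, of size] unfolding size_mset by simp
      moreover have "length (verts R) \<le> length (concat (map verts Rs))"
        using R by (simp add: length_concat comp_def member_le_sum_list)
      ultimately show "length (verts R) < length (verts T)"
        using A0 by simp
      show "distinct (map fst (verts R))"
        using dist R by (auto simp: map_concat distinct_concat_iff)
      show "\<Union>(\<P>R R) = vset R"
      proof
        show "vset R \<subseteq> \<Union>(\<P>R R)"
        proof
          fix w assume w: "w \<in> vset R"
          then have "w \<in> \<Union>\<P>"
            using R less.prems(2) vsetT by blast
          then show "w \<in> \<Union>(\<P>R R)"
            using w by (auto simp: \<P>R_def)
        qed
      qed (use sub[OF R] in \<open>auto simp: \<P>R_def\<close>)
      show "disjoint (\<P>R R)"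
        using less.prems(3) by (auto simp: disjoint_def \<P>R_def)
      fix S' assume "S' \<in> \<P>R R"
      then have S': "S' \<in> \<P>" "S' \<inter> vset R \<noteq> {}"
        by (auto simp: \<P>R_def)
      then have "conn (inner_edges R) S'"
        using less.prems(4)[OF S'(1)] restrict[OF R S'(1) sub[OF R S']] by (blast intro: conn_mono)
      then show "S' \<noteq> {} \<and> conn (inner_edges R) S'"
        using S' by auto
    qed
    then have "\<exists>X. \<forall>R\<in>set Rs. sub (\<lambda>A n. A) (X R) = R \<and>
     (\<forall>(A, n)\<in>set (verts (X R)). leaves A = [0..<n] \<and> vset A \<in> \<P>R R \<and>
        (\<forall>a b. (a, b) \<in> inner_edges R \<longrightarrow> a \<in> vset A \<longrightarrow> b \<in> vset A \<longrightarrow> (a, b) \<in> inner_edges A))"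
      by (intro bchoice ballI)
    then obtain X where X: "\<And>R. R \<in> set Rs \<Longrightarrow> sub (\<lambda>A n. A) (X R) = R \<and>
     (\<forall>(A, n)\<in>set (verts (X R)). leaves A = [0..<n] \<and> vset A \<in> \<P>R R \<and>
        (\<forall>a b. (a, b) \<in> inner_edges R \<longrightarrow> a \<in> vset A \<longrightarrow> b \<in> vset A \<longrightarrow> (a, b) \<in> inner_edges A))"
      by blast
    \<comment> \<open>The branches decorate the leaves of \<open>A0\<close>; replacing them by their
      numbers in planar order turns \<open>A0\<close> into a label \<open>A\<close>.\<close>
    obtain A where A: "leaves A = [0..<length Rs]" "map_ptree id (\<lambda>a. Rs ! a) A = A0"
      using ex_numbering[of A0 "\<lambda>a. Rs ! a" 0] unfolding Rs_def by auto
    have vA: "vset A = S"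
      using SA0 A(2)[symmetric] by (simp add: ptree.set_map)
    have eA: "inner_edges A = inner_edges A0"
      using A(2)[symmetric] by (simp add: inner_edges_map_leaves)
    have "sub (\<lambda>A n. A) (Node A (map X Rs)) = plug (\<lambda>a. map (sub (\<lambda>A n. A)) (map X Rs) ! a) A"
      by simp
    also have "\<dots> = plug (\<lambda>a. Rs ! a) A"
      using X A(1) by (intro plug_cong) (auto simp flip: set_leaves)
    also have "\<dots> = plug (\<lambda>t. t) (map_ptree id (\<lambda>a. Rs ! a) A)"
      by (simp add: plug_map)
    finally have "sub (\<lambda>A n. A) (Node A (map X Rs)) = T"
      using A plugA0 by simp
    moreover have "leaves A' = [0..<n] \<and> vset A' \<in> \<P> \<and>
        (\<forall>a b. (a, b) \<in> inner_edges T \<longrightarrow> a \<in> vset A' \<longrightarrow> b \<in> vset A' \<longrightarrow> (a, b) \<in> inner_edges A')"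
      if An: "(A', n) \<in> set (verts (Node A (map X Rs)))" for A' n
    proof (cases "A' = A \<and> n = length Rs")
      case True
      have "(a, b) \<in> inner_edges A" if ab: "(a, b) \<in> inner_edges T" "a \<in> S" "b \<in> S" for a b
      proof -
        consider "(a, b) \<in> inner_edges A0" | R where "R \<in> set Rs" "(a, b) \<in> inner_edges R"
          using inside[OF ab(1) S(1)] ab by blast
        then show ?thesis
        proof cases
          case (2 R)
          then show ?thesis
            using F1[of R] inner_edges_vset[of R] ab SA0 by blast
        qed (simp add: eA)
      qed
      then show ?thesis
        using True A vA S by simp
    next
      case False
      then obtain R where R: "R \<in> set Rs" "(A', n) \<in> set (verts (X R))"
        using An by auto
      then have *: "leaves A' = [0..<n]" "vset A' \<in> \<P>R R"
        "\<And>a b. (a, b) \<in> inner_edges R \<Longrightarrow> a \<in> vset A' \<Longrightarrow> b \<in> vset A' \<Longrightarrow> (a, b) \<in> inner_edges A'"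
        using X[OF R(1)] by blast+
      then have A': "vset A' \<in> \<P>" "vset A' \<inter> vset R \<noteq> {}"
        by (auto simp: \<P>R_def)
      then show ?thesis
        using * restrict[OF R(1) A'(1) sub[OF R(1) A']] by blast
    qed
    ultimately show ?thesis
      by (intro exI[of _ "Node A (map X Rs)"]) blast
  qed
qed

section \<open>Trees with prescribed invariants\<close>

text \<open>All sets cut off by edges, whatever their lengths: the sets whose weights can be
  prescribed on \<open>t\<close>.\<close>

fun blocks :: "('v, 'c \<times> nat) ptree \<Rightarrow> nat set set" where
  "blocks (Leaf a) = {}"
| "blocks (Node v ts) = insert (tags (Node v ts)) (\<Union> (set (map blocks ts)))"

lemma single_vertex_tree:
  assumes "vset t = {v}" "distinct (map fst (verts t))" "leaves t = [0..<n]"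
  shows "t = single v n"
proof (cases t)
  case (Node w ts)
  have "\<exists>a. u = Leaf a" if "u \<in> set ts" for u
  proof (cases u)
    case (Node z us)
    then have "z \<in> vset u"
      by simp
    moreover have "vset u \<subseteq> vset t"
      unfolding \<open>t = Node w ts\<close> using that by auto
    moreover have "w \<in> vset t"
      unfolding \<open>t = Node w ts\<close> by simp
    ultimately have "z \<in> vset u" "vset u \<subseteq> vset t" "w \<in> vset t"
      by blast+
    then have "w \<in> vset u"
      using assms(1) by auto
    then have "w \<in> fst ` set (concat (map verts ts))"
      using that by (force simp: fst_set_verts[symmetric])
    then show ?thesis
      using assms(2) \<open>t = Node w ts\<close> by auto
  qed auto
  then have "ts = map Leaf (concat (map leaves ts))"
    by (induction ts) force+
  then show ?thesis
    using assms Node by (simp add: single_def)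
qed (use assms in simp)

text \<open>The maximal elements of \<open>B\<close> and the remaining vertices as singletons form a
  partition into connected sets. Decomposing \<open>T\<close> along it gives the root label; the
  child for a maximal element is built by induction from the elements of \<open>B\<close> inside it,
  and a singleton becomes a leaf.\<close>

lemma ex_wtree:
  assumes "numbered m T" "distinct (map fst (verts T))"
    and "\<And>S. S \<in> B \<Longrightarrow> subtree T S \<and> large_proper T S"
    and "\<And>S S'. S \<in> B \<Longrightarrow> S' \<in> B \<Longrightarrow> S \<inter> S' = S \<or> S \<inter> S' = S' \<or> S \<inter> S' = {}"
  shows "\<exists>t. wf_wtree t \<and> rc t = m \<and> dummy_root_length t \<and> composite t = T \<and> B \<subseteq> blocks t"
  using assms
proof (induction "card (vset T)" arbitrary: m T B rule: less_induct)
  case less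
  have fin: "finite (vset T)"
    by (simp flip: fst_set_verts)
  have "B \<subseteq> Pow (vset T)"
    using less.prems(3) by (auto simp: subtree_def)
  then have finB: "finite B"
    by (rule finite_subset) (simp add: fin)
  define M where "M = {S \<in> B. \<forall>S'\<in>B. S \<subseteq> S' \<longrightarrow> S = S'}"
  define \<P> where "\<P> = M \<union> {{v} | v. v \<in> vset T \<and> (\<forall>S\<in>B. v \<notin> S)}"
  have subT: "S \<noteq> {}" "S \<subseteq> vset T" "conn (inner_edges T) S" "2 \<le> card S" "S \<noteq> vset T" if "S \<in> B" for S
    using less.prems(3)[OF that] unfolding subtree_conn large_proper_def by blast+
  have M_above: "\<exists>S'\<in>M. S \<subseteq> S'" if "S \<in> B" for S
    using finite_has_maximal2[OF finB that] by (auto simp: M_def)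
  have cover: "\<Union>\<P> = vset T"
    proof (intro equalityI subsetI)
      fix v assume v: "v \<in> vset T"
      show "v \<in> \<Union>\<P>"
      proof (cases "\<exists>S\<in>B. v \<in> S")
        case True
        then obtain S where S: "S \<in> B" "v \<in> S"
          by (elim bexE)
        from M_above[OF S(1)] obtain S' where "S' \<in> M" "S \<subseteq> S'"
          by (elim bexE)
        then show ?thesis
          using S(2) unfolding \<P>_def by (intro UnionI[of S']) auto
      next
        case False
        then have "{v} \<in> \<P>"
          using v by (auto simp: \<P>_def)
        then show ?thesis
          by blast
      qed
    next
      fix v assume "v \<in> \<Union>\<P>"
      then obtain S where S: "S \<in> \<P>" "v \<in> S"
        by (elim UnionE)
      show "v \<in> vset T"
      proof (cases "S \<in> M")
        case True
        then have "S \<in> B"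
          by (simp add: M_def)
        then show ?thesis
          by (rule subsetD[OF subT(2) S(2)])
      next
        case False
        then show ?thesis
          using S by (auto simp: \<P>_def)
      qed
    qed
  have disj: "disjoint \<P>"
      unfolding disjoint_def
    proof (intro ballI impI)
      fix S S' assume *: "S \<in> \<P>" "S' \<in> \<P>" "S \<noteq> S'"
      have mm: "S \<inter> S' = {}" if "S \<in> M" "S' \<in> M"
      proof -
        have SS: "S \<in> B" "S' \<in> B" "\<not> S \<subseteq> S'" "\<not> S' \<subseteq> S"
          using that *(3) by (auto simp: M_def)
        have "S \<inter> S' \<noteq> S" "S \<inter> S' \<noteq> S'"
          using SS(3,4) by auto
        then show ?thesis
          using less.prems(4)[OF SS(1,2)] by blast
      qed
      have ms: "S \<inter> S' = {}" if "S \<in> M" "S' = {v}" "\<forall>S\<in>B. v \<notin> S" for S S' v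
        using that by (simp add: M_def)
      from *(1) consider "S \<in> M" | v where "S = {v}" "\<forall>S\<in>B. v \<notin> S"
        unfolding \<P>_def by (elim UnE CollectE exE conjE) simp_all
      then show "S \<inter> S' = {}"
      proof cases
        case S: 1
        from *(2) consider "S' \<in> M" | v where "S' = {v}" "\<forall>S\<in>B. v \<notin> S"
          unfolding \<P>_def by (elim UnE CollectE exE conjE) simp_all
        then show ?thesis
          using mm[OF S] ms[OF S] by cases simp_all
      next
        case S: (2 v)
        from *(2) consider "S' \<in> M" | w where "S' = {w}"
          unfolding \<P>_def by (elim UnE CollectE exE conjE) simp_all
        then show ?thesis
          using ms[OF _ S] S(1) *(3) by cases (simp_all add: Int_commute)
      qed
    qed
  have blk: "S \<noteq> {} \<and> conn (inner_edges T) S" if "S \<in> \<P>" for S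
  proof (cases "S \<in> M")
    case True
    then have "S \<in> B"
      by (simp add: M_def)
    then show ?thesis
      using subT(1,3) by simp
  next
    case False
    then show ?thesis
      using that conn_singleton by (auto simp: \<P>_def)
  qed
  from block_decomposition[OF less.prems(2) cover disj blk]
  obtain X :: "(ltree, nat) ptree" where X: "sub (\<lambda>A n. A) X = T"
    "\<And>A n. (A, n) \<in> set (verts X) \<Longrightarrow> leaves A = [0..<n] \<and> vset A \<in> \<P>"
    "\<And>A n a b. (A, n) \<in> set (verts X) \<Longrightarrow> (a, b) \<in> inner_edges T \<Longrightarrow> a \<in> vset A \<Longrightarrow> b \<in> vset A \<Longrightarrow> (a, b) \<in> inner_edges A"
    by blast
  have num: "numbered n A" if "(A, n) \<in> set (verts X)" for A n
    using X(2)[OF that] by (simp add: numbered_def)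
  define As where "As = map fst (verts X)"
  define ns where "ns = map snd (verts X)"
  have lenAs: "length As = length (verts X)" "length ns = length (verts X)"
    by (simp_all add: As_def ns_def)
  have nthX: "verts X ! k = (As ! k, ns ! k)" "(As ! k, ns ! k) \<in> set (verts X)" if "k < length (verts X)" for k
  proof -
    show "verts X ! k = (As ! k, ns ! k)"
      using that by (simp add: As_def ns_def)
    then show "(As ! k, ns ! k) \<in> set (verts X)"
      using that nth_mem by metis
  qed
  have "mset (verts T) = (\<Sum>(A, n)\<leftarrow>verts X. mset (verts A))"
    using mset_verts_sub[of X "\<lambda>A n. A"] num X(1) by auto
  also have "\<dots> = mset (concat (map verts As))"
    by (simp add: As_def mset_concat comp_def case_prod_unfold)
  finally have msetT: "mset (verts T) = mset (concat (map verts As))" .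
  then have "mset (map fst (verts T)) = mset (map fst (concat (map verts As)))"
    by (simp only: mset_map)
  then have "mset (map fst (verts T)) = mset (concat (map (\<lambda>A. map fst (verts A)) As))"
    by (simp only: map_concat map_map comp_def)
  then have dist: "distinct (concat (map (\<lambda>A. map fst (verts A)) As))"
    using less.prems(2) mset_eq_imp_distinct_iff by blast
  have ne: "vset A \<noteq> {}" if "(A, n) \<in> set (verts X)" for A n
    using X(2)[OF that] blk by blast
  have distAs: "distinct As"
  proof -
    have "distinct (removeAll [] (map (\<lambda>A. map fst (verts A)) As))"
      using dist by (simp add: distinct_concat_iff)
    moreover have "[] \<notin> set (map (\<lambda>A. map fst (verts A)) As)"
      using ne by (force simp: As_def fst_set_verts[symmetric])
    ultimately have "distinct (map (\<lambda>A. map fst (verts A)) As)"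
      by simp
    then show ?thesis
      by (simp add: distinct_map)
  qed
  \<comment> \<open>Labels of \<open>O_operad\<close> need numbers as vertices. The pieces are
    pairwise different because they are nonempty and disjoint, so their positions in
    \<open>As\<close> serve as names.\<close>
  define idx where "idx A = (THE k. k < length As \<and> As ! k = A)" for A
  have idx: "idx (As ! k) = k" if "k < length As" for k
    unfolding idx_def using that distAs by (auto simp: nth_eq_iff_index_eq intro!: the_equality)
  define x where "x = map_ptree idx id X"
  have "verts x = map (\<lambda>i. (i, ns ! i)) [0..<length ns]"
    unfolding x_def verts_map using nthX idx lenAs
    by (intro nth_equalityI) auto
  moreover have "numbered m x"
    using mset_leaves_sub[of X "\<lambda>A n. A"] num X(1) less.prems(1) by (auto simp: numbered_def x_def leaves_map)
  ultimately have x: "x \<in> ltrees m ns"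
    by (simp add: ltrees_iff)
  have T: "T = sub (\<lambda>k n. As ! k) x"
  proof -
    have "sub (\<lambda>k n. As ! k) x = sub (\<lambda>A n. As ! idx A) X"
      by (simp add: x_def sub_map)
    also have "\<dots> = sub (\<lambda>A n. A) X"
    proof (rule sub_cong)
      fix A n assume "(A, n) \<in> set (verts X)"
      then obtain k where "k < length As" "A = As ! k"
        using lenAs nthX(1) unfolding in_set_conv_nth by auto
      then show "As ! idx A = A"
        using idx by simp
    qed
    finally show ?thesis
      using X(1) by simp
  qed
  have "\<exists>t. wf_wtree t \<and> rc t = n \<and> composite t = A \<and>
      {S \<in> B. S \<subseteq> vset A} \<subseteq> blocks t" if An: "(A, n) \<in> set (verts X)" for A n
  proof -
    have distA: "distinct (map fst (verts A))"
      using An dist by (force simp: distinct_concat_iff As_def)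
    show ?thesis
    proof (cases "vset A \<in> B")
      case True
      define B' where "B' = {S \<in> B. S \<subset> vset A}"
      have VA: "vset A \<subset> vset T" "2 \<le> card (vset A)"
        using subT[OF True] by blast+
      have "\<exists>t. wf_wtree t \<and> rc t = n \<and> dummy_root_length t \<and> composite t = A \<and> B' \<subseteq> blocks t"
      proof (rule less.hyps)
        show "card (vset A) < card (vset T)"
          using VA(1) fin by (rule psubset_card_mono[rotated])
        show "numbered n A"
          by (rule num[OF An])
        show "distinct (map fst (verts A))"
          by (rule distA)
        show "subtree A S \<and> large_proper A S" if "S \<in> B'" for S
        proof -
          have S: "S \<in> B" "S \<subseteq> vset A" "S \<noteq> vset A"
            using that by (auto simp: B'_def)
          have "conn (inner_edges A) S"
            using X(3)[OF An] S(2) by (intro conn_mono[OF subT(3)[OF S(1)]]) blast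
          then show ?thesis
            using subT[OF S(1)] S unfolding subtree_conn large_proper_def by blast
        qed
      qed (use less.prems(4) in \<open>auto simp: B'_def\<close>)
      then obtain t where t: "wf_wtree t" "rc t = n" "composite t = A" "B' \<subseteq> blocks t"
        by blast
      \<comment> \<open>The block itself is not in \<open>B'\<close>, but it is cut off by the
        outgoing edge of \<open>t\<close>, which is not a leaf as the block has at least two
        elements.\<close>
      have "tags t = vset A"
        using vset_composite[OF t(1)] t(3) by simp
      then have "vset A \<in> blocks t"
        using VA(2) by (cases t) (auto dest: sym)
      then have "{S \<in> B. S \<subseteq> vset A} \<subseteq> blocks t"
        using t(4) by (auto simp: B'_def)
      then show ?thesis
        using t by blast
    next
      case False
      then obtain v where v: "vset A = {v}" "\<forall>S\<in>B. v \<notin> S"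
        using X(2)[OF An] unfolding \<P>_def M_def by blast
      have "A = single v n"
        using single_vertex_tree[OF v(1) distA] X(2)[OF An] by blast
      moreover have "{S \<in> B. S \<subseteq> vset A} = {}"
      proof -
        have False if S: "S \<in> B" "S \<subseteq> vset A" for S
        proof -
          have "S = {v}"
            using subT(1)[OF S(1)] S(2) v(1) by auto
          then show False
            using v(2) S(1) by auto
        qed
        then show ?thesis
          by (intro equals0I) (elim CollectE conjE)
      qed
      ultimately show ?thesis
        by (intro exI[of _ "Leaf (n, v)"]) auto
    qed
  qed
  then have "\<forall>p\<in>set (verts X). \<exists>t. wf_wtree t \<and> rc t = snd p \<and> composite t = fst p \<and>
      {S \<in> B. S \<subseteq> vset (fst p)} \<subseteq> blocks t"
    by (intro ballI) (metis prod.collapse)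
  from bchoice[OF this] obtain f where f: "\<And>p. p \<in> set (verts X) \<Longrightarrow> wf_wtree (f p) \<and>
      rc (f p) = snd p \<and> composite (f p) = fst p \<and> {S \<in> B. S \<subseteq> vset (fst p)} \<subseteq> blocks (f p)"
    by blast
  define ts where "ts = map f (verts X)"
  have rc_ts: "map rc ts = ns"
    unfolding ts_def ns_def map_map by (rule map_cong) (simp_all add: f)
  have comp_ts: "map composite ts = As"
    unfolding ts_def As_def map_map by (rule map_cong) (simp_all add: f)
  have wf_ts: "\<forall>t\<in>set ts. wf_wtree t"
    by (simp add: ts_def f)
  have "B \<subseteq> blocks (Node (m, 1, x) ts)"
  proof
    fix S assume S: "S \<in> B"
    then obtain S' where S': "S' \<in> M" "S \<subseteq> S'"
      using M_above by blast
    obtain v where v: "v \<in> S"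
      using subT(1)[OF S] by blast
    then have "v \<in> vset T"
      using subT(2)[OF S] by blast
    then have "v \<in> fst ` set (concat (map verts As))"
      using mset_eq_setD[OF msetT] by (metis fst_set_verts)
    then obtain A n where An: "(A, n) \<in> set (verts X)" "v \<in> vset A"
      by (force simp: As_def fst_set_verts[symmetric])
    have "vset A \<in> \<P>"
      using X(2)[OF An(1)] by blast
    then have "vset A \<in> M"
      using An(2) v S unfolding \<P>_def by (elim UnE CollectE exE conjE) (simp, metis singletonD)
    then have "S \<subseteq> vset A"
    proof -
      have AB: "vset A \<in> B" "vset A \<subseteq> S \<Longrightarrow> vset A = S"
        using \<open>vset A \<in> M\<close> S by (simp_all add: M_def)
      have "S \<inter> vset A \<noteq> {}"
        using An(2) v by blast
      then have "S \<inter> vset A = S \<or> S \<inter> vset A = vset A"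
        using less.prems(4)[OF S AB(1)] by simp
      then show ?thesis
        using AB(2) by auto
    qed
    then have "S \<in> {S \<in> B. S \<subseteq> vset (fst (A, n))}"
      using S by simp
    then have "S \<in> blocks (f (A, n))"
      using f[OF An(1)] by blast
    moreover have "f (A, n) \<in> set ts"
      using An(1) by (simp add: ts_def)
    ultimately show "S \<in> blocks (Node (m, 1, x) ts)"
      by auto
  qed
  then show ?case
    using x T rc_ts comp_ts wf_ts
    by (intro exI[of _ "Node (m, 1, x) ts"]) simp
qed

fun relength :: "(nat set \<Rightarrow> real) \<Rightarrow> ('c, 'x) wtree \<Rightarrow> ('c, 'x) wtree" where
  "relength w (Leaf a) = Leaf a"
| "relength w (Node (c, l, x) ts) = Node (c, w (tags (Node (c, l, x) ts)), x) (map (relength w) ts)"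

lemma leaves_relength: "leaves (relength w t) = leaves t"
  by (induction w t rule: relength.induct) (auto intro!: arg_cong[where f=concat])

lemma shape_relength: "shape (relength w t) = shape t"
  by (induction w t rule: relength.induct) auto

lemma tags_relength: "tags (relength w t) = tags t"
  by (simp add: tags_leaves leaves_relength)

lemma composite_relength: "composite (relength w t) = composite t"
proof (induction w t rule: relength.induct)
  case (2 w c l x ts)
  then have "map composite (map (relength w) ts) = map composite ts"
    by auto
  then show ?case
    by (simp only: relength.simps composite.simps)
qed (auto split: prod.splits)

lemma wf_relength: "wf_wtree t \<Longrightarrow> (\<And>S. 0 \<le> w S \<and> w S \<le> 1) \<Longrightarrow> wf_wtree (relength w t)"
  by (induction w t rule: relength.induct) (auto simp: shape_relength comp_def)

lemma cuts_relength: "cuts a (relength w t) = {S \<in> blocks t. a < w S}"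
proof (induction w t rule: relength.induct)
  case (2 w c l x ts)
  then have "\<Union> (cuts a ` relength w ` set ts) = {S \<in> \<Union> (blocks ` set ts). a < w S}"
    by auto
  then show ?case
    by (auto simp: tags_relength)
qed simp

section \<open>The bracketing of a decorated tree\<close>

lemma inner_edges_child: "t \<in> set ts \<Longrightarrow> inner_edges t \<subseteq> inner_edges (Node v ts)"
  by auto

lemma tree_root_connected:
  "w \<in> vset (Node v ts) \<Longrightarrow> (v, w) \<in> (inner_edges (Node v ts))\<^sup>*"
proof (induction "Node v ts" arbitrary: v ts w)
  case (Node v ts)
  show ?case
  proof (cases "w = v")
    case False
    then obtain t where t: "t \<in> set ts" "w \<in> vset t"
      using Node.prems by auto
    obtain u us where u: "t = Node u us"
      using t(2) by (cases t) auto
    have "(u, w) \<in> (inner_edges (Node u us))\<^sup>*"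
      using Node.hyps(1)[of u us w] t u by simp
    moreover have "inner_edges (Node u us) \<subseteq> inner_edges (Node v ts)"
      using inner_edges_child[OF t(1)] unfolding u .
    ultimately have "(u, w) \<in> (inner_edges (Node v ts))\<^sup>*"
      by (rule subsetD[OF rtrancl_mono, rotated])
    moreover have "(v, u) \<in> inner_edges (Node v ts)"
      using t u by auto
    ultimately show ?thesis
      by (rule converse_rtrancl_into_rtrancl[rotated])
  qed simp
qed

lemma tree_conn: "conn (inner_edges t) (vset t)"
proof (cases t)
  case (Node r ts)
  let ?E = "(inner_edges t \<union> (inner_edges t)\<inverse>) \<inter> vset t \<times> vset t"
  have sub: "inner_edges t \<subseteq> ?E"
    using inner_edges_vset[of t] by auto
  have root: "(r, w) \<in> ?E\<^sup>*" if "w \<in> vset t" for w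
    using tree_root_connected[of w r ts] that subsetD[OF rtrancl_mono[OF sub], of "(r, w)"]
    unfolding Node by simp
  have "sym ?E"
    by (auto simp: sym_def)
  then have "(w, r) \<in> ?E\<^sup>*" if "w \<in> vset t" for w
    using root[OF that] sym_rtrancl by (meson symD)
  then show ?thesis
    unfolding conn_def using root rtrancl_trans by meson
qed (simp add: conn_def)

lemma inner_edges_plug_outer: "inner_edges t \<subseteq> inner_edges (plug f t)"
proof (induction t)
  case (Node v ts)
  have "(v, w) \<in> inner_edges (plug f (Node v ts))" if "Node w us \<in> set ts" for w us
  proof -
    have "plug f (Node w us) \<in> plug f ` set ts"
      using that by (rule imageI)
    then have "Node w (map (plug f) us) \<in> set (map (plug f) ts)"
      by simp
    then show ?thesis
      unfolding plug.simps inner_edges.simps by blast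
  qed
  then have "{(v, w) | w us. Node w us \<in> set ts} \<subseteq> inner_edges (plug f (Node v ts))"
    by blast
  moreover have "inner_edges t \<subseteq> inner_edges (plug f (Node v ts))" if "t \<in> set ts" for t
  proof -
    have "inner_edges (plug f t) \<subseteq> inner_edges (plug f (Node v ts))"
      using that by auto
    then show ?thesis
      using Node[OF that] by blast
  qed
  ultimately show ?case
    unfolding inner_edges.simps(2)[of v ts] by (intro Un_least UN_least)
qed simp

lemma inner_edges_plug_inner: "l \<in> lset t \<Longrightarrow> inner_edges (f l) \<subseteq> inner_edges (plug f t)"
proof (induction t)
  case (Node v ts)
  then obtain t where t: "t \<in> set ts" "l \<in> lset t"
    by auto
  have "inner_edges (f l) \<subseteq> inner_edges (plug f t)"
    by (rule Node.IH[OF t])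
  also have "\<dots> \<subseteq> inner_edges (plug f (Node v ts))"
    using t(1) by auto
  finally show ?case .
qed auto

text \<open>In a numbered label every child is plugged in somewhere, so the substituted tree of each
  vertex survives with its edges.\<close>

lemma inner_edges_sub:
  assumes "\<And>v n. (v, n) \<in> set (verts t) \<Longrightarrow> numbered n (g v n)" "(k, m) \<in> set (verts t)"
  shows "inner_edges (g k m) \<subseteq> inner_edges (sub g t)"
  using assms
proof (induction t)
  case (Node v ts)
  show ?case
  proof (cases "k = v \<and> m = length ts")
    case True
    then show ?thesis
      using inner_edges_plug_outer[of "g k m"] by simp
  next
    case False
    then obtain t where t: "t \<in> set ts" "(k, m) \<in> set (verts t)"
      using Node.prems(2) by auto
    then obtain i where i: "i < length ts" "(k, m) \<in> set (verts (ts ! i))"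
      unfolding in_set_conv_nth[of t] by blast
    have "set (verts (ts ! i)) \<subseteq> set (verts (Node v ts))"
      using nth_mem[OF i(1)] by auto
    then have "inner_edges (g k m) \<subseteq> inner_edges (sub g (ts ! i))"
      using i by (intro Node.IH Node.prems(1)) auto
    also have "\<dots> = inner_edges (map (sub g) ts ! i)"
      using i by simp
    also have "\<dots> \<subseteq> inner_edges (sub g (Node v ts))"
      unfolding sub.simps using lset_numbered[OF Node.prems(1)[of v "length ts"]] i
      by (intro inner_edges_plug_inner[where f="\<lambda>a. map (sub g) ts ! a"]) simp
    finally show ?thesis .
  qed
qed simp

text \<open>The set cut off by an edge is the vertex set of the composite of a branch of
  \<open>t\<close>, and the edges of this composite survive in the composite of \<open>t\<close>. A
  branch without leaves cuts off the empty set, which is no subtree.\<close>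

lemma cuts_subtree:
  "wf_wtree t \<Longrightarrow> S \<in> cuts a t \<Longrightarrow> S \<noteq> {} \<Longrightarrow> subtree (composite t) S"
proof (induction a t rule: cuts.induct)
  case (2 a c l x ts)
  have vs: "vset (composite (Node (c, l, x) ts)) = tags (Node (c, l, x) ts)"
    using 2 by (intro vset_composite)
  show ?case
  proof (cases "S = tags (Node (c, l, x) ts)")
    case True
    then show ?thesis
      using tree_conn[of "composite (Node (c, l, x) ts)"] 2(4) vs unfolding subtree_conn by simp
  next
    case False
    then obtain t where "t \<in> set ts" "S \<in> cuts a t"
      using 2(3) by (auto simp del: tags_simps split: if_splits)
    then obtain k where k: "k < length ts" "S \<in> cuts a (ts ! k)"
      unfolding in_set_conv_nth by blast
    have mem: "ts ! k \<in> set ts"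
      using k by simp
    have x: "x \<in> ltrees c (map rc ts)" and wf: "\<forall>t\<in>set ts. wf_wtree t"
      using 2 by auto
    have st: "subtree (composite (ts ! k)) S"
      using 2(1)[OF mem] wf mem k(2) 2(4) by blast
    have "(k, rc (ts ! k)) \<in> set (verts x)"
      using k by (auto simp: set_verts_ltrees[OF x])
    then have "inner_edges (map composite ts ! k) \<subseteq> inner_edges (composite (Node (c, l, x) ts))"
      unfolding composite.simps using numbered_child[OF x wf]
      by (intro inner_edges_sub[where g="\<lambda>k n. map composite ts ! k"]) auto
    then have sub: "inner_edges (composite (ts ! k)) \<subseteq> inner_edges (composite (Node (c, l, x) ts))"
      unfolding nth_map[OF k(1)] .
    have "conn (inner_edges (composite (ts ! k))) S"
      using st unfolding subtree_conn by (elim conjE)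
    then have "conn (inner_edges (composite (Node (c, l, x) ts))) S"
      by (rule conn_mono) (rule subsetD[OF sub])
    moreover have "S \<subseteq> tags (Node (c, l, x) ts)"
      using cuts_subset_tags[OF k(2)] mem unfolding tags_simps by blast
    ultimately show ?thesis
      using 2(4) unfolding subtree_conn vs by blast
  qed
qed simp

text \<open>Sets cut off within the same child are compared by induction, and those from different
  children are disjoint.\<close>

lemma cuts_laminar:
  "tag_distinct t \<Longrightarrow> S \<in> cuts a t \<Longrightarrow> S' \<in> cuts a t \<Longrightarrow> S \<inter> S' = S \<or> S \<inter> S' = S' \<or> S \<inter> S' = {}"
proof (induction a t rule: cuts.induct)
  case (2 a c l x ts)
  show ?case
  proof (cases "S = tags (Node (c, l, x) ts) \<or> S' = tags (Node (c, l, x) ts)")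
    case True
    then show ?thesis
      using cuts_subset_tags[OF 2(3)] cuts_subset_tags[OF 2(4)] by blast
  next
    case False
    then obtain t t' where "t \<in> set ts" "S \<in> cuts a t" "t' \<in> set ts" "S' \<in> cuts a t'"
      using 2(3,4) by (auto simp del: tags_simps split: if_splits)
    then obtain i j where ij: "i < length ts" "S \<in> cuts a (ts ! i)" "j < length ts" "S' \<in> cuts a (ts ! j)"
      unfolding in_set_conv_nth by blast
    show ?thesis
    proof (cases "i = j")
      case True
      then show ?thesis
        using 2(1)[of "ts ! i"] ij tag_distinct_child[OF 2(2)] by simp
    next
      case False
      then show ?thesis
        using tags_disjoint[OF 2(2) ij(1,3)] cuts_subset_tags[OF ij(2)] cuts_subset_tags[OF ij(4)] by blast
    qed
  qed
qed simp

text \<open>The filter by \<open>large_proper\<close> removes the edge below the root vertex and the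
  edges over at most one leaf, whose lengths are not invariant under the relations.\<close>

definition model_point :: "(nat, ltree) wtree \<Rightarrow> ltree \<times> (nat set \<Rightarrow> real)" where
  "model_point t = (composite t, \<lambda>S. if large_proper (composite t) S then edge_weight t S else 0)"

definition model_points :: "nat \<Rightarrow> nat list \<Rightarrow> (ltree \<times> (nat set \<Rightarrow> real)) set" where
  "model_points n ms = Sigma (ltrees n ms) (\<lambda>T. weight_functions (bracketings T))"

text \<open>Inside a product of a discrete set with real lines, the Hausdorff property is immediate
  and continuity can be checked coordinatewise.\<close>

definition model :: "nat \<Rightarrow> nat list \<Rightarrow> (ltree \<times> (nat set \<Rightarrow> real)) topology" where
  "model n ms = subtopology (prod_topology (discrete_topology (ltrees n ms)) (powertop_real UNIV))
     (model_points n ms)"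

lemma topspace_model [simp]: "topspace (model n ms) = model_points n ms"
  by (auto simp: model_def model_points_def)

lemma Hausdorff_model: "Hausdorff_space (model n ms)"
  unfolding model_def
  by (intro Hausdorff_space_subtopology)
     (simp add: Hausdorff_space_prod_topology Hausdorff_space_product_topology)

lemma large_nonempty: "large_proper T S \<Longrightarrow> S \<noteq> {}"
  by (auto simp: large_proper_def)

lemma model_point_level:
  assumes "0 \<le> a"
  shows "{S. a < snd (model_point t) S} = {S \<in> cuts a t. large_proper (composite t) S}"
  using assms cuts_iff[OF assms, of _ t] by (auto simp: model_point_def)

lemma composite_wpoints: "t \<in> wpoints c cs \<Longrightarrow> composite t \<in> ltrees c cs"
  using composite_ltrees[of t cs] by (auto simp: wpoints_def tag_distinct_def)

lemma model_point_in: "t \<in> wpoints c cs \<Longrightarrow> model_point t \<in> model_points c cs"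
proof -
  assume t: "t \<in> wpoints c cs"
  then have wf: "wf_wtree t" "tag_distinct t"
    by (auto simp: wpoints_def)
  have "{S. 0 < snd (model_point t) S} \<in> bracketings (composite t)"
    unfolding model_point_level[OF order.refl] bracketings_def
    using cuts_subtree[OF wf(1)] cuts_laminar[OF wf(2)] large_nonempty by fast
  then show ?thesis
    using composite_wpoints[OF t] edge_weight_nonneg edge_weight_le[OF wf(1)]
    by (auto simp: model_points_def weight_functions_def model_point_def)
qed

lemma model_point_eq_iff: "model_point t = model_point u \<longleftrightarrow> same_invariants t u"
proof
  assume eq: "model_point t = model_point u"
  have comp: "composite t = composite u"
    using eq by (simp add: model_point_def)
  show "same_invariants t u"
    unfolding same_invariants_def
  proof (intro conjI allI impI)
    fix a :: real and S assume a: "0 \<le> a" and S: "large_proper (composite t) S"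
    have "S \<in> {S. a < snd (model_point t) S} \<longleftrightarrow> S \<in> {S. a < snd (model_point u) S}"
      unfolding eq by (rule refl)
    then show "S \<in> cuts a t \<longleftrightarrow> S \<in> cuts a u"
      unfolding model_point_level[OF a] using S comp by simp
  qed (rule comp)
next
  assume same: "same_invariants t u"
  have "edge_weight t S = edge_weight u S" if S: "large_proper (composite t) S" for S
  proof (rule ccontr)
    assume "edge_weight t S \<noteq> edge_weight u S"
    moreover have "a < edge_weight t S \<longleftrightarrow> a < edge_weight u S" if "0 \<le> a" for a
      using same S that cuts_iff[OF that, of S t] cuts_iff[OF that, of S u] unfolding same_invariants_def by metis
    ultimately show False
      using edge_weight_nonneg[of t S] edge_weight_nonneg[of u S] by (metis linorder_neqE_linordered_idom order.irrefl)
  qed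
  then show "model_point t = model_point u"
    using same unfolding model_point_def same_invariants_def by auto
qed

lemma w0_class_model_point:
  "t \<in> wpoints c cs \<Longrightarrow> w0_class O_operad t = {u \<in> wpoints c cs. model_point u = model_point t}"
  unfolding w0_class_wpoints model_point_eq_iff[symmetric] by auto

section \<open>Continuity\<close>

lemma continuous_map_Max:
  assumes "finite A" "\<And>a. a \<in> A \<Longrightarrow> continuous_map X euclideanreal (f a)"
  shows "continuous_map X euclideanreal (\<lambda>x. Max (insert c ((\<lambda>a. f a x) ` A)))"
  using assms
proof (induction A rule: finite_induct)
  case (insert a A)
  have "Max (insert c ((\<lambda>a. f a x) ` insert a A)) = max (f a x) (Max (insert c ((\<lambda>a. f a x) ` A)))" for x
    using insert.hyps by (simp add: insert_commute[of c])
  then show ?case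
    using insert by (simp add: continuous_map_real_max)
qed simp

lemma openin_finite_product_discrete:
  assumes "finite I" "Z \<subseteq> PiE I X"
  shows "openin (product_topology (\<lambda>i. discrete_topology (X i)) I) Z"
proof -
  have "openin (product_topology (\<lambda>i. discrete_topology (X i)) I) (PiE I (\<lambda>i. {z i}))" if "z \<in> Z" for z
    using assms that by (subst openin_PiE) (auto simp: PiE_iff)
  then have "openin (product_topology (\<lambda>i. discrete_topology (X i)) I) (\<Union>z\<in>Z. PiE I (\<lambda>i. {z i}))"
    by blast
  moreover have "(\<Union>z\<in>Z. PiE I (\<lambda>i. {z i})) = Z"
  proof (intro equalityI subsetI)
    fix y assume "y \<in> (\<Union>z\<in>Z. PiE I (\<lambda>i. {z i}))"
    then obtain z where z: "z \<in> Z" "y \<in> PiE I (\<lambda>i. {z i})"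
      by blast
    have "y = z"
      using z assms(2) by (intro extensionalityI[of y I z]) (auto simp: PiE_iff extensional_def)
    then show "y \<in> Z"
      using z by simp
  next
    fix z assume "z \<in> Z"
    then show "z \<in> (\<Union>z\<in>Z. PiE I (\<lambda>i. {z i}))"
      using assms(2) by (intro UN_I[of z]) (auto simp: PiE_iff)
  qed
  ultimately show ?thesis
    by simp
qed

text \<open>The topology of \<open>wspace\<close> is given by coordinates indexed by positions, so
  the recursion is unfolded into one maximum over positions.\<close>

lemma edge_weight_positions:
  fixes t :: "('a, 'b) wtree"
  shows "edge_weight t S = Max (insert 0 (length_at t ` {p \<in> vertex_pos t. tags (tree_at t p) = S}))"
proof (induction t S rule: edge_weight.induct)
  case (2 c l x ts S)
  let ?N = "Node (c, l, x) ts"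
  let ?P = "\<lambda>t. {p \<in> vertex_pos t. tags (tree_at t p) = S}"
  have fin: "finite (?P t)" for t :: "('a, 'b) wtree"
    using finite_vertex_pos[of t] by simp
  have split: "length_at ?N ` ?P ?N =
      (if tags ?N = S then {l} else {}) \<union> (\<Union>i<length ts. length_at (ts ! i) ` ?P (ts ! i))"
  proof -
    have "?P ?N = (if tags ?N = S then {[]} else {}) \<union> (\<Union>i<length ts. Cons i ` ?P (ts ! i))"
      by auto
    moreover have "length_at ?N [] = l" "length_at ?N (i # p) = length_at (ts ! i) p" for i p
      by (auto simp: length_at_def)
    ultimately show ?thesis
      by (simp add: image_Un image_UN image_image)
  qed
  have "a < edge_weight ?N S \<longleftrightarrow> a < Max (insert 0 (length_at ?N ` ?P ?N))" if "0 \<le> a" for a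
  proof -
    have "a < edge_weight ?N S \<longleftrightarrow> (a < l \<and> S = tags ?N) \<or> (\<exists>t\<in>set ts. a < edge_weight t S)"
      using that by (subst edge_weight.simps, subst Max_gr_iff) auto
    also have "\<dots> \<longleftrightarrow> (a < l \<and> S = tags ?N) \<or> (\<exists>i<length ts. a < edge_weight (ts ! i) S)"
      by (metis in_set_conv_nth)
    also have "\<dots> \<longleftrightarrow> (a < l \<and> S = tags ?N) \<or> (\<exists>i<length ts. \<exists>b\<in>length_at (ts ! i) ` ?P (ts ! i). a < b)"
    proof -
      have "a < edge_weight (ts ! i) S \<longleftrightarrow> (\<exists>b\<in>length_at (ts ! i) ` ?P (ts ! i). a < b)" if "i < length ts" for i
        using 2[of "ts ! i"] that \<open>0 \<le> a\<close> fin[of "ts ! i"] by (subst 2) (auto simp: Max_gr_iff)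
      then show ?thesis
        by blast
    qed
    also have "\<dots> \<longleftrightarrow> (\<exists>b\<in>insert 0 (length_at ?N ` ?P ?N). a < b)"
      unfolding split using that by auto
    also have "\<dots> \<longleftrightarrow> a < Max (insert 0 (length_at ?N ` ?P ?N))"
      using fin[of ?N] by (subst Max_gr_iff) auto
    finally show ?thesis .
  qed
  moreover have "0 \<le> Max (insert 0 (length_at ?N ` ?P ?N))"
    using fin[of ?N] by simp
  ultimately show ?case
    using edge_weight_nonneg[of ?N S] by (meson linorder_neqE_linordered_idom order.irrefl)
qed simp

lemma composite_cong:
  "shape t = shape u \<Longrightarrow> (\<And>p. p \<in> vertex_pos t \<Longrightarrow> label_at t p = label_at u p) \<Longrightarrow> composite t = composite u"
proof (induction t arbitrary: u)
  case (Leaf a)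
  then show ?case
    by (cases u) auto
next
  case (Node v ts)
  obtain c l x where v: "v = (c, l, x)"
    by (cases v)
  obtain w us where u: "u = Node w us"
    using Node.prems(1) by (cases u) auto
  obtain c' l' x' where w: "w = (c', l', x')"
    by (cases w)
  have sh: "map shape ts = map shape us"
    using Node.prems(1) u by simp
  then have len: "length ts = length us"
    by (metis length_map)
  have "x = x'"
    using Node.prems(2)[of "[]"] by (simp add: u v w label_at_def)
  moreover have "map composite ts = map composite us"
  proof (rule nth_equalityI)
    fix i assume "i < length (map composite ts)"
    then have i: "i < length ts" "i < length us"
      using len by auto
    have "composite (ts ! i) = composite (us ! i)"
    proof (rule Node.IH)
      show "shape (ts ! i) = shape (us ! i)"
        using arg_cong[OF sh, of "\<lambda>xs. xs ! i"] i by simp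
      fix p assume "p \<in> vertex_pos (ts ! i)"
      then have "i # p \<in> vertex_pos (Node v ts)"
        using i by auto
      then show "label_at (ts ! i) p = label_at (us ! i) p"
        using Node.prems(2)[of "i # p"] by (simp add: u label_at_def)
    qed (use i in simp)
    then show "map composite ts ! i = map composite us ! i"
      using i by simp
  qed (simp add: len)
  ultimately show ?case
    by (simp only: u v w composite.simps)
qed

lemma tags_shape: "tags (shape t) = tags t"
  by (simp add: tags_def shape_def ptree.set_map)

text \<open>Labels are discrete and each shape has finitely many vertices, so on a decoration space
  any condition on the labels alone is open. By \<open>composite_cong\<close> the value of the
  composite is such a condition.\<close>

lemma continuous_composite:
  "continuous_map (wspace O_operad c cs) (discrete_topology (ltrees c cs)) composite"
  unfolding continuous_map_def
proof (intro conjI allI impI)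
  show "composite \<in> topspace (wspace O_operad c cs) \<rightarrow> topspace (discrete_topology (ltrees c cs))"
    using composite_wpoints by (auto simp: topspace_wspace)
  fix \<U> :: "ltree set"
  define Z where "Z S = {x \<in> PiE (vertex_pos S) (\<lambda>v. ltrees (root_color (tree_at S v)) (input_colors (tree_at S v))).
      \<exists>t. shape t = S \<and> restrict (label_at t) (vertex_pos t) = x \<and> composite t \<in> \<U>}" for S
  define V where "V = (SIGMA S:wshapes c cs.
      topspace (product_topology (\<lambda>_. top_of_set {0..1::real}) (vertex_pos S - {[]})) \<times> Z S)"
  let ?X = "sum_topology (decoration_space O_operad) (wshapes c cs)"
  have "openin ?X V"
    unfolding V_def openin_disjoint_union
  proof
    fix S
    have "openin (product_topology (\<lambda>v. ops O_operad (root_color (tree_at S v)) (input_colors (tree_at S v)))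
          (vertex_pos S)) (Z S)"
      unfolding O_simps using finite_vertex_pos[of S]
      by (intro openin_finite_product_discrete) (auto simp: Z_def)
    then show "openin (decoration_space O_operad S)
        (topspace (product_topology (\<lambda>_. top_of_set {0..1}) (vertex_pos S - {[]})) \<times> Z S)"
      unfolding decoration_space_def openin_prod_Times_iff using openin_topspace by blast
  qed
  moreover have "{t \<in> topspace (wspace O_operad c cs). composite t \<in> \<U>} = untangle -` V \<inter> {t. dummy_root_length t}"
  proof (intro equalityI subsetI)
    fix t assume t: "t \<in> {t \<in> topspace (wspace O_operad c cs). composite t \<in> \<U>}"
    then have "dummy_root_length t" "untangle t \<in> topspace ?X"
      by (auto simp: wspace_def topspace_pullback_topology)
    moreover have "composite t \<in> \<U>"
      using t by simp
    ultimately show "t \<in> untangle -` V \<inter> {t. dummy_root_length t}"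
      unfolding untangle_eq V_def Z_def decoration_space_def by (auto simp: vertex_pos_shape)
  next
    fix t assume t: "t \<in> untangle -` V \<inter> {t. dummy_root_length t}"
    then have "t \<in> topspace (wspace O_operad c cs)"
      using openin_subset[OF \<open>openin ?X V\<close>] by (auto simp: wspace_def topspace_pullback_topology)
    moreover have "restrict (label_at t) (vertex_pos t) \<in> Z (shape t)"
      using t unfolding untangle_eq V_def by simp
    then obtain u where u: "shape u = shape t" "restrict (label_at u) (vertex_pos u) = restrict (label_at t) (vertex_pos t)"
      "composite u \<in> \<U>"
      unfolding Z_def by blast
    have "vertex_pos u = vertex_pos t"
      using u(1) vertex_pos_shape by metis
    then have "label_at t p = label_at u p" if "p \<in> vertex_pos t" for p
      using fun_cong[OF u(2), of p] that by simp
    then have "composite t = composite u"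
      using u(1) by (intro composite_cong) auto
    ultimately show "t \<in> {t \<in> topspace (wspace O_operad c cs). composite t \<in> \<U>}"
      using u(3) by simp
  qed
  ultimately show "openin (wspace O_operad c cs) {t \<in> topspace (wspace O_operad c cs). composite t \<in> \<U>}"
    unfolding wspace_def openin_pullback_topology by blast
qed

text \<open>On a fixed shape the edges that cut off \<open>U\<close> are fixed, so the weight is a
  maximum of finitely many coordinates. The root position \<open>[]\<close> has no length
  coordinate, and it drops out because \<open>U\<close> is proper.\<close>

lemma continuous_edge_weight:
  "continuous_map (wspace O_operad c cs) euclideanreal (\<lambda>t. snd (model_point t) U)"
proof -
  define g where "g = (\<lambda>(S :: nat wshape, s :: nat list \<Rightarrow> real, x :: nat list \<Rightarrow> ltree).
    if 2 \<le> card U \<and> U \<noteq> tags S then Max (insert 0 (s ` {p \<in> vertex_pos S - {[]}. tags (tree_at S p) = U})) else 0)"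
  have "continuous_map (sum_topology (decoration_space O_operad) (wshapes c cs)) euclideanreal g"
  proof (rule continuous_map_from_sum_topology)
    fix S :: "nat wshape"
    let ?I = "{p \<in> vertex_pos S - {[]}. tags (tree_at S p) = U}"
    have "continuous_map (decoration_space O_operad S) euclideanreal (\<lambda>d. fst d p)" if "p \<in> ?I" for p
    proof -
      have "continuous_map (decoration_space O_operad S)
         (product_topology (\<lambda>_. top_of_set {0..1}) (vertex_pos S - {[]})) fst"
        unfolding decoration_space_def by (rule continuous_map_fst)
      moreover have "continuous_map (product_topology (\<lambda>_. top_of_set {0..1::real}) (vertex_pos S - {[]}))
         (top_of_set {0..1}) (\<lambda>s. s p)"
        using that by (intro continuous_map_product_projection) auto
      ultimately have "continuous_map (decoration_space O_operad S) (top_of_set {0..1}) ((\<lambda>s. s p) \<circ> fst)"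
        by (rule continuous_map_compose)
      then show ?thesis
        by (simp add: continuous_map_in_subtopology comp_def)
    qed
    moreover have "finite ?I"
      using finite_vertex_pos[of S] by simp
    ultimately have "continuous_map (decoration_space O_operad S) euclideanreal
        (\<lambda>d. Max (insert 0 ((\<lambda>p. fst d p) ` ?I)))"
      by (intro continuous_map_Max[where f="\<lambda>p d. fst d p"])
    then show "continuous_map (decoration_space O_operad S) euclideanreal (\<lambda>d. g (S, d))"
      by (cases "2 \<le> card U \<and> U \<noteq> tags S") (auto simp: g_def case_prod_unfold)
  qed
  then have "continuous_map (wspace O_operad c cs) euclideanreal (g \<circ> untangle)"
    unfolding wspace_def by (rule continuous_map_pullback)
  then show ?thesis
  proof (rule continuous_map_eq)
    fix t assume "t \<in> topspace (wspace O_operad c cs)"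
    then have wf: "wf_wtree t"
      by (simp add: topspace_wspace wpoints_def)
    show "(g \<circ> untangle) t = snd (model_point t) U"
    proof (cases "2 \<le> card U \<and> U \<noteq> tags t")
      case True
      have "{p \<in> vertex_pos (shape t) - {[]}. tags (tree_at (shape t) p) = U} =
          {p \<in> vertex_pos t. tags (tree_at t p) = U}" (is "?A = ?B")
      proof -
        have "tags (tree_at (shape t) p) = tags (tree_at t p)" if "p \<in> vertex_pos t" for p
          using tree_at_shape[OF that] tags_shape[of "tree_at t p"] by simp
        moreover have "tags (tree_at t []) \<noteq> U"
          using True by auto
        ultimately show ?thesis
          unfolding vertex_pos_shape by (intro Collect_cong) (metis DiffE DiffI singletonD)
      qed
      moreover have "restrict (length_at t) (vertex_pos t - {[]}) p = length_at t p" if "p \<in> ?B" for p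
        using that True by auto
      then have "restrict (length_at t) (vertex_pos t - {[]}) ` ?B = length_at t ` ?B"
        by (intro image_cong refl)
      ultimately show ?thesis
        using True vset_composite[OF wf] edge_weight_positions[of t U]
        by (simp add: g_def untangle_eq model_point_def large_proper_def tags_shape)
    next
      case False
      then show ?thesis
        using vset_composite[OF wf]
        by (auto simp: g_def untangle_eq model_point_def large_proper_def tags_shape)
    qed
  qed
qed

lemma continuous_model_point: "continuous_map (wspace O_operad c cs) (model c cs) model_point"
proof -
  have "continuous_map (wspace O_operad c cs) (powertop_real UNIV) (\<lambda>t. snd (model_point t))"
    unfolding continuous_map_componentwise_UNIV using continuous_edge_weight by blast
  then have "continuous_map (wspace O_operad c cs) (prod_topology (discrete_topology (ltrees c cs)) (powertop_real UNIV))
      (\<lambda>t. (composite t, snd (model_point t)))"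
    by (intro continuous_map_pairedI continuous_composite)
  moreover have "(\<lambda>t. (composite t, snd (model_point t))) = model_point"
    by (auto simp: model_point_def)
  ultimately show ?thesis
    unfolding model_def using model_point_in
    by (intro continuous_map_into_subtopology) (auto simp: topspace_wspace)
qed

section \<open>The quotient map onto the models\<close>

text \<open>A closed cube, compact by Tychonoff's theorem; every weight function lies in the one
  given by its support.\<close>

definition weights_on :: "'k set \<Rightarrow> ('k \<Rightarrow> real) set" where
  "weights_on B = PiE UNIV (\<lambda>S. if S \<in> B then {0..1} else {0})"

lemma weights_on_iff: "w \<in> weights_on B \<longleftrightarrow> (\<forall>S. 0 \<le> w S \<and> w S \<le> 1 \<and> (S \<notin> B \<longrightarrow> w S = 0))"
  unfolding weights_on_def PiE_UNIV_domain Pi_iff by (simp, metis order.refl zero_le_one)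

lemma compact_weights_on: "compactin (powertop_real UNIV) (weights_on B)"
  unfolding weights_on_def compactin_PiE by auto

text \<open>The vertices of the composite with their arities are the leaves with their colours, so
  the profile can be read off from the composite.\<close>

lemma leaves_of_composite:
  assumes "wf_wtree t" "composite t \<in> ltrees (rc t) cs"
  shows "tag_distinct t \<and> set (leaves t) = {(cs ! j, j) | j. j < length cs}"
proof -
  have m: "mset (map (\<lambda>(c, j). (j, c)) (leaves t)) = mset (map (\<lambda>i. (i, cs ! i)) [0..<length cs])"
    using mset_verts_composite[OF assms(1)] assms(2) by (simp add: ltrees_iff)
  have "mset (map fst (map (\<lambda>(c, j). (j, c)) (leaves t))) = mset (map fst (map (\<lambda>i. (i, cs ! i)) [0..<length cs]))"
    using m by (simp only: mset_map)
  then have "mset (map snd (leaves t)) = mset [0..<length cs]"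
    by (simp add: comp_def case_prod_unfold del: mset_map)
  then have "tag_distinct t"
    unfolding tag_distinct_def using mset_eq_imp_distinct_iff[of "map snd (leaves t)" "[0..<length cs]"] by simp
  moreover have "(\<lambda>(c, j). (j, c)) ` set (leaves t) = (\<lambda>i. (i, cs ! i)) ` {..<length cs}"
    using mset_eq_setD[OF m] by (simp add: atLeast0LessThan)
  then have "(\<lambda>(j, c). (c, j)) ` (\<lambda>(c, j). (j, c)) ` set (leaves t) = (\<lambda>(j, c). (c, j)) ` (\<lambda>i. (i, cs ! i)) ` {..<length cs}"
    by simp
  then have "set (leaves t) = (\<lambda>i. (cs ! i, i)) ` {..<length cs}"
    by (simp add: image_image case_prod_unfold)
  then have "set (leaves t) = {(cs ! j, j) | j. j < length cs}"
    by auto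
  ultimately show ?thesis
    by blast
qed

lemma wpoints_iff:
  "t \<in> wpoints c cs \<longleftrightarrow> wf_wtree t \<and> dummy_root_length t \<and> rc t = c \<and> composite t \<in> ltrees c cs"
  using leaves_of_composite[of t cs] composite_wpoints[of t c cs] by (auto simp: wpoints_def)

lemma reset_root_facts:
  "composite (reset_root t) = composite t" "dummy_root_length (reset_root t)" "rc (reset_root t) = rc t"
  "shape (reset_root t) = shape t" "wf_wtree t \<Longrightarrow> wf_wtree (reset_root t)"
  "S \<noteq> tags t \<Longrightarrow> S \<in> cuts a (reset_root t) \<longleftrightarrow> S \<in> cuts a t"
  by (cases t rule: reset_root.cases; auto split: prod.splits)+

lemma label_at_relength:
  fixes t :: "(nat, ltree) wtree"
  shows "p \<in> vertex_pos t \<Longrightarrow> label_at (reset_root (relength w t)) p = label_at t p \<and>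
     (p \<noteq> [] \<longrightarrow> length_at (reset_root (relength w t)) p = w (tags (tree_at t p)))"
proof -
  have rel: "p \<in> vertex_pos t \<Longrightarrow> tree_at (relength w t) p = relength w (tree_at t p)" for p
  proof (induction t arbitrary: p)
    case (Node v ts)
    then show ?case
      by (cases p; cases v) auto
  qed simp
  have lab: "p \<in> vertex_pos t \<Longrightarrow> label_at (relength w t) p = label_at t p \<and>
      length_at (relength w t) p = w (tags (tree_at t p))" for p
  proof -
    assume p: "p \<in> vertex_pos t"
    then obtain c l x ts where "tree_at t p = Node (c, l, x) ts"
      using tree_at_vertex by (metis prod_cases3)
    then show ?thesis
      using rel[OF p] by (simp add: label_at_def length_at_def)
  qed
  have res: "label_at (reset_root u) p = label_at u p \<and> (p \<noteq> [] \<longrightarrow> length_at (reset_root u) p = length_at u p)"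
    for u :: "(nat, ltree) wtree" and p
    by (cases u rule: reset_root.cases; cases p) (auto simp: label_at_def length_at_def)
  show "p \<in> vertex_pos t \<Longrightarrow> ?thesis"
    using res[of "relength w t" p] lab[of p] by simp
qed

text \<open>Edges above the root vertex with the same set of leaves get the same length, so the
  maximum in \<open>edge_weight\<close> is just this length. Blocks of \<open>t\<close> outside
  \<open>B\<close> get length \<open>0\<close> and stay invisible.\<close>

lemma section_point:
  assumes t: "wf_wtree t" "rc t = n" "composite t \<in> ltrees n ms" and B: "B \<in> bracketings (composite t)" "B \<subseteq> blocks t"
    and w: "w \<in> weights_on B"
  shows "reset_root (relength w t) \<in> wpoints n ms"
    and "model_point (reset_root (relength w t)) = (composite t, w)"
proof -
  let ?t = "reset_root (relength w t)"
  have bnd: "0 \<le> w S \<and> w S \<le> 1" for S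
    using w by (simp add: weights_on_iff)
  have comp: "composite ?t = composite t"
    by (simp add: reset_root_facts composite_relength)
  have wf: "wf_wtree ?t"
    using wf_relength[OF t(1) bnd] by (simp add: reset_root_facts)
  show "?t \<in> wpoints n ms"
    unfolding wpoints_iff using wf comp t by (simp add: reset_root_facts shape_relength)
  have "snd (model_point ?t) S = w S" for S
  proof (cases "large_proper (composite t) S")
    case True
    then have S: "S \<noteq> tags (relength w t)"
      using vset_composite[OF t(1)] by (auto simp: large_proper_def tags_relength)
    have iff: "a < edge_weight ?t S \<longleftrightarrow> S \<in> blocks t \<and> a < w S" if "0 \<le> a" for a
      using cuts_iff[OF that, of S ?t] reset_root_facts(6)[OF S, of a] cuts_relength[of a w t] by auto
    have "edge_weight ?t S = w S"
    proof (cases "S \<in> B")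
      case True
      then have "a < edge_weight ?t S \<longleftrightarrow> a < w S" if "0 \<le> a" for a
        using iff[OF that] B(2) by blast
      then show ?thesis
        using bnd[of S] edge_weight_nonneg[of ?t S] by (metis linorder_neqE_linordered_idom order.irrefl)
    next
      case False
      then have "w S = 0"
        using w by (simp add: weights_on_iff)
      then show ?thesis
        using iff[of 0] edge_weight_nonneg[of ?t S] by simp
    qed
    then show ?thesis
      using True comp by (simp add: model_point_def)
  next
    case False
    then have "S \<notin> B"
      using B(1) by (auto simp: bracketings_def)
    then show ?thesis
      using False comp w by (simp add: model_point_def weights_on_iff)
  qed
  then show "model_point ?t = (composite t, w)"
    using comp by (simp add: prod_eq_iff model_point_def fun_eq_iff)
qed

text \<open>Shape and labels are constant along the section, and each length is a coordinate of
  \<open>w\<close>.\<close>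

lemma continuous_section:
  assumes t: "wf_wtree t" "rc t = n" "composite t \<in> ltrees n ms" and B: "B \<in> bracketings (composite t)" "B \<subseteq> blocks t"
  shows "continuous_map (subtopology (powertop_real UNIV) (weights_on B)) (wspace O_operad n ms)
     (\<lambda>w. reset_root (relength w t))"
  unfolding wspace_def
proof (rule continuous_map_pullback')
  let ?F = "subtopology (powertop_real UNIV) (weights_on B)"
  let ?S = "shape t" and ?x = "restrict (label_at t) (vertex_pos t)"
  let ?s = "\<lambda>w. restrict (\<lambda>p. w (tags (tree_at t p))) (vertex_pos t - {[]})"
  have top: "topspace ?F = weights_on B"
    by simp
  have unt: "untangle (reset_root (relength w t)) = (?S, ?s w, ?x)" for w
  proof -
    have "shape (reset_root (relength w t)) = ?S"
      by (simp add: reset_root_facts shape_relength)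
    moreover from this have "vertex_pos (reset_root (relength w t)) = vertex_pos t"
      using vertex_pos_shape by metis
    ultimately show ?thesis
      unfolding untangle_eq using label_at_relength[of _ t w] by (auto intro!: restrict_ext)
  qed
  have pt: "reset_root (relength w t) \<in> topspace (wspace O_operad n ms)" if "w \<in> weights_on B" for w
    using section_point(1)[OF assms that] by (simp add: topspace_wspace)
  show "topspace ?F \<subseteq> (\<lambda>w. reset_root (relength w t)) -` {t. dummy_root_length t}"
    using reset_root_facts(2) by auto
  have "(\<lambda>_. 0) \<in> weights_on B"
    by (simp add: weights_on_iff)
  then have dec: "untangle (reset_root (relength (\<lambda>_. 0) t)) \<in> topspace (sum_topology (decoration_space O_operad) (wshapes n ms))"
    using pt by (auto simp: wspace_def topspace_pullback_topology)
  then have S: "?S \<in> wshapes n ms" and x: "?x \<in> topspace (product_topology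
      (\<lambda>v. ops O_operad (root_color (tree_at ?S v)) (input_colors (tree_at ?S v))) (vertex_pos ?S))"
    unfolding unt decoration_space_def by auto
  have "continuous_map ?F (product_topology (\<lambda>_. top_of_set {0..1}) (vertex_pos ?S - {[]})) ?s"
    unfolding continuous_map_componentwise
  proof (intro conjI ballI)
    show "?s ` topspace ?F \<subseteq> extensional (vertex_pos ?S - {[]})"
      by (auto simp: vertex_pos_shape)
    fix p assume p: "p \<in> vertex_pos ?S - {[]}"
    have "continuous_map ?F (top_of_set {0..1}) (\<lambda>w. w (tags (tree_at t p)))"
      unfolding continuous_map_in_subtopology
    proof
      show "continuous_map ?F euclideanreal (\<lambda>w. w (tags (tree_at t p)))"
        by (intro continuous_map_from_subtopology continuous_map_product_projection) simp
      show "(\<lambda>w. w (tags (tree_at t p))) \<in> topspace ?F \<rightarrow> {0..1}"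
        unfolding top by (auto simp: weights_on_iff)
    qed
    then show "continuous_map ?F (top_of_set {0..1}) (\<lambda>w. ?s w p)"
      using p by (simp add: vertex_pos_shape)
  qed
  then have "continuous_map ?F (decoration_space O_operad ?S) (\<lambda>w. (?s w, ?x))"
    unfolding decoration_space_def using x by (intro continuous_map_pairedI) auto
  then have "continuous_map ?F (sum_topology (decoration_space O_operad) (wshapes n ms)) ((\<lambda>d. (?S, d)) \<circ> (\<lambda>w. (?s w, ?x)))"
    using continuous_map_component_injection[OF S, of "decoration_space O_operad"] by (rule continuous_map_compose)
  moreover have "(\<lambda>d. (?S, d)) \<circ> (\<lambda>w. (?s w, ?x)) = untangle \<circ> (\<lambda>w. reset_root (relength w t))"
    by (simp add: fun_eq_iff unt)
  ultimately show "continuous_map ?F (sum_topology (decoration_space O_operad) (wshapes n ms))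
      (untangle \<circ> (\<lambda>w. reset_root (relength w t)))"
    by simp
qed

section \<open>Finiteness of the sets of labelled trees and of bracketings\<close>

fun bounded_trees :: "nat \<Rightarrow> nat \<Rightarrow> ltree set" where
  "bounded_trees N 0 = Leaf ` {..<N}"
| "bounded_trees N (Suc d) = Leaf ` {..<N} \<union>
     (\<lambda>(v, ts). Node v ts) ` ({..<N} \<times> {ts. set ts \<subseteq> bounded_trees N d \<and> length ts \<le> N})"

lemma finite_bounded_trees: "finite (bounded_trees N d)"
  by (induction d) (auto intro!: finite_cartesian_product finite_lists_length_le)

lemma in_bounded_trees:
  "lset t \<subseteq> {..<N} \<Longrightarrow> \<forall>(v, n)\<in>set (verts t). v < N \<and> n \<le> N \<Longrightarrow> length (verts t) \<le> d \<Longrightarrow> t \<in> bounded_trees N d"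
proof (induction t arbitrary: d)
  case (Leaf a)
  then show ?case
    by (cases d) auto
next
  case (Node v ts)
  obtain d' where d: "d = Suc d'"
    using Node.prems(3) by (cases d) auto
  have "t \<in> bounded_trees N d'" if t: "t \<in> set ts" for t
  proof (rule Node.IH[OF t])
    have "length (verts t) \<le> length (concat (map verts ts))"
      using t by (simp add: length_concat comp_def member_le_sum_list)
    then show "length (verts t) \<le> d'"
      using Node.prems(3) d by simp
  qed (use Node.prems t in auto)
  then show ?case
    using Node.prems(2) d by auto
qed

text \<open>Leaf numbers, vertex numbers and arities are bounded by \<open>N\<close>, and the height
  is bounded by the number of vertices.\<close>

lemma finite_ltrees: "finite (ltrees n ms)"
proof -
  define N where "N = n + length ms + sum_list ms"
  have "T \<in> bounded_trees N (length ms)" if T: "T \<in> ltrees n ms" for T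
  proof (rule in_bounded_trees)
    show "lset T \<subseteq> {..<N}"
      using T lset_numbered[of n T] by (auto simp: ltrees_iff N_def)
    have "ms ! i \<le> sum_list ms" if "i < length ms" for i
      using that by (simp add: member_le_sum_list)
    then show "\<forall>(v, n)\<in>set (verts T). v < N \<and> n \<le> N"
      using set_verts_ltrees[OF T] by (fastforce simp: N_def)
    show "length (verts T) \<le> length ms"
      using length_verts_ltrees[OF T] by simp
  qed
  then show ?thesis
    using finite_subset[OF _ finite_bounded_trees] by blast
qed

lemma finite_bracketings: "finite (bracketings T)"
proof -
  have "finite (vset T)"
    by (simp flip: fst_set_verts)
  then have "finite (Pow (Pow (vset T)))"
    by simp
  moreover have "bracketings T \<subseteq> Pow (Pow (vset T))"
    by (auto simp: bracketings_def subtree_def)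
  ultimately show ?thesis
    by (rule finite_subset[rotated])
qed

lemma bracketings_subset: "B \<in> bracketings T \<Longrightarrow> B' \<subseteq> B \<Longrightarrow> B' \<in> bracketings T"
  unfolding bracketings_def mem_Collect_eq by (meson subsetD)

lemma ex_section_tree:
  assumes T: "T \<in> ltrees n ms" and B: "B \<in> bracketings T"
  shows "\<exists>t. wf_wtree t \<and> rc t = n \<and> composite t = T \<and> B \<subseteq> blocks t"
proof -
  have "\<exists>t. wf_wtree t \<and> rc t = n \<and> dummy_root_length t \<and> composite t = T \<and> B \<subseteq> blocks t"
  proof (rule ex_wtree)
    show "numbered n T"
      using T by (simp add: ltrees_iff)
    show "distinct (map fst (verts T))"
      by (rule distinct_verts_ltrees[OF T])
  qed (use B in \<open>simp_all add: bracketings_def\<close>)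
  then show ?thesis
    by blast
qed

text \<open>For each pair of a tree and a bracketing one decorated tree is chosen; varying its
  lengths over the cube of the bracketing gives a compact family. There are finitely many pairs, and
  a model point lies in the image of the family given by its support.\<close>

proposition quotient_model_point: "quotient_map (wspace O_operad n ms) (model n ms) model_point"
proof -
  define \<tau> where "\<tau> T B = (SOME t. wf_wtree t \<and> rc t = n \<and> composite t = T \<and> B \<subseteq> blocks t)" for T B
  have \<tau>: "wf_wtree (\<tau> T B)" "rc (\<tau> T B) = n" "composite (\<tau> T B) = T" "B \<subseteq> blocks (\<tau> T B)"
    if "T \<in> ltrees n ms" "B \<in> bracketings T" for T B
    using someI_ex[OF ex_section_tree[OF that]] unfolding \<tau>_def by blast+
  define K where "K = (\<Union>(T, B)\<in>Sigma (ltrees n ms) bracketings. (\<lambda>w. reset_root (relength w (\<tau> T B))) ` weights_on B)"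
  have "compactin (wspace O_operad n ms) K"
    unfolding K_def
  proof (rule compactin_Union)
    show "finite ((\<lambda>(T, B). (\<lambda>w. reset_root (relength w (\<tau> T B))) ` weights_on B) ` Sigma (ltrees n ms) bracketings)"
      by (intro finite_imageI finite_SigmaI finite_ltrees finite_bracketings)
    fix C assume "C \<in> (\<lambda>(T, B). (\<lambda>w. reset_root (relength w (\<tau> T B))) ` weights_on B) ` Sigma (ltrees n ms) bracketings"
    then obtain T B where TB: "T \<in> ltrees n ms" "B \<in> bracketings T" and C: "C = (\<lambda>w. reset_root (relength w (\<tau> T B))) ` weights_on B"
      by blast
    show "compactin (wspace O_operad n ms) C"
      unfolding C
    proof (rule image_compactin)
      show "compactin (subtopology (powertop_real UNIV) (weights_on B)) (weights_on B)"
        by (simp add: compactin_subtopology compact_weights_on)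
      show "continuous_map (subtopology (powertop_real UNIV) (weights_on B)) (wspace O_operad n ms)
          (\<lambda>w. reset_root (relength w (\<tau> T B)))"
        using \<tau>[OF TB] TB by (intro continuous_section) auto
    qed
  qed
  moreover have "model_point ` K = topspace (model n ms)"
  proof (intro equalityI subsetI)
    fix y assume "y \<in> model_point ` K"
    moreover have "K \<subseteq> wpoints n ms"
      using compactin_subset_topspace[OF \<open>compactin _ K\<close>] by (simp add: topspace_wspace)
    ultimately show "y \<in> topspace (model n ms)"
      using model_point_in by auto
  next
    fix y assume "y \<in> topspace (model n ms)"
    then obtain T w where y: "y = (T, w)" and T: "T \<in> ltrees n ms" and w: "w \<in> weight_functions (bracketings T)"
      by (auto simp: model_points_def)
    define B where "B = {S. 0 < w S}"
    have B: "B \<in> bracketings T"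
      using w by (simp add: weight_functions_def B_def)
    have wB: "w \<in> weights_on B"
      using w by (auto simp: weight_functions_def weights_on_iff B_def intro: order.antisym)
    have "model_point (reset_root (relength w (\<tau> T B))) = (T, w)"
      using section_point(2)[of "\<tau> T B" n ms B w] \<tau>[OF T B] T B wB by simp
    moreover have "reset_root (relength w (\<tau> T B)) \<in> K"
      unfolding K_def using T B wB by (intro UN_I[of "(T, B)"]) auto
    ultimately show "y \<in> model_point ` K"
      using y by (metis imageI)
  qed
  ultimately show ?thesis
    using continuous_model_point Hausdorff_model by (intro quotient_map_compact) auto
qed

section \<open>Grafting and the composition of models\<close>

text \<open>Weights are at most \<open>1\<close>, so thresholds \<open>a < 1\<close> suffice; this
  matters for the bracket of weight \<open>1\<close> that composition creates.\<close>

lemma weights_eqI: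
  fixes w w' :: "'k \<Rightarrow> real"
  assumes "\<And>S. 0 \<le> w S \<and> w S \<le> 1" "\<And>S. 0 \<le> w' S \<and> w' S \<le> 1"
    and "\<And>a. 0 \<le> a \<Longrightarrow> a < 1 \<Longrightarrow> {S. a < w S} = {S. a < w' S}"
  shows "w = w'"
proof
  fix S
  show "w S = w' S"
  proof (rule superlevels_eqI)
    fix u :: real assume "0 < u" "u \<le> 1"
    then have "S \<in> {S. 1 - u < w S} \<longleftrightarrow> S \<in> {S. 1 - u < w' S}"
      using assms(3)[of "1 - u"] by simp
    then show "1 - u < w S \<longleftrightarrow> 1 - u < w' S"
      by simp
  qed (use assms(1,2) in auto)
qed

lemma model_points_props:
  assumes "(T, w) \<in> model_points n ms"
  shows "T \<in> ltrees n ms" "0 \<le> w S" "w S \<le> 1" "0 \<le> a \<Longrightarrow> {S. a < w S} \<in> bracketings T"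
    "0 < w S \<Longrightarrow> S \<subseteq> vset T"
proof -
  have w: "w \<in> weight_functions (bracketings T)" and T: "T \<in> ltrees n ms"
    using assms by (auto simp: model_points_def)
  then show "T \<in> ltrees n ms" "0 \<le> w S" "w S \<le> 1"
    by (auto simp: weight_functions_def)
  have B: "{S. 0 < w S} \<in> bracketings T"
    using w by (simp add: weight_functions_def)
  show "{S. a < w S} \<in> bracketings T" if "0 \<le> a"
    by (rule bracketings_subset[OF B]) (use that in auto)
  show "S \<subseteq> vset T" if "0 < w S"
    using B that by (auto simp: bracketings_def subtree_def)
qed

text \<open>The maxima take care of different sets with the same image: \<open>subst_subtree\<close>
  forgets whether \<open>i\<close> belongs to \<open>S\<close> when \<open>T'\<close> has no
  vertices. The last term is the bracket \<open>T'\<close> itself, which has weight \<open>1\<close>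
  like the edge created by grafting.\<close>

definition model_circ :: "nat \<Rightarrow> ltree \<times> (nat set \<Rightarrow> real) \<Rightarrow> ltree \<times> (nat set \<Rightarrow> real) \<Rightarrow> ltree \<times> (nat set \<Rightarrow> real)" where
  "model_circ i = (\<lambda>(T, w) (T', w').
     (subst_vertex i T' T, \<lambda>U. if large_proper (subst_vertex i T' T) U then
        max (Max (insert 0 (w ` {S \<in> Pow (vset T). subst_subtree i T' S = U})))
            (max (Max (insert 0 (w' ` {S \<in> Pow (vset T'). (\<lambda>j. i + j) ` S = U})))
                 (if U = (\<lambda>j. i + j) ` vset T' then 1 else 0))
        else 0))"

definition model_act :: "(nat \<Rightarrow> nat) \<Rightarrow> ltree \<times> (nat set \<Rightarrow> real) \<Rightarrow> ltree \<times> (nat set \<Rightarrow> real)" where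
  "model_act \<pi> = (\<lambda>(T, w). (relabel_vertices \<pi> T, \<lambda>U. w (\<pi> ` U)))"

definition model_ident :: "nat \<Rightarrow> ltree \<times> (nat set \<Rightarrow> real)" where
  "model_ident n = (corolla n, \<lambda>_. 0)"

lemma finite_vset: "finite (vset t)"
  by (simp flip: fst_set_verts)

text \<open>The superlevel set of a maximum is the union of the superlevel sets. The assumption
  \<open>a < 1\<close> admits the bracket \<open>T'\<close>, as \<open>subst_bracketing\<close>
  does.\<close>

lemma model_circ_level:
  assumes x: "(T, w) \<in> model_points c cs" and y: "(T', w') \<in> model_points c' cs'" and a: "0 \<le> a" "a < 1"
  shows "{U. a < snd (model_circ i (T, w) (T', w')) U} = subst_bracketing i T T' ({S. a < w S}, {S. a < w' S})"
proof -
  have fin: "finite {S \<in> Pow (vset t). P S}" for t :: ltree and P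
    using finite_vset[of t] by simp
  have "a < snd (model_circ i (T, w) (T', w')) U \<longleftrightarrow> large_proper (subst_vertex i T' T) U \<and>
     ((\<exists>S\<in>Pow (vset T). subst_subtree i T' S = U \<and> a < w S) \<or>
      (\<exists>S\<in>Pow (vset T'). (\<lambda>j. i + j) ` S = U \<and> a < w' S) \<or> U = (\<lambda>j. i + j) ` vset T')" for U
  proof -
    have "a < Max (insert 0 (v ` {S \<in> Pow (vset t). P S})) \<longleftrightarrow> (\<exists>S\<in>Pow (vset t). P S \<and> a < v S)"
      for v :: "nat set \<Rightarrow> real" and t :: ltree and P
      using a fin[of t P] by (subst Max_gr_iff) auto
    then show ?thesis
      using a by (auto simp: model_circ_def less_max_iff_disj)
  qed
  moreover have "(\<exists>S\<in>Pow (vset T). subst_subtree i T' S = U \<and> a < w S) \<longleftrightarrow> U \<in> subst_subtree i T' ` {S. a < w S}" for U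
  proof -
    have "S \<in> Pow (vset T)" if "a < w S" for S
      using model_points_props(5)[OF x, of S] a(1) that by simp
    then show ?thesis
      by (simp only: image_iff mem_Collect_eq Bex_def) metis
  qed
  moreover have "(\<exists>S\<in>Pow (vset T'). (\<lambda>j. i + j) ` S = U \<and> a < w' S) \<longleftrightarrow> U \<in> image (\<lambda>j. i + j) ` {S. a < w' S}" for U
  proof -
    have "S \<in> Pow (vset T')" if "a < w' S" for S
      using model_points_props(5)[OF y, of S] a(1) that by simp
    then show ?thesis
      by (simp only: image_iff[of U] mem_Collect_eq Bex_def) metis
  qed
  ultimately show ?thesis
    unfolding subst_bracketing_def prod.case by (intro Collect_cong) (simp only: Un_iff singleton_iff, blast)
qed

lemma model_circ_bounds:
  assumes x: "(T, w) \<in> model_points c cs" and y: "(T', w') \<in> model_points c' cs'"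
  shows "0 \<le> snd (model_circ i (T, w) (T', w')) U \<and> snd (model_circ i (T, w) (T', w')) U \<le> 1"
proof -
  have fin: "finite (w ` {S \<in> Pow (vset T). P S})" "finite (w' ` {S \<in> Pow (vset T'). P S})" for P
    using finite_vset[of T] finite_vset[of T'] by simp_all
  have "Max (insert 0 (w ` {S \<in> Pow (vset T). subst_subtree i T' S = U})) \<le> 1"
    using fin(1) model_points_props(3)[OF x] by (subst Max_le_iff) auto
  moreover have "Max (insert 0 (w' ` {S \<in> Pow (vset T'). (\<lambda>j. i + j) ` S = U})) \<le> 1"
    using fin(2) model_points_props(3)[OF y] by (subst Max_le_iff) auto
  moreover have "0 \<le> Max (insert 0 (w ` {S \<in> Pow (vset T). subst_subtree i T' S = U}))"
    using fin(1) by simp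
  ultimately show ?thesis
    by (cases "large_proper (subst_vertex i T' T) U") (simp_all add: model_circ_def le_max_iff_disj)
qed

definition shift :: "nat \<Rightarrow> ('c, 'x) wtree \<Rightarrow> ('c, 'x) wtree" where
  "shift i = map_ptree id (\<lambda>(d, a). (d, i + a))"

lemma shift_plug: "shift i t = plug (\<lambda>b. Leaf (fst b, i + snd b)) t"
  unfolding shift_def map_leaves_plug[of _ t] by (simp add: case_prod_unfold)

lemma graft_plug:
  "graft i t u = plug (\<lambda>b. if snd b = i then shift i u else Leaf (fst b, outer_idx i (length (leaves u)) (snd b))) t"
  unfolding graft_def shift_def[symmetric] by (simp add: case_prod_unfold)

lemma relabel_plug: "relabel_leaves \<pi> t = plug (\<lambda>b. Leaf (fst b, inv_into UNIV \<pi> (snd b))) t"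
  unfolding relabel_leaves_def map_leaves_plug[of _ t] by (simp add: case_prod_unfold)

lemma lset_wpoints: "t \<in> wpoints c cs \<Longrightarrow> lset t = {(cs ! j, j) | j. j < length cs}"
  by (simp add: wpoints_def flip: set_leaves)

lemma tags_wpoints: "t \<in> wpoints c cs \<Longrightarrow> tags t = {..<length cs}"
  by (force simp: tags_def lset_wpoints)

lemma length_leaves_wpoints: "t \<in> wpoints c cs \<Longrightarrow> length (leaves t) = length cs"
proof -
  assume t: "t \<in> wpoints c cs"
  then have "distinct (map snd (leaves t))" "set (map snd (leaves t)) = {..<length cs}"
    using tags_wpoints[OF t] by (auto simp: wpoints_def tag_distinct_def tags_leaves)
  then show ?thesis
    using distinct_card[of "map snd (leaves t)"] by simp
qed

lemma dummy_plug: "dummy_root_length t \<Longrightarrow> (\<And>b. dummy_root_length (F b)) \<Longrightarrow> dummy_root_length (plug F t)"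
  by (cases t rule: dummy_root_length.cases) auto

context
  fixes t u :: "(nat, ltree) wtree" and c i :: nat and cs ds :: "nat list"
  assumes t: "t \<in> wpoints c cs" and u: "u \<in> wpoints (cs ! i) ds" and i: "i < length cs"
begin

lemma shift_facts:
  "wf_wtree (shift i u)" "rc (shift i u) = cs ! i" "composite (shift i u) = map_ptree (\<lambda>j. i + j) id (composite u)"
  "dummy_root_length (shift i u)" "tags (shift i u) = (\<lambda>j. i + j) ` tags u"
  "cuts a (shift i u) = image (\<lambda>j. i + j) ` cuts a u"
proof -
  have wf: "wf_wtree u" "rc u = cs ! i" "dummy_root_length u"
    using u by (auto simp: wpoints_def)
  show "wf_wtree (shift i u)" "rc (shift i u) = cs ! i" "composite (shift i u) = map_ptree (\<lambda>j. i + j) id (composite u)"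
    using composite_map_leaves[OF wf(1), of "\<lambda>j. i + j"] wf(2) unfolding shift_def by auto
  show "dummy_root_length (shift i u)"
    unfolding shift_plug by (rule dummy_plug) (use wf in auto)
  show "tags (shift i u) = (\<lambda>j. i + j) ` tags u"
    unfolding shift_def by (rule tags_map_leaves)
  show "cuts a (shift i u) = image (\<lambda>j. i + j) ` cuts a u"
    unfolding shift_def by (rule cuts_map_leaves)
qed

lemma composite_graft:
  "wf_wtree (graft i t u)" "rc (graft i t u) = c" "composite (graft i t u) = subst_vertex i (composite u) (composite t)"
proof -
  let ?F = "\<lambda>b. if snd b = i then shift i u else Leaf (fst b, outer_idx i (length (leaves u)) (snd b))"
  have wf: "wf_wtree t" "rc t = c"
    using t by (auto simp: wpoints_def)
  have F: "wf_wtree (?F (d, j)) \<and> rc (?F (d, j)) = d" if "(d, j) \<in> lset t" for d j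
    using that lset_wpoints[OF t] shift_facts by auto
  have pl: "wf_wtree (plug ?F t) \<and> rc (plug ?F t) = rc t \<and>
    composite (plug ?F t) = sub (\<lambda>j n. composite (?F (n, j))) (composite t)"
    using F by (rule composite_plug[OF wf(1)])
  then show "wf_wtree (graft i t u)" "rc (graft i t u) = c"
    using wf by (auto simp: graft_plug)
  have len: "length (leaves u) = length (verts (composite u))"
    using length_leaves_wpoints[OF u] length_verts_ltrees[OF composite_wpoints[OF u]] by simp
  have "sub (\<lambda>j n. composite (?F (n, j))) (composite t) = subst_vertex i (composite u) (composite t)"
    unfolding subst_vertex_eq_sub by (rule sub_cong) (simp add: shift_facts len)
  then show "composite (graft i t u) = subst_vertex i (composite u) (composite t)"
    using pl by (simp add: graft_plug)
qed

lemma graft_wpoints: "graft i t u \<in> wpoints c (plug_profile i cs ds)"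
proof -
  have "composite (graft i t u) \<in> ltrees c (plug_profile i cs ds)"
    unfolding composite_graft(3)
    by (rule subst_vertex_ltrees[OF composite_wpoints[OF t] composite_wpoints[OF u] i])
  moreover have "dummy_root_length (graft i t u)"
    unfolding graft_plug
    using t shift_facts(4) by (intro dummy_plug) (auto simp: wpoints_def)
  ultimately show ?thesis
    unfolding wpoints_iff using composite_graft(1,2) by simp
qed

text \<open>The new internal edge is the outgoing edge of \<open>u\<close>, so it is accounted for
  by the cuts of \<open>u\<close>.\<close>

lemma cuts_graft:
  "cuts a (graft i t u) = subst_subtree i (composite u) ` cuts a t \<union> image (\<lambda>j. i + j) ` cuts a u"
  "tags (graft i t u) = subst_subtree i (composite u) (tags t)"
proof -
  let ?F = "\<lambda>b. if snd b = i then shift i u else Leaf (fst b, outer_idx i (length (leaves u)) (snd b))"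
  let ?f = "\<lambda>j. if j = i then (\<lambda>j. i + j) ` tags u else {outer_idx i (length (leaves u)) j}"
  have tagsF: "tags (?F (d, j)) = ?f j" if "(d, j) \<in> lset t" for d j
    using shift_facts(5) by simp
  have len: "length (leaves u) = length (verts (composite u))"
    using length_leaves_wpoints[OF u] length_verts_ltrees[OF composite_wpoints[OF u]] by simp
  have vs: "vset (composite u) = tags u"
    using u by (simp add: wpoints_def vset_composite)
  have f: "\<Union> (?f ` S) = subst_subtree i (composite u) S" for S
    unfolding subst_subtree_def vs len[symmetric] by (auto split: if_splits)
  have cuts_p: "cuts a (plug ?F t) = (\<lambda>S. \<Union> (?f ` S)) ` cuts a t \<union> (\<Union>b\<in>lset t. cuts a (?F b))"
    using tagsF by (rule cuts_plug)
  have "(\<Union>b\<in>lset t. cuts a (?F b)) = cuts a (shift i u)"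
    using i unfolding lset_wpoints[OF t] by (auto split: if_splits)
  then show "cuts a (graft i t u) = subst_subtree i (composite u) ` cuts a t \<union> image (\<lambda>j. i + j) ` cuts a u"
    using cuts_p unfolding graft_plug f shift_facts(6) by simp
  have "tags (plug ?F t) = \<Union> (?f ` tags t)"
    using tagsF by (rule tags_plug)
  then show "tags (graft i t u) = subst_subtree i (composite u) (tags t)"
    unfolding graft_plug f .
qed

text \<open>The brackets entering \<open>subst_bracketing\<close> have already been filtered for
  large proper sets, whereas the cuts of the graft are filtered only at the end. If a cut fails the
  first filter but its image passes the second, it is \<open>{i}\<close> in \<open>t\<close> or
  everything in \<open>u\<close>, and its image is the bracket of the whole of \<open>u\<close>.
  That bracket is cut off by the outgoing edge of \<open>u\<close>, whose length is
  \<open>1\<close>.\<close>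

lemma graft_level:
  assumes a: "0 \<le> a" "a < 1"
  shows "{U. a < snd (model_point (graft i t u)) U} = subst_bracketing i (composite t) (composite u)
     ({S. a < snd (model_point t) S}, {S. a < snd (model_point u) S})"
proof -
  let ?T = "composite t" and ?T' = "composite u"
  let ?T'' = "subst_vertex i ?T' ?T"
  let ?sh = "(\<lambda>j. i + j)"
  have V: "vset ?T = tags t" "vset ?T' = tags u" "vset ?T'' = tags (graft i t u)"
    using t u vset_composite[OF composite_graft(1)] by (simp_all add: wpoints_def vset_composite composite_graft(3))
  have card_sh: "card (?sh ` S) = card S" for S
    by (rule card_image) simp
  have small: "card (subst_subtree i ?T' {j}) = 1" if "j \<noteq> i" for j
    using that by (simp add: subst_subtree_def)
  have i_sub: "subst_subtree i ?T' {i} = ?sh ` vset ?T'"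
    by (simp add: subst_subtree_def)
  have 1: "U \<in> subst_subtree i ?T' ` {S \<in> cuts a t. large_proper ?T S} \<or> U = ?sh ` vset ?T'"
    if lp: "large_proper ?T'' U" and "U = subst_subtree i ?T' S" "S \<in> cuts a t" for U S
  proof (cases "large_proper ?T S")
    case False
    have "S \<noteq> vset ?T"
      using that V cuts_graft(2) by (auto simp: large_proper_def)
    then have "card S < 2"
      using False by (auto simp: large_proper_def)
    moreover have "finite S"
      using cuts_subset_tags[OF that(3)] finite_tags by (rule finite_subset)
    ultimately have "S = {} \<or> (\<exists>j. S = {j})"
      by (metis One_nat_def card_1_singletonE card_0_eq less_2_cases)
    moreover have "S \<noteq> {}"
      using that by (auto simp: large_proper_def subst_subtree_def)
    ultimately obtain j where "S = {j}"
      by blast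
    moreover have "j = i"
      using small[of j] that \<open>S = {j}\<close> by (auto simp: large_proper_def)
    ultimately show ?thesis
      using that i_sub by simp
  qed (use that in blast)
  have 2: "U \<in> image ?sh ` {S \<in> cuts a u. large_proper ?T' S} \<or> U = ?sh ` vset ?T'"
    if lp: "large_proper ?T'' U" and "U = ?sh ` S" "S \<in> cuts a u" for U S
    using that card_sh[of S] by (auto simp: large_proper_def)
  have 3: "?sh ` vset ?T' \<in> image ?sh ` cuts a u" if lp: "large_proper ?T'' (?sh ` vset ?T')"
  proof -
    have "2 \<le> card (tags u)"
      using lp V card_sh[of "vset ?T'"] by (simp add: large_proper_def)
    then have "tags u \<in> cuts a u"
      using u a(2) by (cases u rule: dummy_root_length.cases) (auto simp: wpoints_def)
    then show ?thesis
      using V by auto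
  qed
  have key: "U \<in> subst_subtree i ?T' ` cuts a t \<union> image ?sh ` cuts a u \<longleftrightarrow>
      U \<in> subst_subtree i ?T' ` {S \<in> cuts a t. large_proper ?T S} \<union>
        image ?sh ` {S \<in> cuts a u. large_proper ?T' S} \<union> {?sh ` vset ?T'}"
    if lp: "large_proper ?T'' U" for U
  proof
    assume "U \<in> subst_subtree i ?T' ` cuts a t \<union> image ?sh ` cuts a u"
    then show "U \<in> subst_subtree i ?T' ` {S \<in> cuts a t. large_proper ?T S} \<union>
        image ?sh ` {S \<in> cuts a u. large_proper ?T' S} \<union> {?sh ` vset ?T'}"
    proof
      assume "U \<in> subst_subtree i ?T' ` cuts a t"
      then obtain S where "U = subst_subtree i ?T' S" "S \<in> cuts a t"
        by (rule imageE)
      from 1[OF lp this] show ?thesis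
        by (elim disjE) simp_all
    next
      assume "U \<in> image ?sh ` cuts a u"
      then obtain S where "U = ?sh ` S" "S \<in> cuts a u"
        by (rule imageE)
      from 2[OF lp this] show ?thesis
        by (elim disjE) simp_all
    qed
  next
    assume "U \<in> subst_subtree i ?T' ` {S \<in> cuts a t. large_proper ?T S} \<union>
        image ?sh ` {S \<in> cuts a u. large_proper ?T' S} \<union> {?sh ` vset ?T'}"
    then consider "U \<in> subst_subtree i ?T' ` {S \<in> cuts a t. large_proper ?T S}"
      | "U \<in> image ?sh ` {S \<in> cuts a u. large_proper ?T' S}" | "U = ?sh ` vset ?T'"
      by (elim UnE) simp_all
    then show "U \<in> subst_subtree i ?T' ` cuts a t \<union> image ?sh ` cuts a u"
    proof cases
      case 1
      then show ?thesis
        by (intro UnI1) (elim imageE, simp)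
    next
      case 2
      then show ?thesis
        by (intro UnI2) (elim imageE, simp)
    next
      case 3
      then show ?thesis
        using \<open>large_proper ?T'' (?sh ` vset ?T') \<Longrightarrow> ?sh ` vset ?T' \<in> image ?sh ` cuts a u\<close> lp by simp
    qed
  qed
  \<comment> \<open>Both sides carry the same filter for large proper sets, so they have to be
    compared only on those.\<close>
  have conj: "(P \<and> Q) = (P' \<and> Q)" if "Q \<Longrightarrow> P = P'" for P P' Q
    using that by blast
  show ?thesis
    unfolding model_point_level[OF a(1)] cuts_graft(1) composite_graft(3) subst_bracketing_def prod.case
    by (rule Collect_cong, rule conj[OF key])
qed

lemma model_point_graft: "model_point (graft i t u) = model_circ i (model_point t) (model_point u)"
proof -
  obtain T w T' w' where Tw: "model_point t = (T, w)" "model_point u = (T', w')"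
    by (metis surj_pair)
  have x: "(T, w) \<in> model_points c cs" and y: "(T', w') \<in> model_points (cs ! i) ds"
    using model_point_in[OF t] model_point_in[OF u] Tw by auto
  have T: "T = composite t" "T' = composite u"
    using Tw by (auto simp: model_point_def)
  have g: "model_point (graft i t u) \<in> model_points c (plug_profile i cs ds)"
    by (rule model_point_in[OF graft_wpoints])
  have "snd (model_point (graft i t u)) = snd (model_circ i (T, w) (T', w'))"
  proof (rule weights_eqI)
    show "0 \<le> snd (model_point (graft i t u)) S \<and> snd (model_point (graft i t u)) S \<le> 1" for S
      using model_points_props(2,3)[of "fst (model_point (graft i t u))" "snd (model_point (graft i t u))"] g by simp
    show "0 \<le> snd (model_circ i (T, w) (T', w')) S \<and> snd (model_circ i (T, w) (T', w')) S \<le> 1" for S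
      by (rule model_circ_bounds[OF x y])
    show "{S. a < snd (model_point (graft i t u)) S} = {S. a < snd (model_circ i (T, w) (T', w')) S}"
      if "0 \<le> a" "a < 1" for a
      using graft_level[OF that] model_circ_level[OF x y that] Tw T by simp
  qed
  moreover have "fst (model_point (graft i t u)) = fst (model_circ i (T, w) (T', w'))"
    using composite_graft(3) T by (simp add: model_point_def model_circ_def)
  ultimately show ?thesis
    unfolding Tw by (simp add: prod_eq_iff)
qed

end

lemma model_point_surj:
  assumes "x \<in> model_points c cs"
  shows "\<exists>t\<in>wpoints c cs. model_point t = x"
proof -
  have "x \<in> model_point ` wpoints c cs"
    using quotient_model_point[of c cs] assms unfolding quotient_map_def topspace_wspace topspace_model by simp
  then obtain t where "x = model_point t" "t \<in> wpoints c cs"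
    by (rule imageE)
  then show ?thesis
    by (intro bexI[of _ t]) simp_all
qed

text \<open>Checked on decorated trees representing the two points: that the positive weights form a
  bracketing is inherited from the graft, without a separate combinatorial argument.\<close>

lemma model_circ_in:
  assumes "x \<in> model_points c cs" "y \<in> model_points (cs ! i) ds" "i < length cs"
  shows "model_circ i x y \<in> model_points c (plug_profile i cs ds)"
proof -
  obtain t u where t: "t \<in> wpoints c cs" "model_point t = x" and u: "u \<in> wpoints (cs ! i) ds" "model_point u = y"
    using model_point_surj[OF assms(1)] model_point_surj[OF assms(2)] by (elim bexE)
  show ?thesis
    using model_point_in[OF graft_wpoints[OF t(1) u(1) assms(3)]]
    unfolding model_point_graft[OF t(1) u(1) assms(3)] t(2) u(2) .
qed

lemma relabel_facts:
  assumes t: "t \<in> wpoints c cs" and \<pi>: "\<pi> permutes {..<length cs}"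
  shows "relabel_leaves \<pi> t \<in> wpoints c (permute_list \<pi> cs)"
    and "model_point (relabel_leaves \<pi> t) = model_act \<pi> (model_point t)"
proof -
  let ?r = "inv_into UNIV \<pi>"
  have wf: "wf_wtree t" "rc t = c" "dummy_root_length t"
    using t by (auto simp: wpoints_def)
  have \<pi>r: "\<pi> (?r j) = j" "?r (\<pi> j) = j" for j
    using permutes_inverses[OF \<pi>] by auto
  have comp: "wf_wtree (relabel_leaves \<pi> t)" "rc (relabel_leaves \<pi> t) = c"
    "composite (relabel_leaves \<pi> t) = relabel_vertices \<pi> (composite t)"
    using composite_map_leaves[OF wf(1), of ?r] wf(2) unfolding relabel_leaves_def relabel_vertices_def by auto
  have "dummy_root_length (relabel_leaves \<pi> t)"
    unfolding relabel_plug by (rule dummy_plug) (use wf in auto)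
  then show w: "relabel_leaves \<pi> t \<in> wpoints c (permute_list \<pi> cs)"
    unfolding wpoints_iff using comp relabel_vertices_ltrees[OF composite_wpoints[OF t] \<pi>] by simp
  have im: "U \<in> image ?r ` C \<longleftrightarrow> \<pi> ` U \<in> C" for U C
  proof
    assume "U \<in> image ?r ` C"
    then obtain S where "S \<in> C" "U = ?r ` S"
      by blast
    moreover have "\<pi> ` ?r ` S = S"
      by (simp add: image_image \<pi>r)
    ultimately show "\<pi> ` U \<in> C"
      by simp
  next
    assume "\<pi> ` U \<in> C"
    moreover have "?r ` \<pi> ` U = U"
      by (simp add: image_image \<pi>r)
    ultimately show "U \<in> image ?r ` C"
      by (metis imageI)
  qed
  have lp: "large_proper (relabel_vertices \<pi> (composite t)) U \<longleftrightarrow> large_proper (composite t) (\<pi> ` U)" for U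
  proof -
    have "card (\<pi> ` U) = card U"
      by (rule card_image[OF permutes_inj_on[OF \<pi>]])
    moreover have "U = ?r ` vset (composite t) \<longleftrightarrow> \<pi> ` U = vset (composite t)"
    proof
      assume "U = ?r ` vset (composite t)"
      then show "\<pi> ` U = vset (composite t)"
        by (simp add: image_image \<pi>r)
    next
      assume "\<pi> ` U = vset (composite t)"
      from this[symmetric] show "U = ?r ` vset (composite t)"
        by (simp add: image_image \<pi>r)
    qed
    moreover have "vset (relabel_vertices \<pi> (composite t)) = ?r ` vset (composite t)"
      by (simp add: relabel_vertices_def ptree.set_map)
    ultimately show ?thesis
      by (simp only: large_proper_def)
  qed
  have "snd (model_point (relabel_leaves \<pi> t)) = (\<lambda>U. snd (model_point t) (\<pi> ` U))"
  proof (rule weights_eqI)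
    show "0 \<le> snd (model_point (relabel_leaves \<pi> t)) S \<and> snd (model_point (relabel_leaves \<pi> t)) S \<le> 1" for S
      using model_points_props(2,3)[of "fst (model_point (relabel_leaves \<pi> t))" "snd (model_point (relabel_leaves \<pi> t))"]
        model_point_in[OF w] by simp
    show "0 \<le> snd (model_point t) (\<pi> ` S) \<and> snd (model_point t) (\<pi> ` S) \<le> 1" for S
      using model_points_props(2,3)[of "fst (model_point t)" "snd (model_point t)"] model_point_in[OF t] by simp
    fix a :: real assume a: "0 \<le> a" "a < 1"
    have cuts: "cuts a (relabel_leaves \<pi> t) = image ?r ` cuts a t"
      unfolding relabel_leaves_def by (rule cuts_map_leaves)
    have "{S. a < snd (model_point (relabel_leaves \<pi> t)) S} =
        {U. \<pi> ` U \<in> cuts a t \<and> large_proper (composite t) (\<pi> ` U)}"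
      unfolding model_point_level[OF a(1)] comp(3) lp cuts im by (rule refl)
    also have "\<dots> = {U. \<pi> ` U \<in> {S. a < snd (model_point t) S}}"
      unfolding model_point_level[OF a(1)] by simp
    finally show "{S. a < snd (model_point (relabel_leaves \<pi> t)) S} = {S. a < snd (model_point t) (\<pi> ` S)}"
      by simp
  qed
  moreover have "fst (model_point (relabel_leaves \<pi> t)) = relabel_vertices \<pi> (fst (model_point t))"
    using comp(3) by (simp add: model_point_def)
  ultimately show "model_point (relabel_leaves \<pi> t) = model_act \<pi> (model_point t)"
    by (simp add: model_act_def prod_eq_iff case_prod_unfold)
qed

lemma model_act_in:
  assumes "x \<in> model_points c cs" "\<pi> permutes {..<length cs}"
  shows "model_act \<pi> x \<in> model_points c (permute_list \<pi> cs)"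
proof -
  obtain t where t: "t \<in> wpoints c cs" "model_point t = x"
    using model_point_surj[OF assms(1)] by (elim bexE)
  show ?thesis
    using model_point_in[OF relabel_facts(1)[OF t(1) assms(2)]] unfolding relabel_facts(2)[OF t(1) assms(2)] t(2) .
qed

lemma leaf_facts: "Leaf (c, 0) \<in> wpoints c [c]" "model_point (Leaf (c, 0)) = model_ident c"
proof -
  show "Leaf (c, 0) \<in> wpoints c [c]"
    by (auto simp: wpoints_def tag_distinct_def)
  show "model_point (Leaf (c, 0)) = model_ident c"
    by (simp add: model_point_def model_ident_def corolla_single fun_eq_iff)
qed

section \<open>The comparison maps\<close>

definition bracketed_point :: "bracketed_tree \<Rightarrow> ltree \<times> (nat set \<Rightarrow> real)" where
  "bracketed_point = (\<lambda>(T, z). (T, weight z))"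

lemma homeomorphic_weight_bracketings:
  "homeomorphic_map (realization (bracketings T))
     (subtopology (powertop_real UNIV) (weight_functions (bracketings T))) weight"
  by (rule homeomorphic_weight[OF finite_bracketings]) (rule bracketings_subset)

lemma weight_in: "z \<in> topspace (realization (bracketings T)) \<Longrightarrow> weight z \<in> weight_functions (bracketings T)"
  using homeomorphic_imp_surjective_map[OF homeomorphic_weight_bracketings[of T]] by auto

lemma BO_topspace:
  "(T, z) \<in> topspace (ops BO_operad n ms) \<longleftrightarrow> T \<in> ltrees n ms \<and> z \<in> topspace (realization (bracketings T))"
  by (simp add: BO_operad_def)

text \<open>On each summand this is \<open>homeomorphic_weight\<close>; the discrete factor of
  \<open>model\<close> separates the summands, which makes the map open.\<close>

lemma homeomorphic_bracketed_point: "homeomorphic_map (ops BO_operad n ms) (model n ms) bracketed_point"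
proof -
  let ?X = "sum_topology (\<lambda>T. realization (bracketings T)) (ltrees n ms)"
  let ?W = "\<lambda>T. subtopology (powertop_real UNIV) (weight_functions (bracketings T)) :: (nat set \<Rightarrow> real) topology"
  have cont: "continuous_map ?X (model n ms) bracketed_point"
  proof (rule continuous_map_from_sum_topology)
    fix T assume T: "T \<in> ltrees n ms"
    have "continuous_map (realization (bracketings T)) (?W T) weight"
      by (rule homeomorphic_imp_continuous_map[OF homeomorphic_weight_bracketings])
    then have "continuous_map (realization (bracketings T)) (powertop_real UNIV) weight"
      by (simp add: continuous_map_in_subtopology)
    then have "continuous_map (realization (bracketings T))
        (prod_topology (discrete_topology (ltrees n ms)) (powertop_real UNIV)) (\<lambda>z. (T, weight z))"
      using T by (intro continuous_map_pairedI) auto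
    then have "continuous_map (realization (bracketings T)) (model n ms) (\<lambda>z. (T, weight z))"
      unfolding model_def using T weight_in
      by (intro continuous_map_into_subtopology) (auto simp: model_points_def)
    then show "continuous_map (realization (bracketings T)) (model n ms) (\<lambda>z. bracketed_point (T, z))"
      by (simp add: bracketed_point_def)
  qed
  have inj: "inj_on bracketed_point (topspace ?X)"
  proof (rule inj_onI)
    fix p q assume *: "p \<in> topspace ?X" "q \<in> topspace ?X" "bracketed_point p = bracketed_point q"
    then obtain T z z' where pq: "p = (T, z)" "q = (T, z')" "weight z = weight z'"
      by (auto simp: bracketed_point_def)
    then have "z \<in> topspace (realization (bracketings T))" "z' \<in> topspace (realization (bracketings T))"
      using * by auto
    then show "p = q"
      using homeomorphic_imp_injective_map[OF homeomorphic_weight_bracketings[of T]] pq by (auto dest: inj_onD)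
  qed
  have opn: "open_map ?X (model n ms) bracketed_point"
    unfolding open_map_def
  proof (intro allI impI)
    fix U assume U: "openin ?X U"
    have "openin (?W T) (weight ` {z. (T, z) \<in> U})" if "T \<in> ltrees n ms" for T
      using homeomorphic_imp_open_map[OF homeomorphic_weight_bracketings[of T]] U that
      by (auto simp: open_map_def openin_sum_topology)
    then have "\<forall>T\<in>ltrees n ms. \<exists>V. openin (powertop_real UNIV) V \<and>
        weight ` {z. (T, z) \<in> U} = V \<inter> weight_functions (bracketings T)"
      by (simp add: openin_subtopology)
    from bchoice[OF this] obtain V where V: "\<And>T. T \<in> ltrees n ms \<Longrightarrow> openin (powertop_real UNIV) (V T) \<and>
        weight ` {z. (T, z) \<in> U} = V T \<inter> weight_functions (bracketings T)"
      by blast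
    have "openin (prod_topology (discrete_topology (ltrees n ms)) (powertop_real UNIV)) (\<Union>T\<in>ltrees n ms. {T} \<times> V T)"
    proof (intro openin_Union ballI)
      fix C assume "C \<in> (\<lambda>T. {T} \<times> V T) ` ltrees n ms"
      then show "openin (prod_topology (discrete_topology (ltrees n ms)) (powertop_real UNIV)) C"
        using V by (auto simp: openin_prod_Times_iff)
    qed
    moreover have "bracketed_point ` U = (\<Union>T\<in>ltrees n ms. {T} \<times> V T) \<inter> model_points n ms"
    proof (intro equalityI subsetI)
      fix y assume "y \<in> bracketed_point ` U"
      then obtain T z where Tz: "(T, z) \<in> U" "y = (T, weight z)"
        by (auto simp: bracketed_point_def)
      then have T: "T \<in> ltrees n ms"
        using openin_subset[OF U] by auto
      have "weight z \<in> V T \<inter> weight_functions (bracketings T)"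
        using V[OF T] Tz by blast
      then show "y \<in> (\<Union>T\<in>ltrees n ms. {T} \<times> V T) \<inter> model_points n ms"
        using T Tz by (auto simp: model_points_def)
    next
      fix y assume "y \<in> (\<Union>T\<in>ltrees n ms. {T} \<times> V T) \<inter> model_points n ms"
      then obtain T w where Tw: "y = (T, w)" "T \<in> ltrees n ms" "w \<in> V T \<inter> weight_functions (bracketings T)"
        by (auto simp: model_points_def)
      then have "w \<in> weight ` {z. (T, z) \<in> U}"
        using V by blast
      then show "y \<in> bracketed_point ` U"
        using Tw(1) by (force simp: bracketed_point_def)
    qed
    ultimately show "openin (model n ms) (bracketed_point ` U)"
      unfolding model_def openin_subtopology by blast
  qed
  have surj: "bracketed_point ` topspace ?X = topspace (model n ms)"
  proof (intro equalityI subsetI)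
    fix y assume "y \<in> bracketed_point ` topspace ?X"
    then show "y \<in> topspace (model n ms)"
      using weight_in by (auto simp: bracketed_point_def model_points_def)
  next
    fix y assume "y \<in> topspace (model n ms)"
    then obtain T w where y: "y = (T, w)" "T \<in> ltrees n ms" "w \<in> weight_functions (bracketings T)"
      by (auto simp: model_points_def)
    then obtain z where "z \<in> topspace (realization (bracketings T))" "w = weight z"
      using homeomorphic_imp_surjective_map[OF homeomorphic_weight_bracketings[of T]] by (force simp: image_iff)
    then show "y \<in> bracketed_point ` topspace ?X"
      using y by (force simp: bracketed_point_def)
  qed
  have "homeomorphic_map ?X (model n ms) bracketed_point"
    by (rule bijective_open_imp_homeomorphic_map[OF cont opn surj inj])
  then show ?thesis
    by (simp add: BO_operad_def)
qed

text \<open>A bracketing is the support of its indicator function, so the claim is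
  \<open>model_circ_in\<close> read at the threshold \<open>0\<close>.\<close>

lemma subst_bracketing_in:
  assumes T: "T \<in> ltrees c cs" and T': "T' \<in> ltrees (cs ! i) ds" and i: "i < length cs"
    and B: "B \<in> bracketings T" "B' \<in> bracketings T'"
  shows "subst_bracketing i T T' (B, B') \<in> bracketings (subst_vertex i T' T)"
proof -
  let ?w = "\<lambda>B S. if S \<in> B then 1 else 0 :: real"
  have lev: "{S. 0 < ?w B S} = B" for B :: "nat set set"
    by auto
  have x: "(T, ?w B) \<in> model_points c cs" and y: "(T', ?w B') \<in> model_points (cs ! i) ds"
    using T T' B by (simp_all add: model_points_def weight_functions_def)
  have "{U. 0 < snd (model_circ i (T, ?w B) (T', ?w B')) U} \<in> bracketings (subst_vertex i T' T)"
    using model_points_props(4)[of "fst (model_circ i (T, ?w B) (T', ?w B'))" "snd (model_circ i (T, ?w B) (T', ?w B'))" _ _ 0]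
      model_circ_in[OF x y i] by (simp add: model_circ_def)
  then show ?thesis
    using model_circ_level[OF x y, of 0 i] unfolding lev by simp
qed

lemma rlevel_weight:
  assumes "z \<in> topspace (realization A)" "0 \<le> a" "a < 1"
  shows "{S. a < weight z S} = rlevel z (1 - a)"
  using weight_level[OF assms(1), of "1 - a"] assms(2,3) by auto

text \<open>Maps of realizations act pointwise on step functions, so at \<open>1 - a\<close> the
  composite has the value of \<open>subst_bracketing\<close> on the superlevel sets at
  \<open>a\<close>. By \<open>model_circ_level\<close> this is the superlevel set of
  \<open>model_circ\<close>.\<close>

lemma bracketed_point_circ:
  assumes x: "x \<in> topspace (ops BO_operad c cs)" and y: "y \<in> topspace (ops BO_operad (cs ! i) ds)" and i: "i < length cs"
  shows "BO_circ i x y \<in> topspace (ops BO_operad c (plug_profile i cs ds))"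
    and "bracketed_point (BO_circ i x y) = model_circ i (bracketed_point x) (bracketed_point y)"
proof -
  obtain T z T' z' where xy: "x = (T, z)" "y = (T', z')"
    by (metis surj_pair)
  have T: "T \<in> ltrees c cs" "T' \<in> ltrees (cs ! i) ds"
    and z: "z \<in> topspace (realization (bracketings T))" "z' \<in> topspace (realization (bracketings T'))"
    using x y by (auto simp: xy BO_topspace)
  let ?T = "subst_vertex i T' T"
  let ?f = "subst_bracketing i T T'"
  let ?p = "real_pair (bracketings T) (bracketings T') z z'"
  let ?m = "real_map (bracketings ?T) ?f ?p"
  have f_in: "?f b \<in> bracketings ?T" if "b \<in> bracketings T \<times> bracketings T'" for b
    using subst_bracketing_in[OF T i] that by (cases b) auto
  have f_mono: "?f b \<le> ?f b'" if "b \<le> b'" for b b'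
    using that by (auto simp: subst_bracketing_def less_eq_prod_def case_prod_unfold)
  have m_in: "?m \<in> topspace (realization (bracketings ?T))"
    using f_in f_mono by (intro real_map_in[OF real_pair_in[OF z]]) auto
  have m_level: "rlevel ?m v = ?f (rlevel z v, rlevel z' v)" if "0 < v" "v \<le> 1" for v
    using rlevel_real_map[OF real_pair_in[OF z], of ?f "bracketings ?T" v] f_in f_mono that
      rlevel_real_pair[OF z that] by simp
  show "BO_circ i x y \<in> topspace (ops BO_operad c (plug_profile i cs ds))"
    using m_in subst_vertex_ltrees[OF T i] by (simp add: BO_circ_def xy BO_topspace)
  have mx: "(T, weight z) \<in> model_points c cs" and my: "(T', weight z') \<in> model_points (cs ! i) ds"
    using T weight_in[OF z(1)] weight_in[OF z(2)] by (simp_all add: model_points_def)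
  have "weight ?m = snd (model_circ i (T, weight z) (T', weight z'))"
  proof (rule weights_eqI)
    show "0 \<le> weight ?m S \<and> weight ?m S \<le> 1" for S
      using weight_in[OF m_in] by (simp add: weight_functions_def)
    show "0 \<le> snd (model_circ i (T, weight z) (T', weight z')) S \<and> snd (model_circ i (T, weight z) (T', weight z')) S \<le> 1" for S
      by (rule model_circ_bounds[OF mx my])
    fix a :: real assume a: "0 \<le> a" "a < 1"
    have "{S. a < weight ?m S} = ?f (rlevel z (1 - a), rlevel z' (1 - a))"
      using rlevel_weight[OF m_in a] m_level[of "1 - a"] a by simp
    also have "\<dots> = {S. a < snd (model_circ i (T, weight z) (T', weight z')) S}"
      using model_circ_level[OF mx my a] rlevel_weight[OF z(1) a] rlevel_weight[OF z(2) a] by simp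
    finally show "{S. a < weight ?m S} = {S. a < snd (model_circ i (T, weight z) (T', weight z')) S}" .
  qed
  then show "bracketed_point (BO_circ i x y) = model_circ i (bracketed_point x) (bracketed_point y)"
    by (simp add: BO_circ_def xy bracketed_point_def prod_eq_iff) (simp add: model_circ_def)
qed

lemma bracketed_point_act:
  assumes x: "x \<in> topspace (ops BO_operad c cs)" and \<pi>: "\<pi> permutes {..<length cs}"
  shows "BO_act \<pi> x \<in> topspace (ops BO_operad c (permute_list \<pi> cs))"
    and "bracketed_point (BO_act \<pi> x) = model_act \<pi> (bracketed_point x)"
proof -
  obtain T z where xT: "x = (T, z)"
    by (metis surj_pair)
  have T: "T \<in> ltrees c cs" and z: "z \<in> topspace (realization (bracketings T))"
    using x by (auto simp: xT BO_topspace)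
  let ?r = "inv_into UNIV \<pi>"
  let ?T = "relabel_vertices \<pi> T"
  let ?f = "image (image ?r)"
  let ?m = "real_map (bracketings ?T) ?f z"
  have \<pi>r: "\<pi> (?r j) = j" "?r (\<pi> j) = j" for j
    using permutes_inverses[OF \<pi>] by auto
  have im: "?f B = {U. \<pi> ` U \<in> B}" for B
  proof (intro equalityI subsetI)
    fix U assume "U \<in> ?f B"
    then obtain S where "S \<in> B" "U = ?r ` S"
      by blast
    then show "U \<in> {U. \<pi> ` U \<in> B}"
      by (simp add: image_image \<pi>r)
  next
    fix U assume "U \<in> {U. \<pi> ` U \<in> B}"
    moreover have "U = ?r ` \<pi> ` U"
      by (simp add: image_image \<pi>r)
    ultimately show "U \<in> ?f B"
      by blast
  qed
  have f_in: "?f B \<in> bracketings ?T" if B: "B \<in> bracketings T" for B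
  proof -
    \<comment> \<open>Again the bracketing is viewed as the support of its indicator
      function.\<close>
    let ?w = "\<lambda>S. if S \<in> B then 1 else 0 :: real"
    have "{S. 0 < ?w S} = B"
      by auto
    then have "(T, ?w) \<in> model_points c cs"
      using T B by (simp add: model_points_def weight_functions_def)
    then have "(?T, \<lambda>U. ?w (\<pi> ` U)) \<in> model_points c (permute_list \<pi> cs)"
      using model_act_in[OF _ \<pi>, of "(T, ?w)"] by (simp add: model_act_def)
    from model_points_props(4)[OF this, of 0] have "{U. 0 < ?w (\<pi> ` U)} \<in> bracketings ?T"
      by simp
    moreover have "{U. 0 < ?w (\<pi> ` U)} = ?f B"
      unfolding im by auto
    ultimately show ?thesis
      by simp
  qed
  have f_mono: "?f b \<le> ?f b'" if "b \<le> b'" for b b' :: "nat set set"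
    using that by (rule image_mono)
  have m_in: "?m \<in> topspace (realization (bracketings ?T))"
    using f_in f_mono by (intro real_map_in[OF z]) auto
  have m_level: "rlevel ?m v = ?f (rlevel z v)" if "0 < v" "v \<le> 1" for v
    using rlevel_real_map[OF z, of ?f "bracketings ?T" v] f_in f_mono that by simp
  show "BO_act \<pi> x \<in> topspace (ops BO_operad c (permute_list \<pi> cs))"
    using m_in relabel_vertices_ltrees[OF T \<pi>] by (simp add: BO_act_def xT BO_topspace)
  have bnd: "0 \<le> weight z S \<and> weight z S \<le> 1" "0 \<le> weight ?m S \<and> weight ?m S \<le> 1" for S
    using weight_in[OF z] weight_in[OF m_in] by (simp_all add: weight_functions_def)
  have "weight ?m = (\<lambda>U. weight z (\<pi> ` U))"
  proof (rule weights_eqI[OF bnd(2) bnd(1)])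
    fix a :: real assume a: "0 \<le> a" "a < 1"
    have "{S. a < weight ?m S} = ?f {S. a < weight z S}"
      using rlevel_weight[OF m_in a] m_level[of "1 - a"] rlevel_weight[OF z a] a by simp
    then show "{S. a < weight ?m S} = {S. a < weight z (\<pi> ` S)}"
      unfolding im by simp
  qed
  then show "bracketed_point (BO_act \<pi> x) = model_act \<pi> (bracketed_point x)"
    by (simp add: BO_act_def xT bracketed_point_def model_act_def)
qed

lemma bracketed_point_ident:
  "BO_ident n \<in> topspace (ops BO_operad n [n])" "bracketed_point (BO_ident n) = model_ident n"
proof -
  let ?p = "([{}], \<lambda>j. if j = 0 then 1 else 0) :: nat set set simplex_point"
  have c: "corolla n \<in> ltrees n [n]"
    by (simp add: corolla_single ltrees_iff)
  have "{} \<in> bracketings (corolla n)"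
    by (simp add: bracketings_def)
  then have p: "?p \<in> topspace (nerve_space (bracketings (corolla n)))"
    by (auto simp: nerve_space_iff standard_simplex_def)
  show "BO_ident n \<in> topspace (ops BO_operad n [n])"
    using c real_class_in[OF p] by (simp add: BO_ident_def BO_topspace)
  have "weight (real_class (bracketings (corolla n)) ?p) = vertex_weight ?p"
    by (rule weight_point[OF real_class_in[OF p] real_class_self[OF p]])
  also have "\<dots> = (\<lambda>_. 0)"
    by (simp add: vertex_weight_def fun_eq_iff)
  finally show "bracketed_point (BO_ident n) = model_ident n"
    by (simp add: BO_ident_def bracketed_point_def model_ident_def)
qed

section \<open>The comparison map on the quotient of decorated trees\<close>

definition class_point :: "(nat, ltree) wtree set \<Rightarrow> ltree \<times> (nat set \<Rightarrow> real)" where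
  "class_point X = model_point (SOME t. t \<in> X)"

lemma class_point_class:
  assumes "t \<in> wpoints c cs"
  shows "class_point (w0_class O_operad t) = model_point t"
proof -
  have "t \<in> w0_class O_operad t"
    using assms by (simp add: w0_class_model_point)
  then have "(SOME u. u \<in> w0_class O_operad t) \<in> w0_class O_operad t"
    by (rule someI)
  then show ?thesis
    using assms by (simp add: class_point_def w0_class_model_point)
qed

lemma W0_topspace: "topspace (ops (W0 O_operad) c cs) = w0_class O_operad ` wpoints c cs"
  by (simp add: W0_def topspace_wspace)

lemma homeomorphic_class_point: "homeomorphic_map (ops (W0 O_operad) c cs) (model c cs) class_point"
proof -
  have "homeomorphic_map (quot_topology (wspace O_operad c cs) (w0_class O_operad)) (model c cs) class_point"
    using quotient_model_point
  proof (rule homeomorphic_map_quot_topology)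
    fix x y assume "x \<in> topspace (wspace O_operad c cs)" "y \<in> topspace (wspace O_operad c cs)" "model_point x = model_point y"
    then show "w0_class O_operad x = w0_class O_operad y"
      by (simp add: topspace_wspace w0_class_model_point)
  next
    fix x assume "x \<in> topspace (wspace O_operad c cs)"
    then show "class_point (w0_class O_operad x) = model_point x"
      using class_point_class by (simp add: topspace_wspace)
  qed
  then show ?thesis
    by (simp add: W0_def)
qed

lemma class_eqI: "t \<in> wpoints c cs \<Longrightarrow> u \<in> wpoints c cs \<Longrightarrow> model_point t = model_point u \<Longrightarrow> w0_class O_operad t = w0_class O_operad u"
  by (simp add: w0_class_model_point)

text \<open>By \<open>model_point_graft\<close> the class of the graft depends only on the two
  classes, so all members of the union agree.\<close>

lemma W0_circ:
  assumes t: "t \<in> wpoints c cs" and u: "u \<in> wpoints (cs ! i) ds" and i: "i < length cs"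
  shows "circ (W0 O_operad) i (w0_class O_operad t) (w0_class O_operad u) = w0_class O_operad (graft i t u)"
proof -
  have "w0_class O_operad (graft i t' u') = w0_class O_operad (graft i t u)"
    if "t' \<in> w0_class O_operad t" "u' \<in> w0_class O_operad u" for t' u'
  proof -
    have t': "t' \<in> wpoints c cs" "model_point t' = model_point t"
      and u': "u' \<in> wpoints (cs ! i) ds" "model_point u' = model_point u"
      using that t u by (simp_all add: w0_class_model_point)
    show ?thesis
      using model_point_graft[OF t u i] model_point_graft[OF t'(1) u'(1) i] t'(2) u'(2)
      by (intro class_eqI[OF graft_wpoints[OF t'(1) u'(1) i] graft_wpoints[OF t u i]]) simp
  qed
  moreover have "w0_class O_operad t \<noteq> {}" "w0_class O_operad u \<noteq> {}"
    using t u by (auto simp: w0_class_model_point)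
  ultimately have "(\<Union>t'\<in>w0_class O_operad t. \<Union>u'\<in>w0_class O_operad u. w0_class O_operad (graft i t' u'))
      = w0_class O_operad (graft i t u)"
    by (intro SUP_eq_const)
  then show ?thesis
    by (simp add: W0_def)
qed

lemma class_point_circ:
  assumes x: "x \<in> topspace (ops (W0 O_operad) c cs)" and y: "y \<in> topspace (ops (W0 O_operad) (cs ! i) ds)" and i: "i < length cs"
  shows "circ (W0 O_operad) i x y \<in> topspace (ops (W0 O_operad) c (plug_profile i cs ds))"
    and "class_point (circ (W0 O_operad) i x y) = model_circ i (class_point x) (class_point y)"
proof -
  obtain t u where t: "t \<in> wpoints c cs" "x = w0_class O_operad t" and u: "u \<in> wpoints (cs ! i) ds" "y = w0_class O_operad u"
    using x y unfolding W0_topspace by blast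
  have g: "graft i t u \<in> wpoints c (plug_profile i cs ds)"
    by (rule graft_wpoints[OF t(1) u(1) i])
  have circ: "circ (W0 O_operad) i x y = w0_class O_operad (graft i t u)"
    unfolding t u by (rule W0_circ[OF t(1) u(1) i])
  show "circ (W0 O_operad) i x y \<in> topspace (ops (W0 O_operad) c (plug_profile i cs ds))"
    unfolding circ W0_topspace using g by (rule imageI)
  show "class_point (circ (W0 O_operad) i x y) = model_circ i (class_point x) (class_point y)"
    unfolding circ class_point_class[OF g] unfolding t u class_point_class[OF t(1)] class_point_class[OF u(1)]
    by (rule model_point_graft[OF t(1) u(1) i])
qed

lemma class_point_act:
  assumes x: "x \<in> topspace (ops (W0 O_operad) c cs)" and \<pi>: "\<pi> permutes {..<length cs}"
  shows "act (W0 O_operad) \<pi> x \<in> topspace (ops (W0 O_operad) c (permute_list \<pi> cs))"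
    and "class_point (act (W0 O_operad) \<pi> x) = model_act \<pi> (class_point x)"
proof -
  obtain t where t: "t \<in> wpoints c cs" "x = w0_class O_operad t"
    using x unfolding W0_topspace by blast
  have "w0_class O_operad (relabel_leaves \<pi> t') = w0_class O_operad (relabel_leaves \<pi> t)" if "t' \<in> w0_class O_operad t" for t'
  proof -
    have t': "t' \<in> wpoints c cs" "model_point t' = model_point t"
      using that t by (simp_all add: w0_class_model_point)
    show ?thesis
      using relabel_facts[OF t(1) \<pi>] relabel_facts[OF t'(1) \<pi>] t'(2) by (intro class_eqI) auto
  qed
  moreover have "w0_class O_operad t \<noteq> {}"
    using t by (auto simp: w0_class_model_point)
  ultimately have "(\<Union>t'\<in>w0_class O_operad t. w0_class O_operad (relabel_leaves \<pi> t')) = w0_class O_operad (relabel_leaves \<pi> t)"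
    by (intro SUP_eq_const)
  then have act: "act (W0 O_operad) \<pi> x = w0_class O_operad (relabel_leaves \<pi> t)"
    unfolding t by (simp add: W0_def)
  show "act (W0 O_operad) \<pi> x \<in> topspace (ops (W0 O_operad) c (permute_list \<pi> cs))"
    unfolding act W0_topspace using relabel_facts(1)[OF t(1) \<pi>] by (rule imageI)
  show "class_point (act (W0 O_operad) \<pi> x) = model_act \<pi> (class_point x)"
    unfolding act class_point_class[OF relabel_facts(1)[OF t(1) \<pi>]] unfolding t class_point_class[OF t(1)]
    by (rule relabel_facts(2)[OF t(1) \<pi>])
qed

lemma class_point_ident:
  "ident (W0 O_operad) c \<in> topspace (ops (W0 O_operad) c [c])" "class_point (ident (W0 O_operad) c) = model_ident c"
proof -
  have i: "ident (W0 O_operad) c = w0_class O_operad (Leaf (c, 0))"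
    by (simp add: W0_def)
  show "ident (W0 O_operad) c \<in> topspace (ops (W0 O_operad) c [c])"
    unfolding i W0_topspace using leaf_facts(1) by (rule imageI)
  show "class_point (ident (W0 O_operad) c) = model_ident c"
    unfolding i class_point_class[OF leaf_facts(1)] by (rule leaf_facts(2))
qed

section \<open>Operads modelled on a topological operad\<close>

lemma length_plug_profile: "i < length cs \<Longrightarrow> length (plug_profile i cs ds) = length cs - 1 + length ds"
  by (simp add: plug_profile_def)

lemma nth_plug_profile_inner: "i < length cs \<Longrightarrow> j < length ds \<Longrightarrow> plug_profile i cs ds ! (i + j) = ds ! j"
  by (simp add: plug_profile_def nth_append)

lemma nth_plug_profile_outer:
  assumes "i < length cs" "k < length cs" "k \<noteq> i"
  shows "plug_profile i cs ds ! outer_idx i (length ds) k = cs ! k"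
    and "outer_idx i (length ds) k < length (plug_profile i cs ds)"
proof -
  show "outer_idx i (length ds) k < length (plug_profile i cs ds)"
    using assms by (auto simp: length_plug_profile outer_idx_def)
  show "plug_profile i cs ds ! outer_idx i (length ds) k = cs ! k"
  proof (cases "k < i")
    case False
    then have "\<not> k + length ds - 1 < i" "\<not> k + length ds - 1 - i < length ds"
      "Suc i + (k + length ds - 1 - i - length ds) = k"
      using assms(3) by auto
    then show ?thesis
      using assms False by (simp add: plug_profile_def outer_idx_def nth_append)
  qed (use assms in \<open>simp add: plug_profile_def outer_idx_def nth_append\<close>)
qed

text \<open>A single map \<open>h\<close> serves all profiles, since operations are not indexed by
  profiles; \<open>profile_unique\<close> makes it injective across them. Closure of
  \<open>P\<close> under its operations ensures that both sides of an axiom are points, where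
  \<open>h\<close> can be cancelled.\<close>

locale modelled_operad = M: topological_operad M
  for M :: "('c, 'y) operad" and P :: "('c, 'x) operad" and h :: "'x \<Rightarrow> 'y" +
  assumes profile_unique:
      "m \<in> topspace (ops M c cs) \<Longrightarrow> m \<in> topspace (ops M c' cs') \<Longrightarrow> c = c' \<and> cs = cs'"
    and homeo: "homeomorphic_map (ops P c cs) (ops M c cs) h"
    and ident_in: "ident P c \<in> topspace (ops P c [c])"
    and h_ident: "h (ident P c) = ident M c"
    and circ_in: "\<lbrakk>x \<in> topspace (ops P c cs); y \<in> topspace (ops P (cs ! i) ds); i < length cs\<rbrakk>
      \<Longrightarrow> circ P i x y \<in> topspace (ops P c (plug_profile i cs ds))"
    and h_circ: "\<lbrakk>x \<in> topspace (ops P c cs); y \<in> topspace (ops P (cs ! i) ds); i < length cs\<rbrakk>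
      \<Longrightarrow> h (circ P i x y) = circ M i (h x) (h y)"
    and act_in: "\<lbrakk>x \<in> topspace (ops P c cs); \<pi> permutes {..<length cs}\<rbrakk>
      \<Longrightarrow> act P \<pi> x \<in> topspace (ops P c (permute_list \<pi> cs))"
    and h_act: "\<lbrakk>x \<in> topspace (ops P c cs); \<pi> permutes {..<length cs}\<rbrakk>
      \<Longrightarrow> h (act P \<pi> x) = act M \<pi> (h x)"
begin

lemma h_in: "x \<in> topspace (ops P c cs) \<Longrightarrow> h x \<in> topspace (ops M c cs)"
  using homeomorphic_imp_surjective_map[OF homeo[of c cs]] by blast

lemma h_inj:
  assumes "x \<in> topspace (ops P c cs)" "y \<in> topspace (ops P c' cs')" "h x = h y"
  shows "x = y"
proof -
  have "c = c' \<and> cs = cs'"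
    using profile_unique[OF h_in[OF assms(1)], of c' cs'] h_in[OF assms(2)] assms(3) by simp
  then show ?thesis
    using homeomorphic_imp_injective_map[OF homeo[of c cs]] assms by (simp add: inj_on_eq_iff)
qed

lemma continuous_pullback:
  assumes "continuous_map X (ops M c cs) (h \<circ> f)" "f \<in> topspace X \<rightarrow> topspace (ops P c cs)"
  shows "continuous_map X (ops P c cs) f"
proof -
  obtain g where g: "homeomorphic_maps (ops P c cs) (ops M c cs) h g"
    using homeo homeomorphic_map_maps by blast
  have "continuous_map X (ops P c cs) (g \<circ> (h \<circ> f))"
    using g by (intro continuous_map_compose[OF assms(1)]) (simp add: homeomorphic_maps_def)
  then show ?thesis
    by (rule continuous_map_eq) (use g assms(2) in \<open>auto simp: homeomorphic_maps_def\<close>)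
qed

lemma continuous_h: "continuous_map (ops P c cs) (ops M c cs) h"
  by (rule homeomorphic_imp_continuous_map[OF homeo])

lemma topological_operad_modelled: "topological_operad P"
proof
  show "ident P c \<in> topspace (ops P c [c])" for c
    by (rule ident_in)
next
  fix i c and cs ds :: "'c list" assume i: "i < length cs"
  let ?X = "prod_topology (ops P c cs) (ops P (cs ! i) ds)"
  have "continuous_map ?X (prod_topology (ops M c cs) (ops M (cs ! i) ds)) (\<lambda>p. (h (fst p), h (snd p)))"
    by (intro continuous_map_pairedI continuous_map_compose[OF continuous_map_fst continuous_h, unfolded comp_def]
        continuous_map_compose[OF continuous_map_snd continuous_h, unfolded comp_def])
  from continuous_map_compose[OF this M.circ_continuous[OF i]]
  have "continuous_map ?X (ops M c (plug_profile i cs ds)) (h \<circ> (\<lambda>(x, y). circ P i x y))"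
    by (rule continuous_map_eq) (use i in \<open>auto simp: h_circ\<close>)
  then show "continuous_map ?X (ops P c (plug_profile i cs ds)) (\<lambda>(x, y). circ P i x y)"
    by (rule continuous_pullback) (use i circ_in in auto)
next
  fix \<pi> c and cs :: "'c list" assume \<pi>: "\<pi> permutes {..<length cs}"
  from continuous_map_compose[OF continuous_h[of c cs] M.act_continuous[OF this]]
  have "continuous_map (ops P c cs) (ops M c (permute_list \<pi> cs)) (h \<circ> act P \<pi>)"
    by (rule continuous_map_eq) (use \<pi> in \<open>auto simp: h_act\<close>)
  then show "continuous_map (ops P c cs) (ops P c (permute_list \<pi> cs)) (act P \<pi>)"
    by (rule continuous_pullback) (use \<pi> act_in in auto)
next
  fix x c and cs :: "'c list" assume x: "x \<in> topspace (ops P c cs)"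
  have "h (circ P 0 (ident P c) x) = h x"
    using h_circ[OF ident_in[of c], of x 0 cs] x M.circ_ident_left[OF h_in[OF x]] by (simp add: h_ident)
  then show "circ P 0 (ident P c) x = x"
    using circ_in[OF ident_in[of c], of x 0 cs] x by (intro h_inj[OF _ x]) auto
next
  fix x c i and cs :: "'c list" assume x: "x \<in> topspace (ops P c cs)" and i: "i < length cs"
  have "h (circ P i x (ident P (cs ! i))) = h x"
    using h_circ[OF x ident_in i] M.circ_ident_right[OF h_in[OF x] i] by (simp add: h_ident)
  then show "circ P i x (ident P (cs ! i)) = x"
    using circ_in[OF x ident_in i] by (intro h_inj[OF _ x])
next
  fix x c i y j z and cs ds es :: "'c list"
  assume x: "x \<in> topspace (ops P c cs)" and i: "i < length cs" and y: "y \<in> topspace (ops P (cs ! i) ds)"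
    and j: "j < length ds" and z: "z \<in> topspace (ops P (ds ! j) es)"
  have ij: "i + j < length (plug_profile i cs ds)"
    using i j by (simp add: length_plug_profile)
  have z': "z \<in> topspace (ops P (plug_profile i cs ds ! (i + j)) es)"
    using z nth_plug_profile_inner[OF i j] by simp
  note a = circ_in[OF x y i] and b = circ_in[OF y z j]
  have "h (circ P (i + j) (circ P i x y) z) = h (circ P i x (circ P j y z))"
    unfolding h_circ[OF a z' ij] h_circ[OF x b i] h_circ[OF x y i] h_circ[OF y z j]
    by (rule M.circ_assoc_sequential[OF h_in[OF x] i h_in[OF y] j h_in[OF z]])
  then show "circ P (i + j) (circ P i x y) z = circ P i x (circ P j y z)"
    by (rule h_inj[OF circ_in[OF a z' ij] circ_in[OF x b i]])
next
  fix x c i k y z and cs ds es :: "'c list"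
  assume x: "x \<in> topspace (ops P c cs)" and ik: "i < k" and k: "k < length cs"
    and y: "y \<in> topspace (ops P (cs ! i) ds)" and z: "z \<in> topspace (ops P (cs ! k) es)"
  have i: "i < length cs"
    using ik k by simp
  have z': "z \<in> topspace (ops P (plug_profile i cs ds ! outer_idx i (length ds) k) es)"
    using z nth_plug_profile_outer(1)[OF i k] ik by simp
  have k': "outer_idx i (length ds) k < length (plug_profile i cs ds)"
    using nth_plug_profile_outer(2)[OF i k] ik by simp
  have y': "y \<in> topspace (ops P (plug_profile k cs es ! i) ds)" and i': "i < length (plug_profile k cs es)"
    using y nth_plug_profile_outer[OF k i, of es] ik by (simp_all add: outer_idx_def)
  note a = circ_in[OF x y i] and b = circ_in[OF x z k]
  have "h (circ P (outer_idx i (length ds) k) (circ P i x y) z) = h (circ P i (circ P k x z) y)"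
    unfolding h_circ[OF a z' k'] h_circ[OF b y' i'] h_circ[OF x y i] h_circ[OF x z k]
    by (rule M.circ_assoc_parallel[OF h_in[OF x] ik k h_in[OF y] h_in[OF z]])
  then show "circ P (outer_idx i (length ds) k) (circ P i x y) z = circ P i (circ P k x z) y"
    by (rule h_inj[OF circ_in[OF a z' k'] circ_in[OF b y' i']])
next
  fix x c and cs :: "'c list" assume x: "x \<in> topspace (ops P c cs)"
  have "h (act P id x) = h x"
    using h_act[OF x permutes_id] M.act_id[OF h_in[OF x]] by simp
  then show "act P id x = x"
    by (rule h_inj[OF act_in[OF x permutes_id] x])
next
  fix x c \<pi> \<rho> and cs :: "'c list"
  assume x: "x \<in> topspace (ops P c cs)" and \<pi>: "\<pi> permutes {..<length cs}" and \<rho>: "\<rho> permutes {..<length cs}"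
  have \<rho>': "\<rho> permutes {..<length (permute_list \<pi> cs)}"
    using \<rho> by simp
  note c = permutes_compose[OF \<rho> \<pi>]
  have "h (act P \<rho> (act P \<pi> x)) = h (act P (\<pi> \<circ> \<rho>) x)"
    unfolding h_act[OF act_in[OF x \<pi>] \<rho>'] h_act[OF x \<pi>] h_act[OF x c] by (rule M.act_comp[OF h_in[OF x] \<pi> \<rho>])
  then show "act P \<rho> (act P \<pi> x) = act P (\<pi> \<circ> \<rho>) x"
    by (rule h_inj[OF act_in[OF act_in[OF x \<pi>] \<rho>'] act_in[OF x c]])
next
  fix x c i y \<pi> \<rho> and cs ds :: "'c list"
  assume x: "x \<in> topspace (ops P c cs)" and i: "i < length cs" and y: "y \<in> topspace (ops P (cs ! i) ds)"
    and \<pi>: "\<pi> permutes {..<length ds}" and \<rho>: "\<rho> permutes {..<length (plug_profile i cs ds)}"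
    and 1: "\<And>j. \<lbrakk>j < length cs; j \<noteq> i\<rbrakk> \<Longrightarrow> \<rho> (outer_idx i (length ds) j) = outer_idx i (length ds) j"
    and 2: "\<And>j. j < length ds \<Longrightarrow> \<rho> (i + j) = i + \<pi> j"
  note a = act_in[OF y \<pi>] and b = circ_in[OF x y i]
  have "h (circ P i x (act P \<pi> y)) = h (act P \<rho> (circ P i x y))"
    unfolding h_circ[OF x a i] h_act[OF b \<rho>] h_act[OF y \<pi>] h_circ[OF x y i]
    by (rule M.circ_act_inner[OF h_in[OF x] i h_in[OF y] \<pi> \<rho> 1 2])
  then show "circ P i x (act P \<pi> y) = act P \<rho> (circ P i x y)"
    by (rule h_inj[OF circ_in[OF x a i] act_in[OF b \<rho>]])
next
  fix x c i y \<pi> \<rho> and cs ds :: "'c list"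
  assume x: "x \<in> topspace (ops P c cs)" and i: "i < length cs" and y: "y \<in> topspace (ops P (cs ! \<pi> i) ds)"
    and \<pi>: "\<pi> permutes {..<length cs}" and \<rho>: "\<rho> permutes {..<length (plug_profile (\<pi> i) cs ds)}"
    and 1: "\<And>j. \<lbrakk>j < length cs; j \<noteq> i\<rbrakk> \<Longrightarrow> \<rho> (outer_idx i (length ds) j) = outer_idx (\<pi> i) (length ds) (\<pi> j)"
    and 2: "\<And>j. j < length ds \<Longrightarrow> \<rho> (i + j) = \<pi> i + j"
  have \<pi>i: "\<pi> i < length cs"
    using permutes_in_image[OF \<pi>, of i] i by simp
  have y': "y \<in> topspace (ops P (permute_list \<pi> cs ! i) ds)" and i': "i < length (permute_list \<pi> cs)"
    using y i permute_list_nth[OF \<pi> i] by simp_all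
  note a = act_in[OF x \<pi>] and b = circ_in[OF x y \<pi>i]
  have "h (circ P i (act P \<pi> x) y) = h (act P \<rho> (circ P (\<pi> i) x y))"
    unfolding h_circ[OF a y' i'] h_act[OF b \<rho>] h_act[OF x \<pi>] h_circ[OF x y \<pi>i]
    by (rule M.circ_act_outer[OF h_in[OF x] i h_in[OF y] \<pi> \<rho> 1 2])
  then show "circ P i (act P \<pi> x) y = act P \<rho> (circ P (\<pi> i) x y)"
    by (rule h_inj[OF circ_in[OF a y' i'] act_in[OF b \<rho>]])
qed

end

text \<open>On each profile the map is \<open>h\<close> followed by the inverse of \<open>k\<close>;
  its compatibility with the operations follows by cancelling \<open>k\<close>.\<close>

lemma operad_iso_modelled:
  assumes "modelled_operad M P h" "modelled_operad M Q k"
  shows "operad_iso P Q (\<lambda>c cs x. inv_into (topspace (ops Q c cs)) k (h x))"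
proof -
  interpret P: modelled_operad M P h by fact
  interpret Q: modelled_operad M Q k by fact
  let ?\<phi> = "\<lambda>c cs x. inv_into (topspace (ops Q c cs)) k (h x)"
  have \<phi>: "k (?\<phi> c cs x) = h x" "?\<phi> c cs x \<in> topspace (ops Q c cs)"
    if "x \<in> topspace (ops P c cs)" for c cs x
  proof -
    have "h x \<in> k ` topspace (ops Q c cs)"
      using P.h_in[OF that] homeomorphic_imp_surjective_map[OF Q.homeo[of c cs]] by simp
    then show "k (?\<phi> c cs x) = h x" "?\<phi> c cs x \<in> topspace (ops Q c cs)"
      by (rule f_inv_into_f, rule inv_into_into)
  qed
  have homeo: "homeomorphic_map (ops P c cs) (ops Q c cs) (?\<phi> c cs)" for c cs
  proof -
    obtain g where g: "homeomorphic_maps (ops Q c cs) (ops M c cs) k g"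
      using Q.homeo homeomorphic_map_maps by blast
    then have "homeomorphic_map (ops M c cs) (ops Q c cs) g"
      using homeomorphic_maps_sym homeomorphic_maps_map by blast
    then have "homeomorphic_map (ops P c cs) (ops Q c cs) (g \<circ> h)"
      by (rule homeomorphic_map_compose[OF P.homeo])
    moreover have "(g \<circ> h) x = ?\<phi> c cs x" if x: "x \<in> topspace (ops P c cs)" for x
      using \<phi>[OF x] g by (simp add: homeomorphic_maps_def) metis
    ultimately show ?thesis
      using homeomorphic_map_eq[of "ops P c cs" "ops Q c cs" "g \<circ> h" "?\<phi> c cs"] by blast
  qed
  have ident: "?\<phi> c [c] (ident P c) = ident Q c" for c
    using \<phi>[OF P.ident_in] by (intro Q.h_inj[OF _ Q.ident_in]) (simp_all add: P.h_ident Q.h_ident)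
  have circ: "?\<phi> c (plug_profile i cs ds) (circ P i x y) = circ Q i (?\<phi> c cs x) (?\<phi> (cs ! i) ds y)"
    if x: "x \<in> topspace (ops P c cs)" and y: "y \<in> topspace (ops P (cs ! i) ds)" and i: "i < length cs" for c cs i ds x y
    using Q.h_circ[OF \<phi>(2)[OF x] \<phi>(2)[OF y] i] P.h_circ[OF x y i] \<phi>(1)[OF x] \<phi>(1)[OF y] \<phi>(1)[OF P.circ_in[OF x y i]]
    by (intro Q.h_inj[OF \<phi>(2)[OF P.circ_in[OF x y i]] Q.circ_in[OF \<phi>(2)[OF x] \<phi>(2)[OF y] i]]) simp
  have act: "?\<phi> c (permute_list \<pi> cs) (act P \<pi> x) = act Q \<pi> (?\<phi> c cs x)"
    if x: "x \<in> topspace (ops P c cs)" and \<pi>: "\<pi> permutes {..<length cs}" for c cs \<pi> x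
    using Q.h_act[OF \<phi>(2)[OF x] \<pi>] P.h_act[OF x \<pi>] \<phi>(1)[OF x] \<phi>(1)[OF P.act_in[OF x \<pi>]]
    by (intro Q.h_inj[OF \<phi>(2)[OF P.act_in[OF x \<pi>]] Q.act_in[OF \<phi>(2)[OF x] \<pi>]]) simp
  show ?thesis
    unfolding operad_iso_def
    using P.topological_operad_modelled Q.topological_operad_modelled homeo ident circ act by simp
qed

section \<open>The operad of models\<close>

context
  fixes t u :: "(nat, ltree) wtree" and c i :: nat and cs ds :: "nat list"
  assumes t: "t \<in> wpoints c cs" and u: "u \<in> wpoints (cs ! i) ds" and i: "i < length cs"
begin

text \<open>The identity holds for the trees themselves, before passing to classes; it comes down to
  renumbering leaves. A leaf of \<open>t\<close> other than \<open>i\<close> is never hit by the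
  second grafting.\<close>

lemma graft_assoc_sequential:
  assumes j: "j < length ds" and v: "v \<in> wpoints (ds ! j) es"
  shows "graft (i + j) (graft i t u) v = graft i t (graft j u v)"
proof -
  have l: "length (leaves u) = length ds" "length (leaves v) = length es"
    "length (leaves (graft j u v)) = length ds - 1 + length es"
    using length_leaves_wpoints[OF u] length_leaves_wpoints[OF v]
      length_leaves_wpoints[OF graft_wpoints[OF u v j]] length_plug_profile[OF j] by simp_all
  show ?thesis
    unfolding graft_plug[of "i + j"] graft_plug[of i t u] graft_plug[of i t "graft j u v"] plug_plug
  proof (rule plug_cong)
    fix a assume "a \<in> lset t"
    then obtain k where a: "a = (cs ! k, k)"
      unfolding lset_wpoints[OF t] by blast
    have "plug (\<lambda>b. if snd b = i + j then shift (i + j) v else Leaf (fst b, outer_idx (i + j) (length (leaves v)) (snd b)))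
        (shift i u) = shift i (graft j u v)"
      unfolding graft_plug[of j] shift_plug plug_plug by (rule plug_cong) (auto simp: outer_idx_def add.assoc plug_plug)
    moreover have "outer_idx i (length ds) k \<noteq> i + j" "outer_idx (i + j) (length es) (outer_idx i (length ds) k) =
        outer_idx i (length ds - 1 + length es) k" if "k \<noteq> i"
      using that j by (auto simp: outer_idx_def)
    ultimately show "plug (\<lambda>b. if snd b = i + j then shift (i + j) v else Leaf (fst b, outer_idx (i + j) (length (leaves v)) (snd b)))
          (if snd a = i then shift i u else Leaf (fst a, outer_idx i (length (leaves u)) (snd a))) =
        (if snd a = i then shift i (graft j u v) else Leaf (fst a, outer_idx i (length (leaves (graft j u v))) (snd a)))"
      unfolding l a by (cases "k = i") simp_all
  qed
qed

lemma graft_assoc_parallel: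
  assumes k: "i < k" "k < length cs" and v: "v \<in> wpoints (cs ! k) es"
  shows "graft (outer_idx i (length ds) k) (graft i t u) v = graft i (graft k t v) u"
proof -
  have l: "length (leaves u) = length ds" "length (leaves v) = length es"
    using length_leaves_wpoints[OF u] length_leaves_wpoints[OF v] by simp_all
  let ?k = "outer_idx i (length ds) k"
  show ?thesis
    unfolding graft_plug[of ?k] graft_plug[of i t u] graft_plug[of k t v] graft_plug[of i _ u] plug_plug
  proof (rule plug_cong)
    fix a assume "a \<in> lset t"
    then obtain m where a: "a = (cs ! m, m)"
      unfolding lset_wpoints[OF t] by blast
    \<comment> \<open>The leaves of the shifted \<open>u\<close> occupy the positions from
      \<open>i\<close> up to \<open>i + length ds - 1\<close>, all below \<open>?k\<close>; so
      grafting at \<open>?k\<close> neither hits nor moves them.\<close>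
    have 1: "plug (\<lambda>b. if snd b = ?k then shift ?k v else Leaf (fst b, outer_idx ?k (length (leaves v)) (snd b)))
        (shift i u) = shift i u"
      unfolding shift_plug plug_plug by (rule plug_cong) (use k in \<open>auto simp: lset_wpoints[OF u] outer_idx_def\<close>)
    have 2: "plug (\<lambda>b. if snd b = i then shift i u else Leaf (fst b, outer_idx i (length (leaves u)) (snd b)))
        (shift k v) = shift ?k v"
      unfolding shift_plug plug_plug by (rule plug_cong) (use k l in \<open>auto simp: lset_wpoints[OF v] outer_idx_def\<close>)
    have 3: "outer_idx i (length ds) m \<noteq> ?k" "outer_idx k (length es) m \<noteq> i"
      "outer_idx ?k (length es) (outer_idx i (length ds) m) = outer_idx i (length ds) (outer_idx k (length es) m)"
      if "m \<noteq> i" "m \<noteq> k"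
      using that k by (auto simp: outer_idx_def)
    have 4: "outer_idx k (length es) i = i" 
      using k by (simp add: outer_idx_def)
    consider "m = i" | "m = k" "m \<noteq> i" | "m \<noteq> i" "m \<noteq> k"
      by blast
    then show "plug (\<lambda>b. if snd b = ?k then shift ?k v else Leaf (fst b, outer_idx ?k (length (leaves v)) (snd b)))
          (if snd a = i then shift i u else Leaf (fst a, outer_idx i (length (leaves u)) (snd a))) =
        plug (\<lambda>b. if snd b = i then shift i u else Leaf (fst b, outer_idx i (length (leaves u)) (snd b)))
          (if snd a = k then shift k v else Leaf (fst a, outer_idx k (length (leaves v)) (snd a)))"
      by cases (use 1 2 3 4 l k in \<open>simp_all add: a\<close>)
  qed
qed

lemma graft_relabel_inner:
  assumes \<pi>: "\<pi> permutes {..<length ds}" and \<rho>: "\<rho> permutes {..<length (plug_profile i cs ds)}"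
    and 1: "\<And>j. \<lbrakk>j < length cs; j \<noteq> i\<rbrakk> \<Longrightarrow> \<rho> (outer_idx i (length ds) j) = outer_idx i (length ds) j"
    and 2: "\<And>j. j < length ds \<Longrightarrow> \<rho> (i + j) = i + \<pi> j"
  shows "graft i t (relabel_leaves \<pi> u) = relabel_leaves \<rho> (graft i t u)"
proof -
  have l: "length (leaves u) = length ds" "length (leaves (relabel_leaves \<pi> u)) = length ds"
    using length_leaves_wpoints[OF u] length_leaves_wpoints[OF relabel_facts(1)[OF u \<pi>]] by simp_all
  have inv: "inv_into UNIV \<rho> b = a" if "\<rho> a = b" for a b
    using permutes_inverses(2)[OF \<rho>, of a] that by simp
  have sh: "plug (\<lambda>b. Leaf (fst b, inv_into UNIV \<rho> (snd b))) (shift i u) = shift i (relabel_leaves \<pi> u)"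
    unfolding shift_plug relabel_plug plug_plug
  proof (rule plug_cong)
    fix b assume "b \<in> lset u"
    then obtain k where k: "k < length ds" "b = (ds ! k, k)"
      unfolding lset_wpoints[OF u] by blast
    have "inv_into UNIV \<pi> k < length ds"
      using permutes_in_image[OF permutes_inv[OF \<pi>], of k] k(1) by simp
    then have "\<rho> (i + inv_into UNIV \<pi> k) = i + k"
      using 2 permutes_inverses(1)[OF \<pi>] by simp
    from inv[OF this] show "plug (\<lambda>b. Leaf (fst b, inv_into UNIV \<rho> (snd b))) (Leaf (fst b, i + snd b)) =
        plug (\<lambda>b. Leaf (fst b, i + snd b)) (Leaf (fst b, inv_into UNIV \<pi> (snd b)))"
      using k(2) by simp
  qed
  show ?thesis
    unfolding graft_plug[of i t] relabel_plug[of \<rho>] plug_plug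
  proof (rule plug_cong)
    fix a assume "a \<in> lset t"
    then obtain k where a: "k < length cs" "a = (cs ! k, k)"
      unfolding lset_wpoints[OF t] by blast
    have "inv_into UNIV \<rho> (outer_idx i (length ds) k) = outer_idx i (length ds) k" if "k \<noteq> i"
      by (rule inv[OF 1[OF a(1) that]])
    then show "(if snd a = i then shift i (relabel_leaves \<pi> u) else Leaf (fst a, outer_idx i (length (leaves (relabel_leaves \<pi> u))) (snd a))) =
        plug (\<lambda>b. Leaf (fst b, inv_into UNIV \<rho> (snd b)))
          (if snd a = i then shift i u else Leaf (fst a, outer_idx i (length (leaves u)) (snd a)))"
      using sh unfolding l a(2) by (cases "k = i") simp_all
  qed
qed

lemma graft_ident_right: "graft i t (Leaf (cs ! i, 0)) = t"
proof -
  have "graft i t (Leaf (cs ! i, 0)) = plug Leaf t"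
    unfolding graft_plug shift_plug by (rule plug_cong) (auto simp: lset_wpoints[OF t] outer_idx_def)
  then show ?thesis
    by simp
qed

end

lemma graft_ident_left: "graft 0 (Leaf (c, 0)) u = u"
  by (simp add: graft_plug shift_plug)

text \<open>The input \<open>i\<close> of the relabelled tree is the leaf \<pi> i of
  \<open>t\<close>. So on the other side \<open>u\<close> is grafted there, and \<rho> moves the
  inserted block to its place.\<close>

lemma graft_relabel_outer:
  assumes t: "t \<in> wpoints c cs" and u: "u \<in> wpoints (cs ! \<pi> i) ds" and i: "i < length cs"
    and \<pi>: "\<pi> permutes {..<length cs}" and \<rho>: "\<rho> permutes {..<length (plug_profile (\<pi> i) cs ds)}"
    and 1: "\<And>j. \<lbrakk>j < length cs; j \<noteq> i\<rbrakk> \<Longrightarrow> \<rho> (outer_idx i (length ds) j) = outer_idx (\<pi> i) (length ds) (\<pi> j)"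
    and 2: "\<And>j. j < length ds \<Longrightarrow> \<rho> (i + j) = \<pi> i + j"
  shows "graft i (relabel_leaves \<pi> t) u = relabel_leaves \<rho> (graft (\<pi> i) t u)"
proof -
  have l: "length (leaves u) = length ds"
    using length_leaves_wpoints[OF u] by simp
  have inv: "inv_into UNIV \<rho> b = a" if "\<rho> a = b" for a b
    using permutes_inverses(2)[OF \<rho>, of a] that by simp
  have sh: "plug (\<lambda>b. Leaf (fst b, inv_into UNIV \<rho> (snd b))) (shift (\<pi> i) u) = shift i u"
    unfolding shift_plug plug_plug
    by (rule plug_cong) (use inv[OF 2] in \<open>auto simp: lset_wpoints[OF u]\<close>)
  show ?thesis
    unfolding graft_plug relabel_plug plug_plug
  proof (rule plug_cong)
    fix a assume "a \<in> lset t"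
    then obtain m where a: "m < length cs" "a = (cs ! m, m)"
      unfolding lset_wpoints[OF t] by blast
    define k where "k = inv_into UNIV \<pi> m"
    have k: "k < length cs" "m = \<pi> k"
      using permutes_in_image[OF permutes_inv[OF \<pi>], of m] a(1) permutes_inverses(1)[OF \<pi>] by (simp_all add: k_def)
    have inj: "\<pi> k = \<pi> i \<longleftrightarrow> k = i"
      using permutes_inj[OF \<pi>] by (simp add: inj_eq)
    have "inv_into UNIV \<rho> (outer_idx (\<pi> i) (length ds) m) = outer_idx i (length ds) k" if "k \<noteq> i"
      using inv[OF 1[OF k(1) that]] k(2) by simp
    then show "plug (\<lambda>b. if snd b = i then shift i u else Leaf (fst b, outer_idx i (length (leaves u)) (snd b)))
          (Leaf (fst a, inv_into UNIV \<pi> (snd a))) =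
        plug (\<lambda>b. Leaf (fst b, inv_into UNIV \<rho> (snd b)))
          (if snd a = \<pi> i then shift (\<pi> i) u else Leaf (fst a, outer_idx (\<pi> i) (length (leaves u)) (snd a)))"
      using sh inj unfolding l a(2) snd_conv fst_conv k_def[symmetric] plug.simps
      by (cases "k = i") (simp_all add: k(2))
  qed
qed

definition model_operad :: "(nat, ltree \<times> (nat set \<Rightarrow> real)) operad" where
  "model_operad = \<lparr>ops = model, circ = model_circ, ident = model_ident, act = model_act\<rparr>"

lemma model_operad_simps [simp]:
  "ops model_operad = model" "circ model_operad = model_circ" "ident model_operad = model_ident"
  "act model_operad = model_act"
  by (simp_all add: model_operad_def)

lemma continuous_map_model:
  assumes "f \<in> topspace X \<rightarrow> model_points c cs"
    and "continuous_map X (discrete_topology (ltrees c cs)) (\<lambda>x. fst (f x))"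
    and "\<And>U. continuous_map X euclideanreal (\<lambda>x. snd (f x) U)"
  shows "continuous_map X (model c cs) f"
proof -
  have "continuous_map X (powertop_real UNIV) (\<lambda>x. snd (f x))"
    using assms(3) by (simp add: continuous_map_componentwise_UNIV)
  with assms(2) have "continuous_map X (prod_topology (discrete_topology (ltrees c cs)) (powertop_real UNIV))
      (\<lambda>x. (fst (f x), snd (f x)))"
    by (rule continuous_map_pairedI)
  then show ?thesis
    unfolding model_def using assms(1) by (simp add: continuous_map_in_subtopology Pi_iff image_subset_iff)
qed

lemma continuous_map_model_fst: "continuous_map (model c cs) (discrete_topology (ltrees c cs)) fst"
  unfolding model_def by (intro continuous_map_from_subtopology continuous_map_fst)

lemma continuous_map_model_snd: "continuous_map (model c cs) euclideanreal (\<lambda>x. snd x U)"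
proof -
  have "continuous_map (model c cs) (powertop_real UNIV) snd"
    unfolding model_def by (intro continuous_map_from_subtopology continuous_map_snd)
  then show ?thesis
    by (simp add: continuous_map_componentwise_UNIV)
qed

lemma continuous_map_model_circ:
  assumes i: "i < length cs"
  shows "continuous_map (prod_topology (model c cs) (model (cs ! i) ds)) (model c (plug_profile i cs ds))
    (\<lambda>(x, y). model_circ i x y)"
proof (rule continuous_map_model)
  let ?X = "prod_topology (model c cs) (model (cs ! i) ds)"
  show "(\<lambda>(x, y). model_circ i x y) \<in> topspace ?X \<rightarrow> model_points c (plug_profile i cs ds)"
    using model_circ_in i by auto
  have "continuous_map ?X (discrete_topology (ltrees c cs)) (fst \<circ> fst)"
    by (rule continuous_map_compose[OF continuous_map_fst continuous_map_model_fst])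
  moreover have "continuous_map ?X (discrete_topology (ltrees (cs ! i) ds)) (fst \<circ> snd)"
    by (rule continuous_map_compose[OF continuous_map_snd continuous_map_model_fst])
  ultimately have "continuous_map ?X (prod_topology (discrete_topology (ltrees c cs)) (discrete_topology (ltrees (cs ! i) ds)))
      (\<lambda>p. ((fst \<circ> fst) p, (fst \<circ> snd) p))"
    by (rule continuous_map_pairedI)
  moreover have "continuous_map (prod_topology (discrete_topology (ltrees c cs)) (discrete_topology (ltrees (cs ! i) ds)))
      (discrete_topology (ltrees c (plug_profile i cs ds))) (\<lambda>(T, T'). subst_vertex i T' T)"
    unfolding prod_topology_discrete_topology[symmetric] using subst_vertex_ltrees i
    by (auto simp: continuous_map_from_discrete_topology)
  ultimately have "continuous_map ?X (discrete_topology (ltrees c (plug_profile i cs ds)))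
      ((\<lambda>(T, T'). subst_vertex i T' T) \<circ> (\<lambda>p. ((fst \<circ> fst) p, (fst \<circ> snd) p)))"
    by (rule continuous_map_compose)
  then show "continuous_map ?X (discrete_topology (ltrees c (plug_profile i cs ds)))
      (\<lambda>p. fst ((\<lambda>(x, y). model_circ i x y) p))"
    by (rule continuous_map_eq) (auto simp: model_circ_def)
  fix U
  have w: "continuous_map ?X euclideanreal (\<lambda>p. snd (fst p) S)" "continuous_map ?X euclideanreal (\<lambda>p. snd (snd p) S)" for S
    by (rule continuous_map_compose[OF continuous_map_fst continuous_map_model_snd, unfolded comp_def],
        rule continuous_map_compose[OF continuous_map_snd continuous_map_model_snd, unfolded comp_def])
  \<comment> \<open>For all points of one profile the trees have the vertices
    \<open>{..<length cs}\<close> and \<open>{..<length ds}\<close>, so the maxima in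
    \<open>model_circ\<close> run over index sets that depend on the profile only.\<close>
  let ?A = "{S \<in> Pow {..<length cs}. outer_idx i (length ds) ` (S - {i}) \<union> (if i \<in> S then (\<lambda>j. i + j) ` {..<length ds} else {}) = U}"
  let ?B = "{S \<in> Pow {..<length ds}. (\<lambda>j. i + j) ` S = U}"
  let ?g = "\<lambda>p. max (Max (insert 0 ((\<lambda>S. snd (fst p) S) ` ?A)))
      (max (Max (insert 0 ((\<lambda>S. snd (snd p) S) ` ?B))) (if U = (\<lambda>j. i + j) ` {..<length ds} then 1 else 0))"
  let ?c = "2 \<le> card U \<and> U \<noteq> {..<length (plug_profile i cs ds)}"
  have g: "continuous_map ?X euclideanreal ?g"
    by (intro continuous_map_real_max continuous_map_Max w) simp_all
  have if_cont: "continuous_map ?X euclideanreal (\<lambda>p. if b then f p else 0)"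
    if "continuous_map ?X euclideanreal f" for b and f :: "_ \<Rightarrow> real"
    using that by (cases b) simp_all
  have "continuous_map ?X euclideanreal (\<lambda>p. if ?c then ?g p else 0)"
    by (rule if_cont[OF g])
  then show "continuous_map ?X euclideanreal (\<lambda>p. snd ((\<lambda>(x, y). model_circ i x y) p) U)"
  proof (rule continuous_map_eq)
    fix p assume "p \<in> topspace ?X"
    then obtain T w T' w' where p: "p = ((T, w), (T', w'))" "(T, w) \<in> model_points c cs" "(T', w') \<in> model_points (cs ! i) ds"
      by auto
    then have T: "T \<in> ltrees c cs" "T' \<in> ltrees (cs ! i) ds"
      using model_points_props(1) by blast+
    show "(if ?c then ?g p else 0) = snd ((\<lambda>(x, y). model_circ i x y) p) U"
      unfolding p(1) prod.case model_circ_def snd_conv fst_conv subst_subtree_def large_proper_def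
        vset_ltrees[OF T(1)] vset_ltrees[OF T(2)] length_verts_ltrees[OF T(2)] vset_ltrees[OF subst_vertex_ltrees[OF T i]]
      by (rule refl)
  qed
qed

lemma continuous_map_model_act:
  assumes \<pi>: "\<pi> permutes {..<length cs}"
  shows "continuous_map (model c cs) (model c (permute_list \<pi> cs)) (model_act \<pi>)"
proof (rule continuous_map_model)
  show "model_act \<pi> \<in> topspace (model c cs) \<rightarrow> model_points c (permute_list \<pi> cs)"
    using model_act_in \<pi> by auto
  have "continuous_map (discrete_topology (ltrees c cs)) (discrete_topology (ltrees c (permute_list \<pi> cs)))
      (relabel_vertices \<pi>)"
    using relabel_vertices_ltrees \<pi> by (auto simp: continuous_map_from_discrete_topology)
  from continuous_map_compose[OF continuous_map_model_fst this]
  show "continuous_map (model c cs) (discrete_topology (ltrees c (permute_list \<pi> cs))) (\<lambda>x. fst (model_act \<pi> x))"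
    by (simp add: model_act_def case_prod_unfold comp_def)
  show "continuous_map (model c cs) euclideanreal (\<lambda>x. snd (model_act \<pi> x) U)" for U
    using continuous_map_model_snd[of c cs "\<pi> ` U"] by (simp add: model_act_def case_prod_unfold)
qed

lemma model_points_profile:
  assumes "x \<in> model_points c cs" "x \<in> model_points c' cs'"
  shows "c = c' \<and> cs = cs'"
proof -
  obtain T where T: "T \<in> ltrees c cs" "T \<in> ltrees c' cs'"
    using assms by (auto simp: model_points_def)
  then have "{..<c} = {..<c'}"
    by (simp add: ltrees_def)
  moreover have len: "length cs = length cs'"
    using T length_verts_ltrees by metis
  moreover have "cs ! j = cs' ! j" if "j < length cs" for j
  proof -
    have "(j, cs ! j) \<in> {(j, cs' ! j) | j. j < length cs'}"
      using that set_verts_ltrees[OF T(1)] set_verts_ltrees[OF T(2)] by auto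
    then show ?thesis
      by simp
  qed
  ultimately show ?thesis
    by (simp add: nth_equalityI)
qed

text \<open>The axioms involving composition are identities between graftings of trees, lifted along
  the surjection \<open>model_point\<close>; those for the action alone are direct computations with
  the formula for \<open>model_act\<close>.\<close>

lemma topological_operad_model: "topological_operad model_operad"
proof (unfold_locales, unfold model_operad_simps topspace_model)
  show "model_ident c \<in> model_points c [c]" for c
    using model_point_in[OF leaf_facts(1)] leaf_facts(2) by simp
next
  fix i c and cs ds :: "nat list" assume "i < length cs"
  then show "continuous_map (prod_topology (model c cs) (model (cs ! i) ds)) (model c (plug_profile i cs ds))
      (\<lambda>(x, y). model_circ i x y)"
    by (rule continuous_map_model_circ)
next
  fix \<pi> c and cs :: "nat list" assume "\<pi> permutes {..<length cs}"
  then show "continuous_map (model c cs) (model c (permute_list \<pi> cs)) (model_act \<pi>)"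
    by (rule continuous_map_model_act)
next
  fix x c and cs :: "nat list" assume "x \<in> model_points c cs"
  then obtain t where t: "t \<in> wpoints c cs" and x: "model_point t = x"
    using model_point_surj by blast
  have "t \<in> wpoints ([c] ! 0) cs"
    using t by simp
  from model_point_graft[OF leaf_facts(1) this] show "model_circ 0 (model_ident c) x = x"
    by (simp add: graft_ident_left leaf_facts(2) x)
next
  fix x c i and cs :: "nat list" assume "x \<in> model_points c cs" and i: "i < length cs"
  then obtain t where t: "t \<in> wpoints c cs" and x: "model_point t = x"
    using model_point_surj by blast
  show "model_circ i x (model_ident (cs ! i)) = x"
    using model_point_graft[OF t leaf_facts(1) i] graft_ident_right[OF t leaf_facts(1) i] by (simp add: leaf_facts(2) x)
next
  fix x c i y j z and cs ds es :: "nat list"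
  assume "x \<in> model_points c cs" and i: "i < length cs" and "y \<in> model_points (cs ! i) ds"
    and j: "j < length ds" and "z \<in> model_points (ds ! j) es"
  then obtain t u v where t: "t \<in> wpoints c cs" "model_point t = x" and u: "u \<in> wpoints (cs ! i) ds" "model_point u = y"
    and v: "v \<in> wpoints (ds ! j) es" "model_point v = z"
    using model_point_surj by metis
  have v': "v \<in> wpoints (plug_profile i cs ds ! (i + j)) es" and ij: "i + j < length (plug_profile i cs ds)"
    using v(1) i j by (simp_all add: nth_plug_profile_inner length_plug_profile)
  have "model_point (graft (i + j) (graft i t u) v) = model_point (graft i t (graft j u v))"
    by (simp only: graft_assoc_sequential[OF t(1) u(1) i j v(1)])
  then show "model_circ (i + j) (model_circ i x y) z = model_circ i x (model_circ j y z)"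
    unfolding model_point_graft[OF graft_wpoints[OF t(1) u(1) i] v' ij]
      model_point_graft[OF t(1) graft_wpoints[OF u(1) v(1) j] i]
      model_point_graft[OF t(1) u(1) i] model_point_graft[OF u(1) v(1) j] t(2) u(2) v(2) .
next
  fix x c i k y z and cs ds es :: "nat list"
  assume "x \<in> model_points c cs" and ik: "i < k" and k: "k < length cs"
    and "y \<in> model_points (cs ! i) ds" and "z \<in> model_points (cs ! k) es"
  then obtain t u v where t: "t \<in> wpoints c cs" "model_point t = x" and u: "u \<in> wpoints (cs ! i) ds" "model_point u = y"
    and v: "v \<in> wpoints (cs ! k) es" "model_point v = z"
    using model_point_surj by metis
  have i: "i < length cs"
    using ik k by simp
  have v': "v \<in> wpoints (plug_profile i cs ds ! outer_idx i (length ds) k) es"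
    and k': "outer_idx i (length ds) k < length (plug_profile i cs ds)"
    using v(1) nth_plug_profile_outer[OF i k, of ds] ik by simp_all
  have u': "u \<in> wpoints (plug_profile k cs es ! i) ds" and i': "i < length (plug_profile k cs es)"
    using u(1) nth_plug_profile_outer[OF k i, of es] ik by (simp_all add: outer_idx_def)
  have "model_point (graft (outer_idx i (length ds) k) (graft i t u) v) = model_point (graft i (graft k t v) u)"
    by (simp only: graft_assoc_parallel[OF t(1) u(1) i ik k v(1)])
  then show "model_circ (outer_idx i (length ds) k) (model_circ i x y) z = model_circ i (model_circ k x z) y"
    unfolding model_point_graft[OF graft_wpoints[OF t(1) u(1) i] v' k']
      model_point_graft[OF graft_wpoints[OF t(1) v(1) k] u' i']
      model_point_graft[OF t(1) u(1) i] model_point_graft[OF t(1) v(1) k] t(2) u(2) v(2) .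
next
  fix x :: "ltree \<times> (nat set \<Rightarrow> real)" and c and cs :: "nat list"
  show "model_act id x = x"
    by (simp add: model_act_def relabel_vertices_def inv_id[unfolded id_def] case_prod_unfold ptree.map_ident id_def)
next
  fix x c \<pi> \<rho> and cs :: "nat list"
  assume \<pi>: "\<pi> permutes {..<length cs}" and \<rho>: "\<rho> permutes {..<length cs}"
  have "inv_into UNIV (\<pi> \<circ> \<rho>) = inv_into UNIV \<rho> \<circ> inv_into UNIV \<pi>"
    using permutes_bij[OF \<pi>] permutes_bij[OF \<rho>] by (simp add: o_inv_distrib)
  then show "model_act \<rho> (model_act \<pi> x) = model_act (\<pi> \<circ> \<rho>) x" for x
    by (simp add: model_act_def relabel_vertices_def case_prod_unfold ptree.map_comp image_comp comp_def id_def)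
next
  fix x c i y \<pi> \<rho> and cs ds :: "nat list"
  assume "x \<in> model_points c cs" and i: "i < length cs" and "y \<in> model_points (cs ! i) ds"
    and \<pi>: "\<pi> permutes {..<length ds}" and \<rho>: "\<rho> permutes {..<length (plug_profile i cs ds)}"
    and 1: "\<And>j. \<lbrakk>j < length cs; j \<noteq> i\<rbrakk> \<Longrightarrow> \<rho> (outer_idx i (length ds) j) = outer_idx i (length ds) j"
    and 2: "\<And>j. j < length ds \<Longrightarrow> \<rho> (i + j) = i + \<pi> j"
  then obtain t u where t: "t \<in> wpoints c cs" "model_point t = x" and u: "u \<in> wpoints (cs ! i) ds" "model_point u = y"
    using model_point_surj by metis
  have "model_point (graft i t (relabel_leaves \<pi> u)) = model_point (relabel_leaves \<rho> (graft i t u))"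
    by (rule arg_cong[where f = model_point, OF graft_relabel_inner[OF t(1) u(1) i \<pi> \<rho> 1 2]])
  then show "model_circ i x (model_act \<pi> y) = model_act \<rho> (model_circ i x y)"
    unfolding model_point_graft[OF t(1) relabel_facts(1)[OF u(1) \<pi>] i] relabel_facts(2)[OF u(1) \<pi>]
      relabel_facts(2)[OF graft_wpoints[OF t(1) u(1) i] \<rho>] model_point_graft[OF t(1) u(1) i] t(2) u(2) .
next
  fix x c i y \<pi> \<rho> and cs ds :: "nat list"
  assume "x \<in> model_points c cs" and i: "i < length cs" and "y \<in> model_points (cs ! \<pi> i) ds"
    and \<pi>: "\<pi> permutes {..<length cs}" and \<rho>: "\<rho> permutes {..<length (plug_profile (\<pi> i) cs ds)}"
    and 1: "\<And>j. \<lbrakk>j < length cs; j \<noteq> i\<rbrakk> \<Longrightarrow> \<rho> (outer_idx i (length ds) j) = outer_idx (\<pi> i) (length ds) (\<pi> j)"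
    and 2: "\<And>j. j < length ds \<Longrightarrow> \<rho> (i + j) = \<pi> i + j"
  then obtain t u where t: "t \<in> wpoints c cs" "model_point t = x" and u: "u \<in> wpoints (cs ! \<pi> i) ds" "model_point u = y"
    using model_point_surj by metis
  have \<pi>i: "\<pi> i < length cs"
    using permutes_in_image[OF \<pi>, of i] i by simp
  have u': "u \<in> wpoints (permute_list \<pi> cs ! i) ds" and i': "i < length (permute_list \<pi> cs)"
    using u(1) i permute_list_nth[OF \<pi> i] by simp_all
  have "model_point (graft i (relabel_leaves \<pi> t) u) = model_point (relabel_leaves \<rho> (graft (\<pi> i) t u))"
    by (rule arg_cong[where f = model_point, OF graft_relabel_outer[OF t(1) u(1) i \<pi> \<rho> 1 2]])
  then show "model_circ i (model_act \<pi> x) y = model_act \<rho> (model_circ (\<pi> i) x y)"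
    unfolding model_point_graft[OF relabel_facts(1)[OF t(1) \<pi>] u' i'] relabel_facts(2)[OF t(1) \<pi>]
      relabel_facts(2)[OF graft_wpoints[OF t(1) u(1) \<pi>i] \<rho>] model_point_graft[OF t(1) u(1) \<pi>i] t(2) u(2) .
qed

lemma modelled_W0: "modelled_operad model_operad (W0 O_operad) class_point"
proof (intro modelled_operad.intro topological_operad_model modelled_operad_axioms.intro, unfold model_operad_simps topspace_model)
  show "c = c' \<and> cs = cs'" if "m \<in> model_points c cs" "m \<in> model_points c' cs'" for m c cs c' cs'
    by (rule model_points_profile[OF that])
qed (fact homeomorphic_class_point class_point_ident class_point_circ class_point_act)+

lemma modelled_BO: "modelled_operad model_operad BO_operad bracketed_point"
proof (intro modelled_operad.intro topological_operad_model modelled_operad_axioms.intro, unfold model_operad_simps topspace_model)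
  show "c = c' \<and> cs = cs'" if "m \<in> model_points c cs" "m \<in> model_points c' cs'" for m c cs c' cs'
    by (rule model_points_profile[OF that])
  have [simp]: "circ BO_operad = BO_circ" "ident BO_operad = BO_ident" "act BO_operad = BO_act"
    by (simp_all add: BO_operad_def)
  show "ident BO_operad c \<in> topspace (ops BO_operad c [c])" "bracketed_point (ident BO_operad c) = model_ident c" for c
    using bracketed_point_ident by simp_all
  show "circ BO_operad i x y \<in> topspace (ops BO_operad c (plug_profile i cs ds))"
    "bracketed_point (circ BO_operad i x y) = model_circ i (bracketed_point x) (bracketed_point y)"
    if "x \<in> topspace (ops BO_operad c cs)" "y \<in> topspace (ops BO_operad (cs ! i) ds)" "i < length cs" for x y c cs i ds
    using bracketed_point_circ[OF that] by simp_all
  show "act BO_operad \<pi> x \<in> topspace (ops BO_operad c (permute_list \<pi> cs))"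
    "bracketed_point (act BO_operad \<pi> x) = model_act \<pi> (bracketed_point x)"
    if "x \<in> topspace (ops BO_operad c cs)" "\<pi> permutes {..<length cs}" for x c cs \<pi>
    using bracketed_point_act[OF that] by simp_all
qed (rule homeomorphic_bracketed_point)

theorem theorem3:
  shows "\<exists>\<phi>. operad_iso (W0 O_operad) BO_operad \<phi>"
  using operad_iso_modelled[OF modelled_W0 modelled_BO] by blast

end
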